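(* Let $(R,\mathfrak m)$ be a Cohen--Macaulay local ring of dimension $d>0$ with infinite residue field $R/\mathfrak m$. Let $I$ be an $\mathfrak m$-primary ideal of $R$ and let $J$ be a minimal reduction of $I$. Then the following lengths are independent of the choice of the minimal reduction $J$ of $I$: (a) $\lambda(I/J)$, and $\lambda(I^n/J^{n-1}I)$ for every $n\geq 2$; (b) $\lambda(R/(J\colon I))$; (c) $\lambda(S_2(I/J))$, where $S_2(I/J)$ denotes the second graded component of the symmetric algebra of the $R$-module $I/J$.
   Context: All rings are commutative and Noetherian. $\lambda(\cdot)$ denotes length of $R$-modules. An ideal $J\subseteq I$ is a reduction of $I$ if $I^{m+1}=JI^m$ for some $m\geq 0$; a minimal reduction of $I$ is a reduction that is minimal with respect to inclusion. $J\colon I=\{a\in R: aI\subseteq J\}$. *)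

theory Defs
  imports "HOL-Algebra.Algebra" "HOL-Library.Extended_Nat"
begin

section \<open>Modules: quotients and length\<close>

definition self_module :: "('a, 'm) ring_scheme \<Rightarrow> ('a, 'a) module" where
  "self_module R =
     \<lparr>carrier = carrier R, monoid.mult = monoid.mult R, one = \<one>\<^bsub>R\<^esub>,
      ring.zero = \<zero>\<^bsub>R\<^esub>, ring.add = ring.add R, smult = monoid.mult R\<rparr>"

text \<open>The ring fields are those of \<^const>\<open>FactRing\<close>, so that the quotient of an algebra
  by an ideal is again an algebra; for a mere module they are meaningless.\<close>

definition quot_module :: "('a, 'b, 'm) module_scheme \<Rightarrow> 'b set \<Rightarrow> ('a, 'b set) module" where
  "quot_module M N =
     \<lparr>carrier = a_rcosets\<^bsub>M\<^esub> N, monoid.mult = rcoset_mult M N, one = N +>\<^bsub>M\<^esub> \<one>\<^bsub>M\<^esub>,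
      ring.zero = N, ring.add = set_add M, smult = (\<lambda>a C. \<Union>x\<in>C. N +>\<^bsub>M\<^esub> (a \<odot>\<^bsub>M\<^esub> x))\<rparr>"

definition ideal_quot :: "('a, 'm) ring_scheme \<Rightarrow> 'a set \<Rightarrow> 'a set \<Rightarrow> ('a, 'a set) module" where
  "ideal_quot R I J = quot_module ((self_module R)\<lparr>carrier := I\<rparr>) J"

text \<open>A chain \<open>N\<^sub>0 \<subset> N\<^sub>1 \<subset> \<dots> \<subset> N\<^sub>k\<close>, given as a list with \<open>k + 1\<close> entries, has length \<open>k\<close>.\<close>

definition module_length :: "('a, 'm) ring_scheme \<Rightarrow> ('a, 'b, 'n) module_scheme \<Rightarrow> enat" where
  "module_length R M =
     (SUP Ns \<in> {Ns. Ns \<noteq> [] \<and> sorted_wrt (\<subset>) Ns \<and> (\<forall>N \<in> set Ns. submodule N R M)}.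
        enat (length Ns - 1))"


section \<open>Cohen--Macaulay local rings\<close>

definition krull_dim :: "('a, 'm) ring_scheme \<Rightarrow> enat" where
  "krull_dim R =
     (SUP Ps \<in> {Ps. Ps \<noteq> [] \<and> sorted_wrt (\<subset>) Ps \<and> (\<forall>P \<in> set Ps. primeideal P R)}.
        enat (length Ps - 1))"

definition regular_sequence :: "('a, 'm) ring_scheme \<Rightarrow> 'a list \<Rightarrow> bool" where
  "regular_sequence R xs \<longleftrightarrow>
     set xs \<subseteq> carrier R \<and>
     (\<forall>i < length xs. \<forall>a \<in> carrier R.
        xs ! i \<otimes>\<^bsub>R\<^esub> a \<in> Idl\<^bsub>R\<^esub> (set (take i xs)) \<longrightarrow> a \<in> Idl\<^bsub>R\<^esub> (set (take i xs))) \<and>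
     Idl\<^bsub>R\<^esub> (set xs) \<noteq> carrier R"

definition depth :: "('a, 'm) ring_scheme \<Rightarrow> 'a set \<Rightarrow> enat" where
  "depth R \<mm> = (SUP xs \<in> {xs. regular_sequence R xs \<and> set xs \<subseteq> \<mm>}. enat (length xs))"

locale cohen_macaulay_local_ring = cring R + noetherian_ring R
  for R (structure) and \<mm> +
  assumes maximalideals: "{M. maximalideal M R} = {\<mm>}"
    and depth_eq_dim: "depth R \<mm> = krull_dim R"


section \<open>Primary ideals, reductions, colon ideals\<close>

definition ideal_radical :: "('a, 'm) ring_scheme \<Rightarrow> 'a set \<Rightarrow> 'a set" where
  "ideal_radical R I = {a \<in> carrier R. \<exists>n::nat. a [^]\<^bsub>R\<^esub> n \<in> I}"

definition primary_ideal :: "('a, 'm) ring_scheme \<Rightarrow> 'a set \<Rightarrow> bool" where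
  "primary_ideal R I \<longleftrightarrow>
     ideal I R \<and> I \<noteq> carrier R \<and>
     (\<forall>a \<in> carrier R. \<forall>b \<in> carrier R. a \<otimes>\<^bsub>R\<^esub> b \<in> I \<longrightarrow> a \<in> I \<or> (\<exists>n::nat. b [^]\<^bsub>R\<^esub> n \<in> I))"

definition primary_to :: "('a, 'm) ring_scheme \<Rightarrow> 'a set \<Rightarrow> 'a set \<Rightarrow> bool" where
  "primary_to R P I \<longleftrightarrow> primary_ideal R I \<and> ideal_radical R I = P"

definition ideal_pow :: "('a, 'm) ring_scheme \<Rightarrow> 'a set \<Rightarrow> nat \<Rightarrow> 'a set" where
  "ideal_pow R I n = I [^]\<^bsub>ideals_set R\<^esub> n"

definition is_reduction :: "('a, 'm) ring_scheme \<Rightarrow> 'a set \<Rightarrow> 'a set \<Rightarrow> bool" where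
  "is_reduction R I J \<longleftrightarrow>
     ideal J R \<and> J \<subseteq> I \<and> (\<exists>m. ideal_pow R I (m + 1) = J \<cdot>\<^bsub>R\<^esub> ideal_pow R I m)"

definition minimal_reduction :: "('a, 'm) ring_scheme \<Rightarrow> 'a set \<Rightarrow> 'a set \<Rightarrow> bool" where
  "minimal_reduction R I J \<longleftrightarrow>
     is_reduction R I J \<and> (\<forall>K. is_reduction R I K \<and> K \<subseteq> J \<longrightarrow> K = J)"

definition colon_ideal :: "('a, 'm) ring_scheme \<Rightarrow> 'a set \<Rightarrow> 'a set \<Rightarrow> 'a set" where
  "colon_ideal R J I = {a \<in> carrier R. \<forall>x \<in> I. a \<otimes>\<^bsub>R\<^esub> x \<in> J}"


section \<open>The symmetric algebra of a module\<close>

text \<open>\<open>Sym(M)\<close> is constructed as the polynomial algebra over \<open>R\<close> with one variable \<open>X\<^sub>x\<close> for each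
  \<open>x \<in> M\<close>, modulo the ideal generated by all \<open>X\<^bsub>x+y\<^esub> - (X\<^sub>x + X\<^sub>y)\<close> and \<open>X\<^bsub>ax\<^esub> - a X\<^sub>x\<close>. These
  relations are homogeneous of degree one, so \<open>Sym(M)\<close> is graded by the images of the
  homogeneous polynomials. Monomials are multisets of variables.\<close>

definition poly_algebra :: "('a, 'm) ring_scheme \<Rightarrow> 'c set \<Rightarrow> ('a, 'c multiset \<Rightarrow> 'a) module" where
  "poly_algebra R V =
     \<lparr>carrier = ring.indexed_pset R V (carrier R),
      monoid.mult = (\<lambda>p q m. \<Oplus>\<^bsub>R\<^esub>k\<in>{k. k \<subseteq># m}. p k \<otimes>\<^bsub>R\<^esub> q (m - k)),
      one = ring.indexed_const R \<one>\<^bsub>R\<^esub>,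
      ring.zero = ring.indexed_const R \<zero>\<^bsub>R\<^esub>,
      ring.add = ring.indexed_padd R,
      smult = (\<lambda>a p m. a \<otimes>\<^bsub>R\<^esub> p m)\<rparr>"

definition sym_relations ::
    "('a, 'm) ring_scheme \<Rightarrow> ('a, 'b, 'n) module_scheme \<Rightarrow> ('b multiset \<Rightarrow> 'a) set" where
  "sym_relations R M =
     (let P = poly_algebra R (carrier M); var = ring.indexed_var R in
      {var (x \<oplus>\<^bsub>M\<^esub> y) \<ominus>\<^bsub>P\<^esub> (var x \<oplus>\<^bsub>P\<^esub> var y) | x y. x \<in> carrier M \<and> y \<in> carrier M} \<union>
      {var (a \<odot>\<^bsub>M\<^esub> x) \<ominus>\<^bsub>P\<^esub> (a \<odot>\<^bsub>P\<^esub> var x) | a x. a \<in> carrier R \<and> x \<in> carrier M})"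

definition sym_ideal ::
    "('a, 'm) ring_scheme \<Rightarrow> ('a, 'b, 'n) module_scheme \<Rightarrow> ('b multiset \<Rightarrow> 'a) set" where
  "sym_ideal R M = Idl\<^bsub>poly_algebra R (carrier M)\<^esub> (sym_relations R M)"

definition symmetric_algebra ::
    "('a, 'm) ring_scheme \<Rightarrow> ('a, 'b, 'n) module_scheme \<Rightarrow> ('a, ('b multiset \<Rightarrow> 'a) set) module" where
  "symmetric_algebra R M = quot_module (poly_algebra R (carrier M)) (sym_ideal R M)"

definition homogeneous_polys ::
    "('a, 'm) ring_scheme \<Rightarrow> 'c set \<Rightarrow> nat \<Rightarrow> ('c multiset \<Rightarrow> 'a) set" where
  "homogeneous_polys R V n =
     {p \<in> carrier (poly_algebra R V). \<forall>m. p m \<noteq> \<zero>\<^bsub>R\<^esub> \<longrightarrow> size m = n}"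

definition sym_component ::
    "('a, 'm) ring_scheme \<Rightarrow> ('a, 'b, 'n) module_scheme \<Rightarrow> nat
      \<Rightarrow> ('a, ('b multiset \<Rightarrow> 'a) set) module" where
  "sym_component R M n = (symmetric_algebra R M)
     \<lparr>carrier := (\<lambda>p. sym_ideal R M +>\<^bsub>poly_algebra R (carrier M)\<^esub> p)
                   ` homogeneous_polys R (carrier M) n\<rparr>"

end

theory Submission
  imports Defs Complex_Main
begin

text \<open>Since the residue field is infinite, a minimal reduction \<open>J\<close> of \<open>I\<close> has at most \<open>d\<close> generators
  (Noether normalization of the fiber cone), hence it is generated by a regular sequence
  \<open>x\<^sub>1, \<dots>, x\<^sub>d\<close>. Then \<open>\<lambda>(R/J\<^sup>k)\<close> and \<open>\<lambda>(R/J\<^sup>k I)\<close> are explicit functions of \<open>k\<close>, \<open>d\<close>, \<open>\<lambda>(R/J)\<close>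
  and \<open>\<lambda>(R/I)\<close>. As \<open>J\<^sup>k\<close> and \<open>I\<^sup>k\<close> contain each other up to a shift of \<open>k\<close>, the growth of
  \<open>\<lambda>(R/J\<^sup>k)\<close> forces \<open>\<lambda>(R/J)\<close> to be the same for all \<open>J\<close>, which gives (a).

  For (b), \<open>(J : I)/J\<close> is \<open>Ext\<^sup>d(R/I, R)\<close>; concretely, its length does not change when the elements
  of the regular sequence are replaced one at a time.

  For (c), the kernel of \<open>S\<^sub>2(I) \<rightarrow> I\<^sup>2\<close> does not depend on \<open>J\<close> and meets the image of
  \<open>J \<otimes> I\<close>, which is the kernel of \<open>S\<^sub>2(I) \<rightarrow> S\<^sub>2(I/J)\<close>, trivially, because the relations between
  the \<open>x\<^sub>i\<close> are Koszul relations and those vanish in \<open>S\<^sub>2(I)\<close>. Hence \<open>\<lambda>(S\<^sub>2(I/J))\<close> is the length of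
  that kernel plus \<open>\<lambda>(I\<^sup>2/JI)\<close>.\<close>


section \<open>Lengths of chains of sets\<close>

text \<open>That \<open>d\<close> generators suffice rests on counting. If the monomials of every
  degree in \<open>s\<close> generators of a reduction are independent in its fiber cone, the
  colengths of its powers grow at least like \<open>n\<^sup>s\<close>. But the reduction contains
  powers of the members of a regular sequence of length \<open>d\<close>, so the growth is at most
  that of \<open>n\<^sup>d\<close>. Hence a reduction with the least number of generators has at
  most \<open>d\<close> of them.

  No Hilbert polynomials, localizations or Ext modules are formed. A length is a supremum over
  chains between two ideals or submodules, and an isomorphism of subquotients becomes an order
  isomorphism of intervals. One identity, that the colength of \<open>K\<close> is the sum of those
  of \<open>K : x\<close> and \<open>K + (x)\<close>, yields the explicit formulas by Pascal's rule.

  Lengths are extended naturals, so each cancellation needs a proof of finiteness. For ideals whose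
  only prime above them is the maximal ideal, Noetherian induction supplies it.\<close>

lemma enat_le_SUP_iff:
  assumes "Y \<noteq> {}"
  shows "enat n \<le> (SUP x\<in>Y. enat (f x)) \<longleftrightarrow> (\<exists>x\<in>Y. n \<le> f x)"
proof
  assume L: "enat n \<le> (SUP x\<in>Y. enat (f x))"
  show "\<exists>x\<in>Y. n \<le> f x"
  proof (rule ccontr)
    assume "\<not> ?thesis"
    then have lt: "\<And>x. x \<in> Y \<Longrightarrow> f x < n" by (auto simp: not_le)
    \<comment> \<open>For \<open>n = 0\<close> the left side always holds, so the right side needs a
      member of \<open>Y\<close>.\<close>
    with assms obtain k where k: "n = Suc k" by (cases n) auto
    have "(SUP x\<in>Y. enat (f x)) \<le> enat k"
      by (rule SUP_least) (use lt k in fastforce)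
    with L k have "enat (Suc k) \<le> enat k" by (metis order_trans)
    then show False by simp
  qed
next
  assume "\<exists>x\<in>Y. n \<le> f x"
  then show "enat n \<le> (SUP x\<in>Y. enat (f x))"
    by (meson SUP_upper2 enat_ord_simps(1))
qed

definition strict_chain :: "'x set set \<Rightarrow> 'x set list \<Rightarrow> bool" where
  "strict_chain \<S> Ns \<longleftrightarrow> Ns \<noteq> [] \<and> sorted_wrt (\<subset>) Ns \<and> set Ns \<subseteq> \<S>"

definition chain_length :: "'x set set \<Rightarrow> enat" where
  "chain_length \<S> = (SUP Ns \<in> Collect (strict_chain \<S>). enat (length Ns - 1))"

lemma module_length_eq: "module_length R M = chain_length {N. submodule N R M}"
  unfolding module_length_def chain_length_def strict_chain_def
  by (rule arg_cong[where f = "\<lambda>Y. Sup (_ ` Y)"]) auto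

lemma krull_dim_eq: "krull_dim R = chain_length {P. primeideal P R}"
  unfolding krull_dim_def chain_length_def strict_chain_def
  by (rule arg_cong[where f = "\<lambda>Y. Sup (_ ` Y)"]) auto

lemma strict_chain_singleton [simp]: "strict_chain \<S> [A] \<longleftrightarrow> A \<in> \<S>"
  by (auto simp: strict_chain_def)

lemma strict_chain_Cons:
  assumes "strict_chain \<S> Ns" "A \<in> \<S>" "A \<subset> hd Ns"
  shows "strict_chain \<S> (A # Ns)"
proof -
  obtain B Bs where "Ns = B # Bs" using assms by (cases Ns) (auto simp: strict_chain_def)
  with assms show ?thesis unfolding strict_chain_def by auto
qed

lemma enat_le_chain_length_iff:
  assumes "\<S> \<noteq> {}"
  shows "enat n \<le> chain_length \<S> \<longleftrightarrow> (\<exists>Ns. strict_chain \<S> Ns \<and> n \<le> length Ns - 1)"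
proof -
  obtain A where "A \<in> \<S>" using assms by blast
  then have "Collect (strict_chain \<S>) \<noteq> {}"
    using strict_chain_singleton[of \<S> A] by blast
  from enat_le_SUP_iff[OF this] show ?thesis unfolding chain_length_def by auto
qed

lemma chain_length_geI: "strict_chain \<S> Ns \<Longrightarrow> enat (length Ns - 1) \<le> chain_length \<S>"
  unfolding chain_length_def by (rule SUP_upper) simp

lemma chain_length_leI:
  "(\<And>Ns. strict_chain \<S> Ns \<Longrightarrow> enat (length Ns - 1) \<le> c) \<Longrightarrow> chain_length \<S> \<le> c"
  unfolding chain_length_def by (rule SUP_least) simp

lemma chain_length_attained:
  assumes "\<S> \<noteq> {}" "chain_length \<S> = enat n"
  obtains Ns where "strict_chain \<S> Ns" "length Ns = Suc n"
proof -
  from assms enat_le_chain_length_iff[OF assms(1), of n]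
  obtain Ns where Ns: "strict_chain \<S> Ns" "n \<le> length Ns - 1" by auto
  then have "length Ns - 1 \<le> n" using chain_length_geI[OF Ns(1)] assms by simp
  moreover have "length Ns \<noteq> 0" using Ns by (auto simp: strict_chain_def)
  ultimately have "length Ns = Suc n" using Ns(2) by linarith
  with that Ns show ?thesis by blast
qed

lemma chain_length_strict_mono_le:
  assumes f: "\<And>A. A \<in> \<S> \<Longrightarrow> f A \<in> \<T>"
    and mono: "\<And>A B. A \<in> \<S> \<Longrightarrow> B \<in> \<S> \<Longrightarrow> A \<subset> B \<Longrightarrow> f A \<subset> f B"
  shows "chain_length \<S> \<le> chain_length \<T>"
proof (rule chain_length_leI)
  fix Ns assume "strict_chain \<S> Ns"
  then have "strict_chain \<T> (map f Ns)"
    using f sorted_wrt_mono_rel[of Ns "(\<subset>)" "\<lambda>A B. f A \<subset> f B"] mono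
    unfolding strict_chain_def sorted_wrt_map by (auto simp: subset_iff)
  from chain_length_geI[OF this] show "enat (length Ns - 1) \<le> chain_length \<T>" by simp
qed

lemma chain_length_mono: "\<S> \<subseteq> \<T> \<Longrightarrow> chain_length \<S> \<le> chain_length \<T>"
  by (rule chain_length_strict_mono_le[where f = "\<lambda>A. A"]) auto

lemma chain_length_eqI:
  assumes "\<And>A. A \<in> \<S> \<Longrightarrow> f A \<in> \<T>" "\<And>B. B \<in> \<T> \<Longrightarrow> g B \<in> \<S>"
    and "\<And>A A'. A \<in> \<S> \<Longrightarrow> A' \<in> \<S> \<Longrightarrow> A \<subseteq> A' \<Longrightarrow> f A \<subseteq> f A'"
    and "\<And>B B'. B \<in> \<T> \<Longrightarrow> B' \<in> \<T> \<Longrightarrow> B \<subseteq> B' \<Longrightarrow> g B \<subseteq> g B'"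
    and gf: "\<And>A. A \<in> \<S> \<Longrightarrow> g (f A) = A" and fg: "\<And>B. B \<in> \<T> \<Longrightarrow> f (g B) = B"
  shows "chain_length \<S> = chain_length \<T>"
proof (rule antisym)
  show "chain_length \<S> \<le> chain_length \<T>"
    by (rule chain_length_strict_mono_le[where f = f], use assms in blast)
       (metis assms(3) gf psubset_eq)
  show "chain_length \<T> \<le> chain_length \<S>"
    by (rule chain_length_strict_mono_le[where f = g], use assms in blast)
       (metis assms(4) fg psubset_eq)
qed

text \<open>In the application \<open>f\<close> and \<open>g\<close> intersect with a fixed middle
  submodule and add it. Each strict step of a chain stays strict under \<open>f\<close> or under
  \<open>g\<close>, so it survives in one of the two image chains after repetitions are
  dropped.\<close>

lemma chain_length_le_add:
  assumes f: "\<And>A. A \<in> \<S> \<Longrightarrow> f A \<in> \<T>" and g: "\<And>A. A \<in> \<S> \<Longrightarrow> g A \<in> \<U>"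
    and fm: "\<And>A B. A \<in> \<S> \<Longrightarrow> B \<in> \<S> \<Longrightarrow> A \<subseteq> B \<Longrightarrow> f A \<subseteq> f B"
    and gm: "\<And>A B. A \<in> \<S> \<Longrightarrow> B \<in> \<S> \<Longrightarrow> A \<subseteq> B \<Longrightarrow> g A \<subseteq> g B"
    and inj: "\<And>A B. A \<in> \<S> \<Longrightarrow> B \<in> \<S> \<Longrightarrow> A \<subseteq> B \<Longrightarrow> f A = f B \<Longrightarrow> g A = g B \<Longrightarrow> A = B"
  shows "chain_length \<S> \<le> chain_length \<T> + chain_length \<U>"
proof (rule chain_length_leI)
  fix Ns assume Ns: "strict_chain \<S> Ns"
  \<comment> \<open>The heads belong to the claim because the next member of the chain is compared
    with them.\<close>
  have "\<exists>Ts Us. strict_chain \<T> Ts \<and> strict_chain \<U> Us \<and> hd Ts = f (hd Ns) \<and> hd Us = g (hd Ns)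
      \<and> length Ns - 1 \<le> (length Ts - 1) + (length Us - 1)"
    using Ns
  proof (induction Ns)
    case Nil
    then show ?case by (simp add: strict_chain_def)
  next
    case (Cons A Ns)
    show ?case
    proof (cases "Ns = []")
      case True
      with Cons.prems have "strict_chain \<T> [f A]" "strict_chain \<U> [g A]"
        using f g by (auto simp: strict_chain_def)
      then show ?thesis using True
        by (intro exI[of _ "[f A]"] exI[of _ "[g A]"]) auto
    next
      case False
      then have ch: "strict_chain \<S> Ns" and A: "A \<in> \<S>" "hd Ns \<in> \<S>" "A \<subset> hd Ns"
        using Cons.prems by (auto simp: strict_chain_def)
      from Cons.IH[OF ch] obtain Ts Us where T: "strict_chain \<T> Ts" "hd Ts = f (hd Ns)"
        and U: "strict_chain \<U> Us" "hd Us = g (hd Ns)"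
        and le: "length Ns - 1 \<le> (length Ts - 1) + (length Us - 1)" by blast
      have ne: "Ts \<noteq> []" "Us \<noteq> []" using T U by (auto simp: strict_chain_def)
      define Ts' where "Ts' = (if f A = f (hd Ns) then Ts else f A # Ts)"
      define Us' where "Us' = (if g A = g (hd Ns) then Us else g A # Us)"
      have "strict_chain \<T> Ts'" "strict_chain \<U> Us'"
        using T U A f g fm[of A "hd Ns"] gm[of A "hd Ns"]
        by (auto simp: Ts'_def Us'_def intro!: strict_chain_Cons)
      moreover have "hd Ts' = f A" "hd Us' = g A"
        using T U by (auto simp: Ts'_def Us'_def)
      moreover have "f A \<noteq> f (hd Ns) \<or> g A \<noteq> g (hd Ns)"
        using inj[of A "hd Ns"] A by auto
      then have "length (A # Ns) - 1 \<le> (length Ts' - 1) + (length Us' - 1)"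
        using le False ne
        by (auto simp: Ts'_def Us'_def neq_Nil_conv)
      ultimately show ?thesis by (intro exI[of _ Ts'] exI[of _ Us']) simp
    qed
  qed
  then obtain Ts Us where "strict_chain \<T> Ts" "strict_chain \<U> Us"
    and le: "length Ns - 1 \<le> (length Ts - 1) + (length Us - 1)" by blast
  then have "enat (length Ts - 1) + enat (length Us - 1) \<le> chain_length \<T> + chain_length \<U>"
    by (intro add_mono chain_length_geI)
  then show "enat (length Ns - 1) \<le> chain_length \<T> + chain_length \<U>"
    using le by (metis enat_ord_simps(1) order_trans plus_enat_simps(1))
qed

lemma chain_length_ge_add:
  assumes sub: "\<T> \<subseteq> \<S>" "\<U> \<subseteq> \<S>"
    and B: "B \<in> \<T>" "B \<in> \<U>" "\<And>A. A \<in> \<T> \<Longrightarrow> A \<subseteq> B" "\<And>A. A \<in> \<U> \<Longrightarrow> B \<subseteq> A"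
  shows "chain_length \<T> + chain_length \<U> \<le> chain_length \<S>"
proof (cases "chain_length \<T> = \<infinity> \<or> chain_length \<U> = \<infinity>")
  case True
  then show ?thesis using chain_length_mono[OF sub(1)] chain_length_mono[OF sub(2)] by auto
next
  case False
  then obtain p q where p: "chain_length \<T> = enat p" and q: "chain_length \<U> = enat q" by auto
  obtain Ts where Ts: "strict_chain \<T> Ts" "length Ts = Suc p"
    using chain_length_attained[OF _ p] B by blast
  obtain Us where Us: "strict_chain \<U> Us" "length Us = Suc q"
    using chain_length_attained[OF _ q] B by blast
  obtain Ts' T where T: "Ts = Ts' @ [T]" using Ts(2) by (cases Ts rule: rev_cases) auto
  obtain Us' U where U: "Us = U # Us'" using Us(2) by (cases Us) auto
  have TU: "T \<subseteq> B" "B \<subseteq> U" using Ts Us T U B by (auto simp: strict_chain_def)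
  \<comment> \<open>If the end of \<open>Ts\<close> equals the start of \<open>Us\<close>, both are
    \<open>B\<close>, and listing it once leaves \<open>p + q\<close> strict inclusions. Otherwise
    the joint itself adds one more.\<close>
  define Ns where "Ns = (if T = U then Ts @ Us' else Ts @ Us)"
  have le: "A \<subseteq> T" if "A \<in> set Ts" for A
    using that Ts(1) unfolding T strict_chain_def by (auto simp: sorted_wrt_append)
  have U_lt: "U \<subset> C" if "C \<in> set Us'" for C
    using that Us(1) unfolding U strict_chain_def by auto
  have 1: "\<forall>A\<in>set Ts. \<forall>C\<in>set Us'. A \<subset> C"
    using le U_lt TU by (meson order_trans subset_psubset_trans)
  have 2: "\<forall>A\<in>set Ts. A \<subset> U" if "T \<noteq> U"
    using le TU that by (metis antisym order_trans psubsetI)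
  have "sorted_wrt (\<subset>) Ns"
  proof (cases "T = U")
    case True
    then show ?thesis using 1 Ts(1) Us(1) unfolding Ns_def
      by (simp add: sorted_wrt_append strict_chain_def U)
  next
    case False
    then show ?thesis using 1 2 Ts(1) Us(1) unfolding Ns_def
      by (simp add: sorted_wrt_append strict_chain_def U)
  qed
  moreover have "Ns \<noteq> []" "set Ns \<subseteq> \<S>"
    using Ts(1) Us(1) sub unfolding strict_chain_def Ns_def by (auto simp: U)
  ultimately have "strict_chain \<S> Ns" by (simp add: strict_chain_def)
  from chain_length_geI[OF this] have "enat (length Ns - 1) \<le> chain_length \<S>" .
  moreover have "p + q \<le> length Ns - 1" using Ts(2) Us(2) by (auto simp: Ns_def U)
  ultimately show ?thesis unfolding p q
    by (metis enat_ord_simps(1) order_trans plus_enat_simps(1))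
qed

section \<open>Intervals of submodules\<close>

lemma set_add_iff: "x \<in> set_add G A B \<longleftrightarrow> (\<exists>a\<in>A. \<exists>b\<in>B. x = a \<oplus>\<^bsub>G\<^esub> b)"
  by (auto simp: set_add_def')

lemma set_add_mono: "A \<subseteq> A' \<Longrightarrow> B \<subseteq> B' \<Longrightarrow> set_add G A B \<subseteq> set_add G A' B'"
  unfolding subset_iff set_add_iff by blast

text \<open>For submodules \<open>A \<subseteq> B\<close> this is the length of \<open>B/A\<close>.
  Staying inside one ambient module avoids iterated quotients.\<close>

definition interval_length :: "('a, 'm) ring_scheme \<Rightarrow> ('a, 'b, 'n) module_scheme \<Rightarrow> 'b set \<Rightarrow> 'b set \<Rightarrow> enat"
  where "interval_length R M A B = chain_length {N. submodule N R M \<and> A \<subseteq> N \<and> N \<subseteq> B}"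

context module begin

lemma submodule_zero: "submodule H R M \<Longrightarrow> \<zero>\<^bsub>M\<^esub> \<in> H"
  using submoduleE(2,3,5)[of H] submoduleE(1)[of H] by (metis M.r_neg ex_in_conv subsetD)

lemma submoduleI':
  assumes "H \<subseteq> carrier M" "\<zero>\<^bsub>M\<^esub> \<in> H"
    and "\<And>a b. a \<in> H \<Longrightarrow> b \<in> H \<Longrightarrow> a \<oplus>\<^bsub>M\<^esub> b \<in> H"
    and s: "\<And>a x. a \<in> carrier R \<Longrightarrow> x \<in> H \<Longrightarrow> a \<odot>\<^bsub>M\<^esub> x \<in> H"
  shows "submodule H R M"
proof (rule submoduleI[OF assms(1,2)])
  fix a assume "a \<in> H"
  then have "(\<ominus> \<one>) \<odot>\<^bsub>M\<^esub> a = \<ominus>\<^bsub>M\<^esub> a" using assms(1) smult_l_minus[of \<one> a] by auto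
  then show "\<ominus>\<^bsub>M\<^esub> a \<in> H" using s[of "\<ominus> \<one>" a] \<open>a \<in> H\<close> by simp
qed (use assms in auto)

lemma submodule_minus:
  "submodule H R M \<Longrightarrow> x \<in> H \<Longrightarrow> y \<in> H \<Longrightarrow> x \<ominus>\<^bsub>M\<^esub> y \<in> H"
  unfolding a_minus_def by (simp add: submoduleE)

lemma submodule_Int: "submodule A R M \<Longrightarrow> submodule B R M \<Longrightarrow> submodule (A \<inter> B) R M"
  by (rule submoduleI') (auto simp: submoduleE submodule_zero dest: submoduleE(1))

lemma submodule_set_add:
  assumes A: "submodule A R M" and B: "submodule B R M"
  shows "submodule (A <+>\<^bsub>M\<^esub> B) R M"
proof (rule submoduleI')
  note c = subsetD[OF submoduleE(1)[OF A]] subsetD[OF submoduleE(1)[OF B]]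
  show "A <+>\<^bsub>M\<^esub> B \<subseteq> carrier M" by (auto simp: set_add_iff c)
  show "\<zero>\<^bsub>M\<^esub> \<in> A <+>\<^bsub>M\<^esub> B"
    using submodule_zero[OF A] submodule_zero[OF B] by (force simp: set_add_iff)
  show "x \<oplus>\<^bsub>M\<^esub> y \<in> A <+>\<^bsub>M\<^esub> B" if xy: "x \<in> A <+>\<^bsub>M\<^esub> B" "y \<in> A <+>\<^bsub>M\<^esub> B" for x y
  proof -
    from xy obtain a b a' b' where h: "a \<in> A" "b \<in> B" "a' \<in> A" "b' \<in> B"
      and e: "x = a \<oplus>\<^bsub>M\<^esub> b" "y = a' \<oplus>\<^bsub>M\<^esub> b'" by (auto simp: set_add_iff)
    have "x \<oplus>\<^bsub>M\<^esub> y = (a \<oplus>\<^bsub>M\<^esub> a') \<oplus>\<^bsub>M\<^esub> (b \<oplus>\<^bsub>M\<^esub> b')"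
      using h c unfolding e by (simp add: M.a_ac)
    then show ?thesis unfolding set_add_iff
      using submoduleE(5)[OF A h(1,3)] submoduleE(5)[OF B h(2,4)] by blast
  qed
  show "r \<odot>\<^bsub>M\<^esub> x \<in> A <+>\<^bsub>M\<^esub> B" if r: "r \<in> carrier R" and x: "x \<in> A <+>\<^bsub>M\<^esub> B" for r x
  proof -
    from x obtain a b where h: "a \<in> A" "b \<in> B" and e: "x = a \<oplus>\<^bsub>M\<^esub> b" by (auto simp: set_add_iff)
    have "r \<odot>\<^bsub>M\<^esub> x = r \<odot>\<^bsub>M\<^esub> a \<oplus>\<^bsub>M\<^esub> r \<odot>\<^bsub>M\<^esub> b" unfolding e using h c r by (simp add: smult_r_distr)
    then show ?thesis unfolding set_add_iff
      using submoduleE(4)[OF A r h(1)] submoduleE(4)[OF B r h(2)] by blast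
  qed
qed

lemma subset_set_add:
  assumes "submodule A R M" "submodule B R M"
  shows "A \<subseteq> A <+>\<^bsub>M\<^esub> B" "B \<subseteq> A <+>\<^bsub>M\<^esub> B"
  using submodule_zero[OF assms(1)] submodule_zero[OF assms(2)]
    submoduleE(1)[OF assms(1)] submoduleE(1)[OF assms(2)]
  by (force simp: set_add_iff)+

lemma submodule_set_add_commute:
  assumes "submodule A R M" "submodule B R M"
  shows "A <+>\<^bsub>M\<^esub> B = B <+>\<^bsub>M\<^esub> A"
proof -
  have "A <+>\<^bsub>M\<^esub> B \<subseteq> B <+>\<^bsub>M\<^esub> A" if "submodule A R M" "submodule B R M" for A B
    using M.a_comm[OF subsetD[OF submoduleE(1)[OF that(1)]] subsetD[OF submoduleE(1)[OF that(2)]]]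
    unfolding subset_iff set_add_iff by blast
  then show ?thesis using assms by blast
qed

lemma set_add_least:
  assumes "submodule C R M" "A \<subseteq> C" "B \<subseteq> C"
  shows "A <+>\<^bsub>M\<^esub> B \<subseteq> C"
  using assms submoduleE(5)[OF assms(1)] by (auto simp: set_add_iff subset_iff)

text \<open>The modular law. It makes adding one submodule and intersecting with another inverse to
  each other on the relevant intervals.\<close>

lemma submodule_modular:
  assumes "submodule A R M" "submodule B R M" "submodule C R M" "A \<subseteq> C"
  shows "(A <+>\<^bsub>M\<^esub> B) \<inter> C = A <+>\<^bsub>M\<^esub> (B \<inter> C)"
proof
  note c = subsetD[OF submoduleE(1)[OF assms(1)]] subsetD[OF submoduleE(1)[OF assms(2)]]
  show "(A <+>\<^bsub>M\<^esub> B) \<inter> C \<subseteq> A <+>\<^bsub>M\<^esub> (B \<inter> C)"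
  proof
    fix x assume x: "x \<in> (A <+>\<^bsub>M\<^esub> B) \<inter> C"
    then obtain a b where h: "a \<in> A" "b \<in> B" "x = a \<oplus>\<^bsub>M\<^esub> b" by (auto simp: set_add_iff)
    then have "b = x \<ominus>\<^bsub>M\<^esub> a"
      using c by (simp add: a_minus_def M.a_comm[of a b] M.a_assoc M.r_neg)
    moreover have "x \<ominus>\<^bsub>M\<^esub> a \<in> C" using submodule_minus[OF assms(3)] x h assms(4) by blast
    ultimately have "b \<in> C" by simp
    then show "x \<in> A <+>\<^bsub>M\<^esub> (B \<inter> C)" using h by (auto simp: set_add_iff)
  qed
  show "A <+>\<^bsub>M\<^esub> (B \<inter> C) \<subseteq> (A <+>\<^bsub>M\<^esub> B) \<inter> C"
  proof
    fix x assume "x \<in> A <+>\<^bsub>M\<^esub> (B \<inter> C)"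
    then obtain a b where h: "a \<in> A" "b \<in> B" "b \<in> C" "x = a \<oplus>\<^bsub>M\<^esub> b" by (auto simp: set_add_iff)
    then show "x \<in> (A <+>\<^bsub>M\<^esub> B) \<inter> C"
      using assms(4) submoduleE(5)[OF assms(3)] by (blast intro: set_add_iff[THEN iffD2])
  qed
qed

text \<open>Comparable submodules with the same intersection with \<open>B\<close> and the same sum
  with \<open>B\<close> coincide by the modular law, so no step of a chain is lost both below and
  above \<open>B\<close>. Conversely a chain below \<open>B\<close> and one above it can be
  joined.\<close>

lemma interval_length_add:
  assumes A: "submodule A R M" and B: "submodule B R M" and C: "submodule C R M"
    and sub: "A \<subseteq> B" "B \<subseteq> C"
  shows "interval_length R M A C = interval_length R M A B + interval_length R M B C"
proof (rule antisym)
  show "interval_length R M A C \<le> interval_length R M A B + interval_length R M B C"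
    unfolding interval_length_def
  proof (rule chain_length_le_add[where f = "\<lambda>N. N \<inter> B" and g = "\<lambda>N. B <+>\<^bsub>M\<^esub> N"])
    fix N assume N: "N \<in> {N. submodule N R M \<and> A \<subseteq> N \<and> N \<subseteq> C}"
    show "N \<inter> B \<in> {N. submodule N R M \<and> A \<subseteq> N \<and> N \<subseteq> B}"
      using N sub B submodule_Int by auto
    show "B <+>\<^bsub>M\<^esub> N \<in> {N. submodule N R M \<and> B \<subseteq> N \<and> N \<subseteq> C}"
      using N sub submodule_set_add[OF B] subset_set_add(1)[OF B] set_add_least[OF C, of B N] by auto
    fix N' assume N': "N' \<in> {N. submodule N R M \<and> A \<subseteq> N \<and> N \<subseteq> C}" and le: "N \<subseteq> N'"
    show "N \<inter> B \<subseteq> N' \<inter> B" "B <+>\<^bsub>M\<^esub> N \<subseteq> B <+>\<^bsub>M\<^esub> N'"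
      using le unfolding subset_iff set_add_iff by blast+
    assume eq: "N \<inter> B = N' \<inter> B" "B <+>\<^bsub>M\<^esub> N = B <+>\<^bsub>M\<^esub> N'"
    have s: "submodule N R M" "submodule N' R M" using N N' by auto
    have "N' = (N <+>\<^bsub>M\<^esub> B) \<inter> N'"
    proof -
      have "N <+>\<^bsub>M\<^esub> B = B <+>\<^bsub>M\<^esub> N" by (rule submodule_set_add_commute[OF s(1) B])
      then show ?thesis using eq(2) subset_set_add(2)[OF B s(2)] by auto
    qed
    also have "\<dots> = N <+>\<^bsub>M\<^esub> (B \<inter> N')" by (rule submodule_modular[OF s(1) B s(2) le])
    also have "\<dots> \<subseteq> N" using eq(1) by (intro set_add_least[OF s(1)]) auto
    finally show "N = N'" using le by auto
  qed
  show "interval_length R M A B + interval_length R M B C \<le> interval_length R M A C"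
    unfolding interval_length_def
    by (rule chain_length_ge_add[where B = B]) (use assms in auto)
qed

text \<open>The second isomorphism theorem, as an order isomorphism of intervals.\<close>

lemma interval_length_set_add:
  assumes A: "submodule A R M" and B: "submodule B R M"
  shows "interval_length R M A (A <+>\<^bsub>M\<^esub> B) = interval_length R M (B \<inter> A) B"
  unfolding interval_length_def
proof (rule chain_length_eqI[where f = "\<lambda>N. B \<inter> N" and g = "\<lambda>N. A <+>\<^bsub>M\<^esub> N"])
  fix N assume N: "N \<in> {N. submodule N R M \<and> A \<subseteq> N \<and> N \<subseteq> A <+>\<^bsub>M\<^esub> B}"
  then show "B \<inter> N \<in> {N. submodule N R M \<and> B \<inter> A \<subseteq> N \<and> N \<subseteq> B}"
    using B submodule_Int by auto
  show "A <+>\<^bsub>M\<^esub> (B \<inter> N) = N"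
    using N submodule_modular[OF A B, of N] by auto
next
  fix N assume N: "N \<in> {N. submodule N R M \<and> B \<inter> A \<subseteq> N \<and> N \<subseteq> B}"
  then have s: "submodule N R M" "N \<subseteq> B" "B \<inter> A \<subseteq> N" by auto
  then show "A <+>\<^bsub>M\<^esub> N \<in> {N. submodule N R M \<and> A \<subseteq> N \<and> N \<subseteq> A <+>\<^bsub>M\<^esub> B}"
    using submodule_set_add[OF A s(1)] subset_set_add(1)[OF A s(1)] set_add_mono[of A A N B M] by simp
  have "N <+>\<^bsub>M\<^esub> A = A <+>\<^bsub>M\<^esub> N"
    by (rule submodule_set_add_commute[OF s(1) A])
  then have "B \<inter> (A <+>\<^bsub>M\<^esub> N) = N <+>\<^bsub>M\<^esub> (A \<inter> B)"
    using submodule_modular[OF s(1) A B s(2)] by blast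
  also have "\<dots> = N"
    using s subset_set_add(1)[OF s(1) submodule_Int[OF A B]] set_add_least[OF s(1), of N "A \<inter> B"] by blast
  finally show "B \<inter> (A <+>\<^bsub>M\<^esub> N) = N" .
qed (blast, rule set_add_mono, simp_all)

text \<open>The correspondence theorem for \<open>\<phi>\<close> with kernel \<open>B\<close>. The
  target is merely a record with suitable operations, as quotients and graded components are; its
  group laws are transported along \<open>\<phi>\<close>.\<close>

lemma module_length_image:
  fixes M' :: "('a, 'e, 'f) module_scheme"
  assumes A: "submodule A R M" and car: "\<phi> ` A = carrier M'"
    and add: "\<And>x y. x \<in> A \<Longrightarrow> y \<in> A \<Longrightarrow> \<phi> (x \<oplus>\<^bsub>M\<^esub> y) = \<phi> x \<oplus>\<^bsub>M'\<^esub> \<phi> y"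
    and sm: "\<And>r x. r \<in> carrier R \<Longrightarrow> x \<in> A \<Longrightarrow> \<phi> (r \<odot>\<^bsub>M\<^esub> x) = r \<odot>\<^bsub>M'\<^esub> \<phi> x"
    and zero: "\<phi> \<zero>\<^bsub>M\<^esub> = \<zero>\<^bsub>M'\<^esub>"
    and B: "B = {x \<in> A. \<phi> x = \<zero>\<^bsub>M'\<^esub>}"
  shows "module_length R M' = interval_length R M B A"
proof -
  note Ac = subsetD[OF submoduleE(1)[OF A]]
  note A0 = submodule_zero[OF A]
  have phiI: "x \<in> A \<Longrightarrow> \<phi> x \<in> carrier M'" for x using car by auto
  have neg: "\<phi> (\<ominus>\<^bsub>M\<^esub> x) \<oplus>\<^bsub>M'\<^esub> \<phi> x = \<zero>\<^bsub>M'\<^esub>" if "x \<in> A" for x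
    using add[of "\<ominus>\<^bsub>M\<^esub> x" x] that submoduleE(3)[OF A] Ac zero by (simp add: M.l_neg)
  \<comment> \<open>Submodules of \<open>M'\<close> are subgroups of its own
    \<open>add_monoid\<close>, so inverses taken there have to be identified with images of
    negatives.\<close>
  have grp: "group (add_monoid M')"
  proof (rule groupI)
    fix x y z assume "x \<in> carrier (add_monoid M')" "y \<in> carrier (add_monoid M')" "z \<in> carrier (add_monoid M')"
    then have xyz: "x \<in> \<phi> ` A" "y \<in> \<phi> ` A" "z \<in> \<phi> ` A" using car by auto
    then show "x \<otimes>\<^bsub>add_monoid M'\<^esub> y \<otimes>\<^bsub>add_monoid M'\<^esub> z = x \<otimes>\<^bsub>add_monoid M'\<^esub> (y \<otimes>\<^bsub>add_monoid M'\<^esub> z)"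
      using Ac submoduleE(5)[OF A] by (auto simp: add[symmetric] M.a_assoc)
  next
    fix x y assume "x \<in> carrier (add_monoid M')" "y \<in> carrier (add_monoid M')"
    then have "x \<in> \<phi> ` A" "y \<in> \<phi> ` A" using car by auto
    then show "x \<otimes>\<^bsub>add_monoid M'\<^esub> y \<in> carrier (add_monoid M')"
      using submoduleE(5)[OF A] phiI by (auto simp: add[symmetric])
  next
    show "\<one>\<^bsub>add_monoid M'\<^esub> \<in> carrier (add_monoid M')" using zero phiI[OF A0] by simp
  next
    fix x assume "x \<in> carrier (add_monoid M')"
    then obtain a where a: "a \<in> A" "x = \<phi> a" using car by auto
    show "\<one>\<^bsub>add_monoid M'\<^esub> \<otimes>\<^bsub>add_monoid M'\<^esub> x = x"
      using a Ac A0 zero add[of "\<zero>\<^bsub>M\<^esub>" a] by auto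
    show "\<exists>y\<in>carrier (add_monoid M'). y \<otimes>\<^bsub>add_monoid M'\<^esub> x = \<one>\<^bsub>add_monoid M'\<^esub>"
      using a neg[of a] phiI[OF submoduleE(3)[OF A a(1)]] by auto
  qed
  interpret G: group "add_monoid M'" by fact
  have inv: "inv\<^bsub>add_monoid M'\<^esub> (\<phi> x) = \<phi> (\<ominus>\<^bsub>M\<^esub> x)" if "x \<in> A" for x
    using G.inv_equality[of "\<phi> (\<ominus>\<^bsub>M\<^esub> x)" "\<phi> x"] neg[OF that] phiI that submoduleE(3)[OF A] by simp
  define f where "f N = {x \<in> A. \<phi> x \<in> N}" for N
  show ?thesis unfolding module_length_eq interval_length_def
  proof (rule chain_length_eqI[where f = f and g = "\<lambda>K. \<phi> ` K"])
    fix N assume "N \<in> {N. submodule N R M'}"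
    then have N: "submodule N R M'" by simp
    interpret N: submodule N R M' by fact
    show "f N \<in> {N. submodule N R M \<and> B \<subseteq> N \<and> N \<subseteq> A}"
    proof -
      have "submodule (f N) R M"
        by (rule submoduleI')
           (use A0 zero N.one_closed N.m_closed N.smult_closed Ac submoduleE(4,5)[OF A] add sm in \<open>auto simp: f_def\<close>)
      moreover have "B \<subseteq> f N" using B N.one_closed by (auto simp: f_def)
      ultimately show ?thesis by (auto simp: f_def)
    qed
    show "\<phi> ` f N = N" using N.subset car by (auto simp: f_def)
  next
    fix K assume K: "K \<in> {N. submodule N R M \<and> B \<subseteq> N \<and> N \<subseteq> A}"
    then have K': "submodule K R M" and KA: "\<And>x. x \<in> K \<Longrightarrow> x \<in> A" by auto
    have "subgroup (\<phi> ` K) (add_monoid M')"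
    proof (rule G.subgroupI)
      show "\<phi> ` K \<subseteq> carrier (add_monoid M')" using KA phiI by auto
      show "\<phi> ` K \<noteq> {}" using submodule_zero[OF K'] by auto
      show "inv\<^bsub>add_monoid M'\<^esub> a \<in> \<phi> ` K" if "a \<in> \<phi> ` K" for a
        using that inv KA submoduleE(3)[OF K'] by auto
      show "a \<otimes>\<^bsub>add_monoid M'\<^esub> b \<in> \<phi> ` K" if "a \<in> \<phi> ` K" "b \<in> \<phi> ` K" for a b
        using that KA submoduleE(5)[OF K'] by (auto simp: add[symmetric])
    qed
    then show "\<phi> ` K \<in> {N. submodule N R M'}"
      using submoduleE(4)[OF K'] KA by (auto simp: submodule_def submodule_axioms_def sm[symmetric])
    show "f (\<phi> ` K) = K"
    proof
      show "f (\<phi> ` K) \<subseteq> K"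
      proof
        fix x assume "x \<in> f (\<phi> ` K)"
        then obtain k where x: "x \<in> A" and k: "k \<in> K" "\<phi> x = \<phi> k" by (auto simp: f_def)
        have "\<phi> (\<ominus>\<^bsub>M\<^esub> k \<oplus>\<^bsub>M\<^esub> x) = \<zero>\<^bsub>M'\<^esub>"
          using add[of "\<ominus>\<^bsub>M\<^esub> k" x] x k KA submoduleE(3)[OF A] neg by simp
        then have "\<ominus>\<^bsub>M\<^esub> k \<oplus>\<^bsub>M\<^esub> x \<in> K"
          using B K x k KA submoduleE(3,5)[OF A] by auto
        then have "k \<oplus>\<^bsub>M\<^esub> (\<ominus>\<^bsub>M\<^esub> k \<oplus>\<^bsub>M\<^esub> x) \<in> K" using k submoduleE(5)[OF K'] by simp
        then show "x \<in> K" using x k KA Ac by (simp add: M.r_neg2)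
      qed
      show "K \<subseteq> f (\<phi> ` K)" using KA by (auto simp: f_def)
    qed
  qed (auto simp: f_def)
qed

end

section \<open>Ideals and their colengths\<close>

context cring begin

lemma idealD:
  assumes "ideal K R"
  shows "\<And>a. a \<in> K \<Longrightarrow> a \<in> carrier R" "\<zero> \<in> K"
    and "\<And>a b. a \<in> K \<Longrightarrow> b \<in> K \<Longrightarrow> a \<oplus> b \<in> K"
    and "\<And>r a. r \<in> carrier R \<Longrightarrow> a \<in> K \<Longrightarrow> r \<otimes> a \<in> K"
    and "\<And>r a. r \<in> carrier R \<Longrightarrow> a \<in> K \<Longrightarrow> a \<otimes> r \<in> K"
    and "\<And>a. a \<in> K \<Longrightarrow> \<ominus> a \<in> K" "\<And>a b. a \<in> K \<Longrightarrow> b \<in> K \<Longrightarrow> a \<ominus> b \<in> K"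
  using assms ideal.Icarr[OF assms] ideal.I_l_closed[OF assms] ideal.I_r_closed[OF assms]
  by (auto simp: additive_subgroup.zero_closed additive_subgroup.a_closed
      additive_subgroup.a_inv_closed ideal.axioms a_minus_def)

lemma ideal_criterion:
  assumes "\<And>a. a \<in> K \<Longrightarrow> a \<in> carrier R" "\<zero> \<in> K"
    and "\<And>a b. a \<in> K \<Longrightarrow> b \<in> K \<Longrightarrow> a \<oplus> b \<in> K"
    and smult: "\<And>r a. r \<in> carrier R \<Longrightarrow> a \<in> K \<Longrightarrow> r \<otimes> a \<in> K"
  shows "ideal K R"
proof (rule idealI[OF ring_axioms])
  show "subgroup K (add_monoid R)"
  proof (rule add.subgroupI)
    show "\<ominus> a \<in> K" if "a \<in> K" for a
      using smult[of "\<ominus> \<one>" a] that assms(1) l_minus[of \<one> a] by simp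
  qed (use assms in auto)
  show "a \<otimes> x \<in> K" "x \<otimes> a \<in> K" if "a \<in> K" "x \<in> carrier R" for a x
    using that assms m_comm[of a x] by auto
qed

lemma ideal_diff_mem:
  assumes "ideal K R" "a \<in> carrier R" "b \<in> K" "a \<ominus> b \<in> K"
  shows "a \<in> K"
proof -
  have "a = (a \<ominus> b) \<oplus> b"
    using assms idealD(1)[OF assms(1,3)] by (simp add: a_minus_def a_assoc l_neg)
  then show ?thesis using idealD(3)[OF assms(1,4,3)] by simp
qed

lemma ideal_add_cancel:
  assumes "ideal K R" "a \<in> carrier R" "b \<in> K"
  shows "b \<oplus> a \<in> K \<longleftrightarrow> a \<in> K" "a \<oplus> b \<in> K \<longleftrightarrow> a \<in> K"
proof -
  have b: "b \<in> carrier R" using idealD(1)[OF assms(1,3)] .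
  have "a = (a \<oplus> b) \<ominus> b" using assms(2) b by (simp add: a_minus_def a_assoc r_neg)
  then show "a \<oplus> b \<in> K \<longleftrightarrow> a \<in> K" using idealD(3,7)[OF assms(1)] assms(3) by metis
  then show "b \<oplus> a \<in> K \<longleftrightarrow> a \<in> K" using a_comm[OF b assms(2)] by simp
qed

lemma ideal_carrier_iff: "ideal K R \<Longrightarrow> K = carrier R \<longleftrightarrow> \<one> \<in> K"
  using ideal.one_imp_carrier by auto

subsection \<open>Lengths of intervals of ideals\<close>

lemma self_module_sel [simp]:
  "carrier (self_module R) = carrier R" "\<zero>\<^bsub>self_module R\<^esub> = \<zero>"
  "x \<oplus>\<^bsub>self_module R\<^esub> y = x \<oplus> y" "x \<odot>\<^bsub>self_module R\<^esub> y = x \<otimes> y"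
  by (simp_all add: self_module_def)

lemma module_self_module: "module R (self_module R)"
proof (rule moduleI[OF is_cring])
  show "abelian_group (self_module R)"
    by (rule abelian_groupI) (auto simp: a_ac intro: bexI[of _ "\<ominus> x" for x] l_neg)
qed (auto simp: l_distr r_distr m_assoc)

lemma submodule_self_module: "submodule K R (self_module R) \<longleftrightarrow> ideal K R"
proof -
  interpret S: module R "self_module R" by (rule module_self_module)
  show ?thesis
  proof
    assume K: "submodule K R (self_module R)"
    show "ideal K R"
      by (rule ideal_criterion)
         (use S.submoduleE[OF K] S.submodule_zero[OF K] in \<open>auto\<close>)
  next
    assume K: "ideal K R"
    show "submodule K R (self_module R)"
      by (rule S.submoduleI') (use idealD[OF K] in auto)
  qed
qed

definition len :: "'a set \<Rightarrow> 'a set \<Rightarrow> enat" where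
  "len A B = chain_length {K. ideal K R \<and> A \<subseteq> K \<and> K \<subseteq> B}"

abbreviation colength :: "'a set \<Rightarrow> enat" where
  "colength A \<equiv> len A (carrier R)"

lemma interval_length_self_module: "interval_length R (self_module R) A B = len A B"
  by (simp add: interval_length_def len_def submodule_self_module)

lemma len_add:
  assumes "ideal A R" "ideal B R" "ideal C R" "A \<subseteq> B" "B \<subseteq> C"
  shows "len A C = len A B + len B C"
  using module.interval_length_add[OF module_self_module, of A B C] assms
  by (simp add: submodule_self_module interval_length_self_module)

lemma colength_add:
  assumes "ideal A R" "ideal B R" "A \<subseteq> B"
  shows "colength A = len A B + colength B"
  using len_add[OF assms(1,2) oneideal assms(3)] idealD(1)[OF assms(2)] by blast

lemma len_refl: "len A A = 0"
proof -
  have "{K. ideal K R \<and> A \<subseteq> K \<and> K \<subseteq> A} \<subseteq> {A}" by auto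
  then have "len A A \<le> chain_length {A}" unfolding len_def by (rule chain_length_mono)
  also have "\<dots> \<le> 0"
  proof (rule chain_length_leI)
    fix Ns assume "strict_chain {A} Ns"
    then have "Ns \<noteq> []" "sorted_wrt (\<subset>) Ns" "set Ns \<subseteq> {A}" by (auto simp: strict_chain_def)
    then have "length Ns = 1"
      by (cases Ns rule: remdups_adj.cases) auto
    then show "enat (length Ns - 1) \<le> 0" by (simp add: zero_enat_def)
  qed
  finally show ?thesis by simp
qed

lemma len_pos:
  assumes "ideal A R" "ideal B R" "A \<subset> B"
  shows "1 \<le> len A B"
proof -
  have "strict_chain {K. ideal K R \<and> A \<subseteq> K \<and> K \<subseteq> B} [A, B]"
    using assms by (auto simp: strict_chain_def)
  from chain_length_geI[OF this] show ?thesis by (simp add: len_def one_enat_def)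
qed

lemma colength_antimono:
  "ideal A R \<Longrightarrow> ideal B R \<Longrightarrow> A \<subseteq> B \<Longrightarrow> colength B \<le> colength A"
  using colength_add[of A B] by simp

lemma ideal_quot_carrier: "carrier (ideal_quot R I J) = (\<lambda>a. J +> a) ` I"
  by (auto simp: ideal_quot_def quot_module_def A_RCOSETS_def' a_r_coset_def' self_module_def)

lemma ideal_quot_zero [simp]: "\<zero>\<^bsub>ideal_quot R I J\<^esub> = J"
  by (simp add: ideal_quot_def quot_module_def)

lemma ideal_quot_add:
  assumes "ideal J R" "x \<in> carrier R" "y \<in> carrier R"
  shows "(J +> x) \<oplus>\<^bsub>ideal_quot R I J\<^esub> (J +> y) = J +> (x \<oplus> y)"
  using ideal.a_rcos_sum[OF assms]
  by (simp add: ideal_quot_def quot_module_def set_add_iff set_eq_iff self_module_def)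

lemma coset_eq_ideal_iff:
  assumes "ideal J R" "x \<in> carrier R"
  shows "J +> x = J \<longleftrightarrow> x \<in> J"
proof -
  interpret J: ideal J R by fact
  show ?thesis using J.a_rcos_const[of x] J.a_rcos_self[OF assms(2)] by blast
qed

text \<open>The scalar action on a coset is a union over its representatives. All of them yield the
  same coset, so the union collapses.\<close>

lemma ideal_quot_smult:
  assumes J: "ideal J R" and r: "r \<in> carrier R" and x: "x \<in> carrier R"
  shows "r \<odot>\<^bsub>ideal_quot R I J\<^esub> (J +> x) = J +> (r \<otimes> x)"
proof -
  interpret J: ideal J R by fact
  have coset_eq: "J +> (r \<otimes> y) = J +> (r \<otimes> x)" if "y \<in> J +> x" for y
  proof -
    from that obtain j where j: "j \<in> J" "y = j \<oplus> x" by (auto simp: a_r_coset_def')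
    have "r \<otimes> y = r \<otimes> j \<oplus> r \<otimes> x"
      using j r x idealD(1)[OF J] by (simp add: r_distr)
    then have "r \<otimes> y \<in> J +> (r \<otimes> x)"
      using idealD(4)[OF J r j(1)] by (auto simp: a_r_coset_def')
    then show ?thesis using a_repr_independence[OF _ _ J.a_subgroup, of "r \<otimes> y" "r \<otimes> x"] r x by simp
  qed
  have "r \<odot>\<^bsub>ideal_quot R I J\<^esub> (J +> x) = (\<Union>y\<in>J +> x. J +> (r \<otimes> y))"
    by (simp add: ideal_quot_def quot_module_def a_r_coset_def' self_module_def)
  also have "\<dots> = (\<Union>y\<in>J +> x. J +> (r \<otimes> x))" by (rule SUP_cong[OF refl coset_eq])
  also have "\<dots> = J +> (r \<otimes> x)" using J.a_rcos_self[OF x] by blast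
  finally show ?thesis .
qed

lemma module_length_ideal_quot:
  assumes I: "ideal I R" and J: "ideal J R" and sub: "J \<subseteq> I"
  shows "module_length R (ideal_quot R I J) = len J I"
proof -
  interpret S: module R "self_module R" by (rule module_self_module)
  note c = idealD(1)[OF I]
  have "module_length R (ideal_quot R I J)
      = interval_length R (self_module R) {x \<in> I. J +> x = \<zero>\<^bsub>ideal_quot R I J\<^esub>} I"
  proof (rule S.module_length_image[where \<phi> = "\<lambda>a. J +> a"])
    show "submodule I R (self_module R)" using I by (simp add: submodule_self_module)
    show "J +> \<zero>\<^bsub>self_module R\<^esub> = \<zero>\<^bsub>ideal_quot R I J\<^esub>"
      using coset_eq_ideal_iff[OF J zero_closed] idealD(2)[OF J] by simp
  qed (simp_all add: c ideal_quot_carrier ideal_quot_add[OF J] ideal_quot_smult[OF J])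
  moreover have "{x \<in> I. J +> x = \<zero>\<^bsub>ideal_quot R I J\<^esub>} = J"
    using coset_eq_ideal_iff[OF J c] sub by auto
  ultimately show ?thesis by (simp add: interval_length_self_module)
qed

subsection \<open>Adjoining multiples of an element\<close>

definition mult_add :: "'a set \<Rightarrow> 'a \<Rightarrow> 'a set \<Rightarrow> 'a set" where
  "mult_add K x L = {k \<oplus> a \<otimes> x | k a. k \<in> K \<and> a \<in> L}"

lemma mult_add_iff: "y \<in> mult_add K x L \<longleftrightarrow> (\<exists>k\<in>K. \<exists>a\<in>L. y = k \<oplus> a \<otimes> x)"
  by (auto simp: mult_add_def)

lemma mult_add_ideal:
  assumes K: "ideal K R" and x: "x \<in> carrier R" and L: "ideal L R"
  shows "ideal (mult_add K x L) R"
proof (rule ideal_criterion)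
  note c = idealD(1)[OF K] idealD(1)[OF L]
  show "a \<in> carrier R" if "a \<in> mult_add K x L" for a
    using that c x by (auto simp: mult_add_def)
  show "\<zero> \<in> mult_add K x L"
    using idealD(2)[OF K] idealD(2)[OF L] x by (force simp: mult_add_def)
  show "y \<oplus> z \<in> mult_add K x L" if yz: "y \<in> mult_add K x L" "z \<in> mult_add K x L" for y z
  proof -
    from yz obtain k a k' a' where h: "k \<in> K" "k' \<in> K" "a \<in> L" "a' \<in> L" "y = k \<oplus> a \<otimes> x" "z = k' \<oplus> a' \<otimes> x"
      by (auto simp: mult_add_iff)
    then have "y \<oplus> z = (k \<oplus> k') \<oplus> (a \<oplus> a') \<otimes> x" using c x by (simp add: l_distr a_ac)
    then show ?thesis using h idealD(3)[OF K] idealD(3)[OF L] unfolding mult_add_iff by blast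
  qed
  show "r \<otimes> y \<in> mult_add K x L" if r: "r \<in> carrier R" and y: "y \<in> mult_add K x L" for r y
  proof -
    from y obtain k a where h: "k \<in> K" "a \<in> L" "y = k \<oplus> a \<otimes> x" by (auto simp: mult_add_iff)
    then have "r \<otimes> y = r \<otimes> k \<oplus> (r \<otimes> a) \<otimes> x" using c x r by (simp add: r_distr m_assoc)
    then show ?thesis using h r idealD(4)[OF K] idealD(4)[OF L] unfolding mult_add_iff by blast
  qed
qed

lemma mult_add_base: "ideal K R \<Longrightarrow> x \<in> carrier R \<Longrightarrow> ideal L R \<Longrightarrow> K \<subseteq> mult_add K x L"
  using idealD(1)[of K] idealD(2)[of L] by (force simp: mult_add_iff)

lemma mult_add_mult: "ideal K R \<Longrightarrow> x \<in> carrier R \<Longrightarrow> ideal L R \<Longrightarrow> a \<in> L \<Longrightarrow> a \<otimes> x \<in> mult_add K x L"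
  using idealD(1)[of L] idealD(2)[of K] by (force simp: mult_add_iff)

lemma mult_add_mono: "K \<subseteq> K' \<Longrightarrow> L \<subseteq> L' \<Longrightarrow> mult_add K x L \<subseteq> mult_add K' x L'"
  unfolding subset_iff mult_add_iff by blast

lemma mult_add_least:
  assumes "ideal N R" "K \<subseteq> N" "\<And>a. a \<in> L \<Longrightarrow> a \<otimes> x \<in> N"
  shows "mult_add K x L \<subseteq> N"
  using assms(2,3) idealD(3)[OF assms(1)] by (auto simp: mult_add_def)

definition adjoin :: "'a set \<Rightarrow> 'a \<Rightarrow> 'a set" where
  "adjoin K x = mult_add K x (carrier R)"

lemma adjoin_iff: "y \<in> adjoin K x \<longleftrightarrow> (\<exists>k\<in>K. \<exists>a\<in>carrier R. y = k \<oplus> a \<otimes> x)"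
  by (simp add: adjoin_def mult_add_iff)

lemma adjoin_ideal: "ideal K R \<Longrightarrow> x \<in> carrier R \<Longrightarrow> ideal (adjoin K x) R"
  unfolding adjoin_def by (rule mult_add_ideal[OF _ _ oneideal])

lemma adjoin_base: "ideal K R \<Longrightarrow> x \<in> carrier R \<Longrightarrow> K \<subseteq> adjoin K x"
  unfolding adjoin_def by (rule mult_add_base[OF _ _ oneideal])

lemma adjoin_self: "ideal K R \<Longrightarrow> x \<in> carrier R \<Longrightarrow> x \<in> adjoin K x"
  unfolding adjoin_def using mult_add_mult[OF _ _ oneideal, of K x \<one>] by simp

lemma adjoin_least: "ideal N R \<Longrightarrow> K \<subseteq> N \<Longrightarrow> x \<in> N \<Longrightarrow> adjoin K x \<subseteq> N"
  unfolding adjoin_def by (rule mult_add_least) (auto intro: idealD)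

lemma adjoin_subset_iff:
  "ideal N R \<Longrightarrow> ideal K R \<Longrightarrow> x \<in> carrier R \<Longrightarrow> adjoin K x \<subseteq> N \<longleftrightarrow> K \<subseteq> N \<and> x \<in> N"
  using adjoin_least[of N K x] adjoin_base[of K x] adjoin_self[of K x] by blast

definition colon_elt :: "'a set \<Rightarrow> 'a \<Rightarrow> 'a set" where
  "colon_elt K x = {a \<in> carrier R. a \<otimes> x \<in> K}"

lemma colon_elt_ideal:
  assumes "ideal K R" "x \<in> carrier R"
  shows "ideal (colon_elt K x) R"
  by (rule ideal_criterion)
     (use assms idealD[OF assms(1)] in \<open>auto simp: colon_elt_def l_distr m_assoc\<close>)

lemma subset_colon_elt: "ideal K R \<Longrightarrow> x \<in> carrier R \<Longrightarrow> K \<subseteq> colon_elt K x"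
  using idealD(1,5)[of K] by (auto simp: colon_elt_def)

text \<open>Multiplication by \<open>x\<close> identifies \<open>R/(K : x)\<close> with
  \<open>(K + (x))/K\<close>. On ideals the two directions are \<open>L\<close> to
  \<open>L : x\<close> and \<open>L\<close> to \<open>K + L x\<close>.\<close>

lemma len_adjoin:
  assumes K: "ideal K R" and x: "x \<in> carrier R"
  shows "len K (adjoin K x) = colength (colon_elt K x)"
  unfolding len_def
proof (rule chain_length_eqI[where f = "\<lambda>L. colon_elt L x" and g = "\<lambda>L. mult_add K x L"])
  note c = idealD(1)[OF K]
  fix L assume "L \<in> {L. ideal L R \<and> K \<subseteq> L \<and> L \<subseteq> adjoin K x}"
  then have L: "ideal L R" "K \<subseteq> L" "L \<subseteq> adjoin K x" by auto
  show "colon_elt L x \<in> {L. ideal L R \<and> colon_elt K x \<subseteq> L \<and> L \<subseteq> carrier R}"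
    using colon_elt_ideal[OF L(1) x] L(2) by (auto simp: colon_elt_def)
  show "mult_add K x (colon_elt L x) = L"
  proof
    show "mult_add K x (colon_elt L x) \<subseteq> L"
      by (rule mult_add_least[OF L(1,2)]) (simp add: colon_elt_def)
    show "L \<subseteq> mult_add K x (colon_elt L x)"
    proof
      fix y assume y: "y \<in> L"
      with L(3) have "y \<in> adjoin K x" by blast
      then obtain k a where ka: "k \<in> K" "a \<in> carrier R" "y = k \<oplus> a \<otimes> x" by (auto simp: adjoin_iff)
      then have "a \<otimes> x \<in> L" using y ideal_add_cancel(1)[OF L(1), of "a \<otimes> x" k] L(2) x by auto
      then show "y \<in> mult_add K x (colon_elt L x)"
        using ka unfolding mult_add_iff colon_elt_def by blast
    qed
  qed
next
  note c = idealD(1)[OF K]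
  fix L assume "L \<in> {L. ideal L R \<and> colon_elt K x \<subseteq> L \<and> L \<subseteq> carrier R}"
  then have L: "ideal L R" "colon_elt K x \<subseteq> L" by auto
  show "mult_add K x L \<in> {L. ideal L R \<and> K \<subseteq> L \<and> L \<subseteq> adjoin K x}"
    using mult_add_ideal[OF K x L(1)] mult_add_base[OF K x L(1)] idealD(1)[OF L(1)]
      mult_add_mono[of K K L "carrier R" x] unfolding adjoin_def by blast
  show "colon_elt (mult_add K x L) x = L"
  proof
    show "L \<subseteq> colon_elt (mult_add K x L) x"
      using mult_add_mult[OF K x L(1)] idealD(1)[OF L(1)] by (auto simp: colon_elt_def)
    show "colon_elt (mult_add K x L) x \<subseteq> L"
    proof
      fix a assume "a \<in> colon_elt (mult_add K x L) x"
      then obtain k b where h: "a \<in> carrier R" "k \<in> K" "b \<in> L" "a \<otimes> x = k \<oplus> b \<otimes> x"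
        by (auto simp: colon_elt_def mult_add_iff)
      have b: "b \<in> carrier R" using idealD(1)[OF L(1)] h by blast
      have "(a \<ominus> b) \<otimes> x = (k \<oplus> b \<otimes> x) \<ominus> b \<otimes> x"
        using h b x c by (simp add: a_minus_def l_distr l_minus)
      also have "\<dots> = k" using h b x c by (simp add: a_minus_def a_assoc r_neg)
      finally have "a \<ominus> b \<in> L" using L(2) h b by (auto simp: colon_elt_def)
      then show "a \<in> L" using ideal_diff_mem[OF L(1)] h by blast
    qed
  qed
  fix L' assume "L \<subseteq> L'"
  then show "mult_add K x L \<subseteq> mult_add K x L'" by (rule mult_add_mono[OF order_refl])
qed (auto simp: colon_elt_def)

text \<open>The recursion behind the colength formulas: when \<open>K\<close> is built from a power
  of an ideal and \<open>x\<close> is one of the generators, the colon term leads to a lower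
  exponent and the other term to fewer generators.\<close>

lemma colength_split:
  assumes "ideal K R" "x \<in> carrier R"
  shows "colength K = colength (colon_elt K x) + colength (adjoin K x)"
  using colength_add[OF assms(1) adjoin_ideal[OF assms] adjoin_base[OF assms]] len_adjoin[OF assms]
  by simp

primrec adjoins :: "'a set \<Rightarrow> 'a list \<Rightarrow> 'a set" where
  "adjoins K [] = K"
| "adjoins K (x # xs) = adjoins (adjoin K x) xs"

lemma adjoins_ideal: "ideal K R \<Longrightarrow> set xs \<subseteq> carrier R \<Longrightarrow> ideal (adjoins K xs) R"
  by (induction xs arbitrary: K) (auto intro: adjoin_ideal)

lemma adjoins_subset_iff:
  "ideal N R \<Longrightarrow> ideal K R \<Longrightarrow> set xs \<subseteq> carrier R \<Longrightarrow> adjoins K xs \<subseteq> N \<longleftrightarrow> K \<subseteq> N \<and> set xs \<subseteq> N"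
proof (induction xs arbitrary: K)
  case (Cons x xs)
  then show ?case using adjoin_ideal[of K x] adjoin_subset_iff[of N K x] by auto
qed simp

lemma adjoins_base: "ideal K R \<Longrightarrow> set xs \<subseteq> carrier R \<Longrightarrow> K \<subseteq> adjoins K xs"
  using adjoins_subset_iff[OF adjoins_ideal, of K xs K xs] by simp

lemma adjoins_set: "ideal K R \<Longrightarrow> set xs \<subseteq> carrier R \<Longrightarrow> set xs \<subseteq> adjoins K xs"
  using adjoins_subset_iff[OF adjoins_ideal, of K xs K xs] by simp

lemma adjoins_append: "adjoins K (xs @ ys) = adjoins (adjoins K xs) ys"
  by (induction xs arbitrary: K) auto

lemma adjoins_set_eq:
  assumes "ideal K R" "set xs \<subseteq> carrier R" "set xs = set ys"
  shows "adjoins K xs = adjoins K ys"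
  using adjoins_subset_iff[OF adjoins_ideal[of K ys], of K xs] adjoins_subset_iff[OF adjoins_ideal[of K xs], of K ys]
    adjoins_base[of K xs] adjoins_base[of K ys] adjoins_set[of K xs] adjoins_set[of K ys] assms
  by auto

lemma adjoins_zero: "set xs \<subseteq> carrier R \<Longrightarrow> adjoins {\<zero>} xs = Idl (set xs)"
proof (rule antisym)
  assume c: "set xs \<subseteq> carrier R"
  show "adjoins {\<zero>} xs \<subseteq> Idl (set xs)"
    using adjoins_subset_iff[OF genideal_ideal[OF c] zeroideal c] genideal_self[OF c]
      idealD(2)[OF genideal_ideal[OF c]] by simp
  show "Idl (set xs) \<subseteq> adjoins {\<zero>} xs"
    by (rule genideal_minimal[OF adjoins_ideal[OF zeroideal c] adjoins_set[OF zeroideal c]])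
qed

end

section \<open>Powers of an ideal generated by a regular sequence\<close>

text \<open>The value \<open>binomial_colength e l r k\<close> is the colength of \<open>J\<^sup>k I\<close> when \<open>J\<close> is generated by a
  permutable regular sequence of length \<open>r\<close>, with \<open>e\<close> and \<open>l\<close> the colengths of \<open>J\<close> and \<open>I\<close>.\<close>

fun binomial_colength :: "enat \<Rightarrow> enat \<Rightarrow> nat \<Rightarrow> nat \<Rightarrow> enat" where
  "binomial_colength e l r 0 = l"
| "binomial_colength e l 0 (Suc k) = e"
| "binomial_colength e l (Suc r) (Suc k) =
     binomial_colength e l (Suc r) k + binomial_colength e l r (Suc k)"

context cring begin

section \<open>Regular elements and permutable regular sequences\<close>

definition regular_elt :: "'a set \<Rightarrow> 'a \<Rightarrow> bool" where
  "regular_elt B x \<longleftrightarrow> (\<forall>a \<in> carrier R. a \<otimes> x \<in> B \<longrightarrow> a \<in> B)"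

lemma regular_eltD: "regular_elt B x \<Longrightarrow> a \<in> carrier R \<Longrightarrow> a \<otimes> x \<in> B \<Longrightarrow> a \<in> B"
  by (simp add: regular_elt_def)

text \<open>The base ideal \<open>B\<close> permits induction along the list. In contrast to
  \<open>regular_sequence\<close> the last quotient may be zero; for elements of the maximal ideal
  and \<open>B\<close> inside it, properness is recovered by \<open>adjoins_le_max\<close>.\<close>

primrec regular_seq :: "'a set \<Rightarrow> 'a list \<Rightarrow> bool" where
  "regular_seq B [] \<longleftrightarrow> True"
| "regular_seq B (x # xs) \<longleftrightarrow> regular_elt B x \<and> regular_seq (adjoin B x) xs"

lemma regular_seq_append:
  "regular_seq B (xs @ ys) \<longleftrightarrow> regular_seq B xs \<and> regular_seq (adjoins B xs) ys"
  by (induction xs arbitrary: B) auto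

text \<open>The inductions split off a generator \<open>x\<close> and need the others to be regular
  both modulo \<open>B\<close> and modulo \<open>B + (x)\<close>. In a local ring this is automatic
  for sequences in the maximal ideal, by \<open>regular_seq_permutable\<close>.\<close>

definition permutable_seq :: "'a set \<Rightarrow> 'a list \<Rightarrow> bool" where
  "permutable_seq B xs \<longleftrightarrow> (\<forall>ys. mset ys = mset xs \<longrightarrow> regular_seq B ys)"

lemma permutable_seq_cong: "mset xs = mset ys \<Longrightarrow> permutable_seq B xs \<longleftrightarrow> permutable_seq B ys"
  by (simp add: permutable_seq_def)

lemma permutable_seq_Cons:
  assumes "permutable_seq B (x # xs)"
  shows "regular_elt B x" "permutable_seq (adjoin B x) xs" "permutable_seq B xs"
proof -
  show "regular_elt B x" using assms unfolding permutable_seq_def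
    by (metis regular_seq.simps(2))
  show "permutable_seq (adjoin B x) xs" unfolding permutable_seq_def
  proof (intro allI impI)
    fix ys assume "mset ys = mset xs"
    then have "mset (x # ys) = mset (x # xs)" by simp
    then have "regular_seq B (x # ys)" using assms unfolding permutable_seq_def by blast
    then show "regular_seq (adjoin B x) ys" by simp
  qed
  show "permutable_seq B xs" unfolding permutable_seq_def
  proof (intro allI impI)
    fix ys assume "mset ys = mset xs"
    then have "mset (ys @ [x]) = mset (x # xs)" by simp
    then have "regular_seq B (ys @ [x])" using assms unfolding permutable_seq_def by blast
    then show "regular_seq B ys" by (simp add: regular_seq_append)
  qed
qed

text \<open>For \<open>J = (xs)\<close> and \<open>B \<subseteq> I\<close>, the set \<open>ideal_power_mod B I xs k\<close> is \<open>J\<^sup>k I + B\<close>.\<close>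

fun ideal_power_mod :: "'a set \<Rightarrow> 'a set \<Rightarrow> 'a list \<Rightarrow> nat \<Rightarrow> 'a set" where
  "ideal_power_mod B I xs 0 = I"
| "ideal_power_mod B I [] (Suc k) = B"
| "ideal_power_mod B I (x # xs) (Suc k) =
     mult_add (ideal_power_mod B I xs (Suc k)) x (ideal_power_mod B I (x # xs) k)"

lemma ideal_power_mod_ideal:
  "ideal B R \<Longrightarrow> ideal I R \<Longrightarrow> set xs \<subseteq> carrier R \<Longrightarrow> ideal (ideal_power_mod B I xs k) R"
  by (induction B I xs k rule: ideal_power_mod.induct) (auto intro: mult_add_ideal)

lemma ideal_power_mod_tail:
  assumes "ideal B R" "ideal I R" "set (x # xs) \<subseteq> carrier R"
  shows "ideal_power_mod B I xs k \<subseteq> ideal_power_mod B I (x # xs) k"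
proof (cases k)
  case (Suc k')
  then show ?thesis
    using assms by (auto intro!: mult_add_base[THEN subsetD] ideal_power_mod_ideal)
qed simp

lemma ideal_power_mod_decseq:
  assumes "ideal B R" "ideal I R" "set xs \<subseteq> I" "B \<subseteq> I"
  shows "ideal_power_mod B I xs (Suc k) \<subseteq> ideal_power_mod B I xs k"
  using assms(3)
proof (induction xs arbitrary: k)
  case Nil
  then show ?case using assms(4) by (cases k) auto
next
  case (Cons x xs)
  show ?case
  proof (induction k)
    case 0
    have "ideal_power_mod B I xs (Suc 0) \<subseteq> I" using Cons.IH[of 0] Cons.prems by simp
    then show ?case
      using mult_add_least[OF assms(2), of "ideal_power_mod B I xs (Suc 0)" I x]
        idealD(5)[OF assms(2)] idealD(1)[OF assms(2)] Cons.prems by simp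
  next
    case (Suc k)
    have "ideal_power_mod B I xs (Suc (Suc k)) \<subseteq> ideal_power_mod B I xs (Suc k)"
      using Cons.IH[of "Suc k"] Cons.prems by simp
    then show ?case
      using mult_add_mono[OF _ Suc, of "ideal_power_mod B I xs (Suc (Suc k))" "ideal_power_mod B I xs (Suc k)" x]
      by (simp only: ideal_power_mod.simps(3))
  qed
qed

lemma adjoin_mult_add_commute:
  assumes K: "ideal K R" and L: "ideal L R" and x: "x \<in> carrier R" and y: "y \<in> carrier R"
  shows "adjoin (mult_add K x L) y = mult_add (adjoin K y) x L"
proof
  have I: "ideal (mult_add (adjoin K y) x L) R" "ideal (adjoin (mult_add K x L) y) R"
    using assms by (simp_all add: mult_add_ideal adjoin_ideal)
  have s: "adjoin K y \<subseteq> mult_add (adjoin K y) x L"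
    by (rule mult_add_base[OF adjoin_ideal[OF K y] x L])
  show "adjoin (mult_add K x L) y \<subseteq> mult_add (adjoin K y) x L"
    using s adjoin_self[OF K y] by (intro adjoin_least[OF I(1)] mult_add_mono adjoin_base[OF K y]) auto
  have t: "mult_add K x L \<subseteq> adjoin (mult_add K x L) y"
    by (rule adjoin_base[OF mult_add_ideal[OF K x L] y])
  have "adjoin K y \<subseteq> adjoin (mult_add K x L) y"
    using mult_add_base[OF K x L] t adjoin_self[OF mult_add_ideal[OF K x L] y]
    by (intro adjoin_least[OF I(2)]) auto
  then show "mult_add (adjoin K y) x L \<subseteq> adjoin (mult_add K x L) y"
    using t mult_add_mult[OF K x L] by (intro mult_add_least[OF I(2)]) auto
qed

lemma mult_add_adjoin_absorb:
  assumes K: "ideal K R" and L: "ideal L R" and x: "x \<in> carrier R" and y: "y \<in> K"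
  shows "mult_add K x (adjoin L y) = mult_add K x L"
proof
  have yc: "y \<in> carrier R" using idealD(1)[OF K y] .
  have I: "ideal (mult_add K x L) R" by (rule mult_add_ideal[OF K x L])
  show "mult_add K x (adjoin L y) \<subseteq> mult_add K x L"
  proof (rule mult_add_least[OF I mult_add_base[OF K x L]])
    fix a assume "a \<in> adjoin L y"
    then obtain l r where a: "l \<in> L" "r \<in> carrier R" "a = l \<oplus> r \<otimes> y" by (auto simp: adjoin_iff)
    have "a \<otimes> x = (r \<otimes> x) \<otimes> y \<oplus> l \<otimes> x"
      using a x yc idealD(1)[OF L a(1)] by algebra
    moreover have "(r \<otimes> x) \<otimes> y \<in> K" using idealD(4)[OF K _ y] a x by simp
    ultimately show "a \<otimes> x \<in> mult_add K x L" using a unfolding mult_add_iff by blast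
  qed
  show "mult_add K x L \<subseteq> mult_add K x (adjoin L y)"
    by (rule mult_add_mono[OF order_refl adjoin_base[OF L yc]])
qed

text \<open>The exponent must be positive: for exponent 0 the right side would be \<open>I\<close>,
  which need not contain \<open>y\<close>. Inside the recursion \<open>y\<close> also appears
  multiplied by \<open>x\<close>, and such terms are absorbed by the base.\<close>

lemma adjoin_ideal_power_mod:
  assumes "ideal B R" "ideal I R" "set xs \<subseteq> carrier R" "y \<in> carrier R"
  shows "adjoin (ideal_power_mod B I xs (Suc k)) y = ideal_power_mod (adjoin B y) I xs (Suc k)"
  using assms(3)
proof (induction xs arbitrary: k)
  case (Cons x xs)
  note B = assms(1) and I = assms(2)
  have B': "ideal (adjoin B y) R" using assms by (simp add: adjoin_ideal)
  have c: "set xs \<subseteq> carrier R" and xy: "x \<in> carrier R" "y \<in> carrier R"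
    using Cons.prems assms(4) by auto
  have K: "ideal (ideal_power_mod B I xs (Suc k)) R" and L: "ideal (ideal_power_mod B I (x # xs) k) R" for k
    using ideal_power_mod_ideal[OF B I c] ideal_power_mod_ideal[OF B I Cons.prems] by blast+
  have step: "adjoin (ideal_power_mod B I (x # xs) (Suc k)) y
      = mult_add (ideal_power_mod (adjoin B y) I xs (Suc k)) x (ideal_power_mod B I (x # xs) k)" for k
    unfolding ideal_power_mod.simps(3) by (simp only: adjoin_mult_add_commute[OF K L xy] Cons.IH[OF c])
  show ?case
  proof (induction k)
    case 0
    show ?case unfolding step by (simp only: ideal_power_mod.simps)
  next
    case (Suc k)
    have "y \<in> ideal_power_mod (adjoin B y) I xs (Suc (Suc k))"
      using adjoin_self[OF K xy(2)] Cons.IH[OF c] by metis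
    then have "mult_add (ideal_power_mod (adjoin B y) I xs (Suc (Suc k))) x
        (adjoin (ideal_power_mod B I (x # xs) (Suc k)) y)
      = mult_add (ideal_power_mod (adjoin B y) I xs (Suc (Suc k))) x
        (ideal_power_mod B I (x # xs) (Suc k))"
      by (rule mult_add_adjoin_absorb[OF ideal_power_mod_ideal[OF B' I c] L xy(1)])
    then show ?case unfolding step[of "Suc k"] Suc.IH by simp
  qed
qed simp

text \<open>Modulo \<open>B\<close>, the quotients of successive powers of the ideal
  \<open>J\<close> generated by \<open>xs\<close> are free over \<open>R/J\<close>, so an element
  regular modulo \<open>J\<close> is regular modulo every power. The proof is a double induction, on
  the list and on \<open>k\<close>: reduction modulo a generator \<open>x\<close> gives
  \<open>a = p + b x\<close>, and \<open>b y\<close> then lies in the power whose exponent is one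
  less.\<close>

lemma regular_elt_power:
  assumes "permutable_seq B (y # xs)" "ideal B R" "set (y # xs) \<subseteq> carrier R"
  shows "regular_elt (ideal_power_mod B (carrier R) xs k) y"
  using assms
proof (induction xs arbitrary: B y k)
  case Nil
  then show ?case by (cases k) (auto simp: regular_elt_def permutable_seq_def)
next
  case (Cons x xs)
  let ?P = "ideal_power_mod B (carrier R)"
  have c: "x \<in> carrier R" "y \<in> carrier R" "set xs \<subseteq> carrier R" using Cons.prems by auto
  have perm: "permutable_seq B (x # y # xs)"
    using Cons.prems(1) permutable_seq_cong[of "x # y # xs" "y # x # xs"] by simp
  have Px: "regular_elt (?P xs k) x" for k
    using Cons.IH[OF permutable_seq_Cons(3)[OF Cons.prems(1)] Cons.prems(2)] c by simp
  have Py: "regular_elt (ideal_power_mod (adjoin B x) (carrier R) xs k) y" for k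
    using Cons.IH[OF permutable_seq_Cons(2)[OF perm] adjoin_ideal[OF Cons.prems(2) c(1)]] c by simp
  have ids: "ideal (?P zs k) R" if "set zs \<subseteq> carrier R" for zs k
    using ideal_power_mod_ideal[OF Cons.prems(2) oneideal that] .
  show ?case
  proof (induction k)
    case 0
    then show ?case by (simp add: regular_elt_def)
  next
    case (Suc k)
    let ?Q = "?P (x # xs) (Suc k)"
    have Q: "ideal ?Q R" using ids c by (simp del: ideal_power_mod.simps)
    show ?case unfolding regular_elt_def
    proof (intro ballI impI)
      fix a assume a: "a \<in> carrier R" "a \<otimes> y \<in> ?Q"
      have "?Q \<subseteq> adjoin (?P xs (Suc k)) x"
        unfolding ideal_power_mod.simps(3) adjoin_def
        by (rule mult_add_mono) (use idealD(1)[OF ids[of "x # xs" k]] c in auto)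
      then have "a \<otimes> y \<in> ideal_power_mod (adjoin B x) (carrier R) xs (Suc k)"
        using a adjoin_ideal_power_mod[OF Cons.prems(2) oneideal c(3) c(1), of k] by auto
      then have "a \<in> ideal_power_mod (adjoin B x) (carrier R) xs (Suc k)"
        using regular_eltD[OF Py a(1)] by blast
      then have "a \<in> adjoin (?P xs (Suc k)) x"
        using adjoin_ideal_power_mod[OF Cons.prems(2) oneideal c(3) c(1), of k] by auto
      then obtain p b where pb: "p \<in> ?P xs (Suc k)" "b \<in> carrier R" "a = p \<oplus> b \<otimes> x"
        by (auto simp: adjoin_iff)
      have pc: "p \<in> carrier R" using idealD(1)[OF ids[OF c(3)] pb(1)] .
      have "p \<in> ?Q" using ideal_power_mod_tail[OF Cons.prems(2) oneideal, of x xs "Suc k"] c pb by auto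
      then have "p \<otimes> y \<in> ?Q" using idealD(5)[OF Q c(2)] by blast
      moreover have "a \<otimes> y = p \<otimes> y \<oplus> (b \<otimes> y) \<otimes> x"
        using pb pc c by algebra
      ultimately have "(b \<otimes> y) \<otimes> x \<in> ?Q"
        using a ideal_add_cancel(1)[OF Q, of "(b \<otimes> y) \<otimes> x" "p \<otimes> y"] pb c by simp
      then obtain q t where qt: "q \<in> ?P xs (Suc k)" "t \<in> ?P (x # xs) k" "(b \<otimes> y) \<otimes> x = q \<oplus> t \<otimes> x"
        by (auto simp: mult_add_iff)
      have qtc: "q \<in> carrier R" "t \<in> carrier R"
        using idealD(1)[OF ids[OF c(3)] qt(1)] idealD(1)[OF ids qt(2)] c by auto
      \<comment> \<open>Here \<open>q\<close> lies in a power formed from the shorter list, modulo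
        which \<open>x\<close> is regular by the outer induction.\<close>
      have "(b \<otimes> y \<ominus> t) \<otimes> x = (q \<oplus> t \<otimes> x) \<ominus> t \<otimes> x"
        using pb c qtc unfolding qt(3)[symmetric] by algebra
      also have "\<dots> = q" using qtc c by algebra
      finally have "b \<otimes> y \<ominus> t \<in> ?P xs (Suc k)"
        using regular_eltD[OF Px, of "b \<otimes> y \<ominus> t"] qt(1) pb c qtc by simp
      then have "b \<otimes> y \<ominus> t \<in> ?P (x # xs) k"
        using ideal_power_mod_tail[OF Cons.prems(2) oneideal, of x xs k]
          ideal_power_mod_decseq[OF Cons.prems(2) oneideal c(3), of k] idealD(1)[OF Cons.prems(2)] c by auto
      then have "b \<otimes> y \<in> ?P (x # xs) k"
        using ideal_diff_mem[OF ids _ qt(2)] pb c by simp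
      then have "b \<in> ?P (x # xs) k" using regular_eltD[OF Suc pb(2)] by blast
      then show "a \<in> ?Q" using pb unfolding ideal_power_mod.simps(3) mult_add_iff by blast
    qed
  qed
qed

lemma ideal_power_mod_mono:
  assumes "ideal B R" "ideal I R" "set xs \<subseteq> I" "B \<subseteq> I"
  shows "ideal_power_mod B (carrier R) xs (Suc k) \<subseteq> ideal_power_mod B I xs k"
  using assms(3)
proof (induction xs arbitrary: k)
  case Nil
  then show ?case using assms(4) by (cases k) auto
next
  case (Cons x xs)
  let ?P = "ideal_power_mod B (carrier R)"
  show ?case
  proof (induction k)
    case 0
    have "?P xs (Suc 0) \<subseteq> I" using Cons.IH[of 0] Cons.prems by simp
    then show ?case
      using mult_add_least[OF assms(2), of "?P xs (Suc 0)" "carrier R" x]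
        idealD(4)[OF assms(2)] Cons.prems by simp
  next
    case (Suc k)
    have "?P xs (Suc (Suc k)) \<subseteq> ideal_power_mod B I xs (Suc k)"
      using Cons.IH[of "Suc k"] Cons.prems by simp
    then show ?case
      using mult_add_mono[OF _ Suc, of "?P xs (Suc (Suc k))" "ideal_power_mod B I xs (Suc k)" x]
      by (simp only: ideal_power_mod.simps(3))
  qed
qed

lemma ideal_power_mod_mono_unit:
  assumes "I \<subseteq> carrier R"
  shows "ideal_power_mod B I xs k \<subseteq> ideal_power_mod B (carrier R) xs k"
proof (induction xs arbitrary: k)
  case Nil
  then show ?case using assms by (cases k) auto
next
  case (Cons x xs)
  show ?case
  proof (induction k)
    case (Suc k)
    then show ?case
      using mult_add_mono[OF Cons.IH[of "Suc k"] Suc, of x] by (simp only: ideal_power_mod.simps(3))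
  qed (use assms in simp)
qed

text \<open>From \<open>a x = q + t x\<close> one wants to cancel \<open>x\<close>. It need not be
  regular modulo \<open>(xs)\<^sup>k\<^sup>+\<^sup>1 I\<close>, only modulo
  \<open>(xs)\<^sup>k\<^sup>+\<^sup>1\<close> (everything relative to \<open>B\<close>). This is
  enough, because \<open>xs\<close> lies in \<open>I\<close> and one factor of the power may be
  traded for \<open>I\<close> at the cost of one exponent.\<close>

lemma colon_ideal_power_mod:
  assumes perm: "permutable_seq B (x # xs)" and B: "ideal B R" and I: "ideal I R"
    and sub: "set (x # xs) \<subseteq> I" "B \<subseteq> I"
  shows "colon_elt (ideal_power_mod B I (x # xs) (Suc k)) x = ideal_power_mod B I (x # xs) k"
proof
  have c: "x \<in> carrier R" "set xs \<subseteq> carrier R" "set xs \<subseteq> I" using sub idealD(1)[OF I] by auto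
  have K: "ideal (ideal_power_mod B I xs k) R" and L: "ideal (ideal_power_mod B I (x # xs) k) R" for k
    using ideal_power_mod_ideal[OF B I] c by (auto simp del: ideal_power_mod.simps)
  show "ideal_power_mod B I (x # xs) k \<subseteq> colon_elt (ideal_power_mod B I (x # xs) (Suc k)) x"
    using mult_add_mult[OF K c(1) L] idealD(1)[OF L] by (auto simp: colon_elt_def)
  show "colon_elt (ideal_power_mod B I (x # xs) (Suc k)) x \<subseteq> ideal_power_mod B I (x # xs) k"
  proof
    fix a assume "a \<in> colon_elt (ideal_power_mod B I (x # xs) (Suc k)) x"
    then obtain q t where a: "a \<in> carrier R" and q: "q \<in> ideal_power_mod B I xs (Suc k)"
      and t: "t \<in> ideal_power_mod B I (x # xs) k" and e: "a \<otimes> x = q \<oplus> t \<otimes> x"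
      by (auto simp: colon_elt_def mult_add_iff)
    have qtc: "q \<in> carrier R" "t \<in> carrier R" using idealD(1)[OF K q] idealD(1)[OF L t] .
    have "(a \<ominus> t) \<otimes> x = (q \<oplus> t \<otimes> x) \<ominus> t \<otimes> x"
      using a c qtc unfolding e[symmetric] by algebra
    also have "\<dots> = q" using qtc c by algebra
    finally have q': "(a \<ominus> t) \<otimes> x = q" .
    have "ideal_power_mod B I xs (Suc k) \<subseteq> ideal_power_mod B (carrier R) xs (Suc k)"
      by (rule ideal_power_mod_mono_unit) (use idealD(1)[OF I] in blast)
    then have "a \<ominus> t \<in> ideal_power_mod B (carrier R) xs (Suc k)"
      using regular_eltD[OF regular_elt_power[OF perm B, of "Suc k"], of "a \<ominus> t"] q q' a qtc c by auto
    then have "a \<ominus> t \<in> ideal_power_mod B I (x # xs) k"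
      using ideal_power_mod_mono[OF B I c(3) sub(2), of k] ideal_power_mod_tail[OF B I, of x xs k] c by auto
    then show "a \<in> ideal_power_mod B I (x # xs) k"
      using ideal_diff_mem[OF L a t] by blast
  qed
qed

lemma adjoin_ideal_power_mod_Cons:
  assumes B: "ideal B R" and I: "ideal I R" and c: "set (x # xs) \<subseteq> carrier R"
  shows "adjoin (ideal_power_mod B I (x # xs) (Suc k)) x = ideal_power_mod (adjoin B x) I xs (Suc k)"
proof -
  have x: "x \<in> carrier R" and xs: "set xs \<subseteq> carrier R" using c by auto
  have K: "ideal (ideal_power_mod B I xs (Suc k)) R" and L: "ideal (ideal_power_mod B I (x # xs) k) R"
    using ideal_power_mod_ideal[OF B I] c by (auto simp del: ideal_power_mod.simps)
  note A = adjoin_ideal[OF K x]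
  have "adjoin (ideal_power_mod B I (x # xs) (Suc k)) x = adjoin (ideal_power_mod B I xs (Suc k)) x"
    unfolding ideal_power_mod.simps(3) adjoin_mult_add_commute[OF K L x x]
  proof (rule antisym)
    show "mult_add (adjoin (ideal_power_mod B I xs (Suc k)) x) x (ideal_power_mod B I (x # xs) k)
        \<subseteq> adjoin (ideal_power_mod B I xs (Suc k)) x"
      by (rule mult_add_least[OF A order_refl])
         (use adjoin_self[OF K x] idealD(1)[OF L] idealD(4)[OF A] in auto)
  qed (rule mult_add_base[OF A x L])
  then show ?thesis using adjoin_ideal_power_mod[OF B I xs x] by simp
qed

text \<open>Splitting off \<open>x\<close> with \<open>colength_split\<close> produces the two
  recursive calls of \<open>binomial_colength\<close>: the colon term lowers the exponent, and
  passing to \<open>B + (x)\<close> shortens the list.\<close>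

lemma colength_ideal_power_mod:
  assumes "permutable_seq B xs" "ideal B R" "ideal I R" "set xs \<subseteq> I" "B \<subseteq> I"
  shows "colength (ideal_power_mod B I xs k)
    = binomial_colength (colength (adjoins B xs)) (colength I) (length xs) k"
  using assms
proof (induction xs arbitrary: B k)
  case Nil
  then show ?case by (cases k) simp_all
next
  case (Cons x xs)
  note prems = Cons.prems
  have c: "x \<in> carrier R" "set (x # xs) \<subseteq> carrier R" using prems idealD(1)[of I] by auto
  have B': "adjoin B x \<subseteq> I" "ideal (adjoin B x) R"
    using prems adjoin_least[of I B x] adjoin_ideal[of B x] c by auto
  show ?case
  proof (induction k)
    case (Suc k)
    have K: "ideal (ideal_power_mod B I (x # xs) (Suc k)) R"
      by (rule ideal_power_mod_ideal[OF prems(2,3) c(2)])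
    have tail: "colength (ideal_power_mod (adjoin B x) I xs (Suc k))
      = binomial_colength (colength (adjoins B (x # xs))) (colength I) (length xs) (Suc k)"
      using Cons.IH[OF permutable_seq_Cons(2)[OF prems(1)] B'(2) prems(3) _ B'(1)] prems(4) by simp
    show ?case
      using colength_split[OF K c(1)] colon_ideal_power_mod[OF prems, of k]
        adjoin_ideal_power_mod_Cons[OF prems(2,3) c(2), of k] Suc tail by simp
  qed simp
qed

text \<open>For arbitrary generators the colon ideal is only known to contain the lower power, so
  the equation for regular sequences becomes an upper bound.\<close>

lemma colength_ideal_power_mod_le:
  assumes "ideal B R" "set xs \<subseteq> carrier R"
  shows "colength (ideal_power_mod B (carrier R) xs k)
    \<le> binomial_colength (colength (adjoins B xs)) 0 (length xs) k"
  using assms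
proof (induction xs arbitrary: B k)
  case Nil
  then show ?case by (cases k) (simp_all add: len_refl)
next
  case (Cons x xs)
  note prems = Cons.prems
  let ?P = "ideal_power_mod B (carrier R)"
  have c: "x \<in> carrier R" "set xs \<subseteq> carrier R" using prems by auto
  show ?case
  proof (induction k)
    case (Suc k)
    have K: "ideal (?P zs k) R" if "set zs \<subseteq> carrier R" for zs k
      by (rule ideal_power_mod_ideal[OF prems(1) oneideal that])
    have tail: "colength (ideal_power_mod (adjoin B x) (carrier R) xs (Suc k))
      \<le> binomial_colength (colength (adjoins B (x # xs))) 0 (length xs) (Suc k)"
      using Cons.IH[OF adjoin_ideal[OF prems(1) c(1)] c(2), of "Suc k"] by simp
    have "?P (x # xs) k \<subseteq> colon_elt (?P (x # xs) (Suc k)) x"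
      using mult_add_mult[OF K[OF c(2)] c(1) K[OF prems(2)], of _ k "Suc k"] idealD(1)[OF K[OF prems(2)]]
      by (auto simp: colon_elt_def)
    then have "colength (colon_elt (?P (x # xs) (Suc k)) x) \<le> colength (?P (x # xs) k)"
      by (rule colength_antimono[OF K[OF prems(2)] colon_elt_ideal[OF K[OF prems(2)] c(1)]])
    then show ?case
      using colength_split[OF K[OF prems(2), of "Suc k"] c(1)] Suc tail
        adjoin_ideal_power_mod_Cons[OF prems(1) oneideal prems(2), of k]
      by (simp del: ideal_power_mod.simps) (meson add_mono order_trans)
  qed (simp add: len_refl)
qed

end

section \<open>Noetherian local rings\<close>

lemma chain_length_finite:
  assumes "finite \<S>"
  shows "chain_length \<S> \<le> enat (card \<S>)"
proof (rule chain_length_leI)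
  fix Ns assume "strict_chain \<S> Ns"
  then have "sorted_wrt (\<subset>) Ns" "set Ns \<subseteq> \<S>" by (auto simp: strict_chain_def)
  moreover from this(1) have "distinct Ns" by (induction Ns) auto
  ultimately have "length Ns \<le> card \<S>"
    using assms card_mono distinct_card by metis
  then show "enat (length Ns - 1) \<le> enat (card \<S>)" by simp
qed

lemma (in noetherian_ring) exists_maximal_ideal_in:
  assumes "K0 \<in> F" "\<And>K. K \<in> F \<Longrightarrow> ideal K R"
  obtains M where "M \<in> F" "\<And>K. K \<in> F \<Longrightarrow> M \<subseteq> K \<Longrightarrow> K = M"
proof -
  have "\<exists>M\<in>F. \<forall>K\<in>F. M \<subseteq> K \<longrightarrow> K = M"
  proof (rule subset_Zorn_nonempty)
    show "F \<noteq> {}" using assms(1) by blast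
  next
    fix C assume C: "C \<noteq> {}" "subset.chain F C"
    then have "subset.chain {I. ideal I R} C"
      using assms(2) by (auto simp: pred_on.chain_def)
    from ideal_chain_is_trivial[OF C(1) this] show "\<Union>C \<in> F"
      using C(2) by (auto simp: pred_on.chain_def)
  qed
  then show ?thesis using that by blast
qed

text \<open>The Cohen-Macaulay condition enters later, as the premise that
  \<open>depth R \<mm>\<close> and \<open>krull_dim R\<close> are the same natural number.\<close>

locale noetherian_local_ring = cring R + noetherian_ring R for R (structure) and \<mm> +
  assumes maximalideals: "{M. maximalideal M R} = {\<mm>}"
begin

section \<open>The maximal ideal, units and Nakayama's lemma\<close>

lemma maximalideal: "maximalideal \<mm> R"
  using maximalideals by blast

lemma max_ideal: "ideal \<mm> R"
  using maximalideal by (rule maximalideal.axioms)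

lemma max_prime: "primeideal \<mm> R"
  using maximalideal by (rule maximalideal_prime)

lemma one_notin_max: "\<one> \<notin> \<mm>"
  using ideal_carrier_iff[OF max_ideal] maximalideal.I_notcarr[OF maximalideal] by auto

lemma max_carrier: "a \<in> \<mm> \<Longrightarrow> a \<in> carrier R"
  using idealD(1)[OF max_ideal] .

lemma proper_ideal_le_max:
  assumes K: "ideal K R" "K \<noteq> carrier R"
  shows "K \<subseteq> \<mm>"
proof -
  let ?S = "{L. ideal L R \<and> K \<subseteq> L \<and> L \<noteq> carrier R}"
  have "K \<in> ?S" "\<And>L. L \<in> ?S \<Longrightarrow> ideal L R" using K by auto
  then obtain M where M: "M \<in> ?S" "\<And>L. L \<in> ?S \<Longrightarrow> M \<subseteq> L \<Longrightarrow> L = M"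
    by (rule exists_maximal_ideal_in) (assumption, rule that)
  have "maximalideal M R"
  proof (rule maximalidealI)
    show "ideal M R" "carrier R \<noteq> M" using M(1) by auto
    show "J = M \<or> J = carrier R" if "ideal J R" "M \<subseteq> J" "J \<subseteq> carrier R" for J
      using M that by blast
  qed
  then have "M = \<mm>" using maximalideals by blast
  then show ?thesis using M(1) by blast
qed

lemma primeideal_le_max: "primeideal P R \<Longrightarrow> P \<subseteq> \<mm>"
  by (metis primeideal.I_notcarr primeideal.axioms(1) proper_ideal_le_max)

lemma notin_max_unit:
  assumes "u \<in> carrier R" "u \<notin> \<mm>"
  obtains v where "v \<in> carrier R" "v \<otimes> u = \<one>"
proof -
  have "adjoin {\<zero>} u = carrier R"
    using proper_ideal_le_max[OF adjoin_ideal[OF zeroideal assms(1)]] adjoin_self[OF zeroideal assms(1)] assms(2)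
    by blast
  then have "\<one> \<in> adjoin {\<zero>} u" by simp
  then obtain v where "v \<in> carrier R" "\<one> = v \<otimes> u"
    using assms(1) by (auto simp: adjoin_iff)
  with that show ?thesis by simp
qed

lemma unit_mult_mem:
  assumes K: "ideal K R" and u: "u \<in> carrier R" "u \<notin> \<mm>" and n: "n \<in> carrier R" "u \<otimes> n \<in> K"
  shows "n \<in> K"
proof -
  obtain v where v: "v \<in> carrier R" "v \<otimes> u = \<one>" using notin_max_unit[OF u] .
  have "v \<otimes> (u \<otimes> n) \<in> K" using idealD(4)[OF K v(1) n(2)] .
  then show ?thesis using u v n by (simp add: m_assoc[symmetric])
qed

text \<open>A form without sums of ideals: the usual hypothesis
  \<open>N \<subseteq> L + \<mm> N\<close> is tested on every ideal \<open>K\<close> that contains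
  \<open>L\<close> and \<open>\<mm> N\<close>. For \<open>K\<close> maximal among the ideals over
  \<open>L\<close> that do not contain \<open>N\<close>, a product \<open>u n\<close> outside
  \<open>K\<close> would give \<open>n = k + r u n\<close>, and \<open>1 - r u\<close> is a
  unit.\<close>

lemma nakayama:
  assumes N: "ideal N R" and L: "ideal L R"
    and step: "\<And>K. ideal K R \<Longrightarrow> L \<subseteq> K \<Longrightarrow> (\<And>u n. u \<in> \<mm> \<Longrightarrow> n \<in> N \<Longrightarrow> u \<otimes> n \<in> K) \<Longrightarrow> N \<subseteq> K"
  shows "N \<subseteq> L"
proof (rule ccontr)
  assume "\<not> N \<subseteq> L"
  let ?S = "{K. ideal K R \<and> L \<subseteq> K \<and> \<not> N \<subseteq> K}"
  have "L \<in> ?S" "\<And>K. K \<in> ?S \<Longrightarrow> ideal K R" using L \<open>\<not> N \<subseteq> L\<close> by auto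
  then obtain K where K: "K \<in> ?S" "\<And>K'. K' \<in> ?S \<Longrightarrow> K \<subseteq> K' \<Longrightarrow> K' = K"
    by (rule exists_maximal_ideal_in) (assumption, rule that)
  have Ki: "ideal K R" using K(1) by blast
  have "u \<otimes> n \<in> K" if u: "u \<in> \<mm>" and n: "n \<in> N" for u n
  proof (rule ccontr)
    assume nK: "u \<otimes> n \<notin> K"
    have uc: "u \<in> carrier R" "n \<in> carrier R" using u n max_carrier idealD(1)[OF N] by auto
    have un: "u \<otimes> n \<in> carrier R" using uc by simp
    have "adjoin K (u \<otimes> n) \<notin> ?S"
      using K(2)[of "adjoin K (u \<otimes> n)"] adjoin_base[OF Ki un] adjoin_self[OF Ki un] nK by auto
    then have "N \<subseteq> adjoin K (u \<otimes> n)"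
      using adjoin_ideal[OF Ki un] adjoin_base[OF Ki un] K(1) by blast
    then obtain k r where kr: "k \<in> K" "r \<in> carrier R" "n = k \<oplus> r \<otimes> (u \<otimes> n)"
      using n by (meson adjoin_iff subsetD)
    have kc: "k \<in> carrier R" using idealD(1)[OF Ki kr(1)] .
    have "(\<one> \<ominus> r \<otimes> u) \<otimes> n = (k \<oplus> r \<otimes> (u \<otimes> n)) \<ominus> r \<otimes> (u \<otimes> n)"
      unfolding kr(3)[symmetric] using uc kr(2) by algebra
    also have "\<dots> = k" using uc kr(2) kc by algebra
    finally have "(\<one> \<ominus> r \<otimes> u) \<otimes> n \<in> K" using kr(1) by simp
    moreover have "\<one> \<ominus> r \<otimes> u \<notin> \<mm>"
      using ideal_diff_mem[OF max_ideal one_closed, of "r \<otimes> u"] idealD(4)[OF max_ideal kr(2) u] one_notin_max by blast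
    ultimately have "n \<in> K" using unit_mult_mem[OF Ki, of "\<one> \<ominus> r \<otimes> u" n] uc kr(2) by blast
    then show False using nK idealD(4)[OF Ki uc(1)] by blast
  qed
  then have "N \<subseteq> K" using step[OF Ki] K(1) by blast
  then show False using K(1) by blast
qed

section \<open>Permutability of regular sequences in the maximal ideal\<close>

lemma adjoin_commute:
  assumes "ideal B R" "x \<in> carrier R" "y \<in> carrier R"
  shows "adjoin (adjoin B x) y = adjoin (adjoin B y) x"
  using adjoins_set_eq[of B "[x, y]" "[y, x]"] assms by auto

text \<open>Cancelling \<open>y\<close> modulo \<open>B + (x)\<close> and then \<open>x\<close>
  modulo \<open>B\<close> shows that \<open>B : y\<close> is contained in
  \<open>B + x (B : y)\<close>, so Nakayama makes \<open>y\<close> regular modulo \<open>B\<close>.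
  For the second claim a relation \<open>a x = b + r y\<close> forces \<open>r = b' + s x\<close>,
  and \<open>a - s y\<close> is killed by \<open>x\<close> modulo \<open>B\<close>.\<close>

lemma regular_swap:
  assumes B: "ideal B R" and x: "x \<in> \<mm>" and y: "y \<in> \<mm>"
    and rx: "regular_elt B x" and ry: "regular_elt (adjoin B x) y"
  shows "regular_elt B y" "regular_elt (adjoin B y) x"
proof -
  note c = max_carrier[OF x] max_carrier[OF y]
  have N: "ideal (colon_elt B y) R" by (rule colon_elt_ideal[OF B c(2)])
  have "colon_elt B y \<subseteq> B"
  proof (rule nakayama[OF N B])
    fix K assume K: "ideal K R" "B \<subseteq> K" and mK: "\<And>u n. u \<in> \<mm> \<Longrightarrow> n \<in> colon_elt B y \<Longrightarrow> u \<otimes> n \<in> K"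
    show "colon_elt B y \<subseteq> K"
    proof
      fix a assume "a \<in> colon_elt B y"
      then have a: "a \<in> carrier R" "a \<otimes> y \<in> B" by (auto simp: colon_elt_def)
      then have "a \<in> adjoin B x" using regular_eltD[OF ry] adjoin_base[OF B c(1)] by blast
      then obtain b r where br: "b \<in> B" "r \<in> carrier R" "a = b \<oplus> r \<otimes> x" by (auto simp: adjoin_iff)
      have bc: "b \<in> carrier R" using idealD(1)[OF B br(1)] .
      have "a \<otimes> y = b \<otimes> y \<oplus> (r \<otimes> y) \<otimes> x" using br(2,3) bc c by algebra
      then have "(r \<otimes> y) \<otimes> x \<in> B"
        using ideal_add_cancel(1)[OF B, of "(r \<otimes> y) \<otimes> x" "b \<otimes> y"] a idealD(5)[OF B c(2) br(1)] br(2) c by simp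
      then have "r \<otimes> y \<in> B" using regular_eltD[OF rx] br(2) c by simp
      then have "r \<in> colon_elt B y" using br(2) by (simp add: colon_elt_def)
      then have "x \<otimes> r \<in> K" using mK[OF x] by blast
      then show "a \<in> K" using br K idealD(3)[OF K(1)] c m_comm by auto
    qed
  qed
  then show ry': "regular_elt B y" by (auto simp: regular_elt_def colon_elt_def)
  show "regular_elt (adjoin B y) x" unfolding regular_elt_def
  proof (intro ballI impI)
    fix a assume a: "a \<in> carrier R" "a \<otimes> x \<in> adjoin B y"
    then obtain b r where br: "b \<in> B" "r \<in> carrier R" "a \<otimes> x = b \<oplus> r \<otimes> y" by (auto simp: adjoin_iff)
    have bc: "b \<in> carrier R" using idealD(1)[OF B br(1)] .
    have "\<ominus> b \<oplus> a \<otimes> x = \<ominus> b \<oplus> (b \<oplus> r \<otimes> y)" using br(3) by simp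
    also have "\<dots> = r \<otimes> y" using bc br(2) c by algebra
    finally have "r \<otimes> y \<in> adjoin B x"
      using idealD(6)[OF B br(1)] a(1) unfolding adjoin_iff by metis
    then have "r \<in> adjoin B x" using regular_eltD[OF ry br(2)] by blast
    then obtain b' s where bs: "b' \<in> B" "s \<in> carrier R" "r = b' \<oplus> s \<otimes> x" by (auto simp: adjoin_iff)
    have b'c: "b' \<in> carrier R" using idealD(1)[OF B bs(1)] .
    have "(a \<ominus> s \<otimes> y) \<otimes> x = a \<otimes> x \<ominus> s \<otimes> x \<otimes> y" using a bs c by algebra
    also have "\<dots> = b \<oplus> b' \<otimes> y" unfolding br(3) bs(3) using bc b'c bs(2) c by algebra
    finally have "(a \<ominus> s \<otimes> y) \<otimes> x \<in> B"
      using idealD(3)[OF B br(1) idealD(5)[OF B c(2) bs(1)]] by simp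
    then have "a \<ominus> s \<otimes> y \<in> B" using regular_eltD[OF rx] a bs c by simp
    moreover have "a = (a \<ominus> s \<otimes> y) \<oplus> s \<otimes> y" using a bs c by algebra
    ultimately show "a \<in> adjoin B y" using bs(2) unfolding adjoin_iff by metis
  qed
qed

lemma regular_seq_move:
  assumes "ideal B R" "set xs \<subseteq> \<mm>" "y \<in> \<mm>" "regular_seq B (xs @ [y])"
  shows "regular_seq B (y # xs)"
  using assms
proof (induction xs arbitrary: B)
  case (Cons x xs)
  have x: "x \<in> carrier R" "x \<in> \<mm>" and y: "y \<in> carrier R" using Cons.prems max_carrier by auto
  have "regular_seq (adjoin B x) (y # xs)"
    using Cons.IH[OF adjoin_ideal[OF Cons.prems(1) x(1)]] Cons.prems by simp
  then show ?case
    using regular_swap[OF Cons.prems(1) x(2) Cons.prems(3)] Cons.prems adjoin_commute[OF Cons.prems(1) x(1) y] by simp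
qed simp

lemma regular_seq_permutable:
  assumes "ideal B R" "set xs \<subseteq> \<mm>" "regular_seq B xs"
  shows "permutable_seq B xs"
  unfolding permutable_seq_def
proof (intro allI impI)
  fix ys assume "mset ys = mset xs"
  then show "regular_seq B ys" using assms
  proof (induction ys arbitrary: B xs)
    case (Cons y ys)
    from Cons.prems(1) have "y \<in> set xs" by (metis list.set_intros(1) set_mset_mset)
    then obtain as bs where xs: "xs = as @ y # bs" by (meson split_list)
    have y: "y \<in> \<mm>" "y \<in> carrier R" and as: "set as \<subseteq> \<mm>" "set bs \<subseteq> \<mm>"
      using Cons.prems xs max_carrier by auto
    have "regular_seq B ((as @ [y]) @ bs)" using Cons.prems xs by simp
    then have "regular_seq B (as @ [y])" and bs: "regular_seq (adjoins B (as @ [y])) bs"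
      unfolding regular_seq_append[of B "as @ [y]"] by auto
    then have *: "regular_seq B (y # as)" using regular_seq_move[OF Cons.prems(2) as(1) y(1)] by blast
    have "adjoins B (as @ [y]) = adjoins B (y # as)"
      by (rule adjoins_set_eq[OF Cons.prems(2)]) (use as y max_carrier in auto)
    then have "regular_seq B (y # as @ bs)"
      using * bs regular_seq_append[of B "y # as" bs] by simp
    then show ?case
      using Cons.IH[of "as @ bs" "adjoin B y"] Cons.prems(1) adjoin_ideal[OF Cons.prems(2) y(2)] as xs by simp
  qed simp
qed

subsection \<open>Associated primes\<close>

text \<open>An ideal maximal among those over \<open>B\<close> that miss \<open>S\<close> is prime:
  two elements outside it would give members of \<open>S\<close> whose product lies in the ideal as
  well.\<close>

lemma exists_prime_disjoint:
  assumes B: "ideal B R" and S: "\<one> \<in> S" "\<And>s t. s \<in> S \<Longrightarrow> t \<in> S \<Longrightarrow> s \<otimes> t \<in> S" "S \<inter> B = {}"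
  obtains Q where "primeideal Q R" "B \<subseteq> Q" "S \<inter> Q = {}"
proof -
  let ?S = "{Q. ideal Q R \<and> B \<subseteq> Q \<and> S \<inter> Q = {}}"
  have "B \<in> ?S" "\<And>K. K \<in> ?S \<Longrightarrow> ideal K R" using B S(3) by auto
  then obtain Q where Q: "Q \<in> ?S" "\<And>K. K \<in> ?S \<Longrightarrow> Q \<subseteq> K \<Longrightarrow> K = Q"
    by (rule exists_maximal_ideal_in) (assumption, rule that)
  from Q(1) have Qi: "ideal Q R" by blast
  have meet: "\<exists>q\<in>Q. \<exists>r\<in>carrier R. q \<oplus> r \<otimes> a \<in> S" if a: "a \<in> carrier R" "a \<notin> Q" for a
  proof -
    have "adjoin Q a \<notin> ?S"
      using Q(2)[of "adjoin Q a"] adjoin_base[OF Qi a(1)] adjoin_self[OF Qi a(1)] a(2) by auto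
    then have "S \<inter> adjoin Q a \<noteq> {}"
      using adjoin_ideal[OF Qi a(1)] adjoin_base[OF Qi a(1)] Q(1) by blast
    then obtain s where "s \<in> S" "s \<in> adjoin Q a" by blast
    then show ?thesis by (auto simp: adjoin_iff)
  qed
  have "primeideal Q R"
  proof (rule primeidealI[OF Qi is_cring])
    show "carrier R \<noteq> Q" using S(1) Q(1) one_closed by auto
    fix a b assume ab: "a \<in> carrier R" "b \<in> carrier R" "a \<otimes> b \<in> Q"
    show "a \<in> Q \<or> b \<in> Q"
    proof (rule ccontr)
      assume "\<not> (a \<in> Q \<or> b \<in> Q)"
      then obtain q r q' r' where h: "q \<in> Q" "r \<in> carrier R" "q \<oplus> r \<otimes> a \<in> S"
        "q' \<in> Q" "r' \<in> carrier R" "q' \<oplus> r' \<otimes> b \<in> S"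
        using meet[OF ab(1)] meet[OF ab(2)] by blast
      have qc: "q \<in> carrier R" "q' \<in> carrier R" using h idealD(1)[OF Qi] by auto
      have "(q \<oplus> r \<otimes> a) \<otimes> (q' \<oplus> r' \<otimes> b)
          = (q' \<oplus> r' \<otimes> b) \<otimes> q \<oplus> ((r \<otimes> a) \<otimes> q' \<oplus> (r \<otimes> r') \<otimes> (a \<otimes> b))"
        using qc h(2,5) ab(1,2) by algebra
      also have "\<dots> \<in> Q"
        using idealD(3)[OF Qi idealD(4)[OF Qi _ h(1), of "q' \<oplus> r' \<otimes> b"]
            idealD(3)[OF Qi idealD(4)[OF Qi _ h(4), of "r \<otimes> a"] idealD(4)[OF Qi _ ab(3), of "r \<otimes> r'"]]]
          h(2,5) qc ab(1,2) by simp
      finally show False using S(2)[OF h(3,6)] Q(1) by blast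
    qed
  qed
  with that Q(1) show ?thesis by blast
qed

definition assoc_primes :: "'a set \<Rightarrow> 'a set set" where
  "assoc_primes B = {P. primeideal P R \<and> (\<exists>a \<in> carrier R. a \<notin> B \<and> P = colon_elt B a)}"

text \<open>Among the ideals \<open>B : c\<close> with \<open>c\<close> outside \<open>B\<close>
  that contain \<open>x\<close>, a maximal one is prime.\<close>

lemma exists_assoc_prime:
  assumes B: "ideal B R" and a: "a \<in> carrier R" "a \<notin> B" and x: "x \<in> carrier R" "x \<otimes> a \<in> B"
  shows "\<exists>P\<in>assoc_primes B. x \<in> P"
proof -
  let ?S = "{colon_elt B c |c. c \<in> carrier R \<and> c \<notin> B \<and> x \<in> colon_elt B c}"
  have "colon_elt B a \<in> ?S" using a x by (auto simp: colon_elt_def)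
  moreover have "ideal K R" if "K \<in> ?S" for K using that colon_elt_ideal[OF B] by blast
  ultimately obtain P where P: "P \<in> ?S" "\<And>K. K \<in> ?S \<Longrightarrow> P \<subseteq> K \<Longrightarrow> K = P"
    by (rule exists_maximal_ideal_in) (assumption, rule that)
  from P(1) obtain c where c: "c \<in> carrier R" "c \<notin> B" "x \<in> colon_elt B c" "P = colon_elt B c" by blast
  have "primeideal P R"
  proof (rule primeidealI[OF _ is_cring])
    show "ideal P R" using colon_elt_ideal[OF B c(1)] c(4) by simp
    show "carrier R \<noteq> P" using c one_closed by (metis (no_types, lifting) colon_elt_def l_one mem_Collect_eq)
    fix u v assume uv: "u \<in> carrier R" "v \<in> carrier R" "u \<otimes> v \<in> P"
    show "u \<in> P \<or> v \<in> P"
    proof (cases "u \<in> P")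
      case False
      then have uc: "u \<otimes> c \<in> carrier R" "u \<otimes> c \<notin> B" using uv c by (auto simp: colon_elt_def)
      have le: "P \<subseteq> colon_elt B (u \<otimes> c)"
      proof
        fix w assume "w \<in> P"
        then have w: "w \<in> carrier R" "w \<otimes> c \<in> B" using c by (auto simp: colon_elt_def)
        have "w \<otimes> (u \<otimes> c) = u \<otimes> (w \<otimes> c)" using w uv c by algebra
        then show "w \<in> colon_elt B (u \<otimes> c)" using w idealD(4)[OF B uv(1) w(2)] by (simp add: colon_elt_def)
      qed
      then have "colon_elt B (u \<otimes> c) \<in> ?S" using uc c by blast
      from P(2)[OF this le] have "colon_elt B (u \<otimes> c) = P" .
      moreover have "v \<otimes> (u \<otimes> c) = (u \<otimes> v) \<otimes> c" using uv c by algebra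
      then have "v \<in> colon_elt B (u \<otimes> c)" using uv c by (simp add: colon_elt_def)
      ultimately show ?thesis by blast
    qed simp
  qed
  then have "P \<in> assoc_primes B" using c by (auto simp: assoc_primes_def)
  then show ?thesis using c by blast
qed

lemma regular_elt_iff_assoc:
  assumes B: "ideal B R" and x: "x \<in> carrier R"
  shows "regular_elt B x \<longleftrightarrow> (\<forall>P\<in>assoc_primes B. x \<notin> P)"
proof
  show "regular_elt B x" if "\<forall>P\<in>assoc_primes B. x \<notin> P"
    unfolding regular_elt_def
    using exists_assoc_prime[OF B _ _ x] that m_comm[OF x] by metis
  show "\<forall>P\<in>assoc_primes B. x \<notin> P" if "regular_elt B x"
  proof
    fix P assume "P \<in> assoc_primes B"
    then obtain a where a: "a \<in> carrier R" "a \<notin> B" "P = colon_elt B a" by (auto simp: assoc_primes_def)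
    then show "x \<notin> P" using regular_eltD[OF that a(1)] m_comm[OF x a(1)] by (auto simp: colon_elt_def)
  qed
qed

lemma assoc_primes_nonempty:
  assumes "ideal B R" "B \<noteq> carrier R"
  shows "assoc_primes B \<noteq> {}"
  using exists_assoc_prime[OF assms(1) one_closed _ zero_closed] ideal_carrier_iff[OF assms(1)]
    idealD(2)[OF assms(1)] assms(2) by auto

lemma assoc_primes_base: "ideal B R \<Longrightarrow> P \<in> assoc_primes B \<Longrightarrow> B \<subseteq> P"
  using subset_colon_elt[of B] by (auto simp: assoc_primes_def)

text \<open>Noetherian induction in place of a prime filtration: \<open>A K\<close> collects the
  associated primes realized by elements of \<open>K\<close>. If \<open>K\<close> is proper, some
  \<open>K : c\<close> is a prime \<open>P0\<close>, and enlarging \<open>K\<close> by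
  \<open>c\<close> adds at most \<open>P0\<close> to the collection.\<close>

lemma finite_assoc_primes:
  assumes B: "ideal B R"
  shows "finite (assoc_primes B)"
proof -
  define A where "A K = {P. primeideal P R \<and> (\<exists>a \<in> K. a \<notin> B \<and> P = colon_elt B a)}" for K
  let ?S = "{K. ideal K R \<and> B \<subseteq> K \<and> finite (A K)}"
  have "A B = {}" by (auto simp: A_def)
  then have "B \<in> ?S" "\<And>K. K \<in> ?S \<Longrightarrow> ideal K R" using B by auto
  then obtain K where K: "K \<in> ?S" "\<And>K'. K' \<in> ?S \<Longrightarrow> K \<subseteq> K' \<Longrightarrow> K' = K"
    by (rule exists_maximal_ideal_in) (assumption, rule that)
  from K(1) have Ki: "ideal K R" and BK: "B \<subseteq> K" by auto
  have "K = carrier R"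
  proof (rule ccontr)
    assume "K \<noteq> carrier R"
    then obtain P0 where "P0 \<in> assoc_primes K" using assoc_primes_nonempty[OF Ki] by blast
    then obtain c where c: "c \<in> carrier R" "c \<notin> K" "P0 = colon_elt K c" and P0: "primeideal P0 R"
      by (auto simp: assoc_primes_def)
    have sub: "A (adjoin K c) \<subseteq> insert P0 (A K)"
    proof
      fix P assume "P \<in> A (adjoin K c)"
      then obtain a where P: "primeideal P R" and a: "a \<in> adjoin K c" "a \<notin> B" and Pa: "P = colon_elt B a"
        by (auto simp: A_def)
      have ac: "a \<in> carrier R" using idealD(1)[OF adjoin_ideal[OF Ki c(1)] a(1)] .
      show "P \<in> insert P0 (A K)"
      \<comment> \<open>If a multiple \<open>s a\<close> lies in \<open>K\<close> but outside
        \<open>B\<close>, it has the same annihilator \<open>P\<close> modulo \<open>B\<close>, so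
        \<open>P\<close> was counted already. Otherwise \<open>B : a = K : a\<close>, and this is
        \<open>P0\<close> because \<open>a\<close> is a multiple of \<open>c\<close> modulo
        \<open>K\<close>.\<close>
      proof (cases "\<exists>s\<in>carrier R. s \<otimes> a \<in> K \<and> s \<otimes> a \<notin> B")
        case True
        then obtain s where s: "s \<in> carrier R" "s \<otimes> a \<in> K" "s \<otimes> a \<notin> B" by blast
        have "colon_elt B (s \<otimes> a) = P"
        proof (rule Set.set_eqI)
          fix b
          show "b \<in> colon_elt B (s \<otimes> a) \<longleftrightarrow> b \<in> P"
          proof (cases "b \<in> carrier R")
            case b: True
            have "b \<otimes> (s \<otimes> a) = (b \<otimes> s) \<otimes> a" using b s ac by (simp add: m_assoc)
            then have "b \<in> colon_elt B (s \<otimes> a) \<longleftrightarrow> b \<otimes> s \<in> P" using b s by (simp add: Pa colon_elt_def)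
            moreover have "s \<notin> P" using s by (simp add: Pa colon_elt_def)
            moreover have "ideal P R" using P by (rule primeideal.axioms)
            ultimately show ?thesis using primeideal.I_prime[OF P b s(1)] idealD(5)[of P s b] s b by blast
          qed (simp add: Pa colon_elt_def)
        qed
        then have "P \<in> A K" using P s unfolding A_def by blast
        then show ?thesis by simp
      next
        case False
        have "P = colon_elt K a"
          unfolding Pa colon_elt_def using False BK by blast
        from a(1) obtain k r where kr: "k \<in> K" "r \<in> carrier R" "a = k \<oplus> r \<otimes> c" by (auto simp: adjoin_iff)
        have kc: "k \<in> carrier R" using idealD(1)[OF Ki kr(1)] .
        have "a \<notin> K" using False ac a(2) one_closed l_one by metis
        have eq: "b \<in> P \<longleftrightarrow> b \<otimes> r \<in> P0" if b: "b \<in> carrier R" for b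
        proof -
          have "b \<otimes> a = b \<otimes> k \<oplus> (b \<otimes> r) \<otimes> c" using b kr(2,3) kc c(1) by algebra
          then have "b \<otimes> a \<in> K \<longleftrightarrow> (b \<otimes> r) \<otimes> c \<in> K"
            using ideal_add_cancel(1)[OF Ki, of "(b \<otimes> r) \<otimes> c" "b \<otimes> k"] idealD(4)[OF Ki b kr(1)] b kr c by simp
          then show ?thesis using b kr c \<open>P = colon_elt K a\<close> by (simp add: colon_elt_def)
        qed
        have rP: "r \<notin> P0"
        proof
          assume "r \<in> P0"
          then have "\<one> \<in> P" using eq[OF one_closed] kr by simp
          then show False using \<open>P = colon_elt K a\<close> \<open>a \<notin> K\<close> ac by (simp add: colon_elt_def)
        qed
        have "P0i": "ideal P0 R" using P0 by (rule primeideal.axioms)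
        have "P = P0"
        proof (rule Set.set_eqI)
          fix b
          show "b \<in> P \<longleftrightarrow> b \<in> P0"
          proof (cases "b \<in> carrier R")
            case True
            then show ?thesis using eq[OF True] primeideal.I_prime[OF P0 True kr(2)] rP idealD(5)[OF P0i kr(2)] by blast
          next
            case False
            then show ?thesis using c(3) Pa by (simp add: colon_elt_def)
          qed
        qed
        then show ?thesis by simp
      qed
    qed
    have "finite (insert P0 (A K))" using K(1) by simp
    then have "adjoin K c \<in> ?S"
      using sub adjoin_ideal[OF Ki c(1)] adjoin_base[OF Ki c(1)] BK finite_subset by blast
    from K(2)[OF this adjoin_base[OF Ki c(1)]] show False
      using adjoin_self[OF Ki c(1)] c(2) by blast
  qed
  then show ?thesis using K(1) by (simp add: A_def assoc_primes_def)
qed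

subsection \<open>Primary ideals of the maximal ideal\<close>

text \<open>Stated through the primes above \<open>K\<close>, so that it passes at once to larger
  ideals and to all powers; the unit ideal satisfies it vacuously.\<close>

definition max_primary :: "'a set \<Rightarrow> bool" where
  "max_primary K \<longleftrightarrow> ideal K R \<and> (\<forall>P. primeideal P R \<and> K \<subseteq> P \<longrightarrow> P = \<mm>)"

lemma finite_colength_max: "colength \<mm> \<noteq> \<infinity>"
proof -
  have "{K. ideal K R \<and> \<mm> \<subseteq> K \<and> K \<subseteq> carrier R} \<subseteq> {\<mm>, carrier R}"
    using maximalideal.I_maximal[OF maximalideal] by blast
  then have "finite {K. ideal K R \<and> \<mm> \<subseteq> K \<and> K \<subseteq> carrier R}" by (rule finite_subset) simp
  from chain_length_finite[OF this] show ?thesis unfolding len_def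
    by (metis enat_ord_simps(5) infinity_ileE)
qed

text \<open>An ideal \<open>L\<close> maximal among counterexamples above \<open>K\<close> has an
  associated prime, necessarily \<open>\<mm> = L : c\<close>. Then \<open>colength_split\<close>
  writes its colength as the sum of the finite colengths of \<open>\<mm>\<close> and
  \<open>L + (c)\<close>.\<close>

lemma max_primary_finite_colength:
  assumes "max_primary K"
  shows "colength K \<noteq> \<infinity>"
proof
  assume inf: "colength K = \<infinity>"
  have K: "ideal K R" using assms by (simp add: max_primary_def)
  let ?S = "{L. ideal L R \<and> K \<subseteq> L \<and> colength L = \<infinity>}"
  have "K \<in> ?S" "\<And>L. L \<in> ?S \<Longrightarrow> ideal L R" using inf K by auto
  then obtain L where L: "L \<in> ?S" "\<And>L'. L' \<in> ?S \<Longrightarrow> L \<subseteq> L' \<Longrightarrow> L' = L"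
    by (rule exists_maximal_ideal_in) (assumption, rule that)
  from L(1) have Li: "ideal L R" and KL: "K \<subseteq> L" by auto
  have "L \<noteq> carrier R" using L(1) len_refl[of "carrier R"] by auto
  then obtain P where P: "P \<in> assoc_primes L" using assoc_primes_nonempty[OF Li] by blast
  then obtain c where c: "c \<in> carrier R" "c \<notin> L" "P = colon_elt L c" "primeideal P R"
    by (auto simp: assoc_primes_def)
  have "P = \<mm>" using assms c(4) KL assoc_primes_base[OF Li P] by (auto simp: max_primary_def)
  have "colength (adjoin L c) \<noteq> \<infinity>"
  proof
    assume "colength (adjoin L c) = \<infinity>"
    then have "adjoin L c \<in> ?S" using adjoin_ideal[OF Li c(1)] adjoin_base[OF Li c(1)] KL by simp
    from L(2)[OF this adjoin_base[OF Li c(1)]] show False using adjoin_self[OF Li c(1)] c(2) by simp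
  qed
  then show False
    using colength_split[OF Li c(1)] L(1) finite_colength_max \<open>P = \<mm>\<close> c(3) by auto
qed

lemma max_primary_mono: "max_primary K \<Longrightarrow> ideal L R \<Longrightarrow> K \<subseteq> L \<Longrightarrow> max_primary L"
  by (auto simp: max_primary_def)

lemma adjoins_le_max: "B \<subseteq> \<mm> \<Longrightarrow> ideal B R \<Longrightarrow> set xs \<subseteq> \<mm> \<Longrightarrow> adjoins B xs \<subseteq> \<mm>"
  using adjoins_subset_iff[OF max_ideal, of B xs] max_carrier by blast

section \<open>Prime avoidance over an infinite residue field\<close>

lemma avoid_residues:
  assumes inf: "infinite (carrier (R Quot \<mm>))" and F: "finite F" "F \<subseteq> carrier R"
  shows "\<exists>t\<in>carrier R. \<forall>f\<in>F. t \<ominus> f \<notin> \<mm>"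
proof (rule ccontr)
  assume neg: "\<not> ?thesis"
  interpret m: ideal \<mm> R by (rule max_ideal)
  have "carrier (R Quot \<mm>) \<subseteq> (\<lambda>f. \<mm> +> f) ` F"
  proof
    fix C assume "C \<in> carrier (R Quot \<mm>)"
    then obtain t where t: "t \<in> carrier R" "C = \<mm> +> t" by (auto simp: FactRing_def A_RCOSETS_def')
    with neg obtain f where f: "f \<in> F" "t \<ominus> f \<in> \<mm>" by blast
    then have "\<mm> +> t = \<mm> +> f"
      using quotient_eq_iff_same_a_r_cos[OF max_ideal t(1), of f] F(2) by blast
    then show "C \<in> (\<lambda>f. \<mm> +> f) ` F" using t f by blast
  qed
  then show False using inf F(1) finite_surj by blast
qed

text \<open>If two parameters put \<open>z + t x\<close> into the same prime \<open>P\<close> and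
  are not congruent modulo \<open>\<mm>\<close>, subtraction puts \<open>x\<close>, and then
  \<open>z\<close>, into \<open>P\<close>. So each prime not containing both elements excludes at
  most one residue class; \<open>bad P\<close> represents it.\<close>

lemma prime_avoid_pair:
  assumes inf: "infinite (carrier (R Quot \<mm>))" and fin: "finite \<P>"
    and pr: "\<And>P. P \<in> \<P> \<Longrightarrow> primeideal P R" and c: "z \<in> carrier R" "x \<in> carrier R"
  shows "\<exists>t\<in>carrier R. \<forall>P\<in>\<P>. z \<oplus> t \<otimes> x \<in> P \<longrightarrow> z \<in> P \<and> x \<in> P"
proof -
  define bad where "bad P = (SOME s. s \<in> carrier R \<and> z \<oplus> s \<otimes> x \<in> P)" for P
  let ?F = "{bad P |P. P \<in> \<P> \<and> (\<exists>s\<in>carrier R. z \<oplus> s \<otimes> x \<in> P)}"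
  have bad: "bad P \<in> carrier R \<and> z \<oplus> bad P \<otimes> x \<in> P" if "s \<in> carrier R" "z \<oplus> s \<otimes> x \<in> P" for P s
    unfolding bad_def by (rule someI[of _ s]) (use that in blast)
  have "?F \<subseteq> bad ` \<P>" by blast
  then have "finite ?F" by (rule finite_surj[OF fin])
  moreover have "?F \<subseteq> carrier R" using bad by blast
  ultimately have "\<exists>t\<in>carrier R. \<forall>f\<in>?F. t \<ominus> f \<notin> \<mm>" by (rule avoid_residues[OF inf])
  then obtain t where t: "t \<in> carrier R" "\<And>f. f \<in> ?F \<Longrightarrow> t \<ominus> f \<notin> \<mm>" by (elim bexE) (rule that, assumption, erule (1) bspec)
  have "z \<in> P \<and> x \<in> P" if P: "P \<in> \<P>" and zt: "z \<oplus> t \<otimes> x \<in> P" for P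
  proof -
    have Pi: "ideal P R" using pr[OF P] by (rule primeideal.axioms)
    note b = bad[OF t(1) zt]
    have "t \<ominus> bad P \<notin> \<mm>" using t zt P by blast
    then have nP: "t \<ominus> bad P \<notin> P" using primeideal_le_max[OF pr[OF P]] by blast
    have "(t \<ominus> bad P) \<otimes> x = (z \<oplus> t \<otimes> x) \<ominus> (z \<oplus> bad P \<otimes> x)" using b t(1) c by algebra
    then have "(t \<ominus> bad P) \<otimes> x \<in> P" using idealD(7)[OF Pi zt] b by simp
    then have xP: "x \<in> P" using primeideal.I_prime[OF pr[OF P], of "t \<ominus> bad P" x] nP t(1) b c by auto
    then have "z \<in> P" using ideal_add_cancel(2)[OF Pi c(1), of "t \<otimes> x"] zt idealD(4)[OF Pi t(1) xP] by blast
    with xP show ?thesis by blast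
  qed
  with t(1) show ?thesis by blast
qed

text \<open>The last clause expresses that \<open>w\<close> and \<open>z\<close> differ by an
  element of the ideal generated by \<open>xs\<close>, so one may replace the other as a generator
  beside \<open>xs\<close>.\<close>

lemma prime_avoid_list:
  assumes inf: "infinite (carrier (R Quot \<mm>))" and fin: "finite \<P>"
    and pr: "\<And>P. P \<in> \<P> \<Longrightarrow> primeideal P R" and c: "z \<in> carrier R" "set xs \<subseteq> carrier R"
  shows "\<exists>w\<in>carrier R. (\<forall>P\<in>\<P>. w \<in> P \<longrightarrow> z \<in> P \<and> set xs \<subseteq> P)
      \<and> (\<forall>K. ideal K R \<and> set xs \<subseteq> K \<longrightarrow> (w \<in> K \<longleftrightarrow> z \<in> K))"
  using c
proof (induction xs arbitrary: z)
  case Nil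
  then show ?case by auto
next
  case (Cons x xs)
  have x: "x \<in> carrier R" using Cons.prems by simp
  obtain t where t: "t \<in> carrier R" "\<And>P. P \<in> \<P> \<Longrightarrow> z \<oplus> t \<otimes> x \<in> P \<Longrightarrow> z \<in> P \<and> x \<in> P"
    using prime_avoid_pair[OF inf fin pr Cons.prems(1) x] by blast
  obtain w where w: "w \<in> carrier R" "\<And>P. P \<in> \<P> \<Longrightarrow> w \<in> P \<Longrightarrow> z \<oplus> t \<otimes> x \<in> P \<and> set xs \<subseteq> P"
    "\<And>K. ideal K R \<Longrightarrow> set xs \<subseteq> K \<Longrightarrow> (w \<in> K \<longleftrightarrow> z \<oplus> t \<otimes> x \<in> K)"
    using Cons.IH[of "z \<oplus> t \<otimes> x"] Cons.prems x t(1) by auto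
  have "w \<in> K \<longleftrightarrow> z \<in> K" if K: "ideal K R" "set (x # xs) \<subseteq> K" for K
  proof -
    have "t \<otimes> x \<in> K" using idealD(4)[OF K(1) t(1)] K(2) by simp
    then show ?thesis using w(3)[OF K(1)] K(2) ideal_add_cancel(2)[OF K(1) Cons.prems(1)] by simp
  qed
  then show ?case using w t by (intro bexI[of _ w]) auto
qed

text \<open>Exchange argument: the elements of a regular sequence are replaced, one at a time, by general
  elements of the parameter ideal.\<close>

lemma parameter_ideal_regular:
  assumes inf: "infinite (carrier (R Quot \<mm>))"
    and B: "ideal B R" "B \<subseteq> \<mm>" and ys: "regular_seq B ys" "set ys \<subseteq> \<mm>"
    and xs: "set xs \<subseteq> \<mm>" "length xs \<le> length ys" "max_primary (adjoins B xs)"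
  shows "\<exists>zs. length zs = length ys \<and> set zs \<subseteq> \<mm> \<and> regular_seq B zs \<and> adjoins B zs = adjoins B xs"
  using B ys xs
proof (induction ys arbitrary: B xs rule: rev_induct)
  case Nil
  then show ?case by auto
next
  case (snoc y ys)
  note B = snoc.prems(1,2)
  have y: "y \<in> \<mm>" and ys: "set ys \<subseteq> \<mm>" "set ys \<subseteq> carrier R" using snoc.prems max_carrier by auto
  define C where "C = adjoins B ys"
  have Ci: "ideal C R" and BC: "B \<subseteq> C" unfolding C_def using adjoins_ideal[OF B(1) ys(2)] adjoins_base[OF B(1) ys(2)] by auto
  have ry: "regular_elt C y" and rys: "regular_seq B ys"
    using snoc.prems(3) by (auto simp: regular_seq_append C_def)
  have not_max: "P \<noteq> \<mm>" if "P \<in> assoc_primes C" for P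
    using that ry y regular_elt_iff_assoc[OF Ci max_carrier[OF y]] by blast
  show ?case
  proof (cases xs)
    case Nil
    \<comment> \<open>The parameters have run out while \<open>y\<close> is still regular. This is
      impossible, since every associated prime of \<open>C\<close> would be \<open>\<mm>\<close>,
      which contains \<open>y\<close>.\<close>
    then have "max_primary B" using snoc.prems by simp
    moreover have "C \<noteq> carrier R"
      using adjoins_le_max[OF B(2,1) ys(1)] one_notin_max one_closed unfolding C_def by blast
    then obtain P where P: "P \<in> assoc_primes C" using assoc_primes_nonempty[OF Ci] by blast
    ultimately have "P = \<mm>" using assoc_primes_base[OF Ci P] BC by (auto simp: max_primary_def assoc_primes_def)
    then show ?thesis using not_max[OF P] by blast
  next
    case (Cons x xs')
    have x: "x \<in> carrier R" "set xs' \<subseteq> carrier R" "set xs' \<subseteq> \<mm>" "x \<in> \<mm>"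
      using snoc.prems Cons max_carrier by auto
    obtain z where z: "z \<in> carrier R" "\<And>P. P \<in> assoc_primes C \<Longrightarrow> z \<in> P \<Longrightarrow> x \<in> P \<and> set xs' \<subseteq> P"
      "\<And>K. ideal K R \<Longrightarrow> set xs' \<subseteq> K \<Longrightarrow> (z \<in> K \<longleftrightarrow> x \<in> K)"
      using prime_avoid_list[OF inf finite_assoc_primes[OF Ci] _ x(1,2)] by (auto simp: assoc_primes_def)
    have zm: "z \<in> \<mm>" using z(3)[OF max_ideal x(3)] x(4) by blast
    \<comment> \<open>A prime associated to \<open>C\<close> that contains \<open>z\<close> contains
      \<open>B\<close> and all of \<open>xs\<close>, hence is \<open>\<mm>\<close>; but
      \<open>\<mm>\<close> is not associated to \<open>C\<close>, since \<open>y\<close> is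
      regular.\<close>
    have "z \<notin> P" if P: "P \<in> assoc_primes C" for P
    proof
      assume "z \<in> P"
      then have "set xs \<subseteq> P" using z(2)[OF P] Cons by simp
      moreover have "primeideal P R" using P by (simp add: assoc_primes_def)
      then have "ideal P R" "primeideal P R" by (auto intro: primeideal.axioms)
      ultimately have "P = \<mm>"
        using snoc.prems(7) adjoins_subset_iff[of P B xs] B(1) BC assoc_primes_base[OF Ci P] Cons x
        by (auto simp: max_primary_def)
      then show False using not_max[OF P] by blast
    qed
    then have "regular_elt C z" using regular_elt_iff_assoc[OF Ci z(1)] by blast
    then have "regular_seq B (ys @ [z])" using rys by (simp add: regular_seq_append C_def)
    \<comment> \<open>The new element replaces the last one and is moved to the front, so that the
      induction hypothesis applies over \<open>B + (z)\<close>.\<close>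
    then have rz: "regular_elt B z" "regular_seq (adjoin B z) ys"
      using regular_seq_move[OF B(1) ys(1) zm] by auto
    have eq: "adjoins (adjoin B z) xs' = adjoins B xs"
    proof -
      have A: "ideal (adjoins B (z # xs')) R" "ideal (adjoins B xs) R"
        using adjoins_ideal[OF B(1)] x z(1) Cons by (auto simp del: adjoins.simps)
      have "set (z # xs') \<subseteq> adjoins B (z # xs')" "B \<subseteq> adjoins B (z # xs')"
        using adjoins_set[OF B(1), of "z # xs'"] adjoins_base[OF B(1), of "z # xs'"] x z(1) by (auto simp del: adjoins.simps)
      moreover have "set xs \<subseteq> adjoins B xs" "B \<subseteq> adjoins B xs"
        using adjoins_set[OF B(1), of xs] adjoins_base[OF B(1), of xs] x Cons by (auto simp del: adjoins.simps)
      ultimately have "set xs \<subseteq> adjoins B (z # xs')" "set (z # xs') \<subseteq> adjoins B xs"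
        using z(3)[OF A(1)] z(3)[OF A(2)] Cons by (auto simp del: adjoins.simps)
      then have "adjoins B (z # xs') = adjoins B xs"
        using adjoins_subset_iff[OF A(1) B(1), of xs] adjoins_subset_iff[OF A(2) B(1), of "z # xs'"]
          \<open>B \<subseteq> adjoins B (z # xs')\<close> \<open>B \<subseteq> adjoins B xs\<close> x z(1) Cons by (auto simp del: adjoins.simps)
      then show ?thesis by simp
    qed
    have "\<exists>zs. length zs = length ys \<and> set zs \<subseteq> \<mm> \<and> regular_seq (adjoin B z) zs
        \<and> adjoins (adjoin B z) zs = adjoins (adjoin B z) xs'"
      using snoc.IH[OF adjoin_ideal[OF B(1) z(1)] adjoin_least[OF max_ideal B(2) zm] rz(2) ys(1) x(3)]
        snoc.prems(6,7) Cons eq by simp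
    then obtain zs where zs: "length zs = length ys" "set zs \<subseteq> \<mm>" "regular_seq (adjoin B z) zs"
      "adjoins (adjoin B z) zs = adjoins (adjoin B z) xs'" by blast
    then show ?thesis using rz(1) eq zm by (intro exI[of _ "z # zs"]) simp
  qed
qed

end

section \<open>Powers of ideals and reductions\<close>

context cring begin

lemma ideal_prod_mono:
  assumes "A \<subseteq> A'" "B \<subseteq> B'"
  shows "A \<cdot> B \<subseteq> A' \<cdot> B'"
proof
  fix x assume "x \<in> A \<cdot> B"
  then show "x \<in> A' \<cdot> B'"
    by (induction rule: ideal_prod.induct) (use assms in \<open>auto intro: ideal_prod.intros\<close>)
qed

lemma ideal_prod_least:
  assumes "ideal N R" "\<And>a b. a \<in> A \<Longrightarrow> b \<in> B \<Longrightarrow> a \<otimes> b \<in> N"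
  shows "A \<cdot> B \<subseteq> N"
proof
  fix x assume "x \<in> A \<cdot> B"
  then show "x \<in> N"
    by (induction rule: ideal_prod.induct) (use assms(2) idealD(3)[OF assms(1)] in auto)
qed

lemma ideal_pow_0: "ideal_pow R I 0 = carrier R"
  by (simp add: ideal_pow_def ideals_set_def)

lemma ideal_pow_Suc: "ideal_pow R I (Suc n) = ideal_pow R I n \<cdot> I"
  by (simp add: ideal_pow_def) (simp add: ideals_set_def)

lemma ideal_pow_ideal: "ideal I R \<Longrightarrow> ideal (ideal_pow R I n) R"
  by (induction n) (simp_all add: ideal_pow_0 ideal_pow_Suc oneideal ideal_prod_is_ideal)

lemma ideal_pow_Suc2: "ideal I R \<Longrightarrow> ideal_pow R I (Suc n) = I \<cdot> ideal_pow R I n"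
  using ideal_prod_commute ideal_pow_ideal by (simp add: ideal_pow_Suc)

lemma ideal_pow_1: "ideal I R \<Longrightarrow> ideal_pow R I 1 = I"
  using ideal_prod_one[of I] by (simp add: ideal_pow_Suc2 ideal_pow_0)

lemma ideal_pow_add:
  assumes "ideal I R"
  shows "ideal_pow R I (m + n) = ideal_pow R I m \<cdot> ideal_pow R I n"
proof (induction n)
  case 0
  then show ?case using ideal_prod_one[OF ideal_pow_ideal[OF assms]] by (simp add: ideal_pow_0)
next
  case (Suc n)
  then show ?case
    using ideal_prod_assoc[OF ideal_pow_ideal[OF assms] ideal_pow_ideal[OF assms] assms, of m n]
    by (simp add: ideal_pow_Suc)
qed

lemma ideal_pow_mono: "A \<subseteq> B \<Longrightarrow> ideal_pow R A n \<subseteq> ideal_pow R B n"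
  by (induction n) (simp_all add: ideal_pow_0 ideal_pow_Suc ideal_prod_mono)

lemma ideal_prod_subset:
  assumes "ideal A R" "ideal B R"
  shows "A \<cdot> B \<subseteq> A" "A \<cdot> B \<subseteq> B"
  using ideal_prod_inter[OF assms] by auto

lemma ideal_pow_antimono:
  assumes "ideal I R" "m \<le> n"
  shows "ideal_pow R I n \<subseteq> ideal_pow R I m"
proof -
  have "ideal_pow R I (m + (n - m)) \<subseteq> ideal_pow R I m"
    unfolding ideal_pow_add[OF assms(1)] by (rule ideal_prod_subset) (simp_all add: ideal_pow_ideal assms)
  then show ?thesis using assms(2) by simp
qed

lemma pow_mem_ideal_pow: "ideal I R \<Longrightarrow> a \<in> I \<Longrightarrow> a [^] n \<in> ideal_pow R I n"
proof (induction n)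
  case 0
  then show ?case by (simp add: ideal_pow_0)
next
  case (Suc n)
  then show ?case by (simp add: ideal_pow_Suc ideal_prod.prod)
qed

text \<open>For an ideal \<open>K\<close> this is \<open>B + (xs) K\<close>. It mediates between the
  recursion of \<open>ideal_power_mod\<close>, which shortens the list, and products of
  ideals.\<close>

primrec lin_comb :: "'a set \<Rightarrow> 'a list \<Rightarrow> 'a set \<Rightarrow> 'a set" where
  "lin_comb B [] K = B"
| "lin_comb B (x # xs) K = mult_add (lin_comb B xs K) x K"

lemma lin_comb_ideal:
  "ideal B R \<Longrightarrow> ideal K R \<Longrightarrow> set xs \<subseteq> carrier R \<Longrightarrow> ideal (lin_comb B xs K) R"
  by (induction xs) (auto intro: mult_add_ideal)

lemma lin_comb_mono: "K \<subseteq> L \<Longrightarrow> lin_comb B xs K \<subseteq> lin_comb B xs L"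
  by (induction xs) (auto intro: mult_add_mono[THEN subsetD])

lemma lin_comb_least:
  assumes "ideal N R" "B \<subseteq> N" "\<And>a x. a \<in> K \<Longrightarrow> x \<in> set xs \<Longrightarrow> a \<otimes> x \<in> N"
  shows "lin_comb B xs K \<subseteq> N"
  using assms(3)
proof (induction xs)
  case (Cons x xs)
  then have "lin_comb B xs K \<subseteq> N" by simp
  then show ?case using mult_add_least[OF assms(1), of "lin_comb B xs K" K x] Cons.prems by simp
qed (use assms(2) in simp)

lemma lin_comb_mult:
  assumes "ideal B R" "ideal K R" "set xs \<subseteq> carrier R" "x \<in> set xs" "a \<in> K"
  shows "a \<otimes> x \<in> lin_comb B xs K"
  using assms(3,4)
proof (induction xs)
  case (Cons y xs)
  have c: "set xs \<subseteq> carrier R" "y \<in> carrier R" using Cons.prems by auto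
  note I = lin_comb_ideal[OF assms(1,2) c(1)]
  show ?case
  proof (cases "x = y")
    case True
    then show ?thesis using mult_add_mult[OF I c(2) assms(2,5)] by simp
  next
    case False
    then have "a \<otimes> x \<in> lin_comb B xs K" using Cons by simp
    then show ?thesis using mult_add_base[OF I c(2) assms(2)] by auto
  qed
qed simp

lemma lin_comb_base:
  assumes "ideal B R" "ideal K R" "set xs \<subseteq> carrier R"
  shows "B \<subseteq> lin_comb B xs K"
  using assms(3)
proof (induction xs)
  case (Cons x xs)
  then have c: "set xs \<subseteq> carrier R" "x \<in> carrier R" by auto
  then show ?case
    using mult_add_base[OF lin_comb_ideal[OF assms(1,2) c(1)] c(2) assms(2)] Cons.IH by auto
qed simp

lemma lin_comb_eq_prod:
  assumes xs: "set xs \<subseteq> carrier R" and K: "ideal K R"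
  shows "lin_comb {\<zero>} xs K = (Idl (set xs)) \<cdot> K"
proof
  note J = genideal_ideal[OF xs]
  note P = ideal_prod_is_ideal[OF J K]
  show "lin_comb {\<zero>} xs K \<subseteq> (Idl (set xs)) \<cdot> K"
  proof (rule lin_comb_least[OF P])
    show "{\<zero>} \<subseteq> (Idl (set xs)) \<cdot> K" using idealD(2)[OF P] by simp
    show "a \<otimes> x \<in> (Idl (set xs)) \<cdot> K" if ax: "a \<in> K" "x \<in> set xs" for a x
    proof -
      have "a \<otimes> x = x \<otimes> a" using ax xs idealD(1)[OF K] by (intro m_comm) auto
      moreover have "x \<in> Idl (set xs)" using ax genideal_self[OF xs] by blast
      ultimately show ?thesis using ideal_prod.prod[of x "Idl (set xs)" a K R] ax by simp
    qed
  qed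
  have L: "ideal (lin_comb {\<zero>} xs K) R" by (rule lin_comb_ideal[OF zeroideal K xs])
  let ?N = "{i \<in> carrier R. \<forall>a\<in>K. i \<otimes> a \<in> lin_comb {\<zero>} xs K}"
  have "ideal ?N R"
    by (rule ideal_criterion)
       (use idealD(1)[OF K] idealD[OF L] in \<open>auto simp: l_distr m_assoc\<close>)
  moreover have "set xs \<subseteq> ?N"
  proof
    fix x assume x: "x \<in> set xs"
    have "x \<otimes> a \<in> lin_comb {\<zero>} xs K" if a: "a \<in> K" for a
    proof -
      have "x \<otimes> a = a \<otimes> x" using x xs idealD(1)[OF K a] by (intro m_comm) auto
      then show ?thesis using lin_comb_mult[OF zeroideal K xs x a] by simp
    qed
    then show "x \<in> ?N" using x xs by blast
  qed
  ultimately have "Idl (set xs) \<subseteq> ?N" by (rule genideal_minimal)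
  then show "(Idl (set xs)) \<cdot> K \<subseteq> lin_comb {\<zero>} xs K"
    by (intro ideal_prod_least[OF L]) auto
qed

text \<open>The recursion multiplies only \<open>x\<close> by the full lower power and gives the
  tail its own power. Nothing is missing: a mixed product \<open>(t x) y\<close> with
  \<open>y\<close> in the tail is counted as \<open>(t y) x\<close>.\<close>

lemma ideal_power_mod_eq_lin_comb:
  assumes B: "ideal B R" and I: "ideal I R" and xs: "set xs \<subseteq> carrier R"
  shows "ideal_power_mod B I xs (Suc k) = lin_comb B xs (ideal_power_mod B I xs k)"
  using xs
proof (induction xs arbitrary: k)
  case (Cons x xs)
  have c: "x \<in> carrier R" "set xs \<subseteq> carrier R" using Cons.prems by auto
  let ?P = "ideal_power_mod B I"
  have K: "ideal (?P xs k) R" "ideal (?P (x # xs) k) R" for k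
    using ideal_power_mod_ideal[OF B I c(2)] ideal_power_mod_ideal[OF B I Cons.prems] by auto
  show ?case
  proof (induction k)
    case 0
    then show ?case using Cons.IH[OF c(2), of 0] by simp
  next
    case (Suc k)
    let ?L = "?P (x # xs) (Suc k)"
    have I1: "ideal (lin_comb B xs (?P xs (Suc k))) R" by (rule lin_comb_ideal[OF B K(1) c(2)])
    have I2: "ideal (mult_add (lin_comb B xs (?P xs (Suc k))) x ?L) R"
      by (rule mult_add_ideal[OF I1 c(1) K(2)])
    have "?P (x # xs) (Suc (Suc k)) = mult_add (lin_comb B xs (?P xs (Suc k))) x ?L"
      using Cons.IH[OF c(2), of "Suc k"] by simp
    also have "\<dots> = mult_add (lin_comb B xs ?L) x ?L"
    proof
      show "mult_add (lin_comb B xs (?P xs (Suc k))) x ?L \<subseteq> mult_add (lin_comb B xs ?L) x ?L"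
        by (intro mult_add_mono lin_comb_mono ideal_power_mod_tail[OF B I Cons.prems]) simp
      have "lin_comb B xs ?L \<subseteq> mult_add (lin_comb B xs (?P xs (Suc k))) x ?L"
      proof (rule lin_comb_least[OF I2])
        show "B \<subseteq> mult_add (lin_comb B xs (?P xs (Suc k))) x ?L"
          using lin_comb_base[OF B K(1) c(2)] mult_add_base[OF I1 c(1) K(2)] by blast
        fix a y assume a: "a \<in> ?L" and y: "y \<in> set xs"
        have yc: "y \<in> carrier R" using y c by auto
        from a obtain q t where qt: "q \<in> ?P xs (Suc k)" "t \<in> ?P (x # xs) k" "a = q \<oplus> t \<otimes> x"
          by (auto simp: mult_add_iff)
        have "q \<in> carrier R" "t \<in> carrier R" using qt idealD(1)[OF K(1)] idealD(1)[OF K(2)] by auto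
        then have "a \<otimes> y = q \<otimes> y \<oplus> (t \<otimes> y) \<otimes> x" using qt(3) yc c(1) by algebra
        moreover have "q \<otimes> y \<in> lin_comb B xs (?P xs (Suc k))"
          by (rule lin_comb_mult[OF B K(1) c(2) y qt(1)])
        moreover have "t \<otimes> y \<in> lin_comb B (x # xs) (?P (x # xs) k)"
          by (rule lin_comb_mult[OF B K(2) Cons.prems _ qt(2)]) (use y in simp)
        then have "t \<otimes> y \<in> ?L" unfolding Suc .
        ultimately show "a \<otimes> y \<in> mult_add (lin_comb B xs (?P xs (Suc k))) x ?L"
          unfolding mult_add_iff by blast
      qed
      then show "mult_add (lin_comb B xs ?L) x ?L \<subseteq> mult_add (lin_comb B xs (?P xs (Suc k))) x ?L"
        using mult_add_mult[OF I1 c(1) K(2)] by (intro mult_add_least[OF I2])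
    qed
    finally show ?case by simp
  qed
qed simp

lemma ideal_power_mod_zero:
  assumes I: "ideal I R" and xs: "set xs \<subseteq> carrier R"
  shows "ideal_power_mod {\<zero>} I xs k = ideal_pow R (Idl (set xs)) k \<cdot> I"
proof (induction k)
  case 0
  then show ?case using ideal_prod_one[OF I] ideal_prod_commute[OF I oneideal] by (simp add: ideal_pow_0)
next
  case (Suc k)
  note J = genideal_ideal[OF xs]
  have "ideal_power_mod {\<zero>} I xs (Suc k) = (Idl (set xs)) \<cdot> (ideal_pow R (Idl (set xs)) k \<cdot> I)"
    unfolding ideal_power_mod_eq_lin_comb[OF zeroideal I xs] Suc
    by (rule lin_comb_eq_prod[OF xs ideal_prod_is_ideal[OF ideal_pow_ideal[OF J] I]])
  then show ?case
    unfolding ideal_pow_Suc2[OF J] by (simp add: ideal_prod_assoc[OF J ideal_pow_ideal[OF J] I])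
qed

section \<open>Reductions of ideals\<close>

lemma is_reductionD:
  assumes "is_reduction R I J"
  shows "ideal J R" "J \<subseteq> I" "\<exists>m. ideal_pow R I (m + 1) = J \<cdot> ideal_pow R I m"
  using assms by (auto simp: is_reduction_def)

lemma reduction_pow:
  assumes I: "ideal I R" and J: "ideal J R" and m: "ideal_pow R I (m + 1) = J \<cdot> ideal_pow R I m"
  shows "ideal_pow R I (m + k) = ideal_pow R J k \<cdot> ideal_pow R I m"
proof (induction k)
  case 0
  have "carrier R \<cdot> ideal_pow R I m = ideal_pow R I m"
    using ideal_prod_one[OF ideal_pow_ideal[OF I]] ideal_prod_commute[OF ideal_pow_ideal[OF I] oneideal] by simp
  then show ?case by (simp add: ideal_pow_0)
next
  case (Suc k)
  note Ii = ideal_pow_ideal[OF I] and Ji = ideal_pow_ideal[OF J]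
  have "ideal_pow R I (m + Suc k) = I \<cdot> (ideal_pow R J k \<cdot> ideal_pow R I m)"
    using Suc ideal_pow_Suc2[OF I, of "m + k"] by simp
  also have "\<dots> = ideal_pow R J k \<cdot> (I \<cdot> ideal_pow R I m)"
    using ideal_prod_assoc[OF I Ji Ii] ideal_prod_assoc[OF Ji I Ii] ideal_prod_commute[OF I Ji] by metis
  also have "I \<cdot> ideal_pow R I m = J \<cdot> ideal_pow R I m" using m ideal_pow_Suc2[OF I, of m] by simp
  also have "ideal_pow R J k \<cdot> (J \<cdot> ideal_pow R I m) = ideal_pow R J (Suc k) \<cdot> ideal_pow R I m"
    using ideal_prod_assoc[OF Ji J Ii] by (simp add: ideal_pow_Suc)
  finally show ?case .
qed

lemma reduction_pow_subset:
  assumes "ideal I R" "is_reduction R I J"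
  obtains m where "\<And>k. ideal_pow R I (m + k) \<subseteq> ideal_pow R J k"
proof -
  obtain m where m: "ideal_pow R I (m + 1) = J \<cdot> ideal_pow R I m" using is_reductionD(3)[OF assms(2)] by blast
  note J = is_reductionD(1)[OF assms(2)]
  show ?thesis
    by (rule that[of m], unfold reduction_pow[OF assms(1) J m])
       (rule ideal_prod_subset(1)[OF ideal_pow_ideal[OF J] ideal_pow_ideal[OF assms(1)]])
qed

lemma reduction_refl: "ideal I R \<Longrightarrow> is_reduction R I I"
  unfolding is_reduction_def using ideal_pow_Suc2[of I 0] by (auto intro: exI[of _ 0])

lemma reduction_trans:
  assumes I: "ideal I R" and J: "is_reduction R I J" and K: "is_reduction R J K"
  shows "is_reduction R I K"
proof -
  note Ji = is_reductionD(1)[OF J] and Ki = is_reductionD(1)[OF K]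
  obtain m n where m: "ideal_pow R I (m + 1) = J \<cdot> ideal_pow R I m"
    and n: "ideal_pow R J (n + 1) = K \<cdot> ideal_pow R J n"
    using is_reductionD(3)[OF J] is_reductionD(3)[OF K] by blast
  note p = reduction_pow[OF I Ji m]
  have "ideal_pow R I (m + (n + 1)) = K \<cdot> (ideal_pow R J n \<cdot> ideal_pow R I m)"
    unfolding p n by (rule ideal_prod_assoc[OF Ki ideal_pow_ideal[OF Ji] ideal_pow_ideal[OF I]])
  also have "\<dots> = K \<cdot> ideal_pow R I (m + n)" unfolding p ..
  finally have "ideal_pow R I ((m + n) + 1) = K \<cdot> ideal_pow R I (m + n)" by (simp add: add.assoc)
  then show ?thesis using Ki is_reductionD(2)[OF J] is_reductionD(2)[OF K] unfolding is_reduction_def by blast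
qed

lemma primeideal_pow_mem:
  assumes "primeideal P R" "a \<in> carrier R" "a [^] (n::nat) \<in> P"
  shows "a \<in> P"
  using assms(3)
proof (induction n)
  case 0
  then show ?case
    using primeideal.I_notcarr[OF assms(1)] ideal_carrier_iff[OF primeideal.axioms(1)[OF assms(1)]] by simp
next
  case (Suc n)
  then show ?case using primeideal.I_prime[OF assms(1), of "a [^] n" a] assms(2) by auto
qed

lemma regular_seq_iff:
  "regular_seq B xs \<longleftrightarrow> (\<forall>i<length xs. regular_elt (adjoins B (take i xs)) (xs ! i))"
proof (induction xs arbitrary: B)
  case (Cons x xs)
  then show ?case by (simp add: All_less_Suc2)
qed simp

end

section \<open>Regular sequences of maximal length\<close>

context noetherian_local_ring begin

lemma max_primary_pow_mem:
  assumes "max_primary K" "y \<in> \<mm>"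
  obtains n :: nat where "y [^] n \<in> K"
proof -
  have K: "ideal K R" using assms(1) by (simp add: max_primary_def)
  have y: "y \<in> carrier R" using max_carrier[OF assms(2)] .
  have "\<exists>n::nat. y [^] n \<in> K"
  proof (rule ccontr)
    assume neg: "\<not> ?thesis"
    let ?S = "range (\<lambda>n::nat. y [^] n)"
    have 1: "\<one> \<in> ?S" by (rule image_eqI[of _ _ 0]) simp_all
    have 2: "s \<otimes> t \<in> ?S" if "s \<in> ?S" "t \<in> ?S" for s t
      using that y by (auto simp: nat_pow_mult)
    have 3: "?S \<inter> K = {}" using neg by auto
    obtain Q where Q: "primeideal Q R" "K \<subseteq> Q" "?S \<inter> Q = {}"
      by (rule exists_prime_disjoint[OF K 1 2 3]) (assumption, assumption, rule that)
    have "Q = \<mm>" using assms(1) Q by (auto simp: max_primary_def)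
    moreover have "y \<in> ?S" by (rule image_eqI[of _ _ 1]) (use y in simp_all)
    ultimately show False using Q(3) assms(2) by blast
  qed
  with that show ?thesis by blast
qed

text \<open>The reduction equation puts a power of \<open>I\<close> into \<open>J\<close>, so every
  prime over \<open>J\<close> also contains \<open>I\<close>.\<close>

lemma max_primary_reduction:
  assumes I: "max_primary I" and J: "is_reduction R I J"
  shows "max_primary J"
proof -
  have Ii: "ideal I R" using I by (simp add: max_primary_def)
  obtain m where m: "ideal_pow R I (m + 1) = J \<cdot> ideal_pow R I m" using is_reductionD(3)[OF J] by blast
  note Ji = is_reductionD(1)[OF J]
  have sub: "ideal_pow R I (m + 1) \<subseteq> J"
    unfolding m by (rule ideal_prod_subset(1)[OF Ji ideal_pow_ideal[OF Ii]])
  have "P = \<mm>" if P: "primeideal P R" "J \<subseteq> P" for P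
  proof -
    have "I \<subseteq> P"
      using primeideal_pow_mem[OF P(1)] pow_mem_ideal_pow[OF Ii, of _ "m + 1"] sub P(2) idealD(1)[OF Ii] by blast
    then show ?thesis using I P(1) by (auto simp: max_primary_def)
  qed
  then show ?thesis using Ji by (auto simp: max_primary_def)
qed

text \<open>This replaces localization at \<open>P\<close>: the products \<open>s y\<^sup>n\<close>
  with \<open>s\<close> outside \<open>P\<close> form a multiplicative set that misses
  \<open>B\<close> because \<open>y\<close> is regular. A prime over \<open>B\<close> disjoint from
  it lies in \<open>P\<close> and omits \<open>y\<close>.\<close>

lemma prime_below_regular:
  assumes B: "ideal B R" and y: "y \<in> carrier R" "regular_elt B y" and P: "primeideal P R" "B \<subseteq> P" "y \<in> P"
  shows "\<exists>Q. primeideal Q R \<and> B \<subseteq> Q \<and> Q \<subset> P"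
proof -
  have Pi: "ideal P R" using P(1) by (rule primeideal.axioms)
  let ?S = "{s \<otimes> y [^] n |s n. s \<in> carrier R \<and> s \<notin> P \<and> n \<in> (UNIV :: nat set)}"
  have 1: "\<one> \<in> ?S"
    using primeideal.I_notcarr[OF P(1)] ideal_carrier_iff[OF Pi] by (auto intro!: exI[of _ \<one>] exI[of _ 0])
  have 2: "u \<otimes> v \<in> ?S" if uv: "u \<in> ?S" "v \<in> ?S" for u v
  proof -
    from uv obtain s t and m n :: nat where h: "s \<in> carrier R" "s \<notin> P" "t \<in> carrier R" "t \<notin> P"
      "u = s \<otimes> y [^] m" "v = t \<otimes> y [^] n" by blast
    have "u \<otimes> v = (s \<otimes> t) \<otimes> y [^] (m + n)"
      using h(1,3,5,6) y(1) by (simp add: nat_pow_mult[symmetric] m_ac)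
    moreover have "s \<otimes> t \<notin> P" using primeideal.I_prime[OF P(1) h(1,3)] h(2,4) by blast
    ultimately show ?thesis using h(1,3) by blast
  qed
  have notB: "s \<otimes> y [^] n \<notin> B" if s: "s \<in> carrier R" "s \<notin> P" for s and n :: nat
  proof (induction n)
    case 0
    then show ?case using s P(2) by auto
  next
    case (Suc n)
    then show ?case using regular_eltD[OF y(2), of "s \<otimes> y [^] n"] s y(1) by (auto simp: m_assoc)
  qed
  then have 3: "?S \<inter> B = {}" by blast
  obtain Q where Q: "primeideal Q R" "B \<subseteq> Q" "?S \<inter> Q = {}"
    by (rule exists_prime_disjoint[OF B 1 2 3]) (assumption, assumption, rule that)
  have "s \<in> ?S" if "s \<in> carrier R" "s \<notin> P" for s
    using that by (auto intro!: exI[of _ s] exI[of _ 0])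
  then have "Q \<subseteq> P" using Q(3) idealD(1)[OF primeideal.axioms(1)[OF Q(1)]] by blast
  moreover have "\<one> \<notin> P" using primeideal.I_notcarr[OF P(1)] ideal_carrier_iff[OF Pi] by auto
  then have "y \<in> ?S" using y(1) by (intro CollectI exI[of _ \<one>] exI[of _ "1::nat"]) simp
  then have "y \<notin> Q" using Q(3) by blast
  ultimately show ?thesis using Q P(3) by blast
qed

text \<open>The chain is built downwards from \<open>P\<close>, each member of the sequence, from
  the last to the first, giving one strict descent.\<close>

lemma prime_chain_regular_seq:
  assumes "ideal B R" "set ys \<subseteq> carrier R" "regular_seq B ys" "primeideal P R" "adjoins B ys \<subseteq> P"
  shows "\<exists>Ps. strict_chain {P. primeideal P R} Ps \<and> length Ps = Suc (length ys) \<and> last Ps = P"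
  using assms(2-)
proof (induction ys arbitrary: P rule: rev_induct)
  case Nil
  then show ?case by (intro exI[of _ "[P]"]) simp
next
  case (snoc y ys)
  have c: "set ys \<subseteq> carrier R" "y \<in> carrier R" using snoc.prems by auto
  note C = adjoins_ideal[OF assms(1) c(1)]
  have Pi: "ideal P R" using snoc.prems(3) by (rule primeideal.axioms)
  have r: "regular_seq B ys" "regular_elt (adjoins B ys) y"
    using snoc.prems(2) by (auto simp: regular_seq_append)
  have "adjoins B ys \<subseteq> P" "y \<in> P"
    using snoc.prems(4) adjoin_subset_iff[OF Pi C c(2)] by (auto simp: adjoins_append)
  then obtain Q where Q: "primeideal Q R" "adjoins B ys \<subseteq> Q" "Q \<subset> P"
    using prime_below_regular[OF C c(2) r(2) snoc.prems(3)] by blast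
  obtain Ps where Ps: "strict_chain {P. primeideal P R} Ps" "length Ps = Suc (length ys)" "last Ps = Q"
    using snoc.IH[OF c(1) r(1) Q(1,2)] by blast
  have "A \<subseteq> Q" if "A \<in> set Ps" for A
  proof -
    obtain Ps' where Ps': "Ps = Ps' @ [Q]" using Ps(2,3) by (metis append_butlast_last_id length_0_conv nat.distinct(1))
    then show ?thesis using that Ps(1) by (auto simp: strict_chain_def sorted_wrt_append)
  qed
  then have "strict_chain {P. primeideal P R} (Ps @ [P])"
    using Ps(1) Q(3) snoc.prems(3) unfolding strict_chain_def sorted_wrt_append by auto
  then show ?case using Ps(2) by (intro exI[of _ "Ps @ [P]"]) simp
qed

text \<open>A prime \<open>P\<close> different from \<open>\<mm>\<close> over the sequence would end
  a chain with as many inclusions as the dimension, and \<open>\<mm>\<close> would prolong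
  it.\<close>

lemma regular_seq_max_primary:
  assumes dim: "krull_dim R = enat (length ys)"
    and B: "ideal B R" and ys: "set ys \<subseteq> carrier R" "regular_seq B ys"
  shows "max_primary (adjoins B ys)"
proof -
  have "P = \<mm>" if P: "primeideal P R" "adjoins B ys \<subseteq> P" for P
  proof (rule ccontr)
    assume "P \<noteq> \<mm>"
    then have lt: "P \<subset> \<mm>" using primeideal_le_max[OF P(1)] by blast
    obtain Ps where Ps: "strict_chain {P. primeideal P R} Ps" "length Ps = Suc (length ys)" "last Ps = P"
      using prime_chain_regular_seq[OF B ys P] by blast
    obtain Ps' where Ps': "Ps = Ps' @ [P]" using Ps(2,3) by (metis append_butlast_last_id length_0_conv nat.distinct(1))
    have "strict_chain {P. primeideal P R} (Ps @ [\<mm>])"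
      using Ps(1) lt max_prime unfolding strict_chain_def sorted_wrt_append Ps' by auto
    from chain_length_geI[OF this] show False using dim Ps(2) by (simp add: krull_dim_eq)
  qed
  then show ?thesis using adjoins_ideal[OF B ys(1)] by (auto simp: max_primary_def)
qed

lemma regular_sequence_regular_seq:
  assumes "regular_sequence R xs"
  shows "regular_seq {\<zero>} xs"
  unfolding regular_seq_iff
proof (intro allI impI)
  fix i assume i: "i < length xs"
  have c: "set xs \<subseteq> carrier R" using assms by (simp add: regular_sequence_def)
  then have t: "set (take i xs) \<subseteq> carrier R" "xs ! i \<in> carrier R" using i set_take_subset[of i xs] by auto
  show "regular_elt (adjoins {\<zero>} (take i xs)) (xs ! i)"
    using assms i t(2) m_comm unfolding adjoins_zero[OF t(1)] regular_elt_def regular_sequence_def by metis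
qed

lemma exists_regular_seq_of_depth:
  assumes "depth R \<mm> = enat d"
  shows "\<exists>ys. length ys = d \<and> set ys \<subseteq> \<mm> \<and> regular_seq {\<zero>} ys"
proof -
  let ?Y = "{xs. regular_sequence R xs \<and> set xs \<subseteq> \<mm>}"
  have "Idl {} = {\<zero>}" using adjoins_zero[of "[]"] by simp
  moreover have "{\<zero>} \<noteq> carrier R"
    using one_notin_max idealD(2)[OF max_ideal] one_closed by (metis singletonD)
  ultimately have "regular_sequence R []"
    using one_notin_max idealD(2)[OF max_ideal] one_closed by (auto simp: regular_sequence_def)
  then have ne: "?Y \<noteq> {}" by (auto intro!: exI[of _ "[]"])
  have "enat d \<le> (SUP xs\<in>?Y. enat (length xs))" using assms by (simp add: depth_def)
  then obtain xs where xs: "xs \<in> ?Y" "d \<le> length xs" using enat_le_SUP_iff[OF ne, of d length] by blast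
  have "regular_seq {\<zero>} (take d xs @ drop d xs)" using regular_sequence_regular_seq[of xs] xs(1) by simp
  then have "regular_seq {\<zero>} (take d xs)" unfolding regular_seq_append by blast
  moreover have "set (take d xs) \<subseteq> \<mm>" using xs(1) set_take_subset[of d xs] by auto
  ultimately show ?thesis using xs(2) by (intro exI[of _ "take d xs"]) simp
qed

end

section \<open>Reductions with few generators\<close>

context cring begin

section \<open>Evaluation of polynomials in one variable, given by coefficient lists\<close>

primrec horner :: "'a list \<Rightarrow> 'a \<Rightarrow> 'a" where
  "horner [] t = \<zero>"
| "horner (b # bs) t = b \<oplus> t \<otimes> horner bs t"

text \<open>The coefficients of the quotient on division by the linear polynomial with root
  \<open>u\<close>; the remainder is \<open>horner bs u\<close>.\<close>

primrec synthetic_div :: "'a \<Rightarrow> 'a list \<Rightarrow> 'a list" where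
  "synthetic_div u [] = []"
| "synthetic_div u (b # bs) = (if bs = [] then [] else horner bs u # synthetic_div u bs)"

lemma horner_closed [simp]: "set bs \<subseteq> carrier R \<Longrightarrow> t \<in> carrier R \<Longrightarrow> horner bs t \<in> carrier R"
  by (induction bs) auto

lemma synthetic_div_closed: "set bs \<subseteq> carrier R \<Longrightarrow> u \<in> carrier R \<Longrightarrow> set (synthetic_div u bs) \<subseteq> carrier R"
  by (induction bs) auto

lemma length_synthetic_div: "length (synthetic_div u bs) = length bs - 1"
  by (induction bs) auto

lemma horner_synthetic_div:
  assumes "set bs \<subseteq> carrier R" "t \<in> carrier R" "u \<in> carrier R"
  shows "horner bs t = horner bs u \<oplus> (t \<ominus> u) \<otimes> horner (synthetic_div u bs) t"
  using assms(1)
proof (induction bs)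
  case Nil
  then show ?case using assms by simp
next
  case (Cons b bs)
  show ?case
  proof (cases "bs = []")
    case True
    then show ?thesis using Cons.prems assms by simp
  next
    case False
    have c: "b \<in> carrier R" "horner bs u \<in> carrier R" "horner (synthetic_div u bs) t \<in> carrier R"
      using Cons.prems assms synthetic_div_closed by auto
    have "horner bs t = horner bs u \<oplus> (t \<ominus> u) \<otimes> horner (synthetic_div u bs) t"
      using Cons by simp
    then have "horner (b # bs) t = b \<oplus> t \<otimes> (horner bs u \<oplus> (t \<ominus> u) \<otimes> horner (synthetic_div u bs) t)"
      by simp
    also have "\<dots> = (b \<oplus> u \<otimes> horner bs u) \<oplus> (t \<ominus> u) \<otimes> (horner bs u \<oplus> t \<otimes> horner (synthetic_div u bs) t)"
      using c assms(2,3) by algebra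
    finally show ?thesis using False by simp
  qed
qed

lemma horner_append:
  assumes "set bs \<subseteq> carrier R" "b \<in> carrier R" "t \<in> carrier R"
  shows "horner (bs @ [b]) t = horner bs t \<oplus> t [^] length bs \<otimes> b"
  using assms(1)
proof (induction bs)
  case Nil
  then show ?case using assms by simp
next
  case (Cons d bs)
  have c: "d \<in> carrier R" "horner bs t \<in> carrier R" "t [^] length bs \<in> carrier R"
    using Cons.prems assms by auto
  have "horner ((d # bs) @ [b]) t = d \<oplus> t \<otimes> (horner bs t \<oplus> t [^] length bs \<otimes> b)"
    using Cons by simp
  also have "\<dots> = (d \<oplus> t \<otimes> horner bs t) \<oplus> (t [^] length bs \<otimes> t) \<otimes> b"
    using c assms(2,3) by algebra
  finally show ?case by simp
qed

lemma horner_map: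
  assumes "\<And>j. b j \<in> carrier R" "t \<in> carrier R"
  shows "horner (map b [0..<n]) t = (\<Oplus>j\<in>{..<n}. t [^] j \<otimes> b j)"
proof (induction n)
  case (Suc n)
  have "horner (map b [0..<Suc n]) t = horner (map b [0..<n]) t \<oplus> t [^] n \<otimes> b n"
    using horner_append[of "map b [0..<n]" "b n" t] assms by auto
  also have "\<dots> = (\<Oplus>j\<in>insert n {..<n}. t [^] j \<otimes> b j)"
    using Suc assms by (subst finsum_insert) (auto simp: a_comm)
  finally show ?case by (simp add: lessThan_Suc)
qed simp

section \<open>Monomials in several elements and congruences in the Rees algebra\<close>

fun monomial :: "'a list \<Rightarrow> nat list \<Rightarrow> 'a" where
  "monomial (a # as) (e # es) = a [^] e \<otimes> monomial as es"
| "monomial _ _ = \<one>"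

lemma monomial_closed [simp]: "set as \<subseteq> carrier R \<Longrightarrow> monomial as es \<in> carrier R"
  by (induction as es rule: monomial.induct) auto

lemma monomial_mem_pow:
  assumes "ideal J R" "set as \<subseteq> J" "length es = length as"
  shows "monomial as es \<in> ideal_pow R J (sum_list es)"
  using assms(2,3)
proof (induction as es rule: monomial.induct)
  case (1 a as e es)
  then show ?case
    using pow_mem_ideal_pow[OF assms(1), of a e] by (auto simp: ideal_pow_add[OF assms(1)] intro: ideal_prod.prod)
qed (auto simp: ideal_pow_0)

lemma add_minus_cancel: "x \<in> carrier R \<Longrightarrow> y \<in> carrier R \<Longrightarrow> x \<oplus> y \<ominus> y = x"
  by algebra

lemma minus_minus_cancel: "x \<in> carrier R \<Longrightarrow> y \<in> carrier R \<Longrightarrow> x \<ominus> (x \<ominus> y) = y"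
  by algebra

lemma finsum_mem_ideal:
  assumes "ideal K R" "\<And>i. i \<in> S \<Longrightarrow> f i \<in> K"
  shows "(\<Oplus>i\<in>S. f i) \<in> K"
proof (cases "finite S")
  case True
  then show ?thesis using assms(2)
  proof (induction S)
    case (insert i S)
    then have "f \<in> S \<rightarrow> carrier R" "f i \<in> carrier R" using idealD(1)[OF assms(1)] by auto
    then show ?case using insert idealD(3)[OF assms(1)] by simp
  qed (use idealD(2)[OF assms(1)] in simp)
qed (use idealD(2)[OF assms(1)] in simp)

text \<open>Coefficients are attached to the indices \<open>e\<close>, not to the values
  \<open>f e\<close>: different exponent vectors may give the same ring element. Distinctness of
  \<open>L\<close> makes the update at \<open>e\<close> harmless for the rest of the sum.\<close>

lemma mem_adjoins_finsum:
  assumes "ideal N R" "distinct L" "\<And>e. f e \<in> carrier R" "x \<in> adjoins N (map f L)"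
  shows "\<exists>c. (\<forall>e. c e \<in> carrier R) \<and> x \<ominus> (\<Oplus>e\<in>set L. c e \<otimes> f e) \<in> N"
  using assms(1,2,4)
proof (induction L arbitrary: N)
  case Nil
  then show ?case using idealD(1)[OF Nil(1)] by (intro exI[of _ "\<lambda>_. \<zero>"]) (simp add: a_minus_def)
next
  case (Cons e L)
  have N': "ideal (adjoin N (f e)) R" using adjoin_ideal[OF Cons.prems(1)] assms(3) by blast
  have minus_eq: "x \<ominus> (r \<otimes> g \<oplus> s) = n"
    if "x \<in> carrier R" "s \<in> carrier R" "n \<in> carrier R" "r \<in> carrier R" "g \<in> carrier R"
      "x \<ominus> s = n \<oplus> r \<otimes> g" for x s n r g
  proof -
    have "x \<ominus> (r \<otimes> g \<oplus> s) = (x \<ominus> s) \<ominus> r \<otimes> g" using that(1-5) by algebra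
    also have "\<dots> = n" unfolding that(6) using that(1-5) by algebra
    finally show ?thesis .
  qed
  obtain c where c: "\<And>e. c e \<in> carrier R" "x \<ominus> (\<Oplus>e\<in>set L. c e \<otimes> f e) \<in> adjoin N (f e)"
    using Cons.IH[OF N'] Cons.prems by auto
  then obtain n r where nr: "n \<in> N" "r \<in> carrier R" "x \<ominus> (\<Oplus>e\<in>set L. c e \<otimes> f e) = n \<oplus> r \<otimes> f e"
    by (auto simp: adjoin_iff)
  define c' where "c' = c(e := r)"
  have sum: "(\<Oplus>i\<in>set L. c' i \<otimes> f i) = (\<Oplus>i\<in>set L. c i \<otimes> f i)"
    using Cons.prems(2) c(1) assms(3) by (intro finsum_cong') (auto simp: c'_def)
  have x: "x \<in> carrier R"
    using idealD(1)[OF adjoins_ideal[OF Cons.prems(1)] Cons.prems(3)] assms(3) by auto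
  have Sc: "(\<Oplus>i\<in>set L. c i \<otimes> f i) \<in> carrier R" using c(1) assms(3) by (intro finsum_closed) auto
  have nc: "n \<in> carrier R" using idealD(1)[OF Cons.prems(1) nr(1)] .
  have "(\<Oplus>i\<in>set (e # L). c' i \<otimes> f i) = r \<otimes> f e \<oplus> (\<Oplus>i\<in>set L. c i \<otimes> f i)"
    using Cons.prems(2) c(1) nr(2) assms(3) sum by (simp add: finsum_insert Pi_def) (simp add: c'_def)
  then have "x \<ominus> (\<Oplus>i\<in>set (e # L). c' i \<otimes> f i) = n"
    using minus_eq[OF x Sc nc nr(2) assms(3) nr(3)] by simp
  then have "x \<ominus> (\<Oplus>i\<in>set (e # L). c' i \<otimes> f i) \<in> N" using nr(1) by simp
  moreover have "\<forall>e. c' e \<in> carrier R" using c(1) nr(2) by (auto simp: c'_def)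
  ultimately show ?case by blast
qed

lemma len_ge_length:
  assumes "ideal N R" "ideal M R" "adjoins N ms \<subseteq> M" "set ms \<subseteq> carrier R"
    and "\<And>i. i < length ms \<Longrightarrow> ms ! i \<notin> adjoins N (take i ms)"
  shows "enat (length ms) \<le> len N M"
  using assms
proof (induction ms arbitrary: N)
  case Nil
  then show ?case by (simp add: zero_enat_def[symmetric])
next
  case (Cons m ms)
  have m: "m \<in> carrier R" "m \<notin> N" "set ms \<subseteq> carrier R" using Cons.prems(4) Cons.prems(5)[of 0] by auto
  note N' = adjoin_ideal[OF Cons.prems(1) m(1)]
  have "enat (length ms) \<le> len (adjoin N m) M"
    using Cons.prems Cons.IH[OF N' Cons.prems(2) _ m(3)] Cons.prems(5)[of "Suc i" for i] by simp
  moreover have "1 \<le> len N (adjoin N m)"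
    using len_pos[OF Cons.prems(1) N'] adjoin_base[OF Cons.prems(1) m(1)] adjoin_self[OF Cons.prems(1) m(1)] m(2)
    by blast
  moreover have "adjoin N m \<subseteq> M" using Cons.prems(3) adjoins_base[OF N' m(3)] by auto
  then have "len N M = len N (adjoin N m) + len (adjoin N m) M"
    using len_add[OF Cons.prems(1) N' Cons.prems(2) adjoin_base[OF Cons.prems(1) m(1)]] by blast
  ultimately have "1 + enat (length ms) \<le> len N M" by (simp add: add_mono)
  then show ?case by (simp add: one_enat_def)
qed

text \<open>The degree \<open>k\<close> part of the ideal generated by \<open>K\<close> in the Rees algebra of \<open>J\<close>.\<close>

definition rees_part :: "'a set \<Rightarrow> 'a set \<Rightarrow> nat \<Rightarrow> 'a set" where
  "rees_part K J k = (case k of 0 \<Rightarrow> {\<zero>} | Suc j \<Rightarrow> K \<cdot> ideal_pow R J j)"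

lemma rees_part_ideal: "ideal K R \<Longrightarrow> ideal J R \<Longrightarrow> ideal (rees_part K J k) R"
  by (cases k) (simp_all add: rees_part_def zeroideal ideal_prod_is_ideal ideal_pow_ideal)

lemma rees_part_mult:
  assumes K: "ideal K R" and J: "ideal J R" and x: "x \<in> ideal_pow R J i" and y: "y \<in> rees_part K J j"
  shows "x \<otimes> y \<in> rees_part K J (i + j)"
proof (cases j)
  case 0
  then have "x \<otimes> y = \<zero>" using y idealD(1)[OF ideal_pow_ideal[OF J] x] by (simp add: rees_part_def)
  then show ?thesis using idealD(2)[OF rees_part_ideal[OF K J]] by simp
next
  case (Suc j')
  note Ji = ideal_pow_ideal[OF J]
  have "x \<otimes> y \<in> ideal_pow R J i \<cdot> (K \<cdot> ideal_pow R J j')"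
    using x y Suc by (auto simp: rees_part_def intro: ideal_prod.prod)
  also have "\<dots> = K \<cdot> (ideal_pow R J i \<cdot> ideal_pow R J j')"
    using ideal_prod_assoc[OF Ji K Ji] ideal_prod_assoc[OF K Ji Ji] ideal_prod_commute[OF K Ji] by metis
  finally show ?thesis using Suc by (simp add: rees_part_def ideal_pow_add[OF J])
qed

lemma rees_part_pow_diff:
  assumes K: "ideal K R" and J: "ideal J R" and xy: "x \<in> J" "y \<in> J" "x \<ominus> y \<in> K"
  shows "x [^] e \<ominus> y [^] e \<in> rees_part K J e"
proof (induction e)
  case 0
  then show ?case by (simp add: rees_part_def a_minus_def r_neg)
next
  case (Suc e)
  have c: "x \<in> carrier R" "y \<in> carrier R" "x [^] e \<in> carrier R" "y [^] e \<in> carrier R"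
    using xy idealD(1)[OF J] by auto
  have "x \<otimes> (x [^] e \<ominus> y [^] e) \<in> rees_part K J (1 + e)"
    by (rule rees_part_mult[OF K J _ Suc]) (use xy ideal_pow_1[OF J] in simp)
  moreover have "(x \<ominus> y) \<otimes> y [^] e \<in> rees_part K J (Suc e)"
    using ideal_prod.prod[OF xy(3) pow_mem_ideal_pow[OF J xy(2)]] by (simp add: rees_part_def)
  moreover have "x [^] Suc e \<ominus> y [^] Suc e = x \<otimes> (x [^] e \<ominus> y [^] e) \<oplus> (x \<ominus> y) \<otimes> y [^] e"
    unfolding nat_pow_Suc using c by algebra
  ultimately show ?case using idealD(3)[OF rees_part_ideal[OF K J]] by simp
qed

text \<open>In the Rees algebra modulo the ideal generated by \<open>K\<close> in degree one, each
  \<open>x\<close> becomes \<open>t a\<close>. A monomial in \<open>as\<close> therefore becomes its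
  value at \<open>ts\<close> times a power of \<open>a\<close>.\<close>

lemma rees_part_monomial_diff:
  assumes K: "ideal K R" and J: "ideal J R" and a: "a \<in> J"
    and "list_all2 (\<lambda>x t. x \<in> J \<and> t \<in> carrier R \<and> x \<ominus> t \<otimes> a \<in> K) as ts" "length es = length as"
  shows "monomial as es \<ominus> monomial ts es \<otimes> a [^] sum_list es \<in> rees_part K J (sum_list es)"
  using assms(4,5)
proof (induction as ts arbitrary: es rule: list_all2_induct)
  case Nil
  then show ?case by (simp add: rees_part_def a_minus_def r_neg)
next
  case (Cons x as t ts)
  then obtain e es' where es: "es = e # es'" "length es' = length as" by (cases es) auto
  let ?f = "sum_list es'"
  have ac: "a \<in> carrier R" using a idealD(1)[OF J] by simp
  have x: "x \<in> J" "t \<in> carrier R" "x \<ominus> t \<otimes> a \<in> K" "x \<in> carrier R" using Cons(1) idealD(1)[OF J] by auto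
  have lists: "set as \<subseteq> carrier R" "set ts \<subseteq> carrier R"
    using Cons(2) idealD(1)[OF J] by (auto simp: list_all2_conv_all_nth in_set_conv_nth)
  have c: "x [^] e \<in> carrier R" "monomial as es' \<in> carrier R" "monomial ts es' \<in> carrier R"
    "(t \<otimes> a) [^] e \<in> carrier R" "a [^] ?f \<in> carrier R" "t [^] e \<in> carrier R" "a [^] e \<in> carrier R"
    using x lists ac by auto
  have p: "(t \<otimes> a) [^] e = t [^] e \<otimes> a [^] e" using x(2) ac by (rule nat_pow_distrib)
  have pf: "a [^] (e + ?f) = a [^] e \<otimes> a [^] ?f" using ac by (simp add: nat_pow_mult)
  have "monomial (x # as) es \<ominus> monomial (t # ts) es \<otimes> a [^] sum_list es
      = x [^] e \<otimes> monomial as es' \<ominus> (t [^] e \<otimes> monomial ts es') \<otimes> (a [^] e \<otimes> a [^] ?f)"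
    by (simp add: es pf)
  also have "\<dots> = x [^] e \<otimes> (monomial as es' \<ominus> monomial ts es' \<otimes> a [^] ?f)
      \<oplus> monomial ts es' \<otimes> (a [^] ?f \<otimes> (x [^] e \<ominus> (t \<otimes> a) [^] e))"
    unfolding p using c by algebra
  also have "\<dots> \<in> rees_part K J (e + ?f)"
  proof (rule idealD(3)[OF rees_part_ideal[OF K J]])
    show "x [^] e \<otimes> (monomial as es' \<ominus> monomial ts es' \<otimes> a [^] ?f) \<in> rees_part K J (e + ?f)"
      by (rule rees_part_mult[OF K J pow_mem_ideal_pow[OF J x(1)] Cons.IH[OF es(2)]])
    have "x [^] e \<ominus> (t \<otimes> a) [^] e \<in> rees_part K J e"
      by (rule rees_part_pow_diff[OF K J x(1) idealD(4)[OF J x(2) a] x(3)])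
    then have "a [^] ?f \<otimes> (x [^] e \<ominus> (t \<otimes> a) [^] e) \<in> rees_part K J (?f + e)"
      by (rule rees_part_mult[OF K J pow_mem_ideal_pow[OF J a]])
    then show "monomial ts es' \<otimes> (a [^] ?f \<otimes> (x [^] e \<ominus> (t \<otimes> a) [^] e)) \<in> rees_part K J (e + ?f)"
      using idealD(4)[OF rees_part_ideal[OF K J] c(3)] by (simp add: add.commute)
  qed
  finally show ?case by (simp add: es)
qed

text \<open>Since \<open>J\<close> lies in \<open>K + (a)\<close>, the Rees algebra modulo
  \<open>K\<close> in degree one is generated by \<open>a\<close>; this is its component of degree
  \<open>k\<close>.\<close>

lemma pow_subset_adjoin_rees_part:
  assumes K: "ideal K R" and J: "ideal J R" and a: "a \<in> J" and sub: "J \<subseteq> adjoin K a"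
  shows "ideal_pow R J k \<subseteq> adjoin (rees_part K J k) (a [^] k)"
proof (induction k)
  case 0
  have "x \<in> adjoin {\<zero>} \<one>" if "x \<in> carrier R" for x using that by (force simp: adjoin_iff)
  then show ?case by (auto simp: ideal_pow_0 rees_part_def)
next
  case (Suc k)
  have ac: "a \<in> carrier R" using a idealD(1)[OF J] by simp
  note Dk = rees_part_ideal[OF K J]
  have N: "ideal (adjoin (rees_part K J (Suc k)) (a [^] Suc k)) R"
    by (rule adjoin_ideal[OF Dk]) (use ac in simp)
  show ?case unfolding ideal_pow_Suc2[OF J]
  proof (rule ideal_prod_least[OF N])
    fix j y assume j: "j \<in> J" and y: "y \<in> ideal_pow R J k"
    obtain u r where ur: "u \<in> K" "r \<in> carrier R" "j = u \<oplus> r \<otimes> a" using sub j by (meson adjoin_iff subsetD)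
    obtain w s where ws: "w \<in> rees_part K J k" "s \<in> carrier R" "y = w \<oplus> s \<otimes> a [^] k"
      using Suc y by (meson adjoin_iff subsetD)
    have c: "u \<in> carrier R" "w \<in> carrier R" "y \<in> carrier R" "a [^] k \<in> carrier R"
      using ur(1) ws(1) y idealD(1)[OF K] idealD(1)[OF Dk] idealD(1)[OF ideal_pow_ideal[OF J]] ac by auto
    have "j \<otimes> y = u \<otimes> y \<oplus> (r \<otimes> a) \<otimes> (w \<oplus> s \<otimes> a [^] k)"
      unfolding ur(3) using c ur(2) ac ws(2,3) by algebra
    also have "\<dots> = (u \<otimes> y \<oplus> r \<otimes> (a \<otimes> w)) \<oplus> (r \<otimes> s) \<otimes> a [^] Suc k"
      unfolding nat_pow_Suc using c ur(2) ac ws(2) by algebra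
    finally have e: "j \<otimes> y = (u \<otimes> y \<oplus> r \<otimes> (a \<otimes> w)) \<oplus> (r \<otimes> s) \<otimes> a [^] Suc k" .
    have "u \<otimes> y \<in> rees_part K J (Suc k)"
      using ideal_prod.prod[OF ur(1) y] by (simp add: rees_part_def)
    moreover have "a \<otimes> w \<in> rees_part K J (1 + k)"
      by (rule rees_part_mult[OF K J _ ws(1)]) (use a ideal_pow_1[OF J] in simp)
    then have "r \<otimes> (a \<otimes> w) \<in> rees_part K J (Suc k)" using idealD(4)[OF Dk ur(2)] by simp
    ultimately have "u \<otimes> y \<oplus> r \<otimes> (a \<otimes> w) \<in> rees_part K J (Suc k)" by (rule idealD(3)[OF Dk])
    then show "j \<otimes> y \<in> adjoin (rees_part K J (Suc k)) (a [^] Suc k)"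
      using e ur(2) ws(2) unfolding adjoin_iff by blast
  qed
qed

end

context noetherian_local_ring begin

text \<open>Over the field \<open>R/\<mm>\<close> a nonzero polynomial has finitely many roots.
  \<open>F\<close> represents them in \<open>R\<close>, and the induction divides off one root at a
  time.\<close>

lemma horner_roots:
  assumes "set bs \<subseteq> carrier R" "\<not> set bs \<subseteq> \<mm>"
  shows "\<exists>F. finite F \<and> F \<subseteq> carrier R \<and> (\<forall>t\<in>carrier R. horner bs t \<in> \<mm> \<longrightarrow> (\<exists>f\<in>F. t \<ominus> f \<in> \<mm>))"
  using assms
proof (induction "length bs" arbitrary: bs rule: less_induct)
  case less
  \<comment> \<open>The quotient by a root stays nonzero modulo \<open>\<mm>\<close>: if all its
    coefficients and the remainder vanish there, so do all coefficients of the dividend.\<close>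
  have step: "set bs \<subseteq> \<mm>" if "u \<in> carrier R" "horner bs u \<in> \<mm>" "set (synthetic_div u bs) \<subseteq> \<mm>" "set bs \<subseteq> carrier R" for u bs
    using that
  proof (induction bs)
    case (Cons b bs)
    have c: "b \<in> carrier R" "horner bs u \<in> carrier R" using Cons.prems by auto
    have h: "horner bs u \<in> \<mm>" using Cons.prems idealD(2)[OF max_ideal] by (cases "bs = []") auto
    then have "b \<in> \<mm>"
      using ideal_add_cancel(2)[OF max_ideal c(1), of "u \<otimes> horner bs u"] Cons.prems idealD(4)[OF max_ideal Cons.prems(1)] by auto
    moreover have "set bs \<subseteq> \<mm>" using Cons h by (cases "bs = []") auto
    ultimately show ?case by simp
  qed simp
  show ?case
  proof (cases "\<exists>u\<in>carrier R. horner bs u \<in> \<mm>")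
    case True
    then obtain u where u: "u \<in> carrier R" "horner bs u \<in> \<mm>" by blast
    let ?q = "synthetic_div u bs"
    have "\<not> set ?q \<subseteq> \<mm>" using step[OF u] less.prems by blast
    moreover have "length ?q < length bs"
      using less.prems by (cases bs) (auto simp: length_synthetic_div)
    ultimately obtain F where F: "finite F" "F \<subseteq> carrier R"
      "\<And>t. t \<in> carrier R \<Longrightarrow> horner ?q t \<in> \<mm> \<Longrightarrow> \<exists>f\<in>F. t \<ominus> f \<in> \<mm>"
      using less.hyps[OF _ synthetic_div_closed[OF less.prems(1) u(1)]] by blast
    have "\<exists>f\<in>insert u F. t \<ominus> f \<in> \<mm>" if t: "t \<in> carrier R" "horner bs t \<in> \<mm>" for t
    proof -
      have q: "horner ?q t \<in> carrier R" using synthetic_div_closed[OF less.prems(1) u(1)] t by simp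
      have "(t \<ominus> u) \<otimes> horner ?q t \<in> \<mm>"
        using t(2) horner_synthetic_div[OF less.prems(1) t(1) u(1)] u(2) t(1) u(1) q
          ideal_add_cancel(1)[OF max_ideal, of "(t \<ominus> u) \<otimes> horner ?q t" "horner bs u"] by simp
      then have "t \<ominus> u \<in> \<mm> \<or> horner ?q t \<in> \<mm>"
        using primeideal.I_prime[OF max_prime _ q] t(1) u(1) by simp
      then show ?thesis using F(3)[OF t(1)] by blast
    qed
    then show ?thesis using F(1,2) u(1) by (intro exI[of _ "insert u F"]) blast
  next
    case False
    then show ?thesis by (intro exI[of _ "{}"]) blast
  qed
qed

lemma exists_horner_nonzero:
  assumes inf: "infinite (carrier (R Quot \<mm>))" and bs: "set bs \<subseteq> carrier R" "\<not> set bs \<subseteq> \<mm>"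
  shows "\<exists>t\<in>carrier R. horner bs t \<notin> \<mm>"
proof -
  obtain F where F: "finite F" "F \<subseteq> carrier R"
    "\<And>t. t \<in> carrier R \<Longrightarrow> horner bs t \<in> \<mm> \<Longrightarrow> \<exists>f\<in>F. t \<ominus> f \<in> \<mm>"
    using horner_roots[OF bs] by blast
  obtain t where "t \<in> carrier R" "\<forall>f\<in>F. t \<ominus> f \<notin> \<mm>" using avoid_residues[OF inf F(1,2)] by blast
  then show ?thesis using F(3) by blast
qed

lemma exists_polynomial_nonzero:
  assumes inf: "infinite (carrier (R Quot \<mm>))"
    and "finite S" "\<And>es. es \<in> S \<Longrightarrow> length es = n" "\<And>es. c es \<in> carrier R" "es0 \<in> S" "c es0 \<notin> \<mm>"
  shows "\<exists>ts. length ts = n \<and> set ts \<subseteq> carrier R \<and> (\<Oplus>es\<in>S. c es \<otimes> monomial ts es) \<notin> \<mm>"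
  using assms(2-)
proof (induction n arbitrary: S c es0)
  case 0
  then have S: "S = {[]}" by auto
  have "c [] \<notin> \<mm>" using 0 S by auto
  then have "(\<Oplus>es\<in>S. c es \<otimes> monomial [] es) \<notin> \<mm>" using 0(3) by (simp add: S finsum_singleton)
  then show ?case by (intro exI[of _ "[]"]) simp
next
  case (Suc n)
  note cc = Suc.prems(3)
  \<comment> \<open>The polynomial is read as one in its first variable, \<open>T j\<close> being
    the exponents in the coefficient of degree \<open>j\<close>. The coefficient of degree
    \<open>j0\<close> is nonzero modulo \<open>\<mm>\<close>, so the induction hypothesis provides
    the other values \<open>ts\<close>.\<close>
  define T where "T j = {es. j # es \<in> S}" for j
  have finT: "finite (T j)" for j
  proof -
    have "T j \<subseteq> tl ` S" unfolding T_def by force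
    then show ?thesis using Suc.prems(1) finite_surj by blast
  qed
  obtain j0 es0' where e0: "es0 = j0 # es0'" using Suc.prems(2)[OF Suc.prems(4)] by (cases es0) auto
  obtain ts where ts: "length ts = n" "set ts \<subseteq> carrier R"
    "(\<Oplus>es\<in>T j0. c (j0 # es) \<otimes> monomial ts es) \<notin> \<mm>"
  proof -
    have "length es = n" if "es \<in> T j0" for es using that Suc.prems(2)[of "j0 # es"] by (simp add: T_def)
    moreover have "es0' \<in> T j0" "c (j0 # es0') \<notin> \<mm>" using Suc.prems(4,5) e0 by (simp_all add: T_def)
    ultimately show ?thesis using that Suc.IH[of "T j0" "\<lambda>es. c (j0 # es)" es0', OF finT] cc by blast
  qed
  define b where "b j = (\<Oplus>es\<in>T j. c (j # es) \<otimes> monomial ts es)" for j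
  have bc: "b j \<in> carrier R" for j unfolding b_def by (intro finsum_closed) (use cc ts in auto)
  obtain N where N: "\<And>es. es \<in> S \<Longrightarrow> hd es < N"
    using finite_nat_set_iff_bounded[of "hd ` S"] Suc.prems(1) by auto
  have j0N: "j0 < N" using N[OF Suc.prems(4)] e0 by simp
  have "\<not> set (map b [0..<N]) \<subseteq> \<mm>" 
  proof -
    have "b j0 \<in> set (map b [0..<N])" using j0N by simp
    moreover have "b j0 \<notin> \<mm>" using ts(3) by (simp add: b_def)
    ultimately show ?thesis by blast
  qed
  then obtain t where t: "t \<in> carrier R" "horner (map b [0..<N]) t \<notin> \<mm>"
    using exists_horner_nonzero[OF inf, of "map b [0..<N]"] bc by auto
  have S: "S = (\<Union>j\<in>{..<N}. (#) j ` T j)"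
  proof
    show "S \<subseteq> (\<Union>j\<in>{..<N}. (#) j ` T j)"
    proof
      fix es assume es: "es \<in> S"
      then obtain j es' where "es = j # es'" using Suc.prems(2)[OF es] by (cases es) auto
      then show "es \<in> (\<Union>j\<in>{..<N}. (#) j ` T j)" using N[OF es] es by (auto simp: T_def)
    qed
  qed (auto simp: T_def)
  have "(\<Oplus>es\<in>S. c es \<otimes> monomial (t # ts) es)
      = (\<Oplus>j\<in>{..<N}. \<Oplus>es\<in>(#) j ` T j. c es \<otimes> monomial (t # ts) es)"
    unfolding S
    by (rule add.finprod_UN_disjoint)
       (use finT cc ts t(1) in \<open>auto simp: pairwise_def disjnt_def\<close>)
  also have "\<dots> = (\<Oplus>j\<in>{..<N}. t [^] j \<otimes> b j)"
  proof (rule finsum_cong')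
    fix j
    have "(\<Oplus>es\<in>(#) j ` T j. c es \<otimes> monomial (t # ts) es)
        = (\<Oplus>es\<in>T j. c (j # es) \<otimes> (t [^] j \<otimes> monomial ts es))"
      by (subst finsum_reindex) (use cc ts t(1) in auto)
    also have "\<dots> = (\<Oplus>es\<in>T j. t [^] j \<otimes> (c (j # es) \<otimes> monomial ts es))"
      by (rule finsum_cong') (use cc ts t(1) in \<open>auto simp: m_lcomm\<close>)
    also have "\<dots> = t [^] j \<otimes> b j"
      unfolding b_def by (rule finsum_rdistr[symmetric]) (use finT cc ts t(1) in auto)
    finally show "(\<Oplus>es\<in>(#) j ` T j. c es \<otimes> monomial (t # ts) es) = t [^] j \<otimes> b j" .
  qed (use t(1) bc in auto)
  also have "\<dots> = horner (map b [0..<N]) t" by (rule horner_map[symmetric]) (use bc t in auto)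
  finally show ?case using t ts by (intro exI[of _ "t # ts"]) simp
qed

text \<open>Noether normalization of the fiber cone: a relation between the monomials of degree \<open>k\<close> becomes,
  after a linear change of the generators, an equation of integral dependence for one of them.\<close>

lemma reduction_of_relation:
  assumes inf: "infinite (carrier (R Quot \<mm>))" and gens: "set (a # as) \<subseteq> carrier R"
    and J: "J = Idl (set (a # as))"
    and S: "finite S" "\<And>es. es \<in> S \<Longrightarrow> length es = Suc (length as) \<and> sum_list es = k"
    and c: "\<And>es. c es \<in> carrier R" "es0 \<in> S" "c es0 \<notin> \<mm>"
    and rel: "(\<Oplus>es\<in>S. c es \<otimes> monomial (a # as) es) \<in> \<mm> \<cdot> ideal_pow R J k"
  shows "\<exists>bs. length bs = length as \<and> set bs \<subseteq> carrier R \<and> is_reduction R J (Idl (set bs))"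
proof -
  have Ji: "ideal J R" unfolding J by (rule genideal_ideal[OF gens])
  have aJ: "a \<in> J" "set as \<subseteq> J" using genideal_self[OF gens] by (auto simp: J)
  have ac: "a \<in> carrier R" "set as \<subseteq> carrier R" using gens by auto
  \<comment> \<open>Dehomogenization: the variable of \<open>a\<close> is set to one. All exponents
    have sum \<open>k\<close>, so the first is determined by the others and no terms are
    merged.\<close>
  define c' where "c' es = c ((k - sum_list es) # es)" for es
  have hd: "(k - sum_list (tl es)) # tl es = es" if "es \<in> S" for es
    using S(2)[OF that] by (cases es) auto
  have inj: "inj_on tl S" using hd by (intro inj_onI) metis
  have "tl es0 \<in> tl ` S" using c(2) by blast
  moreover have "c' (tl es0) \<notin> \<mm>" using c(3) hd[OF c(2)] by (simp add: c'_def)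
  moreover have "length es = length as" if "es \<in> tl ` S" for es using that S(2) by auto
  ultimately obtain ts where ts: "length ts = length as" "set ts \<subseteq> carrier R"
    "(\<Oplus>es\<in>tl ` S. c' es \<otimes> monomial ts es) \<notin> \<mm>"
    using exists_polynomial_nonzero[OF inf, of "tl ` S" "length as" c' "tl es0"] S(1) c(1) by (auto simp: c'_def)
  \<comment> \<open>The value of the form at \<open>(1, ts)\<close>. It becomes the coefficient of
    \<open>a\<^sup>k\<close> after the change of generators.\<close>
  define g where "g = (\<Oplus>es\<in>S. c es \<otimes> monomial ts (tl es))"
  have gc: "g \<in> carrier R" unfolding g_def by (intro finsum_closed) (use c(1) ts in auto)
  have "(\<Oplus>es\<in>tl ` S. c' es \<otimes> monomial ts es) = (\<Oplus>es\<in>S. c' (tl es) \<otimes> monomial ts (tl es))"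
    by (rule finsum_reindex) (use c(1) ts inj in \<open>auto simp: c'_def\<close>)
  also have "\<dots> = g" unfolding g_def
    by (rule finsum_cong') (use c(1) ts hd in \<open>auto simp: c'_def\<close>)
  finally have gm: "g \<notin> \<mm>" using ts(3) by simp
  \<comment> \<open>Modulo the ideal \<open>K\<close> of these new generators each old one becomes a
    multiple \<open>t a\<close>, so \<open>J = K + (a)\<close>, and the form turns into
    \<open>g a\<^sup>k\<close> up to an element of
    \<open>K J\<^sup>k\<^sup>-\<^sup>1\<close>.\<close>
  define bs where "bs = map2 (\<lambda>x t. x \<ominus> t \<otimes> a) as ts"
  define K where "K = Idl (set bs)"
  have "x \<in> carrier R \<and> t \<in> carrier R" if "(x, t) \<in> set (zip as ts)" for x t
    using set_zip_leftD[OF that] set_zip_rightD[OF that] ac ts(2) by blast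
  then have bs: "length bs = length as" "set bs \<subseteq> carrier R"
    using ts ac by (auto simp: bs_def)
  have Ki: "ideal K R" unfolding K_def by (rule genideal_ideal[OF bs(2)])
  have bK: "set bs \<subseteq> K" unfolding K_def by (rule genideal_self[OF bs(2)])
  have rel2: "list_all2 (\<lambda>x t. x \<in> J \<and> t \<in> carrier R \<and> x \<ominus> t \<otimes> a \<in> K) as ts"
  proof -
    have "as ! i \<ominus> ts ! i \<otimes> a \<in> K" if "i < length as" for i
      using bK nth_mem[of i bs] that ts(1) by (auto simp: bs_def)
    then show ?thesis using ts aJ(2) by (auto simp: list_all2_conv_all_nth)
  qed
  have KJ: "K \<subseteq> J" unfolding K_def
  proof (rule genideal_minimal[OF Ji])
    show "set bs \<subseteq> J"
      using rel2 ts(1) aJ idealD(4,7)[OF Ji] by (auto simp: bs_def list_all2_conv_all_nth set_zip)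
  qed
  have JKa: "J \<subseteq> adjoin K a" unfolding J
  proof (rule genideal_minimal[OF adjoin_ideal[OF Ki ac(1)]])
    have "as ! i \<in> adjoin K a" if i: "i < length as" for i
    proof -
      have e: "as ! i = (as ! i \<ominus> ts ! i \<otimes> a) \<oplus> ts ! i \<otimes> a"
        "as ! i \<ominus> ts ! i \<otimes> a \<in> K" "ts ! i \<in> carrier R"
        using rel2 i ac idealD(1)[OF Ji] by (auto simp: list_all2_conv_all_nth a_minus_def a_assoc l_neg)
      then show ?thesis unfolding adjoin_iff by blast
    qed
    then show "set (a # as) \<subseteq> adjoin K a" using adjoin_self[OF Ki ac(1)] by (auto simp: in_set_conv_nth)
  qed
  note Dk = rees_part_ideal[OF Ki Ji, of k]
  have Jk: "ideal (ideal_pow R J k) R" by (rule ideal_pow_ideal[OF Ji])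
  have mJk: "ideal (\<mm> \<cdot> ideal_pow R J k) R" by (rule ideal_prod_is_ideal[OF max_ideal Jk])
  have term_diff: "monomial (a # as) es \<ominus> monomial ts (tl es) \<otimes> a [^] k \<in> rees_part K J k" if es: "es \<in> S" for es
  proof -
    obtain e es' where e: "es = e # es'" "length es' = length as" "e + sum_list es' = k"
      using S(2)[OF es] by (cases es) auto
    have c1: "monomial as es' \<in> carrier R" "monomial ts es' \<in> carrier R" "a [^] e \<in> carrier R" "a [^] sum_list es' \<in> carrier R"
      using ac ts by auto
    have "a [^] k = a [^] e \<otimes> a [^] sum_list es'" using ac e(3) by (simp add: nat_pow_mult)
    then have "monomial (a # as) es \<ominus> monomial ts (tl es) \<otimes> a [^] k
        = a [^] e \<otimes> (monomial as es' \<ominus> monomial ts es' \<otimes> a [^] sum_list es')"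
      unfolding e(1) monomial.simps list.sel using c1 by algebra
    also have "\<dots> \<in> rees_part K J (e + sum_list es')"
      by (rule rees_part_mult[OF Ki Ji pow_mem_ideal_pow[OF Ji aJ(1)] rees_part_monomial_diff[OF Ki Ji aJ(1) rel2 e(2)]])
    finally show ?thesis using e(3) by simp
  qed
  have ak: "a [^] k \<in> carrier R" using ac by simp
  have diff: "(\<Oplus>es\<in>S. c es \<otimes> monomial (a # as) es) \<ominus> g \<otimes> a [^] k \<in> rees_part K J k"
  proof -
    let ?d = "\<lambda>es. c es \<otimes> (monomial (a # as) es \<ominus> monomial ts (tl es) \<otimes> a [^] k)"
    have d: "(\<Oplus>es\<in>S. ?d es) \<in> rees_part K J k"
      by (rule finsum_mem_ideal[OF Dk]) (rule idealD(4)[OF Dk c(1) term_diff])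
    have "(\<Oplus>es\<in>S. ?d es) \<oplus> g \<otimes> a [^] k = (\<Oplus>es\<in>S. ?d es) \<oplus> (\<Oplus>es\<in>S. (c es \<otimes> monomial ts (tl es)) \<otimes> a [^] k)"
      unfolding g_def by (subst finsum_ldistr) (use S(1) c(1) ts ak in auto)
    also have "\<dots> = (\<Oplus>es\<in>S. ?d es \<oplus> (c es \<otimes> monomial ts (tl es)) \<otimes> a [^] k)"
      by (rule finsum_addf[symmetric]) (use c(1) ts ac ak in auto)
    also have "\<dots> = (\<Oplus>es\<in>S. c es \<otimes> monomial (a # as) es)"
    proof (rule finsum_cong')
      fix es
      have "c es \<in> carrier R" "monomial (a # as) es \<in> carrier R" "monomial ts (tl es) \<in> carrier R"
        using c(1) gens ts by auto
      then show "?d es \<oplus> (c es \<otimes> monomial ts (tl es)) \<otimes> a [^] k = c es \<otimes> monomial (a # as) es"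
        using ak by algebra
    qed (use c(1) gens in auto)
    finally have s: "(\<Oplus>es\<in>S. c es \<otimes> monomial (a # as) es) = (\<Oplus>es\<in>S. ?d es) \<oplus> g \<otimes> a [^] k" by simp
    have "(\<Oplus>es\<in>S. ?d es) \<in> carrier R" using idealD(1)[OF Dk d] .
    then have "(\<Oplus>es\<in>S. ?d es) \<oplus> g \<otimes> a [^] k \<ominus> g \<otimes> a [^] k = (\<Oplus>es\<in>S. ?d es)"
      using gc ak by (intro add_minus_cancel) auto
    then show ?thesis unfolding s using d by simp
  qed
  \<comment> \<open>As \<open>g\<close> is a unit, the relation puts \<open>a\<^sup>k\<close> into
    \<open>K J\<^sup>k\<^sup>-\<^sup>1 + \<mm> J\<^sup>k\<close>. With \<open>J = K + (a)\<close>
    this sum contains \<open>J\<^sup>k\<close>, and Nakayama removes the second summand.\<close>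
  have "ideal_pow R J k \<subseteq> rees_part K J k"
  proof (rule nakayama[OF Jk Dk])
    fix L assume L: "ideal L R" "rees_part K J k \<subseteq> L"
      and mL: "\<And>u n. u \<in> \<mm> \<Longrightarrow> n \<in> ideal_pow R J k \<Longrightarrow> u \<otimes> n \<in> L"
    let ?s = "\<Oplus>es\<in>S. c es \<otimes> monomial (a # as) es"
    have "\<mm> \<cdot> ideal_pow R J k \<subseteq> L" by (rule ideal_prod_least[OF L(1) mL])
    then have s: "?s \<in> L" using rel by blast
    have "?s \<ominus> (?s \<ominus> g \<otimes> a [^] k) \<in> L" using idealD(7)[OF L(1) s] diff L(2) by blast
    moreover have "?s \<ominus> (?s \<ominus> g \<otimes> a [^] k) = g \<otimes> a [^] k"
      using idealD(1)[OF L(1) s] gc ak by (intro minus_minus_cancel) auto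
    ultimately have "a [^] k \<in> L" using unit_mult_mem[OF L(1) gc gm ak] by simp
    then have "adjoin (rees_part K J k) (a [^] k) \<subseteq> L" by (rule adjoin_least[OF L])
    then show "ideal_pow R J k \<subseteq> L" using pow_subset_adjoin_rees_part[OF Ki Ji aJ(1) JKa, of k] by blast
  qed
  \<comment> \<open>In degree 0 the inclusion would say that the unit ideal is zero. A positive
    \<open>k\<close> leaves room for \<open>k - 1\<close> as exponent in the reduction
    equation.\<close>
  moreover have "k \<noteq> 0"
  proof
    assume "k = 0"
    then have "\<one> \<in> {\<zero>}" using calculation by (simp add: ideal_pow_0 rees_part_def subset_iff)
    then show False using one_notin_max idealD(2)[OF max_ideal] by simp
  qed
  then obtain j where j: "k = Suc j" by (cases k) auto
  ultimately have "ideal_pow R J (j + 1) \<subseteq> K \<cdot> ideal_pow R J j" by (simp add: rees_part_def)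
  moreover have "K \<cdot> ideal_pow R J j \<subseteq> ideal_pow R J (j + 1)"
    using ideal_prod_mono[OF KJ order_refl, of "ideal_pow R J j"] ideal_pow_Suc2[OF Ji, of j] by simp
  ultimately have "is_reduction R J K" using Ki KJ unfolding is_reduction_def by blast
  then show ?thesis using bs unfolding K_def by blast
qed

end

section \<open>Growth of colengths of powers\<close>

text \<open>The number of monomials of degree less than \<open>k\<close> in \<open>r\<close>
  variables. The value at 0 is set apart because there the truncated \<open>k - 1\<close> would give
  1.\<close>

definition power_count :: "nat \<Rightarrow> nat \<Rightarrow> nat" where
  "power_count r k = (if k = 0 then 0 else (k - 1 + r) choose r)"

lemma binomial_colength_eq_power_count:
  "binomial_colength (enat c) 0 r k = enat (c * power_count r k)"
proof (induction "enat c" "0 :: enat" r k rule: binomial_colength.induct)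
  case (3 r k)
  have "power_count (Suc r) (Suc k) = power_count (Suc r) k + power_count r (Suc k)"
    by (cases k) (simp_all add: power_count_def)
  with 3 show ?case by (simp add: distrib_left)
qed (simp_all add: power_count_def zero_enat_def)

text \<open>Each summand is the number of monomials of degree \<open>k\<close> in \<open>s\<close>
  variables.\<close>

lemma sum_binomial_power_count:
  "0 < s \<Longrightarrow> (\<Sum>k<n. (k + s - 1) choose k) = power_count s n"
proof (cases n)
  case (Suc N)
  assume s: "0 < s"
  have "(\<Sum>k<n. (k + s - 1) choose k) = (\<Sum>k\<le>N. ((s - 1) + k) choose k)"
    using s by (intro sum.cong) (auto simp: Suc lessThan_Suc_atMost ac_simps)
  also have "\<dots> = Suc (s - 1 + N) choose N" by (rule sum_choose_lower)
  also have "\<dots> = (N + s) choose s"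
    using s binomial_symmetric[of N "N + s"] by (simp add: add.commute)
  finally show ?thesis by (simp add: Suc power_count_def)
qed (simp add: power_count_def)

lemma power_count_growth:
  assumes "\<And>n. power_count s n \<le> C * power_count d n"
  shows "s \<le> d"
proof (rule ccontr)
  assume "\<not> s \<le> d"
  \<comment> \<open>At \<open>n = N + 1\<close> the quotient of \<open>power_count (Suc d)\<close>
    by \<open>power_count d\<close> is \<open>(N + d + 1) / (d + 1)\<close>, which this choice makes
    larger than \<open>C\<close>.\<close>
  define N where "N = C * Suc d"
  have "Suc d \<le> s" using \<open>\<not> s \<le> d\<close> by simp
  then have "(N + Suc d) choose (Suc d) \<le> (N + s) choose s"
    using binomial_right_mono[of "N + Suc d" "N + s" N] binomial_symmetric[of N "N + Suc d"] binomial_symmetric[of N "N + s"]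
    by simp
  also have "\<dots> \<le> C * ((N + d) choose d)" using assms[of "Suc N"] by (simp add: power_count_def)
  finally have le: "(N + Suc d) choose (Suc d) \<le> C * ((N + d) choose d)" .
  have "Suc (N + d) * ((N + d) choose d) = Suc d * ((N + Suc d) choose (Suc d))"
    using Suc_times_binomial[of d "N + d"] by simp
  also have "\<dots> \<le> Suc d * (C * ((N + d) choose d))" using le by (rule mult_left_mono) simp
  also have "\<dots> = N * ((N + d) choose d)" by (simp only: N_def ac_simps)
  finally have "Suc (N + d) \<le> N" by (rule mult_right_le_imp_le) simp
  then show False by simp
qed

text \<open>The exact ratio of the two binomials is \<open>1 + d / (M + 1 - d)\<close>; the lower
  bound on \<open>M\<close> makes the estimate uniform.\<close>

lemma binomial_step_le:
  assumes "N + d \<le> M"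
  shows "real (Suc M choose d) \<le> real (M choose d) * (1 + real d / real (Suc N))"
proof -
  have "(Suc M - d) * (Suc M choose d) = Suc M * (M choose d)"
    using binomial_absorb_comp[of "Suc M" d] by simp
  then have "real (Suc M - d) * real (Suc M choose d) = real (Suc M) * real (M choose d)"
    by (metis of_nat_mult)
  moreover have pos: "0 < real (Suc M - d)" using assms by simp
  ultimately have "real (Suc M choose d) = real (M choose d) * (real (Suc M) / real (Suc M - d))"
    by (simp add: field_simps)
  also have "real (Suc M) / real (Suc M - d) = 1 + real d / real (Suc M - d)"
    using assms pos by (simp add: field_simps of_nat_diff)
  also have "real (M choose d) * \<dots> \<le> real (M choose d) * (1 + real d / real (Suc N))"
    using assms by (intro mult_left_mono add_left_mono divide_left_mono) auto
  finally show ?thesis .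
qed

text \<open>Both sides are polynomials in \<open>k\<close>, for positive \<open>k\<close>, with
  leading coefficients \<open>e'/d!\<close> and \<open>e/d!\<close>, which a shift by
  \<open>m\<close> leaves unchanged. Concretely, the shift costs at most the factor
  \<open>q N ^ m\<close>, which tends to one.\<close>

lemma power_count_shift:
  assumes "\<And>k. e' * power_count d k \<le> e * power_count d (m + k)"
  shows "e' \<le> e"
proof -
  define q where "q N = 1 + real d / real (Suc N)" for N
  have shift: "real ((N + d + m) choose d) \<le> real ((N + d) choose d) * q N ^ m" for N
  proof (induction m)
    case (Suc m)
    have "real ((N + d + Suc m) choose d) \<le> real ((N + d + m) choose d) * q N"
      using binomial_step_le[of N d "N + d + m"] by (simp add: q_def)
    also have "\<dots> \<le> (real ((N + d) choose d) * q N ^ m) * q N"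
      by (rule mult_right_mono[OF Suc]) (simp add: q_def)
    finally show ?case by (simp add: ac_simps)
  qed simp
  have le: "real e' \<le> real e * q N ^ m" for N
  proof -
    have "e' * ((N + d) choose d) \<le> e * ((N + d + m) choose d)"
      using assms[of "Suc N"] by (simp add: power_count_def ac_simps)
    then have "real e' * real ((N + d) choose d) \<le> real e * real ((N + d + m) choose d)"
      by (metis of_nat_le_iff of_nat_mult)
    also have "\<dots> \<le> real e * (real ((N + d) choose d) * q N ^ m)"
      by (rule mult_left_mono[OF shift]) simp
    finally have "real e' * real ((N + d) choose d) \<le> (real e * q N ^ m) * real ((N + d) choose d)"
      by (simp add: ac_simps)
    moreover have "0 < real ((N + d) choose d)" by simp
    ultimately show ?thesis by (rule mult_right_le_imp_le)
  qed
  have "(\<lambda>N. real e * (1 + real d * inverse (real (Suc N))) ^ m) \<longlonglongrightarrow> real e * (1 + real d * 0) ^ m"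
    by (intro tendsto_intros LIMSEQ_inverse_real_of_nat)
  then have "(\<lambda>N. real e * q N ^ m) \<longlonglongrightarrow> real e"
    by (simp add: q_def divide_inverse)
  then have "real e' \<le> real e"
    by (rule LIMSEQ_le_const) (use le in auto)
  then show ?thesis by simp
qed

section \<open>Minimal reductions\<close>

context noetherian_local_ring begin

text \<open>A relation of degree \<open>k\<close> among the images of \<open>as\<close> in the fiber
  cone, the sum of all \<open>J\<^sup>k/\<mm> J\<^sup>k\<close>. It is nontrivial because some
  coefficient is a unit.\<close>

definition monomial_relation :: "'a list \<Rightarrow> nat \<Rightarrow> bool" where
  "monomial_relation as k \<longleftrightarrow> (\<exists>S c es0. finite S \<and> (\<forall>es\<in>S. length es = length as \<and> sum_list es = k)
     \<and> (\<forall>es. c es \<in> carrier R) \<and> es0 \<in> S \<and> c es0 \<notin> \<mm>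
     \<and> (\<Oplus>es\<in>S. c es \<otimes> monomial as es) \<in> \<mm> \<cdot> ideal_pow R (Idl (set as)) k)"

text \<open>Without a relation, the monomials of degree \<open>k\<close>, added one by one to
  \<open>\<mm> J\<^sup>k\<close>, enlarge the ideal each time. Their number therefore bounds the
  length of \<open>J\<^sup>k/\<mm> J\<^sup>k\<close> from below, and
  \<open>J\<^sup>k\<^sup>+\<^sup>1\<close> lies in \<open>\<mm> J\<^sup>k\<close>.\<close>

lemma no_relation_length:
  assumes as: "set as \<subseteq> carrier R" and J: "J = Idl (set as)" and Jm: "J \<subseteq> \<mm>"
    and nr: "\<not> monomial_relation as k"
  shows "enat ((k + length as - 1) choose k) \<le> len (ideal_pow R J (Suc k)) (ideal_pow R J k)"
proof -
  have Ji: "ideal J R" unfolding J by (rule genideal_ideal[OF as])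
  have aJ: "set as \<subseteq> J" unfolding J by (rule genideal_self[OF as])
  note Jk = ideal_pow_ideal[OF Ji]
  let ?N = "\<mm> \<cdot> ideal_pow R J k"
  have N: "ideal ?N R" by (rule ideal_prod_is_ideal[OF max_ideal Jk])
  have NJ: "?N \<subseteq> ideal_pow R J k" by (rule ideal_prod_subset(2)[OF max_ideal Jk])
  let ?E = "{es :: nat list. length es = length as \<and> sum_list es = k}"
  have "?E \<subseteq> {es. set es \<subseteq> {..k} \<and> length es = length as}"
    using member_le_sum_list by auto
  then have "finite ?E" by (rule finite_subset) (simp add: finite_lists_length_eq)
  then obtain L where L: "set L = ?E" "distinct L" using finite_distinct_list by blast
  let ?f = "monomial as"
  have fc: "?f e \<in> carrier R" for e using as by simp
  have "enat (length (map ?f L)) \<le> len ?N (ideal_pow R J k)"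
  proof (rule len_ge_length[OF N Jk])
    have "?f e \<in> ideal_pow R J k" if "e \<in> set L" for e
      using monomial_mem_pow[OF Ji aJ, of e] that L(1) by auto
    then show "adjoins ?N (map ?f L) \<subseteq> ideal_pow R J k"
      using adjoins_subset_iff[OF Jk N, of "map ?f L" k] fc NJ by auto
    show "set (map ?f L) \<subseteq> carrier R" using fc by auto
    fix i assume i: "i < length (map ?f L)"
    show "map ?f L ! i \<notin> adjoins ?N (take i (map ?f L))"
    proof
      assume "map ?f L ! i \<in> adjoins ?N (take i (map ?f L))"
      then have "?f (L ! i) \<in> adjoins ?N (map ?f (take i L))" using i by (simp add: take_map)
      then obtain c where c: "\<And>e. c e \<in> carrier R"
        "?f (L ! i) \<ominus> (\<Oplus>e\<in>set (take i L). c e \<otimes> ?f e) \<in> ?N"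
        using mem_adjoins_finsum[OF N distinct_take[OF L(2)], of ?f] fc by blast
      have new: "L ! i \<notin> set (take i L)"
        using L(2) i by (metis distinct_take id_take_nth_drop length_map not_distinct_conv_prefix)
      \<comment> \<open>A monomial generated by its predecessors modulo
        \<open>\<mm> J\<^sup>k\<close> gives a relation whose coefficient at that monomial is one,
        hence outside \<open>\<mm>\<close>.\<close>
      define c' where "c' e = (if e = L ! i then \<one> else \<ominus> c e)" for e
      have c': "c' e \<in> carrier R" for e using c(1) by (simp add: c'_def)
      let ?T = "set (take i L)"
      have neg: "(\<Oplus>e\<in>?T. c' e \<otimes> ?f e) = \<ominus> (\<Oplus>e\<in>?T. c e \<otimes> ?f e)"
      proof -
        have "(\<Oplus>e\<in>?T. c' e \<otimes> ?f e) = (\<Oplus>e\<in>?T. \<ominus> \<one> \<otimes> (c e \<otimes> ?f e))"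
          using new c(1) fc by (intro finsum_cong') (auto simp: c'_def l_minus)
        also have "\<dots> = \<ominus> \<one> \<otimes> (\<Oplus>e\<in>?T. c e \<otimes> ?f e)"
          by (rule finsum_rdistr[symmetric]) (use c(1) fc in auto)
        also have "\<dots> = \<ominus> (\<Oplus>e\<in>?T. c e \<otimes> ?f e)"
          using finsum_closed[of "\<lambda>e. c e \<otimes> ?f e" ?T] c(1) fc by (simp add: l_minus Pi_def)
        finally show ?thesis .
      qed
      have "(\<Oplus>e\<in>insert (L ! i) ?T. c' e \<otimes> ?f e) = c' (L ! i) \<otimes> ?f (L ! i) \<oplus> (\<Oplus>e\<in>?T. c' e \<otimes> ?f e)"
        by (rule finsum_insert) (use new c' fc in auto)
      also have "\<dots> = ?f (L ! i) \<ominus> (\<Oplus>e\<in>?T. c e \<otimes> ?f e)"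
        unfolding neg using fc by (simp add: c'_def a_minus_def)
      finally have "(\<Oplus>e\<in>insert (L ! i) ?T. c' e \<otimes> ?f e) \<in> ?N" using c(2) by simp
      moreover have "insert (L ! i) ?T \<subseteq> ?E" using L(1) i set_take_subset[of i L] nth_mem[of i L] by auto
      moreover have "c' (L ! i) \<notin> \<mm>" using one_notin_max by (simp add: c'_def)
      ultimately have "monomial_relation as k"
        unfolding monomial_relation_def J[symmetric]
        by (intro exI[of _ "insert (L ! i) ?T"] exI[of _ c'] exI[of _ "L ! i"]) (use c' in auto)
      with nr show False ..
    qed
  qed
  moreover have "length L = (k + length as - 1) choose k"
    using card_length_sum_list[of "length as" k] distinct_card[OF L(2)] L(1) by simp
  moreover have sub: "ideal_pow R J (Suc k) \<subseteq> ?N"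
    unfolding ideal_pow_Suc2[OF Ji] by (rule ideal_prod_mono[OF Jm order_refl])
  have "len (ideal_pow R J (Suc k)) (ideal_pow R J k) = len (ideal_pow R J (Suc k)) ?N + len ?N (ideal_pow R J k)"
    by (rule len_add[OF Jk N Jk sub NJ])
  ultimately show ?thesis by (metis add.commute le_iff_add length_map order_trans)
qed

lemma no_relations_colength:
  assumes as: "set as \<subseteq> carrier R" "as \<noteq> []" and J: "J = Idl (set as)" and Jm: "J \<subseteq> \<mm>"
    and nr: "\<And>k. \<not> monomial_relation as k"
  shows "enat (power_count (length as) n) \<le> colength (ideal_pow R J n)"
proof -
  have Ji: "ideal J R" unfolding J by (rule genideal_ideal[OF as(1)])
  have "enat (\<Sum>k<n. (k + length as - 1) choose k) \<le> colength (ideal_pow R J n)"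
  proof (induction n)
    case (Suc n)
    have "ideal_pow R J (Suc n) \<subseteq> ideal_pow R J n" by (rule ideal_pow_antimono[OF Ji]) simp
    then have "colength (ideal_pow R J (Suc n))
        = len (ideal_pow R J (Suc n)) (ideal_pow R J n) + colength (ideal_pow R J n)"
      by (rule colength_add[OF ideal_pow_ideal[OF Ji] ideal_pow_ideal[OF Ji]])
    then show ?case
      using add_mono[OF no_relation_length[OF as(1) J Jm nr, of n] Suc] by (simp add: add.commute)
  qed (simp add: zero_enat_def[symmetric])
  then show ?thesis using sum_binomial_power_count[of "length as" n] as(2) by simp
qed

text \<open>Suitable powers of the \<open>ys\<close> lie in \<open>J\<close>, and the ideal they
  generate still has finite colength \<open>C\<close>. Its powers lie in those of \<open>J\<close>,
  and their colengths are bounded by the estimate for arbitrary generators.\<close>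

lemma colength_pow_upper:
  assumes J: "max_primary J" and ys: "set ys \<subseteq> \<mm>" "max_primary (adjoins {\<zero>} ys)"
  obtains C where "\<And>n. colength (ideal_pow R J n) \<le> enat (C * power_count (length ys) n)"
proof -
  have Ji: "ideal J R" using J by (simp add: max_primary_def)
  have "\<exists>n::nat. y [^] n \<in> J" if "y \<in> set ys" for y
    using max_primary_pow_mem[OF J] ys(1) that by blast
  then obtain p :: "'a \<Rightarrow> nat" where p: "\<And>y. y \<in> set ys \<Longrightarrow> y [^] p y \<in> J" by metis
  define zs where "zs = map (\<lambda>y. y [^] p y) ys"
  have yc: "set ys \<subseteq> carrier R" using ys(1) max_carrier by blast
  have zs: "set zs \<subseteq> J" "set zs \<subseteq> carrier R" using p yc by (auto simp: zs_def)
  have "P = \<mm>" if P: "primeideal P R" "adjoins {\<zero>} zs \<subseteq> P" for P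
  proof -
    have Pi: "ideal P R" using P(1) by (rule primeideal.axioms)
    have "set zs \<subseteq> P" using adjoins_set[OF zeroideal zs(2)] P(2) by blast
    then have "set ys \<subseteq> P"
      using primeideal_pow_mem[OF P(1)] yc by (auto simp: zs_def)
    then have "adjoins {\<zero>} ys \<subseteq> P"
      using adjoins_subset_iff[OF Pi zeroideal yc] idealD(2)[OF Pi] by simp
    then show ?thesis using ys(2) P(1) by (auto simp: max_primary_def)
  qed
  then have "max_primary (adjoins {\<zero>} zs)"
    using adjoins_ideal[OF zeroideal zs(2)] by (auto simp: max_primary_def)
  then obtain C where C: "colength (adjoins {\<zero>} zs) = enat C"
    using max_primary_finite_colength by auto
  show ?thesis
  proof (rule that[of C])
    fix n
    have Z: "ideal (ideal_power_mod {\<zero>} (carrier R) zs n) R"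
      by (rule ideal_power_mod_ideal[OF zeroideal oneideal zs(2)])
    have "Idl (set zs) \<subseteq> J" by (rule genideal_minimal[OF Ji zs(1)])
    then have "ideal_power_mod {\<zero>} (carrier R) zs n \<subseteq> ideal_pow R J n"
      using ideal_power_mod_zero[OF oneideal zs(2), of n] ideal_pow_mono[of "Idl (set zs)" J n]
        ideal_prod_one[OF ideal_pow_ideal[OF genideal_ideal[OF zs(2)]]] by simp
    then have "colength (ideal_pow R J n) \<le> colength (ideal_power_mod {\<zero>} (carrier R) zs n)"
      by (rule colength_antimono[OF Z ideal_pow_ideal[OF Ji]])
    also have "\<dots> \<le> enat (C * power_count (length zs) n)"
      using colength_ideal_power_mod_le[OF zeroideal zs(2), of n] C
      by (simp add: binomial_colength_eq_power_count)
    finally show "colength (ideal_pow R J n) \<le> enat (C * power_count (length ys) n)"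
      by (simp add: zs_def)
  qed
qed

text \<open>Take a reduction of \<open>J\<close> with the least number of generators. A relation in
  its fiber cone would save one more generator; without relations its powers have colengths of
  growth degree \<open>length as\<close>, while the upper bound has degree
  \<open>length ys\<close>.\<close>

lemma exists_small_reduction:
  assumes inf: "infinite (carrier (R Quot \<mm>))"
    and J: "max_primary J" "J \<subseteq> \<mm>" and ys: "set ys \<subseteq> \<mm>" "max_primary (adjoins {\<zero>} ys)"
  shows "\<exists>as. length as \<le> length ys \<and> set as \<subseteq> carrier R \<and> is_reduction R J (Idl (set as))"
proof -
  have Ji: "ideal J R" using J by (simp add: max_primary_def)
  let ?Q = "\<lambda>s. \<exists>as. length as = s \<and> set as \<subseteq> carrier R \<and> is_reduction R J (Idl (set as))"
  obtain A where A: "A \<subseteq> carrier R" "finite A" "J = Idl A" using finetely_gen[OF Ji] by blast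
  obtain gs where "set gs = A" using finite_list[OF A(2)] by blast
  then have "?Q (length gs)" using A reduction_refl[OF Ji] by blast
  then have "?Q (LEAST s. ?Q s)" by (rule LeastI)
  then obtain as where as: "length as = (LEAST s. ?Q s)" "set as \<subseteq> carrier R" "is_reduction R J (Idl (set as))"
    by blast
  have "length as \<le> length ys"
  proof (cases as)
    case (Cons a as')
    let ?J = "Idl (set as)"
    have rel: "\<not> monomial_relation as k" for k
    proof
      assume "monomial_relation as k"
      then obtain S c es0 where "finite S" "\<And>es. es \<in> S \<Longrightarrow> length es = length as \<and> sum_list es = k"
        "\<And>es. c es \<in> carrier R" "es0 \<in> S" "c es0 \<notin> \<mm>"
        "(\<Oplus>es\<in>S. c es \<otimes> monomial as es) \<in> \<mm> \<cdot> ideal_pow R ?J k"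
        unfolding monomial_relation_def by blast
      then have "\<exists>bs. length bs = length as' \<and> set bs \<subseteq> carrier R \<and> is_reduction R ?J (Idl (set bs))"
        using reduction_of_relation[OF inf, of a as' ?J S k c es0] as(2) Cons by simp
      then have "?Q (length as')" using reduction_trans[OF Ji as(3)] by blast
      then have "(LEAST s. ?Q s) \<le> length as'" by (rule Least_le)
      then show False using as(1) Cons by simp
    qed
    have Jm: "?J \<subseteq> \<mm>" using is_reductionD(2)[OF as(3)] J(2) by blast
    obtain C where C: "\<And>n. colength (ideal_pow R ?J n) \<le> enat (C * power_count (length ys) n)"
      using colength_pow_upper[OF max_primary_reduction[OF J(1) as(3)] ys] by blast
    have "as \<noteq> []" using Cons by simp
    have "enat (power_count (length as) n) \<le> enat (C * power_count (length ys) n)" for n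
      using no_relations_colength[OF as(2) \<open>as \<noteq> []\<close> refl Jm rel, of n] C[of n] by (rule order_trans)
    then have "power_count (length as) n \<le> C * power_count (length ys) n" for n
      by (simp only: enat_ord_simps)
    then show ?thesis by (rule power_count_growth)
  qed simp
  then show ?thesis using as(2,3) by blast
qed

lemma minimal_reduction_regular:
  assumes inf: "infinite (carrier (R Quot \<mm>))" and dim: "krull_dim R = enat d" and depth: "depth R \<mm> = enat d"
    and I: "max_primary I" "I \<subseteq> \<mm>" and J: "minimal_reduction R I J"
  shows "\<exists>xs. length xs = d \<and> set xs \<subseteq> carrier R \<and> permutable_seq {\<zero>} xs \<and> J = Idl (set xs)
    \<and> adjoins {\<zero>} xs = J \<and> max_primary J"
proof -
  have red: "is_reduction R I J" and min: "\<And>K. is_reduction R I K \<Longrightarrow> K \<subseteq> J \<Longrightarrow> K = J"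
    using J by (auto simp: minimal_reduction_def)
  have Ii: "ideal I R" using I by (simp add: max_primary_def)
  have Jp: "max_primary J" by (rule max_primary_reduction[OF I(1) red])
  have Jm: "J \<subseteq> \<mm>" using is_reductionD(2)[OF red] I(2) by blast
  obtain ys where ys: "length ys = d" "set ys \<subseteq> \<mm>" "regular_seq {\<zero>} ys"
    using exists_regular_seq_of_depth[OF depth] by blast
  have yc: "set ys \<subseteq> carrier R" using ys(2) max_carrier by blast
  have yp: "max_primary (adjoins {\<zero>} ys)"
    by (rule regular_seq_max_primary[OF _ zeroideal yc ys(3)]) (simp add: dim ys(1))
  obtain as where as: "length as \<le> length ys" "set as \<subseteq> carrier R" "is_reduction R J (Idl (set as))"
    using exists_small_reduction[OF inf Jp Jm ys(2) yp] by blast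
  \<comment> \<open>A reduction of \<open>J\<close> is a reduction of \<open>I\<close>, so
    minimality identifies it with \<open>J\<close>, which is thereby generated by at most
    \<open>d\<close> elements.\<close>
  have eq: "Idl (set as) = J"
    by (rule min[OF reduction_trans[OF Ii red as(3)] is_reductionD(2)[OF as(3)]])
  then have asJ: "adjoins {\<zero>} as = J" using adjoins_zero[OF as(2)] by simp
  have asm: "set as \<subseteq> \<mm>" using adjoins_set[OF zeroideal as(2)] asJ Jm by blast
  have zm: "{\<zero>} \<subseteq> \<mm>" using idealD(2)[OF max_ideal] by simp
  obtain zs where zs: "length zs = length ys" "set zs \<subseteq> \<mm>" "regular_seq {\<zero>} zs"
    "adjoins {\<zero>} zs = adjoins {\<zero>} as"
    using parameter_ideal_regular[OF inf zeroideal zm ys(3,2) asm as(1)] asJ Jp by blast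
  have zc: "set zs \<subseteq> carrier R" using zs(2) max_carrier by blast
  show ?thesis
    using zs ys(1) zc asJ Jp adjoins_zero[OF zc] regular_seq_permutable[OF zeroideal zs(2,3)]
    by (intro exI[of _ zs]) simp
qed

section \<open>Lengths attached to a minimal reduction\<close>

lemma reduction_colength_le:
  assumes I: "ideal I R" and J: "is_reduction R I J" and J': "is_reduction R I J'"
    and xs: "set xs \<subseteq> carrier R" "permutable_seq {\<zero>} xs" "J = Idl (set xs)"
    and ys: "set ys \<subseteq> carrier R" "permutable_seq {\<zero>} ys" "J' = Idl (set ys)" "length ys = length xs"
    and e: "colength J = enat e" and e': "colength J' = enat e'"
  shows "e' \<le> e"
proof -
  have pow: "colength (ideal_pow R (Idl (set zs)) k) = enat (c * power_count (length zs) k)"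
    if "set zs \<subseteq> carrier R" "permutable_seq {\<zero>} zs" "colength (Idl (set zs)) = enat c" for zs k c
  proof -
    have "ideal_power_mod {\<zero>} (carrier R) zs k = ideal_pow R (Idl (set zs)) k"
      using ideal_power_mod_zero[OF oneideal that(1)] ideal_prod_one[OF ideal_pow_ideal[OF genideal_ideal[OF that(1)]]]
      by simp
    then show ?thesis
      using colength_ideal_power_mod[OF that(2) zeroideal oneideal that(1), of k] that(3) adjoins_zero[OF that(1)]
      by (simp add: len_refl binomial_colength_eq_power_count)
  qed
  obtain m where m: "\<And>k. ideal_pow R I (m + k) \<subseteq> ideal_pow R J' k"
    using reduction_pow_subset[OF I J'] by blast
  note Ji = is_reductionD(1)[OF J] and J'i = is_reductionD(1)[OF J']
  have "e' * power_count (length xs) k \<le> e * power_count (length xs) (m + k)" for k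
  proof -
    have "enat (e' * power_count (length xs) k) = colength (ideal_pow R J' k)"
      using pow[OF ys(1,2), of e' k] e' ys by simp
    also have "\<dots> \<le> colength (ideal_pow R I (m + k))"
      by (rule colength_antimono[OF ideal_pow_ideal[OF I] ideal_pow_ideal[OF J'i] m])
    also have "\<dots> \<le> colength (ideal_pow R J (m + k))"
      by (rule colength_antimono[OF ideal_pow_ideal[OF Ji] ideal_pow_ideal[OF I] ideal_pow_mono[OF is_reductionD(2)[OF J]]])
    also have "\<dots> = enat (e * power_count (length xs) (m + k))"
      using pow[OF xs(1,2), of e "m + k"] e xs by simp
    finally show ?thesis by simp
  qed
  then show ?thesis by (rule power_count_shift)
qed

subsection \<open>Colon ideals\<close>

lemma colon_ideal_ideal:
  assumes "ideal K R" "I \<subseteq> carrier R"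
  shows "ideal (colon_ideal R K I) R"
  by (rule ideal_criterion)
     (use assms idealD[OF assms(1)] in \<open>auto simp: colon_ideal_def l_distr m_assoc subset_iff\<close>)

lemma subset_colon_ideal: "ideal K R \<Longrightarrow> I \<subseteq> carrier R \<Longrightarrow> K \<subseteq> colon_ideal R K I"
  using idealD(1,5)[of K] by (auto simp: colon_ideal_def)

text \<open>The module \<open>((C + (x)) : I) / (C + (x))\<close> is \<open>Ext\<^sup>1(R/I, R/C)\<close>, whatever the regular element
  \<open>x \<in> I\<close>; the isomorphism for \<open>x\<close> and \<open>z\<close> sends \<open>a\<close> to the class of \<open>b\<close> with \<open>a z - b x \<in> C\<close>.\<close>

definition exchange :: "'a set \<Rightarrow> 'a \<Rightarrow> 'a \<Rightarrow> 'a set \<Rightarrow> 'a set" where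
  "exchange C x z L = {b \<in> carrier R. \<exists>a\<in>L. a \<otimes> z \<ominus> b \<otimes> x \<in> C}"

lemma exchange_interval:
  assumes C: "ideal C R" and I: "ideal I R" and CI: "C \<subseteq> I" and xz: "x \<in> I" "z \<in> I"
    and rx: "regular_elt C x"
    and L: "ideal L R" "adjoin C x \<subseteq> L" "L \<subseteq> colon_ideal R (adjoin C x) I"
  shows "ideal (exchange C x z L) R" "adjoin C z \<subseteq> exchange C x z L"
    "exchange C x z L \<subseteq> colon_ideal R (adjoin C z) I"
proof -
  have c: "x \<in> carrier R" "z \<in> carrier R" using xz idealD(1)[OF I] by auto
  have xL: "x \<in> L" using adjoin_self[OF C c(1)] L(2) by blast
  show id: "ideal (exchange C x z L) R"
  proof (rule ideal_criterion)
    show "\<zero> \<in> exchange C x z L"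
      using idealD(2)[OF L(1)] idealD(2)[OF C] c by (auto simp: exchange_def a_minus_def intro!: bexI[of _ \<zero>])
  next
    fix b b' assume "b \<in> exchange C x z L" "b' \<in> exchange C x z L"
    then obtain a a' where h: "a \<in> L" "a' \<in> L" "b \<in> carrier R" "b' \<in> carrier R"
      "a \<otimes> z \<ominus> b \<otimes> x \<in> C" "a' \<otimes> z \<ominus> b' \<otimes> x \<in> C" by (auto simp: exchange_def)
    have ac: "a \<in> carrier R" "a' \<in> carrier R" using h idealD(1)[OF L(1)] by auto
    have "(a \<oplus> a') \<otimes> z \<ominus> (b \<oplus> b') \<otimes> x = (a \<otimes> z \<ominus> b \<otimes> x) \<oplus> (a' \<otimes> z \<ominus> b' \<otimes> x)"
      using ac h(3,4) c by algebra
    then have "(a \<oplus> a') \<otimes> z \<ominus> (b \<oplus> b') \<otimes> x \<in> C" using idealD(3)[OF C h(5,6)] by simp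
    then show "b \<oplus> b' \<in> exchange C x z L"
      using idealD(3)[OF L(1) h(1,2)] h(3,4) unfolding exchange_def by blast
  next
    fix r b assume r: "r \<in> carrier R" and "b \<in> exchange C x z L"
    then obtain a where h: "a \<in> L" "b \<in> carrier R" "a \<otimes> z \<ominus> b \<otimes> x \<in> C" by (auto simp: exchange_def)
    have ac: "a \<in> carrier R" using h idealD(1)[OF L(1)] by auto
    have "(r \<otimes> a) \<otimes> z \<ominus> (r \<otimes> b) \<otimes> x = r \<otimes> (a \<otimes> z \<ominus> b \<otimes> x)" using ac h(2) r c by algebra
    then have "(r \<otimes> a) \<otimes> z \<ominus> (r \<otimes> b) \<otimes> x \<in> C" using idealD(4)[OF C r h(3)] by simp
    then show "r \<otimes> b \<in> exchange C x z L"
      using idealD(4)[OF L(1) r h(1)] r h(2) unfolding exchange_def by blast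
  qed (simp add: exchange_def)
  have zero: "\<zero> \<otimes> z \<ominus> b \<otimes> x \<in> C" if "b \<in> C" for b
    using idealD(6)[OF C idealD(5)[OF C c(1) that]] idealD(1)[OF C that] c by (simp add: a_minus_def)
  show "adjoin C z \<subseteq> exchange C x z L"
  proof (rule adjoin_least[OF id])
    show "C \<subseteq> exchange C x z L"
      using zero idealD(1)[OF C] idealD(2)[OF L(1)] unfolding exchange_def by blast
    have "x \<otimes> z \<ominus> z \<otimes> x = \<zero>" using c by algebra
    then have "x \<otimes> z \<ominus> z \<otimes> x \<in> C" using idealD(2)[OF C] by simp
    then show "z \<in> exchange C x z L" using xL c unfolding exchange_def by blast
  qed
  show "exchange C x z L \<subseteq> colon_ideal R (adjoin C z) I"
  proof
    fix b assume "b \<in> exchange C x z L"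
    then obtain a where h: "a \<in> L" "b \<in> carrier R" "a \<otimes> z \<ominus> b \<otimes> x \<in> C" by (auto simp: exchange_def)
    have ac: "a \<in> carrier R" using h idealD(1)[OF L(1)] by auto
    have "b \<otimes> i \<in> adjoin C z" if i: "i \<in> I" for i
    proof -
      have ic: "i \<in> carrier R" using i idealD(1)[OF I] by auto
      have "a \<otimes> i \<in> adjoin C x" using h(1) L(3) i by (auto simp: colon_ideal_def)
      then obtain k r where kr: "k \<in> C" "r \<in> carrier R" "a \<otimes> i = k \<oplus> r \<otimes> x" by (auto simp: adjoin_iff)
      have kc: "k \<in> carrier R" using idealD(1)[OF C kr(1)] .
      \<comment> \<open>The claim is tested after multiplication by \<open>x\<close>, which is
        regular modulo \<open>C\<close>. Substituting \<open>a i = k + r x\<close> leaves only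
        multiples of \<open>k\<close> and of \<open>a z - b x\<close>, both in
        \<open>C\<close>.\<close>
      have "(b \<otimes> i \<ominus> r \<otimes> z) \<otimes> x = z \<otimes> (a \<otimes> i) \<ominus> i \<otimes> (a \<otimes> z \<ominus> b \<otimes> x) \<ominus> r \<otimes> z \<otimes> x"
        using h(2) ic kr(2) ac c by algebra
      also have "\<dots> = z \<otimes> k \<ominus> i \<otimes> (a \<otimes> z \<ominus> b \<otimes> x)"
        unfolding kr(3) using h(2) ic kr(2) ac c kc by algebra
      also have "\<dots> \<in> C"
        by (rule idealD(7)[OF C idealD(4)[OF C c(2) kr(1)] idealD(4)[OF C ic h(3)]])
      finally have "b \<otimes> i \<ominus> r \<otimes> z \<in> C" using regular_eltD[OF rx] h(2) ic kr(2) c by simp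
      moreover have "b \<otimes> i = (b \<otimes> i \<ominus> r \<otimes> z) \<oplus> r \<otimes> z" using h(2) ic kr(2) c by algebra
      ultimately show ?thesis using kr(2) unfolding adjoin_iff by blast
    qed
    then show "b \<in> colon_ideal R (adjoin C z) I" using h(2) by (simp add: colon_ideal_def)
  qed
qed

lemma exchange_exchange:
  assumes C: "ideal C R" and I: "ideal I R" and xz: "x \<in> I" "z \<in> I" and rz: "regular_elt C z"
    and L: "ideal L R" "adjoin C x \<subseteq> L" "L \<subseteq> colon_ideal R (adjoin C x) I"
  shows "exchange C z x (exchange C x z L) = L"
proof
  have c: "x \<in> carrier R" "z \<in> carrier R" using xz idealD(1)[OF I] by auto
  have CL: "C \<subseteq> L" using adjoin_base[OF C c(1)] L(2) by blast
  show "exchange C z x (exchange C x z L) \<subseteq> L"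
  proof
    fix a assume "a \<in> exchange C z x (exchange C x z L)"
    then obtain b a' where h: "a \<in> carrier R" "b \<in> carrier R" "a' \<in> L"
      "b \<otimes> x \<ominus> a \<otimes> z \<in> C" "a' \<otimes> z \<ominus> b \<otimes> x \<in> C" by (auto simp: exchange_def)
    have ac: "a' \<in> carrier R" using h idealD(1)[OF L(1)] by auto
    have "(a' \<ominus> a) \<otimes> z = (a' \<otimes> z \<ominus> b \<otimes> x) \<oplus> (b \<otimes> x \<ominus> a \<otimes> z)" using h(1,2) ac c by algebra
    then have "a' \<ominus> a \<in> C" using regular_eltD[OF rz, of "a' \<ominus> a"] idealD(3)[OF C h(5,4)] h(1) ac by simp
    then have "a' \<ominus> (a' \<ominus> a) \<in> L" using idealD(7)[OF L(1) h(3)] CL by blast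
    then show "a \<in> L" using minus_minus_cancel[OF ac h(1)] by simp
  qed
  show "L \<subseteq> exchange C z x (exchange C x z L)"
  proof
    fix a assume a: "a \<in> L"
    \<comment> \<open>The partner \<open>b\<close> of \<open>a\<close> exists because
      \<open>a\<close> lies in the colon ideal and \<open>z\<close> lies in
      \<open>I\<close>.\<close>
    then have "a \<otimes> z \<in> adjoin C x" using L(3) xz(2) by (auto simp: colon_ideal_def)
    then obtain k b where kb: "k \<in> C" "b \<in> carrier R" "a \<otimes> z = k \<oplus> b \<otimes> x" by (auto simp: adjoin_iff)
    have ac: "a \<in> carrier R" "k \<in> carrier R" using a kb idealD(1)[OF L(1)] idealD(1)[OF C] by auto
    have "a \<otimes> z \<ominus> b \<otimes> x = k" unfolding kb(3) using ac kb(2) c by algebra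
    moreover have "b \<otimes> x \<ominus> a \<otimes> z = \<ominus> k" unfolding kb(3) using ac kb(2) c by algebra
    ultimately have "a \<otimes> z \<ominus> b \<otimes> x \<in> C" "b \<otimes> x \<ominus> a \<otimes> z \<in> C" using kb(1) idealD(6)[OF C kb(1)] by auto
    then show "a \<in> exchange C z x (exchange C x z L)"
      using a ac kb(2) unfolding exchange_def by blast
  qed
qed

lemma len_colon_exchange:
  assumes C: "ideal C R" and I: "ideal I R" and CI: "C \<subseteq> I" and xz: "x \<in> I" "z \<in> I"
    and r: "regular_elt C x" "regular_elt C z"
  shows "len (adjoin C x) (colon_ideal R (adjoin C x) I) = len (adjoin C z) (colon_ideal R (adjoin C z) I)"
  unfolding len_def
proof (rule chain_length_eqI[where f = "exchange C x z" and g = "exchange C z x"])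
  fix L assume "L \<in> {L. ideal L R \<and> adjoin C x \<subseteq> L \<and> L \<subseteq> colon_ideal R (adjoin C x) I}"
  then have L: "ideal L R" "adjoin C x \<subseteq> L" "L \<subseteq> colon_ideal R (adjoin C x) I" by auto
  show "exchange C x z L \<in> {L. ideal L R \<and> adjoin C z \<subseteq> L \<and> L \<subseteq> colon_ideal R (adjoin C z) I}"
    using exchange_interval[OF C I CI xz r(1) L] by simp
  show "exchange C z x (exchange C x z L) = L" by (rule exchange_exchange[OF C I xz r(2) L])
next
  fix L assume "L \<in> {L. ideal L R \<and> adjoin C z \<subseteq> L \<and> L \<subseteq> colon_ideal R (adjoin C z) I}"
  then have L: "ideal L R" "adjoin C z \<subseteq> L" "L \<subseteq> colon_ideal R (adjoin C z) I" by auto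
  show "exchange C z x L \<in> {L. ideal L R \<and> adjoin C x \<subseteq> L \<and> L \<subseteq> colon_ideal R (adjoin C x) I}"
    using exchange_interval[OF C I CI xz(2,1) r(2) L] by simp
  show "exchange C x z (exchange C z x L) = L" by (rule exchange_exchange[OF C I xz(2,1) r(1) L])
qed (auto simp: exchange_def)

lemma adjoins_Cons_eq:
  assumes "ideal B R" "set (x # xs) \<subseteq> carrier R"
  shows "adjoins B (x # xs) = adjoin (adjoins B xs) x"
  using adjoins_set_eq[of B "x # xs" "xs @ [x]"] assms by (simp add: adjoins_append)

text \<open>By permutability \<open>x\<close> and \<open>y\<close> may be taken as the last
  elements, over \<open>C\<close> and \<open>D\<close>. A general combination \<open>z\<close> of
  them is regular modulo both, and replacing \<open>x\<close> and \<open>y\<close> by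
  \<open>z\<close> changes no length. Moved to the front, \<open>z\<close> is a common first
  element, and the induction continues over \<open>B + (z)\<close>.\<close>

lemma len_colon_regular_seq:
  assumes inf: "infinite (carrier (R Quot \<mm>))" and I: "ideal I R" "I \<subseteq> \<mm>"
    and B: "ideal B R" "B \<subseteq> I" and xs: "set xs \<subseteq> I" "regular_seq B xs"
    and ys: "set ys \<subseteq> I" "regular_seq B ys" "length ys = length xs"
  shows "len (adjoins B xs) (colon_ideal R (adjoins B xs) I) = len (adjoins B ys) (colon_ideal R (adjoins B ys) I)"
  using B xs ys
proof (induction xs arbitrary: B ys)
  case Nil
  then show ?case by simp
next
  case (Cons x xs)
  note B = Cons.prems(1,2)
  obtain y ys' where ys: "ys = y # ys'" "length ys' = length xs" using Cons.prems(7) by (cases ys) auto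
  have I': "x \<in> I" "y \<in> I" "set xs \<subseteq> I" "set ys' \<subseteq> I" using Cons.prems ys by auto
  have m: "x \<in> \<mm>" "y \<in> \<mm>" "set xs \<subseteq> \<mm>" "set ys' \<subseteq> \<mm>" using I' I(2) by auto
  have c: "x \<in> carrier R" "y \<in> carrier R" "set xs \<subseteq> carrier R" "set ys' \<subseteq> carrier R"
    using I' idealD(1)[OF I(1)] by auto
  define C where "C = adjoins B xs"
  define D where "D = adjoins B ys'"
  have C: "ideal C R" "C \<subseteq> I" and D: "ideal D R" "D \<subseteq> I"
    unfolding C_def D_def
    using adjoins_ideal[OF B(1) c(3)] adjoins_ideal[OF B(1) c(4)]
      adjoins_subset_iff[OF I(1) B(1) c(3)] adjoins_subset_iff[OF I(1) B(1) c(4)] B(2) I' by auto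
  have move: "regular_seq B zs \<and> regular_elt (adjoins B zs) z" if "regular_seq B (z # zs)" "z \<in> \<mm>" "set zs \<subseteq> \<mm>" for z zs
  proof -
    have "permutable_seq B (z # zs)" by (rule regular_seq_permutable[OF B(1)]) (use that in auto)
    then have "regular_seq B (zs @ [z])" unfolding permutable_seq_def by auto
    then show ?thesis by (simp add: regular_seq_append)
  qed
  have rx: "regular_seq B xs" "regular_elt C x" and ry: "regular_seq B ys'" "regular_elt D y"
    using move[of x xs] move[of y ys'] Cons.prems(4,6) m ys(1) unfolding C_def D_def by auto
  \<comment> \<open>No prime of \<open>?P\<close> contains both \<open>x\<close> and
    \<open>y\<close>: those of \<open>C\<close> omit \<open>x\<close> and those of \<open>D\<close>
    omit \<open>y\<close>. So one value of \<open>t\<close> serves all of them.\<close>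
  let ?P = "assoc_primes C \<union> assoc_primes D"
  have "finite ?P" using finite_assoc_primes[OF C(1)] finite_assoc_primes[OF D(1)] by simp
  moreover have "primeideal P R" if "P \<in> ?P" for P using that by (auto simp: assoc_primes_def)
  ultimately obtain t where t: "t \<in> carrier R" "\<And>P. P \<in> ?P \<Longrightarrow> x \<oplus> t \<otimes> y \<in> P \<Longrightarrow> x \<in> P \<and> y \<in> P"
    using prime_avoid_pair[OF inf _ _ c(1,2), of ?P] by blast
  define z where "z = x \<oplus> t \<otimes> y"
  have zI: "z \<in> I" unfolding z_def using idealD(3)[OF I(1) I'(1) idealD(4)[OF I(1) t(1) I'(2)]] .
  have z: "z \<in> carrier R" "z \<in> \<mm>" using zI idealD(1)[OF I(1)] I(2) by auto
  have "\<forall>P\<in>assoc_primes C. z \<notin> P" "\<forall>P\<in>assoc_primes D. z \<notin> P"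
    using t(2) rx(2) ry(2) regular_elt_iff_assoc[OF C(1) c(1)] regular_elt_iff_assoc[OF D(1) c(2)]
    unfolding z_def by blast+
  then have rz: "regular_elt C z" "regular_elt D z"
    using regular_elt_iff_assoc[OF C(1) z(1)] regular_elt_iff_assoc[OF D(1) z(1)] by auto
  have "regular_seq B (xs @ [z])" "regular_seq B (ys' @ [z])"
    using rx(1) ry(1) rz by (simp_all add: regular_seq_append C_def D_def)
  then have rs: "regular_seq (adjoin B z) xs" "regular_seq (adjoin B z) ys'"
    using regular_seq_move[OF B(1) m(3) z(2)] regular_seq_move[OF B(1) m(4) z(2)] by auto
  have eqs: "adjoins B (x # xs) = adjoin C x" "adjoins (adjoin B z) xs = adjoin C z"
    "adjoins B (y # ys') = adjoin D y" "adjoins (adjoin B z) ys' = adjoin D z"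
    using adjoins_Cons_eq[OF B(1)] c z(1) unfolding C_def D_def by (simp_all del: adjoins.simps add: adjoins.simps(2)[symmetric])
  have "len (adjoin C z) (colon_ideal R (adjoin C z) I) = len (adjoin D z) (colon_ideal R (adjoin D z) I)"
    using Cons.IH[OF adjoin_ideal[OF B(1) z(1)] adjoin_least[OF I(1) B(2) zI] I'(3) rs(1) I'(4) rs(2) ys(2)]
    unfolding eqs .
  then show ?case
    using len_colon_exchange[OF C(1) I(1) C(2) I'(1) zI rx(2) rz(1)]
      len_colon_exchange[OF D(1) I(1) D(2) I'(2) zI ry(2) rz(2)]
    unfolding ys(1) eqs by simp
qed

end

section \<open>The polynomial algebra\<close>

context module begin

definition span :: "'c set \<Rightarrow> 'c set" where
  "span S = \<Inter>{N. submodule N R M \<and> S \<subseteq> N}"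

lemma span_base: "S \<subseteq> span S"
  by (auto simp: span_def)

lemma span_least: "submodule N R M \<Longrightarrow> S \<subseteq> N \<Longrightarrow> span S \<subseteq> N"
  by (auto simp: span_def)

lemma submodule_span:
  assumes "S \<subseteq> carrier M"
  shows "submodule (span S) R M"
proof (rule submoduleI')
  show "span S \<subseteq> carrier M" by (rule span_least[OF carrier_is_submodule assms])
qed (auto simp: span_def submodule_zero submoduleE)

end

lemma finite_sub_multisets: "finite {k. k \<subseteq># m}"
proof (induction m)
  case (add x m)
  have "{k. k \<subseteq># add_mset x m} \<subseteq> {k. k \<subseteq># m} \<union> add_mset x ` {k. k \<subseteq># m}"
  proof
    fix k assume "k \<in> {k. k \<subseteq># add_mset x m}"
    then have k: "k \<subseteq># add_mset x m" by simp
    show "k \<in> {k. k \<subseteq># m} \<union> add_mset x ` {k. k \<subseteq># m}"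
    proof (cases "x \<in># k")
      case True
      then obtain k' where k': "k = add_mset x k'" by (meson mset_add)
      then show ?thesis using k by auto
    next
      case False
      have "count k a \<le> count m a" for a
        using k False mset_subset_eq_count[OF k, of a] by (cases "a = x") (auto simp: not_in_iff)
      then have "k \<subseteq># m" by (simp add: subseteq_mset_def)
      then show ?thesis by simp
    qed
  qed
  then show ?case by (rule finite_subset) (use add in simp)
qed simp

lemma sub_multiset_double_diff: "k \<subseteq># m \<Longrightarrow> m - (m - k) = k"
  by (metis add_diff_cancel_left' add_diff_cancel_right' mset_subset_eq_exists_conv)

context cring begin

section \<open>Multiplication of polynomials as convolution over multisets\<close>

definition conv :: "('c multiset \<Rightarrow> 'a) \<Rightarrow> ('c multiset \<Rightarrow> 'a) \<Rightarrow> 'c multiset \<Rightarrow> 'a" where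
  "conv p q = (\<lambda>m. \<Oplus>k\<in>{k. k \<subseteq># m}. p k \<otimes> q (m - k))"

definition pscale :: "'a \<Rightarrow> ('c multiset \<Rightarrow> 'a) \<Rightarrow> 'c multiset \<Rightarrow> 'a" where
  "pscale a p = (\<lambda>m. a \<otimes> p m)"

abbreviation polys :: "'c set \<Rightarrow> ('c multiset \<Rightarrow> 'a) set" where
  "polys V \<equiv> indexed_pset V (carrier R)"

lemma polys_coeff: "p \<in> polys V \<Longrightarrow> p m \<in> carrier R"
  using indexed_pset_in_carrier[OF subset_refl] by (auto simp: carrier_coeff_def)

lemma conv_closed:
  assumes "\<And>m. p m \<in> carrier R" "\<And>m. q m \<in> carrier R"
  shows "conv p q m \<in> carrier R"
  unfolding conv_def using assms by (intro finsum_closed) auto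

lemma conv_const:
  fixes q :: "'c multiset \<Rightarrow> 'a"
  assumes "k \<in> carrier R" "\<And>m. q m \<in> carrier R"
  shows "conv (indexed_const k) q = pscale k q"
proof
  fix m :: "'c multiset"
  have "conv (indexed_const k) q m = (\<Oplus>j\<in>{{#} :: 'c multiset}. k \<otimes> q m)"
    unfolding conv_def
    by (rule add.finprod_mono_neutral_cong_right[OF finite_sub_multisets])
       (use assms in \<open>auto simp: indexed_const_def\<close>)
  then show "conv (indexed_const k) q m = pscale k q m"
    using assms by (simp add: finsum_singleton pscale_def)
qed

lemma conv_padd:
  assumes "\<And>m. p m \<in> carrier R" "\<And>m. p' m \<in> carrier R" "\<And>m. q m \<in> carrier R"
  shows "conv (indexed_padd p p') q = indexed_padd (conv p q) (conv p' q)"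
proof
  fix m
  have "conv (indexed_padd p p') q m = (\<Oplus>k\<in>{k. k \<subseteq># m}. p k \<otimes> q (m - k) \<oplus> p' k \<otimes> q (m - k))"
    unfolding conv_def by (rule finsum_cong') (use assms in \<open>auto simp: indexed_padd_def l_distr\<close>)
  also have "\<dots> = conv p q m \<oplus> conv p' q m" unfolding conv_def by (rule finsum_addf) (use assms in auto)
  finally show "conv (indexed_padd p p') q m = indexed_padd (conv p q) (conv p' q) m"
    by (simp add: indexed_padd_def)
qed

lemma conv_pmult:
  assumes "\<And>m. p m \<in> carrier R" "\<And>m. q m \<in> carrier R"
  shows "conv (indexed_pmult p i) q = indexed_pmult (conv p q) i"
proof
  fix m
  show "conv (indexed_pmult p i) q m = indexed_pmult (conv p q) i m"
  proof (cases "i \<in># m")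
    case False
    have "conv (indexed_pmult p i) q m = (\<Oplus>k\<in>{k. k \<subseteq># m}. \<zero>)"
      unfolding conv_def by (rule finsum_cong') (use False assms in \<open>auto simp: indexed_pmult_def dest: mset_subset_eqD\<close>)
    then show ?thesis using False by (simp add: indexed_pmult_def)
  next
    case True
    then obtain m' where m: "m = add_mset i m'" by (meson mset_add)
    have "conv (indexed_pmult p i) q m
        = (\<Oplus>k\<in>add_mset i ` {k. k \<subseteq># m'}. p (k - {#i#}) \<otimes> q (m - k))"
      unfolding conv_def
    proof (rule add.finprod_mono_neutral_cong_right[OF finite_sub_multisets])
      show "add_mset i ` {k. k \<subseteq># m'} \<subseteq> {k. k \<subseteq># m}" by (auto simp: m)
      fix k assume "k \<in> {k. k \<subseteq># m} - add_mset i ` {k. k \<subseteq># m'}"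
      then have "i \<notin># k" by (auto simp: m dest!: multi_member_split)
      then show "indexed_pmult p i k \<otimes> q (m - k) = \<zero>" using assms by (simp add: indexed_pmult_def)
    qed (use assms in \<open>auto simp: indexed_pmult_def\<close>)
    also have "\<dots> = (\<Oplus>k\<in>{k. k \<subseteq># m'}. p (add_mset i k - {#i#}) \<otimes> q (m - add_mset i k))"
      by (rule finsum_reindex) (use assms in \<open>auto simp: inj_on_def\<close>)
    finally show ?thesis by (simp add: m indexed_pmult_def conv_def)
  qed
qed

lemma conv_comm:
  fixes p q :: "'c multiset \<Rightarrow> 'a"
  assumes "\<And>m. p m \<in> carrier R" "\<And>m. q m \<in> carrier R"
  shows "conv p q = conv q p"
proof
  fix m :: "'c multiset"
  have img: "(\<lambda>k. m - k) ` {k. k \<subseteq># m} = {k. k \<subseteq># m}"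
  proof
    show "{k. k \<subseteq># m} \<subseteq> (\<lambda>k. m - k) ` {k. k \<subseteq># m}"
    proof
      fix k assume "k \<in> {k. k \<subseteq># m}"
      then have "k = m - (m - k)" "m - k \<in> {k. k \<subseteq># m}" by (simp_all add: sub_multiset_double_diff)
      then show "k \<in> (\<lambda>k. m - k) ` {k. k \<subseteq># m}" by (rule image_eqI)
    qed
  qed auto
  have inj: "inj_on (\<lambda>k. m - k) {k. k \<subseteq># m}"
    by (rule inj_on_inverseI[where g = "\<lambda>k. m - k"]) (simp add: sub_multiset_double_diff)
  have "conv p q m = (\<Oplus>k\<in>(\<lambda>k. m - k) ` {k. k \<subseteq># m}. p k \<otimes> q (m - k))" unfolding img conv_def ..
  also have "\<dots> = (\<Oplus>k\<in>{k. k \<subseteq># m}. p (m - k) \<otimes> q (m - (m - k)))"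
    by (rule finsum_reindex) (use assms inj in auto)
  also have "\<dots> = conv q p m"
    unfolding conv_def
    by (rule finsum_cong') (use assms in \<open>auto simp: m_comm sub_multiset_double_diff\<close>)
  finally show "conv p q m = conv q p m" .
qed

lemma pscale_closed:
  fixes V :: "'c set"
  assumes "a \<in> carrier R" "p \<in> polys V"
  shows "pscale a p \<in> polys V"
  using assms(2)
proof (induction rule: indexed_pset.induct)
  case (indexed_const k)
  have "pscale a (indexed_const k :: 'c multiset \<Rightarrow> 'a) = indexed_const (a \<otimes> k)"
    using assms(1) by (auto simp: indexed_const_def pscale_def)
  then show ?case using assms(1) indexed_const by (auto intro: indexed_pset.indexed_const)
next
  case (indexed_padd p q)
  have "pscale a (indexed_padd p q) = indexed_padd (pscale a p) (pscale a q)"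
    using assms(1) polys_coeff[OF indexed_padd(1)] polys_coeff[OF indexed_padd(2)]
    by (simp add: indexed_padd_def r_distr pscale_def)
  then show ?case using indexed_padd by (auto intro: indexed_pset.indexed_padd)
next
  case (indexed_pmult p i)
  have "pscale a (indexed_pmult p i) = indexed_pmult (pscale a p) i"
    using assms(1) by (auto simp: indexed_pmult_def pscale_def)
  then show ?case using indexed_pmult by (auto intro: indexed_pset.indexed_pmult)
qed

lemma conv_polys: "p \<in> polys V \<Longrightarrow> q \<in> polys V \<Longrightarrow> conv p q \<in> polys V"
proof (induction rule: indexed_pset.induct)
  case (indexed_const k)
  then show ?case using pscale_closed by (subst conv_const) (auto simp: polys_coeff)
next
  case (indexed_padd p p')
  then show ?case by (subst conv_padd) (auto simp: polys_coeff intro: indexed_pset.indexed_padd)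
next
  case (indexed_pmult p i)
  then show ?case by (subst conv_pmult) (auto simp: polys_coeff intro: indexed_pset.indexed_pmult)
qed

lemma conv_pscale:
  assumes "a \<in> carrier R" "\<And>m. p m \<in> carrier R" "\<And>m. q m \<in> carrier R"
  shows "conv (pscale a p) q = pscale a (conv p q)"
proof
  fix m
  have "conv (pscale a p) q m = (\<Oplus>k\<in>{k. k \<subseteq># m}. a \<otimes> (p k \<otimes> q (m - k)))"
    unfolding conv_def by (rule finsum_cong') (use assms in \<open>auto simp: m_assoc pscale_def\<close>)
  also have "\<dots> = a \<otimes> conv p q m"
    unfolding conv_def by (rule finsum_rdistr[symmetric]) (use assms finite_sub_multisets in auto)
  finally show "conv (pscale a p) q m = pscale a (conv p q) m" by (simp add: pscale_def)
qed

text \<open>Convolution commutes with scaling, sums and multiplication by a variable in its first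
  argument, so induction over the construction of \<open>p\<close> replaces the reindexing of a
  triple sum.\<close>

lemma conv_assoc:
  assumes "p \<in> polys V" "q \<in> polys V" "r \<in> polys V"
  shows "conv (conv p q) r = conv p (conv q r)"
  using assms(1)
proof (induction rule: indexed_pset.induct)
  note c = polys_coeff[OF assms(2)] polys_coeff[OF assms(3)]
  note cc = conv_closed[OF c]
  {
    case (indexed_const k)
    show ?case
      by (simp only: conv_const[OF indexed_const c(1)] conv_const[OF indexed_const cc] conv_pscale[OF indexed_const c])
  next
    case (indexed_padd p p')
    note p = polys_coeff[OF indexed_padd(1)] polys_coeff[OF indexed_padd(2)]
    show ?case
      by (simp only: conv_padd[OF p c(1)] conv_padd[OF p cc] indexed_padd.IH
          conv_padd[OF conv_closed[OF p(1) c(1)] conv_closed[OF p(2) c(1)] c(2)])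
  next
    case (indexed_pmult p i)
    note p = polys_coeff[OF indexed_pmult(1)]
    show ?case
      by (simp only: conv_pmult[OF p c(1)] conv_pmult[OF p cc] conv_pmult[OF conv_closed[OF p c(1)] c(2)] indexed_pmult.IH)
  }
qed

lemma poly_algebra_sel [simp]:
  "carrier (poly_algebra R V) = polys V"
  "p \<oplus>\<^bsub>poly_algebra R V\<^esub> q = indexed_padd p q"
  "p \<otimes>\<^bsub>poly_algebra R V\<^esub> q = conv p q"
  "\<zero>\<^bsub>poly_algebra R V\<^esub> = indexed_const \<zero>"
  "\<one>\<^bsub>poly_algebra R V\<^esub> = indexed_const \<one>"
  "a \<odot>\<^bsub>poly_algebra R V\<^esub> p = pscale a p"
  by (simp_all add: poly_algebra_def conv_def pscale_def)

lemma poly_algebra_cring: "cring (poly_algebra R V)"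
proof (rule cringI)
  show "abelian_group (poly_algebra R V)"
  proof (rule abelian_groupI)
    fix p assume p: "p \<in> carrier (poly_algebra R V)"
    have "pscale (\<ominus> \<one>) p \<in> polys V" using p by (intro pscale_closed) auto
    moreover have "indexed_padd (pscale (\<ominus> \<one>) p) p = indexed_const \<zero>"
      using polys_coeff[of p V] p by (simp add: indexed_padd_def indexed_const_def pscale_def l_minus l_neg)
    ultimately show "\<exists>q\<in>carrier (poly_algebra R V). q \<oplus>\<^bsub>poly_algebra R V\<^esub> p = \<zero>\<^bsub>poly_algebra R V\<^esub>"
      by auto
  next
    fix p q r assume "p \<in> carrier (poly_algebra R V)" "q \<in> carrier (poly_algebra R V)" "r \<in> carrier (poly_algebra R V)"
    then have "p m \<in> carrier R" "q m \<in> carrier R" "r m \<in> carrier R" for m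
      using polys_coeff by auto
    then show "(p \<oplus>\<^bsub>poly_algebra R V\<^esub> q) \<oplus>\<^bsub>poly_algebra R V\<^esub> r
        = p \<oplus>\<^bsub>poly_algebra R V\<^esub> (q \<oplus>\<^bsub>poly_algebra R V\<^esub> r)"
      by (simp add: indexed_padd_def a_assoc)
  next
    fix p q assume "p \<in> carrier (poly_algebra R V)" "q \<in> carrier (poly_algebra R V)"
    then have "p m \<in> carrier R" "q m \<in> carrier R" for m
      using polys_coeff by auto
    then show "p \<oplus>\<^bsub>poly_algebra R V\<^esub> q = q \<oplus>\<^bsub>poly_algebra R V\<^esub> p"
      by (simp add: indexed_padd_def a_comm)
  next
    fix p assume "p \<in> carrier (poly_algebra R V)"
    then have "p m \<in> carrier R" for m using polys_coeff by auto
    then show "\<zero>\<^bsub>poly_algebra R V\<^esub> \<oplus>\<^bsub>poly_algebra R V\<^esub> p = p"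
      by (simp add: indexed_padd_def indexed_zero_def)
  qed (auto intro: indexed_pset.indexed_padd indexed_pset.indexed_const)
  show "comm_monoid (poly_algebra R V)"
  proof (rule comm_monoidI)
    fix p assume p: "p \<in> carrier (poly_algebra R V)"
    then show "\<one>\<^bsub>poly_algebra R V\<^esub> \<otimes>\<^bsub>poly_algebra R V\<^esub> p = p"
      using conv_const[OF one_closed, of p] polys_coeff[of p V] by (simp add: pscale_def)
    fix q assume q: "q \<in> carrier (poly_algebra R V)"
    show "p \<otimes>\<^bsub>poly_algebra R V\<^esub> q \<in> carrier (poly_algebra R V)" using p q conv_polys by simp
    show "p \<otimes>\<^bsub>poly_algebra R V\<^esub> q = q \<otimes>\<^bsub>poly_algebra R V\<^esub> p" 
    proof -
      have pq: "p \<in> polys V" "q \<in> polys V" using p q by auto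
      show ?thesis using conv_comm[OF polys_coeff[OF pq(1)] polys_coeff[OF pq(2)]] by simp
    qed
    fix r assume "r \<in> carrier (poly_algebra R V)"
    then show "(p \<otimes>\<^bsub>poly_algebra R V\<^esub> q) \<otimes>\<^bsub>poly_algebra R V\<^esub> r
        = p \<otimes>\<^bsub>poly_algebra R V\<^esub> (q \<otimes>\<^bsub>poly_algebra R V\<^esub> r)"
      using conv_assoc[of p V q r] p q by simp
  qed (auto intro: indexed_pset.indexed_const)
  fix p q r assume "p \<in> carrier (poly_algebra R V)" "q \<in> carrier (poly_algebra R V)" "r \<in> carrier (poly_algebra R V)"
  then have c: "p m \<in> carrier R" "q m \<in> carrier R" "r m \<in> carrier R" for m using polys_coeff by auto
  show "(p \<oplus>\<^bsub>poly_algebra R V\<^esub> q) \<otimes>\<^bsub>poly_algebra R V\<^esub> r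
      = p \<otimes>\<^bsub>poly_algebra R V\<^esub> r \<oplus>\<^bsub>poly_algebra R V\<^esub> q \<otimes>\<^bsub>poly_algebra R V\<^esub> r"
    using conv_padd[OF c] by simp
qed

lemma poly_algebra_module: "module R (poly_algebra R V)"
proof (rule moduleI[OF is_cring])
  interpret P: cring "poly_algebra R V" by (rule poly_algebra_cring)
  show "abelian_group (poly_algebra R V)" by (rule P.is_abelian_group)
next
  fix a b p assume "a \<in> carrier R" "b \<in> carrier R" "p \<in> carrier (poly_algebra R V)"
  then have h: "a \<in> carrier R" "b \<in> carrier R" "p m \<in> carrier R" for m using polys_coeff by auto
  show "(a \<oplus> b) \<odot>\<^bsub>poly_algebra R V\<^esub> p
      = (a \<odot>\<^bsub>poly_algebra R V\<^esub> p) \<oplus>\<^bsub>poly_algebra R V\<^esub> (b \<odot>\<^bsub>poly_algebra R V\<^esub> p)"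
    using h by (simp add: pscale_def indexed_padd_def l_distr)
  show "a \<otimes> b \<odot>\<^bsub>poly_algebra R V\<^esub> p = a \<odot>\<^bsub>poly_algebra R V\<^esub> (b \<odot>\<^bsub>poly_algebra R V\<^esub> p)"
    using h by (simp add: pscale_def m_assoc)
next
  fix a p q assume "a \<in> carrier R" "p \<in> carrier (poly_algebra R V)" "q \<in> carrier (poly_algebra R V)"
  then have h: "a \<in> carrier R" "p m \<in> carrier R" "q m \<in> carrier R" for m using polys_coeff by auto
  show "a \<odot>\<^bsub>poly_algebra R V\<^esub> (p \<oplus>\<^bsub>poly_algebra R V\<^esub> q)
      = (a \<odot>\<^bsub>poly_algebra R V\<^esub> p) \<oplus>\<^bsub>poly_algebra R V\<^esub> (a \<odot>\<^bsub>poly_algebra R V\<^esub> q)"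
    using h by (simp add: pscale_def indexed_padd_def r_distr)
next
  fix p assume "p \<in> carrier (poly_algebra R V)"
  then have "p m \<in> carrier R" for m using polys_coeff by auto
  then show "\<one> \<odot>\<^bsub>poly_algebra R V\<^esub> p = p" by (simp add: pscale_def)
qed (simp add: pscale_closed)

lemma poly_algebra_minus:
  assumes "p \<in> polys V" "q \<in> polys V"
  shows "p \<ominus>\<^bsub>poly_algebra R V\<^esub> q = (\<lambda>m. p m \<ominus> q m)"
proof -
  interpret P: module R "poly_algebra R V" by (rule poly_algebra_module)
  have "\<ominus>\<^bsub>poly_algebra R V\<^esub> q = pscale (\<ominus> \<one>) q"
    using P.smult_l_minus[OF one_closed, of q] assms(2) P.smult_one[of q] by simp
  then show ?thesis
    using polys_coeff[OF assms(1)] polys_coeff[OF assms(2)]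
    by (simp add: a_minus_def indexed_padd_def pscale_def l_minus)
qed

lemma indexed_var_poly: "x \<in> V \<Longrightarrow> indexed_var x \<in> polys V"
  unfolding indexed_var_def by (intro indexed_pset.indexed_pmult indexed_pset.indexed_const) auto

lemma indexed_var_apply: "indexed_var x m = (if m = {#x#} then \<one> else \<zero>)"
  unfolding indexed_var_def indexed_pmult_def indexed_const_def
  by (auto simp: diff_single_eq_union dest!: multi_member_split)

lemma conv_var:
  assumes "\<And>m. p m \<in> carrier R"
  shows "conv p (indexed_var x) = indexed_pmult p x"
proof -
  have "conv p (indexed_var x) = conv (indexed_var x) p"
    by (rule conv_comm) (use assms in \<open>auto simp: indexed_var_apply\<close>)
  also have "\<dots> = indexed_pmult (conv (indexed_const \<one>) p) x"
    unfolding indexed_var_def by (rule conv_pmult) (use assms in \<open>auto simp: indexed_const_def\<close>)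
  also have "conv (indexed_const \<one>) p = p" using conv_const[OF one_closed, of p] assms by (simp add: pscale_def)
  finally show ?thesis .
qed

lemma finite_poly_support: "p \<in> polys V \<Longrightarrow> finite {m. p m \<noteq> \<zero>}"
proof (induction rule: indexed_pset.induct)
  case (indexed_const k)
  have "{m. indexed_const k m \<noteq> \<zero>} \<subseteq> {{#}}" by (auto simp: indexed_const_def)
  then show ?case by (rule finite_subset) simp
next
  case (indexed_padd p q)
  have "{m. indexed_padd p q m \<noteq> \<zero>} \<subseteq> {m. p m \<noteq> \<zero>} \<union> {m. q m \<noteq> \<zero>}"
    by (auto simp: indexed_padd_def)
  then show ?case using indexed_padd by (meson finite_Un finite_subset)
next
  case (indexed_pmult p i)
  have "{m. indexed_pmult p i m \<noteq> \<zero>} \<subseteq> add_mset i ` {m. p m \<noteq> \<zero>}"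
    by (auto simp: indexed_pmult_def image_iff split: if_splits) (metis insert_DiffM)
  then show ?case using indexed_pmult finite_surj by blast
qed

section \<open>Free modules\<close>

definition free_module :: "'k set \<Rightarrow> ('a, 'k \<Rightarrow> 'a) module" where
  "free_module A = \<lparr>carrier = {f. (\<forall>p. f p \<in> carrier R) \<and> finite {p. f p \<noteq> \<zero>} \<and> {p. f p \<noteq> \<zero>} \<subseteq> A},
     monoid.mult = undefined, one = undefined, ring.zero = (\<lambda>_. \<zero>), ring.add = (\<lambda>f g p. f p \<oplus> g p),
     smult = (\<lambda>r f p. r \<otimes> f p)\<rparr>"

lemma free_module_sel:
  "f \<in> carrier (free_module A) \<longleftrightarrow> (\<forall>p. f p \<in> carrier R) \<and> finite {p. f p \<noteq> \<zero>} \<and> (\<forall>p. f p \<noteq> \<zero> \<longrightarrow> p \<in> A)"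
  "\<zero>\<^bsub>free_module A\<^esub> = (\<lambda>_. \<zero>)"
  "f \<oplus>\<^bsub>free_module A\<^esub> g = (\<lambda>p. f p \<oplus> g p)"
  "r \<odot>\<^bsub>free_module A\<^esub> f = (\<lambda>p. r \<otimes> f p)"
  by (auto simp: free_module_def)

context
  notes free_module_sel [simp]
begin

lemma free_module_add_support:
  assumes "finite {p. f p \<noteq> \<zero>}" "finite {p. g p \<noteq> \<zero>}"
  shows "finite {p. f p \<oplus> g p \<noteq> \<zero>}"
proof -
  have "{p. f p \<oplus> g p \<noteq> \<zero>} \<subseteq> {p. f p \<noteq> \<zero>} \<union> {p. g p \<noteq> \<zero>}" by auto
  then show ?thesis using assms by (meson finite_Un finite_subset)
qed

lemma free_module_smult_support:
  assumes "finite {p. f p \<noteq> \<zero>}" "r \<in> carrier R"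
  shows "finite {p. r \<otimes> f p \<noteq> \<zero>}"
proof -
  have "{p. r \<otimes> f p \<noteq> \<zero>} \<subseteq> {p. f p \<noteq> \<zero>}" using assms(2) by auto
  then show ?thesis using assms(1) by (rule finite_subset)
qed

lemma module_free_module: "module R (free_module A)"
proof (rule moduleI[OF is_cring])
  show "abelian_group (free_module A)"
  proof (rule abelian_groupI)
    fix f assume f: "f \<in> carrier (free_module A)"
    have "{p. \<ominus> f p \<noteq> \<zero>} = {p. f p \<noteq> \<zero>}"
      using f by (auto simp: add.inv_eq_1_iff)
    then show "\<exists>g\<in>carrier (free_module A). g \<oplus>\<^bsub>free_module A\<^esub> f = \<zero>\<^bsub>free_module A\<^esub>"
      using f by (intro bexI[of _ "\<lambda>p. \<ominus> f p"]) (auto simp: l_neg)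
  next
    fix f g assume fg: "f \<in> carrier (free_module A)" "g \<in> carrier (free_module A)"
    have "p \<in> A" if "f p \<oplus> g p \<noteq> \<zero>" for p using that fg by (cases "f p = \<zero>") auto
    then show "f \<oplus>\<^bsub>free_module A\<^esub> g \<in> carrier (free_module A)"
      using fg free_module_add_support[of f g] by auto
    show "f \<oplus>\<^bsub>free_module A\<^esub> g = g \<oplus>\<^bsub>free_module A\<^esub> f" using fg by (auto simp: a_comm)
    fix h assume "h \<in> carrier (free_module A)"
    then show "f \<oplus>\<^bsub>free_module A\<^esub> g \<oplus>\<^bsub>free_module A\<^esub> h = f \<oplus>\<^bsub>free_module A\<^esub> (g \<oplus>\<^bsub>free_module A\<^esub> h)"
      using fg by (auto simp: a_assoc)
  qed auto
  fix r f assume rf: "r \<in> carrier R" "f \<in> carrier (free_module A)"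
  have "p \<in> A" if "r \<otimes> f p \<noteq> \<zero>" for p using that rf by (cases "f p = \<zero>") auto
  with rf show "r \<odot>\<^bsub>free_module A\<^esub> f \<in> carrier (free_module A)"
    using free_module_smult_support[of f r] by auto
qed (auto simp: l_distr r_distr m_assoc)

definition basis_vec :: "'k \<Rightarrow> 'k \<Rightarrow> 'a" where
  "basis_vec p = (\<lambda>q. if q = p then \<one> else \<zero>)"

lemma basis_vec_closed: "p \<in> A \<Longrightarrow> basis_vec p \<in> carrier (free_module A)"
proof -
  assume p: "p \<in> A"
  have "{q. basis_vec p q \<noteq> \<zero>} \<subseteq> {p}" by (auto simp: basis_vec_def)
  then have "finite {q. basis_vec p q \<noteq> \<zero>}" "{q. basis_vec p q \<noteq> \<zero>} \<subseteq> A"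
    using p by (auto intro: finite_subset)
  then show ?thesis by (auto simp: basis_vec_def)
qed

lemma free_module_induct [consumes 1, case_names zero add]:
  assumes f: "f \<in> carrier (free_module A)" and z: "Q (\<lambda>_. \<zero>)"
    and step: "\<And>g r p. g \<in> carrier (free_module A) \<Longrightarrow> Q g \<Longrightarrow> r \<in> carrier R \<Longrightarrow> p \<in> A \<Longrightarrow>
      Q (r \<odot>\<^bsub>free_module A\<^esub> basis_vec p \<oplus>\<^bsub>free_module A\<^esub> g)"
  shows "Q f"
proof -
  have "finite {p. f p \<noteq> \<zero>}" using f by simp
  then show ?thesis using f
  proof (induction "{p. f p \<noteq> \<zero>}" arbitrary: f rule: finite_induct)
    case empty
    then have "f = (\<lambda>_. \<zero>)" by auto
    then show ?case using z by simp
  next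
    case (insert p S)
    define g where "g = f(p := \<zero>)"
    have sup: "{q. g q \<noteq> \<zero>} = S" using insert(2,4) by (auto simp: g_def)
    have g: "g \<in> carrier (free_module A)"
      using insert(1,4,5) sup by (auto simp: g_def)
    have p: "p \<in> A" "f p \<in> carrier R" using insert(4,5) by auto
    have "f = f p \<odot>\<^bsub>free_module A\<^esub> basis_vec p \<oplus>\<^bsub>free_module A\<^esub> g"
      using insert(5) by (auto simp: g_def basis_vec_def)
    then show ?case using step[OF g insert(3)[OF sup[symmetric] g] p(2,1)] by simp
  qed
qed

end

end

context module begin

definition lin_ext :: "('k \<Rightarrow> 'c) \<Rightarrow> ('k \<Rightarrow> 'a) \<Rightarrow> 'c" where
  "lin_ext g f = (\<Oplus>\<^bsub>M\<^esub>p\<in>{p. f p \<noteq> \<zero>}. f p \<odot>\<^bsub>M\<^esub> g p)"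

context
  notes free_module_sel [simp]
  fixes A :: "'k set" and g :: "'k \<Rightarrow> 'c"
  assumes g: "\<And>p. p \<in> A \<Longrightarrow> g p \<in> carrier M"
begin

lemma lin_ext_superset:
  assumes f: "f \<in> carrier (free_module A)" and S: "finite S" "{p. f p \<noteq> \<zero>} \<subseteq> S" "S \<subseteq> A"
  shows "lin_ext g f = (\<Oplus>\<^bsub>M\<^esub>p\<in>S. f p \<odot>\<^bsub>M\<^esub> g p)"
  unfolding lin_ext_def
  by (rule M.add.finprod_mono_neutral_cong_left[OF S(1,2)]) (use f S(3) g in \<open>auto simp: subset_iff\<close>)

lemma lin_ext_closed: "f \<in> carrier (free_module A) \<Longrightarrow> lin_ext g f \<in> carrier M"
  unfolding lin_ext_def by (intro M.finsum_closed) (use g in auto)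

lemma lin_ext_add:
  assumes f: "f \<in> carrier (free_module A)" and h: "h \<in> carrier (free_module A)"
  shows "lin_ext g (f \<oplus>\<^bsub>free_module A\<^esub> h) = lin_ext g f \<oplus>\<^bsub>M\<^esub> lin_ext g h"
proof -
  interpret F: module R "free_module A" by (rule module_free_module)
  let ?S = "{p. f p \<noteq> \<zero>} \<union> {p. h p \<noteq> \<zero>}"
  have S: "finite ?S" "?S \<subseteq> A" using f h by auto
  have sub: "{p. (f \<oplus>\<^bsub>free_module A\<^esub> h) p \<noteq> \<zero>} \<subseteq> ?S" using f h by auto
  have fh: "f \<oplus>\<^bsub>free_module A\<^esub> h \<in> carrier (free_module A)" using f h by (rule F.a_closed)
  have "lin_ext g (f \<oplus>\<^bsub>free_module A\<^esub> h) = (\<Oplus>\<^bsub>M\<^esub>p\<in>?S. (f p \<oplus> h p) \<odot>\<^bsub>M\<^esub> g p)"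
    using lin_ext_superset[OF fh S(1) sub S(2)] by simp
  also have "\<dots> = (\<Oplus>\<^bsub>M\<^esub>p\<in>?S. f p \<odot>\<^bsub>M\<^esub> g p \<oplus>\<^bsub>M\<^esub> h p \<odot>\<^bsub>M\<^esub> g p)"
    by (rule M.finsum_cong') (use f h g S(2) in \<open>auto simp: smult_l_distr\<close>)
  also have "\<dots> = (\<Oplus>\<^bsub>M\<^esub>p\<in>?S. f p \<odot>\<^bsub>M\<^esub> g p) \<oplus>\<^bsub>M\<^esub> (\<Oplus>\<^bsub>M\<^esub>p\<in>?S. h p \<odot>\<^bsub>M\<^esub> g p)"
    by (rule M.finsum_addf) (use f h g S(2) in auto)
  also have "\<dots> = lin_ext g f \<oplus>\<^bsub>M\<^esub> lin_ext g h"
    using lin_ext_superset[OF f S(1) _ S(2)] lin_ext_superset[OF h S(1) _ S(2)] by simp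
  finally show ?thesis .
qed

lemma lin_ext_smult:
  assumes f: "f \<in> carrier (free_module A)" and r: "r \<in> carrier R"
  shows "lin_ext g (r \<odot>\<^bsub>free_module A\<^esub> f) = r \<odot>\<^bsub>M\<^esub> lin_ext g f"
proof -
  interpret F: module R "free_module A" by (rule module_free_module)
  let ?S = "{p. f p \<noteq> \<zero>}"
  have S: "finite ?S" "?S \<subseteq> A" using f by auto
  have sub: "{p. (r \<odot>\<^bsub>free_module A\<^esub> f) p \<noteq> \<zero>} \<subseteq> ?S" using f r by auto
  have rf: "r \<odot>\<^bsub>free_module A\<^esub> f \<in> carrier (free_module A)" using r f by (rule F.smult_closed)
  have "lin_ext g (r \<odot>\<^bsub>free_module A\<^esub> f) = (\<Oplus>\<^bsub>M\<^esub>p\<in>?S. (r \<otimes> f p) \<odot>\<^bsub>M\<^esub> g p)"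
    using lin_ext_superset[OF rf S(1) sub S(2)] by simp
  also have "\<dots> = (\<Oplus>\<^bsub>M\<^esub>p\<in>?S. r \<odot>\<^bsub>M\<^esub> (f p \<odot>\<^bsub>M\<^esub> g p))"
    by (rule M.finsum_cong') (use f r g S(2) in \<open>auto simp: smult_assoc1\<close>)
  also have "\<dots> = r \<odot>\<^bsub>M\<^esub> lin_ext g f"
    unfolding lin_ext_def by (rule finsum_smult_ldistr[symmetric]) (use f r g S in auto)
  finally show ?thesis .
qed

lemma lin_ext_basis_vec:
  assumes p: "p \<in> A"
  shows "lin_ext g (basis_vec p) = g p"
proof -
  have "lin_ext g (basis_vec p) = (\<Oplus>\<^bsub>M\<^esub>q\<in>{p}. basis_vec p q \<odot>\<^bsub>M\<^esub> g q)"
    by (rule lin_ext_superset[OF basis_vec_closed[OF p]]) (use p in \<open>auto simp: basis_vec_def\<close>)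
  also have "\<dots> = g p" using g[OF p] by (simp add: M.finsum_singleton basis_vec_def)
  finally show ?thesis .
qed

lemma lin_ext_zero: "lin_ext g (\<lambda>_. \<zero>) = \<zero>\<^bsub>M\<^esub>"
  by (simp add: lin_ext_def)

lemma submodule_lin_ext_vimage:
  assumes "submodule N R M"
  shows "submodule {f \<in> carrier (free_module A). lin_ext g f \<in> N} R (free_module A)"
proof -
  interpret F: module R "free_module A" by (rule module_free_module)
  show ?thesis
  proof (rule F.submoduleI')
    show "\<zero>\<^bsub>free_module A\<^esub> \<in> {f \<in> carrier (free_module A). lin_ext g f \<in> N}"
      using lin_ext_zero submodule_zero[OF assms] by simp
  qed (use lin_ext_add lin_ext_smult submoduleE[OF assms] F.a_closed F.smult_closed in
      \<open>auto simp del: free_module_sel\<close>)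
qed

end

end

context module begin

lemma diff_add_cancel:
  assumes "x \<in> carrier M" "y \<in> carrier M"
  shows "(x \<ominus>\<^bsub>M\<^esub> y) \<oplus>\<^bsub>M\<^esub> y = x"
  using assms by (simp add: a_minus_def M.a_assoc M.l_neg)

lemma diff_zero_iff:
  assumes "x \<in> carrier M" "y \<in> carrier M"
  shows "x \<ominus>\<^bsub>M\<^esub> y = \<zero>\<^bsub>M\<^esub> \<longleftrightarrow> x = y"
  using assms diff_add_cancel[OF assms] by (auto simp: a_minus_def M.r_neg)

lemma submodule_diff_mem:
  assumes "submodule N R M" "x \<in> carrier M" "y \<in> carrier M" "x \<ominus>\<^bsub>M\<^esub> y \<in> N"
  shows "x \<in> N \<longleftrightarrow> y \<in> N"
proof
  show "x \<in> N" if "y \<in> N"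
    using submoduleE(5)[OF assms(1,4) that] diff_add_cancel[OF assms(2,3)] by simp
  show "y \<in> N" if "x \<in> N"
  proof -
    have "x \<ominus>\<^bsub>M\<^esub> (x \<ominus>\<^bsub>M\<^esub> y) = y"
      using assms(2,3) by (simp add: a_minus_def M.minus_add M.a_assoc[symmetric] M.r_neg)
    then show ?thesis using submodule_minus[OF assms(1) that assms(4)] by simp
  qed
qed

lemma submodule_diff_trans:
  assumes "submodule N R M" "x \<in> carrier M" "y \<in> carrier M" "z \<in> carrier M"
    and "x \<ominus>\<^bsub>M\<^esub> y \<in> N" "y \<ominus>\<^bsub>M\<^esub> z \<in> N"
  shows "x \<ominus>\<^bsub>M\<^esub> z \<in> N"
proof -
  have "(x \<ominus>\<^bsub>M\<^esub> y) \<oplus>\<^bsub>M\<^esub> (y \<ominus>\<^bsub>M\<^esub> z) = ((x \<ominus>\<^bsub>M\<^esub> y) \<oplus>\<^bsub>M\<^esub> y) \<oplus>\<^bsub>M\<^esub> \<ominus>\<^bsub>M\<^esub> z"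
    using assms(2-4) by (simp add: a_minus_def M.a_assoc)
  also have "\<dots> = x \<ominus>\<^bsub>M\<^esub> z" using diff_add_cancel[OF assms(2,3)] by (simp add: a_minus_def)
  finally show ?thesis using submoduleE(5)[OF assms(1,5,6)] by simp
qed

lemma submodule_diff_add:
  assumes "submodule N R M" "x \<in> carrier M" "y \<in> carrier M" "x' \<in> carrier M" "y' \<in> carrier M"
    and "x \<ominus>\<^bsub>M\<^esub> y \<in> N" "x' \<ominus>\<^bsub>M\<^esub> y' \<in> N"
  shows "(x \<oplus>\<^bsub>M\<^esub> x') \<ominus>\<^bsub>M\<^esub> (y \<oplus>\<^bsub>M\<^esub> y') \<in> N"
proof -
  have "(x \<oplus>\<^bsub>M\<^esub> x') \<ominus>\<^bsub>M\<^esub> (y \<oplus>\<^bsub>M\<^esub> y') = (x \<ominus>\<^bsub>M\<^esub> y) \<oplus>\<^bsub>M\<^esub> (x' \<ominus>\<^bsub>M\<^esub> y')"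
    using assms(2-5) by (simp add: a_minus_def M.minus_add M.a_ac)
  then show ?thesis using submoduleE(5)[OF assms(1,6,7)] by simp
qed

lemma submodule_diff_smult:
  assumes "submodule N R M" "x \<in> carrier M" "y \<in> carrier M" "r \<in> carrier R" "x \<ominus>\<^bsub>M\<^esub> y \<in> N"
  shows "r \<odot>\<^bsub>M\<^esub> x \<ominus>\<^bsub>M\<^esub> r \<odot>\<^bsub>M\<^esub> y \<in> N"
proof -
  have "r \<odot>\<^bsub>M\<^esub> x \<ominus>\<^bsub>M\<^esub> r \<odot>\<^bsub>M\<^esub> y = r \<odot>\<^bsub>M\<^esub> (x \<ominus>\<^bsub>M\<^esub> y)"
    using assms(2-4) by (simp add: a_minus_def smult_r_distr smult_r_minus)
  then show ?thesis using submoduleE(4)[OF assms(1,4,5)] by simp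
qed

lemma lin_ext_diff:
  assumes g: "\<And>p. p \<in> A \<Longrightarrow> g p \<in> carrier M"
    and f: "f \<in> carrier (free_module A)" and h: "h \<in> carrier (free_module A)"
  shows "lin_ext g (f \<ominus>\<^bsub>free_module A\<^esub> h) = lin_ext g f \<ominus>\<^bsub>M\<^esub> lin_ext g h"
proof -
  interpret F: module R "free_module A" by (rule module_free_module)
  have d: "f \<ominus>\<^bsub>free_module A\<^esub> h \<in> carrier (free_module A)" using f h by (rule F.minus_closed)
  note c = lin_ext_closed[where A = A and g = g, OF g d] lin_ext_closed[where A = A and g = g, OF g f] lin_ext_closed[where A = A and g = g, OF g h]
  have cancel: "x \<oplus>\<^bsub>M\<^esub> y \<ominus>\<^bsub>M\<^esub> y = x" if "x \<in> carrier M" "y \<in> carrier M" for x y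
    using that by (simp add: a_minus_def M.a_assoc M.r_neg)
  have "lin_ext g f = lin_ext g (f \<ominus>\<^bsub>free_module A\<^esub> h) \<oplus>\<^bsub>M\<^esub> lin_ext g h"
    using lin_ext_add[where A = A and g = g, OF g d h] F.diff_add_cancel[OF f h] by simp
  then show ?thesis using cancel[OF c(1,3)] by metis
qed

end

section \<open>The symmetric square of an ideal\<close>

text \<open>\<open>S\<^sub>2(I)\<close> is presented as the quotient of the free module \<open>F\<close> on \<open>I \<times> I\<close> by the submodule \<open>W\<close>
  of bilinearity and symmetry relations.\<close>

locale ideal_square = cring R for R (structure) + fixes I
  assumes I: "ideal I R"
begin

abbreviation F :: "('a, 'a \<times> 'a \<Rightarrow> 'a) module" where
  "F \<equiv> free_module (I \<times> I)"

abbreviation e :: "'a \<Rightarrow> 'a \<Rightarrow> 'a \<times> 'a \<Rightarrow> 'a" where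
  "e a b \<equiv> basis_vec (a, b)"

interpretation F: module R F by (rule module_free_module)
interpretation S: module R "self_module R" by (rule module_self_module)

lemma Ic: "a \<in> I \<Longrightarrow> a \<in> carrier R"
  using idealD(1)[OF I] .

lemma e_closed: "a \<in> I \<Longrightarrow> b \<in> I \<Longrightarrow> e a b \<in> carrier F"
  by (rule basis_vec_closed) simp

definition relations :: "('a \<times> 'a \<Rightarrow> 'a) set" where
  "relations = {e (a \<oplus> b) c \<ominus>\<^bsub>F\<^esub> (e a c \<oplus>\<^bsub>F\<^esub> e b c) |a b c. a \<in> I \<and> b \<in> I \<and> c \<in> I}
     \<union> {e (r \<otimes> a) c \<ominus>\<^bsub>F\<^esub> (r \<odot>\<^bsub>F\<^esub> e a c) |r a c. r \<in> carrier R \<and> a \<in> I \<and> c \<in> I}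
     \<union> {e a b \<ominus>\<^bsub>F\<^esub> e b a |a b. a \<in> I \<and> b \<in> I}"

definition W :: "('a \<times> 'a \<Rightarrow> 'a) set" where
  "W = F.span relations"

lemma relations_closed: "relations \<subseteq> carrier F"
  using idealD(3,4)[OF I]
  by (auto simp: relations_def
      intro!: F.minus_closed F.a_closed F.smult_closed e_closed)

lemma W_submodule: "submodule W R F"
  unfolding W_def by (rule F.submodule_span[OF relations_closed])

lemma W_relations:
  assumes "W \<subseteq> N" "a \<in> I" "c \<in> I"
  shows "b \<in> I \<Longrightarrow> e (a \<oplus> b) c \<ominus>\<^bsub>F\<^esub> (e a c \<oplus>\<^bsub>F\<^esub> e b c) \<in> N"
    and "r \<in> carrier R \<Longrightarrow> e (r \<otimes> a) c \<ominus>\<^bsub>F\<^esub> (r \<odot>\<^bsub>F\<^esub> e a c) \<in> N"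
    and "e a c \<ominus>\<^bsub>F\<^esub> e c a \<in> N"
proof -
  have "relations \<subseteq> N" using F.span_base[of relations] assms(1) unfolding W_def by blast
  then show "b \<in> I \<Longrightarrow> e (a \<oplus> b) c \<ominus>\<^bsub>F\<^esub> (e a c \<oplus>\<^bsub>F\<^esub> e b c) \<in> N"
    and "r \<in> carrier R \<Longrightarrow> e (r \<otimes> a) c \<ominus>\<^bsub>F\<^esub> (r \<odot>\<^bsub>F\<^esub> e a c) \<in> N"
    and "e a c \<ominus>\<^bsub>F\<^esub> e c a \<in> N"
    using assms(2,3) unfolding relations_def by blast+
qed

lemma e_mem_commute:
  assumes "submodule N R F" "W \<subseteq> N" "a \<in> I" "b \<in> I"
  shows "e a b \<in> N \<longleftrightarrow> e b a \<in> N"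
  by (rule F.submodule_diff_mem[OF assms(1) e_closed e_closed W_relations(3)])
     (use assms in auto)

text \<open>Modulo \<open>N\<close> the symbol \<open>e a c\<close> is linear in \<open>a\<close>.
  This extends a statement about tensors from generators of an ideal to all its elements.\<close>

lemma ideal_e_mem:
  assumes N: "submodule N R F" "W \<subseteq> N" and c: "c \<in> I"
  shows "ideal {a \<in> I. e a c \<in> N} R"
proof (rule ideal_criterion)
  have smult: "e (r \<otimes> a) c \<in> N" if "r \<in> carrier R" "a \<in> I" "r \<odot>\<^bsub>F\<^esub> e a c \<in> N" for r a
    using F.submodule_diff_mem[OF N(1) e_closed[OF idealD(4)[OF I that(1,2)] c]
        F.smult_closed[OF that(1) e_closed[OF that(2) c]] W_relations(2)[OF N(2) that(2) c that(1)]] that(3)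
    by blast
  fix a assume a: "a \<in> {a \<in> I. e a c \<in> N}"
  show "a \<in> carrier R" using a Ic by blast
  show "r \<otimes> a \<in> {a \<in> I. e a c \<in> N}" if "r \<in> carrier R" for r
    using smult[OF that, of a] a F.submoduleE(4)[OF N(1) that] idealD(4)[OF I that] by blast
  fix b assume b: "b \<in> {a \<in> I. e a c \<in> N}"
  have "e a c \<oplus>\<^bsub>F\<^esub> e b c \<in> N" using a b F.submoduleE(5)[OF N(1)] by blast
  moreover have "e (a \<oplus> b) c \<ominus>\<^bsub>F\<^esub> (e a c \<oplus>\<^bsub>F\<^esub> e b c) \<in> N"
    using W_relations(1)[OF N(2)] a b c by blast
  moreover have "e (a \<oplus> b) c \<in> carrier F" "e a c \<oplus>\<^bsub>F\<^esub> e b c \<in> carrier F"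
    using a b c idealD(3)[OF I] by (auto intro!: F.a_closed e_closed)
  ultimately show "a \<oplus> b \<in> {a \<in> I. e a c \<in> N}"
    using F.submodule_diff_mem[OF N(1)] a b idealD(3)[OF I] by blast
next
  have z: "\<zero> \<in> I" using idealD(2)[OF I] .
  have "\<zero> \<odot>\<^bsub>F\<^esub> e \<zero> c \<in> N"
    using F.smult_l_null[OF e_closed[OF z c]] F.submodule_zero[OF N(1)] by simp
  then have "e (\<zero> \<otimes> \<zero>) c \<in> N"
    using F.submodule_diff_mem[OF N(1) e_closed[OF idealD(4)[OF I zero_closed z] c]
        F.smult_closed[OF zero_closed e_closed[OF z c]] W_relations(2)[OF N(2) z c zero_closed]]
    by blast
  then show "\<zero> \<in> {a \<in> I. e a c \<in> N}" using z by simp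
qed

section \<open>The multiplication map onto the square of \<open>I\<close>\<close>

definition pair_mult :: "'a \<times> 'a \<Rightarrow> 'a" where
  "pair_mult = (\<lambda>(a, b). a \<otimes> b)"

definition ev :: "('a \<times> 'a \<Rightarrow> 'a) \<Rightarrow> 'a" where
  "ev = S.lin_ext pair_mult"

text \<open>Modulo \<open>W\<close> this is the kernel of the map from \<open>S\<^sub>2(I)\<close>
  to \<open>I\<^sup>2\<close>, an object in which no reduction occurs.\<close>

definition ev_ker :: "('a \<times> 'a \<Rightarrow> 'a) set" where
  "ev_ker = {f \<in> carrier F. ev f = \<zero>}"

lemma ev_arg: "p \<in> I \<times> I \<Longrightarrow> pair_mult p \<in> carrier (self_module R)"
  using Ic by (auto simp: pair_mult_def)

lemma ev_closed: "f \<in> carrier F \<Longrightarrow> ev f \<in> carrier R"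
  unfolding ev_def using S.lin_ext_closed[where A = "I \<times> I" and g = pair_mult, OF ev_arg] by simp

lemma ev_add: "f \<in> carrier F \<Longrightarrow> g \<in> carrier F \<Longrightarrow> ev (f \<oplus>\<^bsub>F\<^esub> g) = ev f \<oplus> ev g"
  unfolding ev_def using S.lin_ext_add[where A = "I \<times> I" and g = pair_mult, OF ev_arg] by simp

lemma ev_smult: "f \<in> carrier F \<Longrightarrow> r \<in> carrier R \<Longrightarrow> ev (r \<odot>\<^bsub>F\<^esub> f) = r \<otimes> ev f"
  unfolding ev_def using S.lin_ext_smult[where A = "I \<times> I" and g = pair_mult, OF ev_arg] by simp

lemma ev_e: "a \<in> I \<Longrightarrow> b \<in> I \<Longrightarrow> ev (e a b) = a \<otimes> b"
  unfolding ev_def using S.lin_ext_basis_vec[where A = "I \<times> I" and g = pair_mult and p = "(a, b)", OF ev_arg] by (simp add: pair_mult_def)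

lemma ev_diff_cancel:
  assumes "f \<in> carrier F" "g \<in> carrier F"
  shows "ev f = ev (f \<ominus>\<^bsub>F\<^esub> g) \<oplus> ev g"
  using ev_add[OF F.minus_closed[OF assms] assms(2)] F.diff_add_cancel[OF assms] by simp

lemma ev_vimage_submodule: "ideal K R \<Longrightarrow> submodule {f \<in> carrier F. ev f \<in> K} R F"
  unfolding ev_def by (rule S.submodule_lin_ext_vimage[where A = "I \<times> I" and g = pair_mult, OF ev_arg]) (simp_all add: submodule_self_module)

lemma ev_ker_submodule: "submodule ev_ker R F"
  using ev_vimage_submodule[OF zeroideal] by (simp add: ev_ker_def)

lemma W_le_ev_ker: "W \<subseteq> ev_ker"
  unfolding W_def
proof (rule F.span_least[OF ev_ker_submodule], rule subsetI)
  fix f assume f: "f \<in> relations"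
  have 0: "x \<ominus>\<^bsub>F\<^esub> y \<in> ev_ker" if "x \<in> carrier F" "y \<in> carrier F" "ev x = ev y" for x y
  proof -
    have c: "ev (x \<ominus>\<^bsub>F\<^esub> y) \<in> carrier R" "ev y \<in> carrier R"
      using that F.minus_closed ev_closed by auto
    have "ev (x \<ominus>\<^bsub>F\<^esub> y) \<oplus> ev y = ev y" using ev_diff_cancel[OF that(1,2)] that(3) by simp
    then have "ev (x \<ominus>\<^bsub>F\<^esub> y) = \<zero>" using c by (simp only: add.r_cancel_one)
    then show ?thesis using F.minus_closed[OF that(1,2)] unfolding ev_ker_def by blast
  qed
  from f consider a b c where "a \<in> I" "b \<in> I" "c \<in> I" "f = e (a \<oplus> b) c \<ominus>\<^bsub>F\<^esub> (e a c \<oplus>\<^bsub>F\<^esub> e b c)"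
    | r a c where "r \<in> carrier R" "a \<in> I" "c \<in> I" "f = e (r \<otimes> a) c \<ominus>\<^bsub>F\<^esub> (r \<odot>\<^bsub>F\<^esub> e a c)"
    | a b where "a \<in> I" "b \<in> I" "f = e a b \<ominus>\<^bsub>F\<^esub> e b a"
    unfolding relations_def by blast
  then show "f \<in> ev_ker"
  proof cases
    case 1
    show ?thesis unfolding 1(4)
      by (rule 0) (use 1 idealD(3)[OF I] Ic in \<open>simp_all add: e_closed F.a_closed ev_add ev_e l_distr\<close>)
  next
    case 2
    show ?thesis unfolding 2(4)
      by (rule 0) (use 2 idealD(4)[OF I] Ic in \<open>simp_all add: e_closed F.smult_closed ev_smult ev_e m_assoc\<close>)
  next
    case 3
    show ?thesis unfolding 3(3)
      by (rule 0) (use 3 Ic in \<open>simp_all add: e_closed ev_e m_comm\<close>)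
  qed
qed

subsection \<open>Koszul relations\<close>

text \<open>This is \<open>N + x \<otimes> I\<close>. A single symbol \<open>e x b\<close> suffices
  in place of a linear combination, since modulo \<open>W\<close> the symbol is linear in
  \<open>b\<close>.\<close>

definition add_tensors :: "('a \<times> 'a \<Rightarrow> 'a) set \<Rightarrow> 'a \<Rightarrow> ('a \<times> 'a \<Rightarrow> 'a) set" where
  "add_tensors N x = {f \<in> carrier F. \<exists>b\<in>I. f \<ominus>\<^bsub>F\<^esub> e x b \<in> N}"

lemma add_tensors_submodule:
  assumes N: "submodule N R F" "W \<subseteq> N" and x: "x \<in> I"
  shows "submodule (add_tensors N x) R F" "N \<subseteq> add_tensors N x" "\<And>b. b \<in> I \<Longrightarrow> e x b \<in> add_tensors N x"
proof -
  \<comment> \<open>The relations impose linearity only in the first slot; symmetry carries it over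
    to the second.\<close>
  have right: "e x (b \<oplus> b') \<ominus>\<^bsub>F\<^esub> (e x b \<oplus>\<^bsub>F\<^esub> e x b') \<in> N" if b: "b \<in> I" "b' \<in> I" for b b'
  proof -
    note bb = idealD(3)[OF I b]
    have 1: "e x (b \<oplus> b') \<ominus>\<^bsub>F\<^esub> e (b \<oplus> b') x \<in> N" by (rule W_relations(3)[OF N(2) x bb])
    have 2: "e (b \<oplus> b') x \<ominus>\<^bsub>F\<^esub> (e b x \<oplus>\<^bsub>F\<^esub> e b' x) \<in> N" by (rule W_relations(1)[OF N(2) b(1) x b(2)])
    have 3: "(e b x \<oplus>\<^bsub>F\<^esub> e b' x) \<ominus>\<^bsub>F\<^esub> (e x b \<oplus>\<^bsub>F\<^esub> e x b') \<in> N"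
      by (rule F.submodule_diff_add[OF N(1)]) (use e_closed x b W_relations(3)[OF N(2)] in blast)+
    have c: "e x (b \<oplus> b') \<in> carrier F" "e (b \<oplus> b') x \<in> carrier F" "e b x \<oplus>\<^bsub>F\<^esub> e b' x \<in> carrier F"
      "e x b \<oplus>\<^bsub>F\<^esub> e x b' \<in> carrier F"
      using e_closed x b bb F.a_closed by blast+
    show ?thesis
      by (rule F.submodule_diff_trans[OF N(1) c(1,2,4) 1 F.submodule_diff_trans[OF N(1) c(2,3,4) 2 3]])
  qed
  have right_smult: "e x (r \<otimes> b) \<ominus>\<^bsub>F\<^esub> (r \<odot>\<^bsub>F\<^esub> e x b) \<in> N" if b: "r \<in> carrier R" "b \<in> I" for r b
  proof -
    note bb = idealD(4)[OF I b]
    have 1: "e x (r \<otimes> b) \<ominus>\<^bsub>F\<^esub> e (r \<otimes> b) x \<in> N" by (rule W_relations(3)[OF N(2) x bb])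
    have 2: "e (r \<otimes> b) x \<ominus>\<^bsub>F\<^esub> (r \<odot>\<^bsub>F\<^esub> e b x) \<in> N" by (rule W_relations(2)[OF N(2) b(2) x b(1)])
    have 3: "r \<odot>\<^bsub>F\<^esub> e b x \<ominus>\<^bsub>F\<^esub> r \<odot>\<^bsub>F\<^esub> e x b \<in> N"
      by (rule F.submodule_diff_smult[OF N(1)]) (use e_closed x b W_relations(3)[OF N(2)] in blast)+
    have c: "e x (r \<otimes> b) \<in> carrier F" "e (r \<otimes> b) x \<in> carrier F" "r \<odot>\<^bsub>F\<^esub> e b x \<in> carrier F"
      "r \<odot>\<^bsub>F\<^esub> e x b \<in> carrier F"
      using e_closed x b bb F.smult_closed by blast+
    show ?thesis
      by (rule F.submodule_diff_trans[OF N(1) c(1,2,4) 1 F.submodule_diff_trans[OF N(1) c(2,3,4) 2 3]])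
  qed
  have z: "\<zero> \<in> I" by (rule idealD(2)[OF I])
  have ez: "e x \<zero> \<in> N"
    using idealD(2)[OF ideal_e_mem[OF N x]] e_mem_commute[OF N x z] by blast
  show sub: "N \<subseteq> add_tensors N x"
    using F.submodule_minus[OF N(1) _ ez] F.submoduleE(1)[OF N(1)] z unfolding add_tensors_def by blast
  show "\<And>b. b \<in> I \<Longrightarrow> e x b \<in> add_tensors N x"
  proof -
    fix b assume b: "b \<in> I"
    have "e x b \<ominus>\<^bsub>F\<^esub> e x b \<in> N"
      using F.diff_zero_iff[OF e_closed[OF x b] e_closed[OF x b]] F.submodule_zero[OF N(1)] by simp
    then show "e x b \<in> add_tensors N x" using b e_closed[OF x b] unfolding add_tensors_def by blast
  qed
  show "submodule (add_tensors N x) R F"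
  proof (rule F.submoduleI')
    show "add_tensors N x \<subseteq> carrier F" unfolding add_tensors_def by blast
    show "\<zero>\<^bsub>F\<^esub> \<in> add_tensors N x" using sub F.submodule_zero[OF N(1)] by blast
  next
    fix f g assume "f \<in> add_tensors N x" "g \<in> add_tensors N x"
    then obtain b b' where h: "f \<in> carrier F" "g \<in> carrier F" "b \<in> I" "b' \<in> I"
      "f \<ominus>\<^bsub>F\<^esub> e x b \<in> N" "g \<ominus>\<^bsub>F\<^esub> e x b' \<in> N" unfolding add_tensors_def by blast
    note ec = e_closed[OF x h(3)] e_closed[OF x h(4)]
    have bb: "b \<oplus> b' \<in> I" by (rule idealD(3)[OF I h(3,4)])
    have 1: "(f \<oplus>\<^bsub>F\<^esub> g) \<ominus>\<^bsub>F\<^esub> (e x b \<oplus>\<^bsub>F\<^esub> e x b') \<in> N"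
      by (rule F.submodule_diff_add[OF N(1) h(1) ec(1) h(2) ec(2) h(5,6)])
    have "e x (b \<oplus> b') \<ominus>\<^bsub>F\<^esub> (e x b \<oplus>\<^bsub>F\<^esub> e x b') \<in> N" by (rule right[OF h(3,4)])
    then have "\<ominus>\<^bsub>F\<^esub> (e x (b \<oplus> b') \<ominus>\<^bsub>F\<^esub> (e x b \<oplus>\<^bsub>F\<^esub> e x b')) \<in> N" by (rule F.submoduleE(3)[OF N(1)])
    moreover have "\<ominus>\<^bsub>F\<^esub> (e x (b \<oplus> b') \<ominus>\<^bsub>F\<^esub> (e x b \<oplus>\<^bsub>F\<^esub> e x b')) = (e x b \<oplus>\<^bsub>F\<^esub> e x b') \<ominus>\<^bsub>F\<^esub> e x (b \<oplus> b')"
      using e_closed[OF x bb] F.a_closed[OF ec]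
      by (simp add: a_minus_def F.minus_add F.a_comm)
    ultimately have 2: "(e x b \<oplus>\<^bsub>F\<^esub> e x b') \<ominus>\<^bsub>F\<^esub> e x (b \<oplus> b') \<in> N" by simp
    have "(f \<oplus>\<^bsub>F\<^esub> g) \<ominus>\<^bsub>F\<^esub> e x (b \<oplus> b') \<in> N"
      by (rule F.submodule_diff_trans[OF N(1) F.a_closed[OF h(1,2)] F.a_closed[OF ec] e_closed[OF x bb] 1 2])
    then show "f \<oplus>\<^bsub>F\<^esub> g \<in> add_tensors N x"
      using F.a_closed[OF h(1,2)] bb unfolding add_tensors_def by blast
  next
    fix r f assume r: "r \<in> carrier R" and "f \<in> add_tensors N x"
    then obtain b where h: "f \<in> carrier F" "b \<in> I" "f \<ominus>\<^bsub>F\<^esub> e x b \<in> N" unfolding add_tensors_def by blast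
    note ec = e_closed[OF x h(2)]
    have bb: "r \<otimes> b \<in> I" by (rule idealD(4)[OF I r h(2)])
    have 1: "r \<odot>\<^bsub>F\<^esub> f \<ominus>\<^bsub>F\<^esub> r \<odot>\<^bsub>F\<^esub> e x b \<in> N" by (rule F.submodule_diff_smult[OF N(1) h(1) ec r h(3)])
    have "\<ominus>\<^bsub>F\<^esub> (e x (r \<otimes> b) \<ominus>\<^bsub>F\<^esub> r \<odot>\<^bsub>F\<^esub> e x b) \<in> N"
      by (rule F.submoduleE(3)[OF N(1) right_smult[OF r h(2)]])
    moreover have "\<ominus>\<^bsub>F\<^esub> (e x (r \<otimes> b) \<ominus>\<^bsub>F\<^esub> r \<odot>\<^bsub>F\<^esub> e x b) = r \<odot>\<^bsub>F\<^esub> e x b \<ominus>\<^bsub>F\<^esub> e x (r \<otimes> b)"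
      using e_closed[OF x bb] F.smult_closed[OF r ec]
      by (simp add: a_minus_def F.minus_add F.a_comm)
    ultimately have 2: "r \<odot>\<^bsub>F\<^esub> e x b \<ominus>\<^bsub>F\<^esub> e x (r \<otimes> b) \<in> N" by simp
    have "r \<odot>\<^bsub>F\<^esub> f \<ominus>\<^bsub>F\<^esub> e x (r \<otimes> b) \<in> N"
      by (rule F.submodule_diff_trans[OF N(1) F.smult_closed[OF r h(1)] F.smult_closed[OF r ec] e_closed[OF x bb] 1 2])
    then show "r \<odot>\<^bsub>F\<^esub> f \<in> add_tensors N x"
      using F.smult_closed[OF r h(1)] bb unfolding add_tensors_def by blast
  qed
qed

text \<open>This is \<open>W\<close> plus \<open>x \<otimes> I\<close> for every \<open>x\<close> in
  the list, built up so that the Koszul argument can remove one generator at a time.\<close>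

primrec tensors :: "'a list \<Rightarrow> ('a \<times> 'a \<Rightarrow> 'a) set" where
  "tensors [] = W"
| "tensors (x # xs) = add_tensors (tensors xs) x"

lemma tensors_submodule: "set xs \<subseteq> I \<Longrightarrow> submodule (tensors xs) R F \<and> W \<subseteq> tensors xs"
proof (induction xs)
  case (Cons x xs)
  then have h: "submodule (tensors xs) R F" "W \<subseteq> tensors xs" "x \<in> I" by auto
  show ?case using add_tensors_submodule(1,2)[OF h] h(2) by auto
qed (simp add: W_submodule)

lemma e_mem_tensors: "set xs \<subseteq> I \<Longrightarrow> x \<in> set xs \<Longrightarrow> b \<in> I \<Longrightarrow> e x b \<in> tensors xs"
proof (induction xs)
  case (Cons y xs)
  then have h: "submodule (tensors xs) R F" "W \<subseteq> tensors xs" "y \<in> I" using tensors_submodule[of xs] by auto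
  show ?case
    using add_tensors_submodule(2,3)[OF h] Cons by (cases "x = y") auto
qed simp

lemma ev_tensors:
  assumes "set xs \<subseteq> I" "ideal K R" "set xs \<subseteq> K" "f \<in> tensors xs"
  shows "ev f \<in> K"
  using assms(1,3,4)
proof (induction xs arbitrary: f)
  case Nil
  then show ?case using W_le_ev_ker idealD(2)[OF assms(2)] by (auto simp: ev_ker_def)
next
  case (Cons x xs)
  then obtain b where b: "f \<in> carrier F" "b \<in> I" "f \<ominus>\<^bsub>F\<^esub> e x b \<in> tensors xs"
    by (auto simp: add_tensors_def)
  have x: "x \<in> I" "x \<in> K" using Cons.prems by auto
  have "ev (f \<ominus>\<^bsub>F\<^esub> e x b) \<in> K" using Cons.IH[OF _ _ b(3)] Cons.prems by simp
  moreover have "x \<otimes> b \<in> K" using idealD(5)[OF assms(2) Ic[OF b(2)] x(2)] .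
  ultimately show ?case
    using ev_diff_cancel[OF b(1) e_closed[OF x(1) b(2)]] ev_e[OF x(1) b(2)] idealD(3)[OF assms(2)] by simp
qed

lemma ideal_e_mem_right:
  assumes N: "submodule N R F" "W \<subseteq> N" and x: "x \<in> I"
  shows "ideal {b \<in> I. e x b \<in> N} R"
proof -
  have "{b \<in> I. e x b \<in> N} = {b \<in> I. e b x \<in> N}" using e_mem_commute[OF N x] by blast
  then show ?thesis using ideal_e_mem[OF N x] by simp
qed

text \<open>The relations between the elements of a regular sequence are the trivial ones, and those vanish
  in the symmetric square.\<close>

lemma tensors_ev_zero:
  assumes "permutable_seq {\<zero>} xs" "set xs \<subseteq> I" "f \<in> tensors xs" "ev f = \<zero>"
  shows "f \<in> W"
  using assms
proof (induction xs arbitrary: f)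
  case (Cons x xs)
  have x: "x \<in> I" "x \<in> carrier R" and xs: "set xs \<subseteq> I" "set xs \<subseteq> carrier R" using Cons.prems Ic by auto
  note N = tensors_submodule[OF xs(1), THEN conjunct1] tensors_submodule[OF xs(1), THEN conjunct2]
  from Cons.prems(3) obtain b where b: "f \<in> carrier F" "b \<in> I" "f \<ominus>\<^bsub>F\<^esub> e x b \<in> tensors xs"
    by (auto simp: add_tensors_def)
  let ?A = "adjoins {\<zero>} xs"
  have A: "ideal ?A R" "set xs \<subseteq> ?A" using adjoins_ideal[OF zeroideal xs(2)] adjoins_set[OF zeroideal xs(2)] by auto
  have "regular_seq {\<zero>} (xs @ [x])" using Cons.prems(1) by (simp add: permutable_seq_def)
  then have reg: "regular_elt ?A x" by (simp add: regular_seq_append)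
  have d: "ev (f \<ominus>\<^bsub>F\<^esub> e x b) \<in> ?A" by (rule ev_tensors[OF xs(1) A b(3)])
  have "ev (f \<ominus>\<^bsub>F\<^esub> e x b) \<oplus> x \<otimes> b = \<zero>"
    using ev_diff_cancel[OF b(1) e_closed[OF x(1) b(2)]] ev_e[OF x(1) b(2)] Cons.prems(4) by simp
  then have "ev (f \<ominus>\<^bsub>F\<^esub> e x b) \<oplus> x \<otimes> b \<in> ?A" using idealD(2)[OF A(1)] by simp
  then have "x \<otimes> b \<in> ?A" using ideal_add_cancel(1)[OF A(1) _ d, of "x \<otimes> b"] x Ic[OF b(2)] by simp
  then have bA: "b \<in> ?A" using regular_eltD[OF reg Ic[OF b(2)]] m_comm[OF x(2) Ic[OF b(2)]] by simp
  \<comment> \<open>Now \<open>b\<close> is a combination of the remaining \<open>xs\<close>. By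
    symmetry \<open>e x y\<close> lies in \<open>tensors xs\<close> for \<open>y\<close> among them,
    so \<open>e x b\<close> does too, and \<open>f\<close> no longer involves
    \<open>x\<close>.\<close>
  let ?K = "{b \<in> I. e x b \<in> tensors xs}"
  have K: "ideal ?K R" by (rule ideal_e_mem_right[OF N x(1)])
  have "e x y \<in> tensors xs" if "y \<in> set xs" for y
    using e_mem_tensors[OF xs(1) that x(1)] e_mem_commute[OF N x(1), of y] xs(1) that by blast
  then have "set xs \<subseteq> ?K" using xs(1) by blast
  then have "?A \<subseteq> ?K" using adjoins_subset_iff[OF K zeroideal xs(2)] idealD(2)[OF K] by blast
  then have "e x b \<in> tensors xs" using bA by blast
  then have "f \<in> tensors xs"
    using F.submodule_diff_mem[OF N(1) b(1) e_closed[OF x(1) b(2)] b(3)] by simp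
  then show ?case using Cons.IH[OF permutable_seq_Cons(3)[OF Cons.prems(1)] xs(1)] Cons.prems(4) by simp
qed simp

definition W_ideal :: "'a set \<Rightarrow> ('a \<times> 'a \<Rightarrow> 'a) set" where
  "W_ideal J = F.span {e a b |a b. a \<in> J \<and> b \<in> I}"

lemma W_ideal_submodule: "J \<subseteq> I \<Longrightarrow> submodule (W_ideal J) R F"
  unfolding W_ideal_def
  by (rule F.submodule_span) (auto intro!: e_closed)

lemma W_ideal_e: "a \<in> J \<Longrightarrow> b \<in> I \<Longrightarrow> e a b \<in> W_ideal J"
  unfolding W_ideal_def using F.span_base[of "{e a b |a b. a \<in> J \<and> b \<in> I}"] by blast

lemma W_ideal_Int_ev_ker:
  assumes "permutable_seq {\<zero>} xs" "set xs \<subseteq> I" "J = Idl (set xs)"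
  shows "W_ideal J \<inter> ev_ker \<subseteq> W"
proof -
  have c: "set xs \<subseteq> carrier R" using assms(2) Ic by blast
  note N = tensors_submodule[OF assms(2), THEN conjunct1] tensors_submodule[OF assms(2), THEN conjunct2]
  have "e a b \<in> tensors xs" if "a \<in> J" "b \<in> I" for a b
  proof -
    have "ideal {a \<in> I. e a b \<in> tensors xs} R" by (rule ideal_e_mem[OF N that(2)])
    moreover have "set xs \<subseteq> {a \<in> I. e a b \<in> tensors xs}" using e_mem_tensors[OF assms(2) _ that(2)] assms(2) by blast
    ultimately have "J \<subseteq> {a \<in> I. e a b \<in> tensors xs}" unfolding assms(3) by (rule genideal_minimal)
    then show ?thesis using that(1) by blast
  qed
  then have "W_ideal J \<subseteq> tensors xs" unfolding W_ideal_def by (intro F.span_least[OF N(1)]) blast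
  then show ?thesis using tensors_ev_zero[OF assms(1,2)] by (auto simp: ev_ker_def)
qed

text \<open>The kernel of the map from \<open>F\<close> onto \<open>S\<^sub>2(I/J)\<close>, as
  \<open>to_poly_mem_sym_ideal_iff\<close> confirms.\<close>

definition sym_kernel :: "'a set \<Rightarrow> ('a \<times> 'a \<Rightarrow> 'a) set" where
  "sym_kernel J = W <+>\<^bsub>F\<^esub> W_ideal J"

lemma sym_kernel_submodule:
  assumes "J \<subseteq> I"
  shows "submodule (sym_kernel J) R F" "W \<subseteq> sym_kernel J" "W_ideal J \<subseteq> sym_kernel J"
  unfolding sym_kernel_def
  using F.submodule_set_add[OF W_submodule W_ideal_submodule[OF assms]]
    F.subset_set_add[OF W_submodule W_ideal_submodule[OF assms]] by auto

text \<open>The interval is cut at \<open>U\<close>, the preimage of \<open>JI\<close> under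
  multiplication; above it lies \<open>I\<^sup>2/JI\<close>. As \<open>U\<close> is the sum of
  \<open>sym_kernel J\<close> and \<open>ev_ker\<close>, which meet in \<open>W\<close>, the part
  below has the length of \<open>ev_ker\<close> over \<open>W\<close>.\<close>

lemma interval_length_sym_kernel:
  assumes J: "permutable_seq {\<zero>} xs" "set xs \<subseteq> I" "J = Idl (set xs)"
  shows "interval_length R F (sym_kernel J) (carrier F)
    = interval_length R F W ev_ker + module_length R (ideal_quot R (I \<cdot> I) (J \<cdot> I))"
proof -
  have c: "set xs \<subseteq> carrier R" using J(2) Ic by blast
  have Ji: "ideal J R" unfolding J(3) by (rule genideal_ideal[OF c])
  have JI: "J \<subseteq> I" unfolding J(3) by (rule genideal_minimal[OF I J(2)])
  note WJ = W_ideal_submodule[OF JI] and K = ev_ker_submodule and W' = sym_kernel_submodule[OF JI]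
  note P = ideal_prod_is_ideal[OF Ji I]
  define U where "U = {f \<in> carrier F. ev f \<in> J \<cdot> I}"
  have U: "submodule U R F" unfolding U_def by (rule ev_vimage_submodule[OF P])
  have KU: "ev_ker \<subseteq> U" unfolding U_def ev_ker_def using idealD(2)[OF P] by auto
  have "{e a b |a b. a \<in> J \<and> b \<in> I} \<subseteq> U"
    unfolding U_def using JI ev_e e_closed ideal_prod.prod[of _ J _ I R] by (auto)
  then have WJU: "W_ideal J \<subseteq> U" unfolding W_ideal_def by (rule F.span_least[OF U])
  have W'U: "sym_kernel J \<subseteq> U"
    unfolding sym_kernel_def by (rule F.set_add_least[OF U]) (use W_le_ev_ker KU WJU in auto)
  have lift: "\<exists>g\<in>W_ideal J. ev g = x" if "x \<in> J \<cdot> I" for x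
    using that
  proof (induction rule: ideal_prod.induct)
    case (prod i j)
    then show ?case using W_ideal_e[of i J j] ev_e[of i j] JI by blast
  next
    case (sum s t)
    then obtain g h where "g \<in> W_ideal J" "h \<in> W_ideal J" "ev g = s" "ev h = t" by blast
    then show ?case
      using F.submoduleE(5)[OF WJ] ev_add[of g h] subsetD[OF F.submoduleE(1)[OF WJ]] by blast
  qed
  have "U \<subseteq> sym_kernel J <+>\<^bsub>F\<^esub> ev_ker"
  proof
    fix f assume "f \<in> U"
    then have f: "f \<in> carrier F" "ev f \<in> J \<cdot> I" by (auto simp: U_def)
    obtain g where g: "g \<in> W_ideal J" "ev g = ev f" using lift[OF f(2)] by blast
    have gc: "g \<in> carrier F" using g(1) F.submoduleE(1)[OF WJ] by blast
    note d = F.minus_closed[OF f(1) gc]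
    have "ev (f \<ominus>\<^bsub>F\<^esub> g) \<oplus> ev g = ev g" using ev_diff_cancel[OF f(1) gc] g(2) by simp
    then have "ev (f \<ominus>\<^bsub>F\<^esub> g) = \<zero>" using ev_closed[OF d] ev_closed[OF gc] by (simp only: add.r_cancel_one)
    then have "f \<ominus>\<^bsub>F\<^esub> g \<in> ev_ker" using d unfolding ev_ker_def by blast
    moreover have "f = g \<oplus>\<^bsub>F\<^esub> (f \<ominus>\<^bsub>F\<^esub> g)"
      using F.diff_add_cancel[OF f(1) gc] F.a_comm[OF gc d] by simp
    ultimately show "f \<in> sym_kernel J <+>\<^bsub>F\<^esub> ev_ker"
      using g(1) W'(3) unfolding set_add_iff by blast
  qed
  then have Ueq: "U = sym_kernel J <+>\<^bsub>F\<^esub> ev_ker" using F.set_add_least[OF U W'U KU] by blast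
  have "ev_ker \<inter> sym_kernel J = W <+>\<^bsub>F\<^esub> (W_ideal J \<inter> ev_ker)"
    unfolding sym_kernel_def using F.submodule_modular[OF W_submodule WJ K W_le_ev_ker] by blast
  also have "\<dots> = W"
    using F.set_add_least[OF W_submodule order_refl W_ideal_Int_ev_ker[OF J]]
      F.subset_set_add(1)[OF W_submodule F.submodule_Int[OF WJ K]] by blast
  finally have "interval_length R F (sym_kernel J) U = interval_length R F W ev_ker"
    unfolding Ueq using F.interval_length_set_add[OF W'(1) K] by simp
  moreover have "module_length R (ideal_quot R (I \<cdot> I) (J \<cdot> I)) = interval_length R F U (carrier F)"
  proof (rule F.module_length_image[where \<phi> = "\<lambda>f. J \<cdot> I +> ev f"])
    show "submodule (carrier F) R F" by (rule F.carrier_is_submodule)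
    have "ev ` carrier F = I \<cdot> I"
    proof
      have "ev f \<in> I \<cdot> I" if "f \<in> carrier F" for f
      proof -
        note II = ideal_prod_is_ideal[OF I I]
        from that show ?thesis
        proof (induction rule: free_module_induct)
          case zero
          have "ev (\<lambda>_. \<zero>) = \<zero>" unfolding ev_def using S.lin_ext_zero[where A = "I \<times> I" and g = pair_mult, OF ev_arg] by simp
          then show ?case using idealD(2)[OF II] by simp
        next
          case (add g r p)
          obtain a b where p: "p = (a, b)" "a \<in> I" "b \<in> I" using add by (cases p) auto
          have "a \<otimes> b \<in> I \<cdot> I" using p by (auto intro: ideal_prod.prod)
          then show ?case
            using add(1,2,3) add.IH p e_closed[OF p(2,3)] idealD(3)[OF II] idealD(4)[OF II]
            by (simp add: ev_add ev_smult ev_e F.smult_closed)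
        qed
      qed
      then show "ev ` carrier F \<subseteq> I \<cdot> I" by blast
      show "I \<cdot> I \<subseteq> ev ` carrier F"
      proof
        fix x assume "x \<in> I \<cdot> I"
        then show "x \<in> ev ` carrier F"
        proof (induction rule: ideal_prod.induct)
          case (prod i j)
          show ?case by (rule image_eqI[OF _ e_closed[OF prod]]) (simp add: ev_e[OF prod])
        next
          case (sum s t)
          then obtain g h where gh: "g \<in> carrier F" "h \<in> carrier F" "s = ev g" "t = ev h" by blast
          show ?case by (rule image_eqI[OF _ F.a_closed[OF gh(1,2)]]) (simp add: ev_add[OF gh(1,2)] gh)
        qed
      qed
    qed
    then show "(\<lambda>f. J \<cdot> I +> ev f) ` carrier F = carrier (ideal_quot R (I \<cdot> I) (J \<cdot> I))"
      unfolding ideal_quot_carrier by (metis image_image)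
    show "J \<cdot> I +> ev (f \<oplus>\<^bsub>F\<^esub> g) = (J \<cdot> I +> ev f) \<oplus>\<^bsub>ideal_quot R (I \<cdot> I) (J \<cdot> I)\<^esub> (J \<cdot> I +> ev g)"
      if "f \<in> carrier F" "g \<in> carrier F" for f g
      using ideal_quot_add[OF P ev_closed[OF that(1)] ev_closed[OF that(2)]] ev_add[OF that] by simp
    show "J \<cdot> I +> ev (r \<odot>\<^bsub>F\<^esub> f) = r \<odot>\<^bsub>ideal_quot R (I \<cdot> I) (J \<cdot> I)\<^esub> (J \<cdot> I +> ev f)"
      if "r \<in> carrier R" "f \<in> carrier F" for r f
      using ideal_quot_smult[OF P that(1) ev_closed[OF that(2)]] ev_smult[OF that(2,1)] by (simp add: free_module_sel(2))
    have "ev \<zero>\<^bsub>F\<^esub> = \<zero>" unfolding ev_def using S.lin_ext_zero[where A = "I \<times> I" and g = pair_mult, OF ev_arg] by (simp add: free_module_sel(2))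
    then show "J \<cdot> I +> ev \<zero>\<^bsub>F\<^esub> = \<zero>\<^bsub>ideal_quot R (I \<cdot> I) (J \<cdot> I)\<^esub>"
      using coset_eq_ideal_iff[OF P zero_closed] idealD(2)[OF P] by simp
    show "U = {f \<in> carrier F. J \<cdot> I +> ev f = \<zero>\<^bsub>ideal_quot R (I \<cdot> I) (J \<cdot> I)\<^esub>}"
      unfolding U_def ideal_quot_zero using coset_eq_ideal_iff[OF P ev_closed] by blast
  qed
  ultimately show ?thesis
    using F.interval_length_add[OF W'(1) U F.carrier_is_submodule W'U F.submoduleE(1)[OF U]] by simp
qed

end

section \<open>The second graded component of the symmetric algebra\<close>

context cring begin

lemma ideal_imp_submodule_poly:
  assumes "ideal N (poly_algebra R V)"
  shows "submodule N R (poly_algebra R V)"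
proof -
  interpret P: module R "poly_algebra R V" by (rule poly_algebra_module)
  interpret Pc: cring "poly_algebra R V" by (rule poly_algebra_cring)
  note N = Pc.idealD[OF assms]
  show ?thesis
  proof (rule P.submoduleI')
    fix a p assume a: "a \<in> carrier R" and p: "p \<in> N"
    have "indexed_const a \<in> carrier (poly_algebra R V)" using a by (auto intro: indexed_pset.indexed_const)
    from N(4)[OF this p] have "conv (indexed_const a) p \<in> N" by simp
    then show "a \<odot>\<^bsub>poly_algebra R V\<^esub> p \<in> N"
      using conv_const[where q = p, OF a polys_coeff[where p = p and V = V]] N(1)[OF p] by simp
  qed (use N in auto)
qed

lemma pmult_poly: "p \<in> polys V \<Longrightarrow> v \<in> V \<Longrightarrow> indexed_pmult p v \<in> polys V"
  by (rule indexed_pset.indexed_pmult)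

lemma pmult_diff:
  assumes "p \<in> polys V" "q \<in> polys V" "v \<in> V"
  shows "indexed_pmult (p \<ominus>\<^bsub>poly_algebra R V\<^esub> q) v
    = indexed_pmult p v \<ominus>\<^bsub>poly_algebra R V\<^esub> indexed_pmult q v"
  unfolding poly_algebra_minus[OF assms(1,2)] poly_algebra_minus[OF pmult_poly[OF assms(1,3)] pmult_poly[OF assms(2,3)]]
  by (auto simp: indexed_pmult_def a_minus_def)

lemma indexed_pmult_empty: "indexed_pmult p v {#} = \<zero>"
  by (simp add: indexed_pmult_def)

lemma pmult_padd: "indexed_pmult (indexed_padd p q) v = indexed_padd (indexed_pmult p v) (indexed_pmult q v)"
  by (auto simp: indexed_pmult_def indexed_padd_def)

lemma pmult_pscale: "a \<in> carrier R \<Longrightarrow> indexed_pmult (pscale a p) v = pscale a (indexed_pmult p v)"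
  by (auto simp: indexed_pmult_def pscale_def)

lemma pmult_var_apply: "indexed_pmult (indexed_var x) y m = (if m = {#x, y#} then \<one> else \<zero>)"
proof (cases "y \<in># m")
  case True
  then obtain m' where "m = add_mset y m'" by (meson mset_add)
  then show ?thesis by (auto simp: indexed_pmult_def indexed_var_apply add_mset_commute)
next
  case False
  then have "m \<noteq> {#x, y#}" by auto
  then show ?thesis using False by (simp add: indexed_pmult_def)
qed

lemma pmult_var_commute: "indexed_pmult (indexed_var x) y = indexed_pmult (indexed_var y) x"
  by (rule ext) (simp add: pmult_var_apply add_mset_commute)

definition hom_part :: "nat \<Rightarrow> ('c multiset \<Rightarrow> 'a) \<Rightarrow> 'c multiset \<Rightarrow> 'a" where
  "hom_part n p = (\<lambda>m. if size m = n then p m else \<zero>)"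

lemma hom_part_padd: "hom_part n (indexed_padd p q) = indexed_padd (hom_part n p) (hom_part n q)"
  by (auto simp: hom_part_def indexed_padd_def)

lemma hom_part_pmult_Suc: "hom_part (Suc n) (indexed_pmult p v) = indexed_pmult (hom_part n p) v"
  by (rule ext) (auto simp: hom_part_def indexed_pmult_def size_Diff_singleton dest!: multi_member_split)

lemma hom_part_pmult_0: "hom_part 0 (indexed_pmult p v) = (\<lambda>_. \<zero>)"
  by (auto simp: hom_part_def indexed_pmult_def)

lemma hom_part_const: "hom_part n (indexed_const k) = (if n = 0 then indexed_const k else (\<lambda>_. \<zero>))"
  by (auto simp: hom_part_def indexed_const_def)

end

context ideal_square begin

interpretation F: module R F by (rule module_free_module)

context
  fixes J assumes J: "ideal J R" and JI: "J \<subseteq> I"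
begin

abbreviation Q :: "('a, 'a set) module" where
  "Q \<equiv> ideal_quot R I J"

abbreviation V :: "'a set set" where
  "V \<equiv> carrier Q"

abbreviation P :: "('a, 'a set multiset \<Rightarrow> 'a) module" where
  "P \<equiv> poly_algebra R V"

abbreviation N :: "('a \<times> 'a \<Rightarrow> 'a) set" where
  "N \<equiv> sym_kernel J"

abbreviation cl :: "'a \<Rightarrow> 'a set" where
  "cl a \<equiv> J +> a"

interpretation P: module R P by (rule poly_algebra_module)
interpretation Pc: cring P by (rule poly_algebra_cring)

lemma cl_V: "a \<in> I \<Longrightarrow> cl a \<in> V"
  by (auto simp: ideal_quot_carrier)

lemma V_cl: "x \<in> V \<Longrightarrow> \<exists>a\<in>I. x = cl a"
  by (auto simp: ideal_quot_carrier)

definition pair_class :: "'a \<times> 'a \<Rightarrow> 'a set multiset" where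
  "pair_class q = {#cl (fst q), cl (snd q)#}"

definition pair_poly :: "'a \<times> 'a \<Rightarrow> 'a set multiset \<Rightarrow> 'a" where
  "pair_poly q = indexed_pmult (indexed_var (cl (fst q))) (cl (snd q))"

lemma pair_poly_closed: "q \<in> I \<times> I \<Longrightarrow> pair_poly q \<in> carrier P"
  unfolding pair_poly_def by (cases q) (simp add: pmult_poly indexed_var_poly cl_V)

definition to_poly :: "('a \<times> 'a \<Rightarrow> 'a) \<Rightarrow> 'a set multiset \<Rightarrow> 'a" where
  "to_poly = P.lin_ext pair_poly"

lemma to_poly_closed: "f \<in> carrier F \<Longrightarrow> to_poly f \<in> polys V"
  unfolding to_poly_def using P.lin_ext_closed[where A = "I \<times> I" and g = pair_poly, OF pair_poly_closed] by simp

lemma to_poly_add: "f \<in> carrier F \<Longrightarrow> h \<in> carrier F \<Longrightarrow>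
    to_poly (f \<oplus>\<^bsub>F\<^esub> h) = indexed_padd (to_poly f) (to_poly h)"
  unfolding to_poly_def using P.lin_ext_add[where A = "I \<times> I" and g = pair_poly, OF pair_poly_closed] by simp

lemma to_poly_smult: "f \<in> carrier F \<Longrightarrow> r \<in> carrier R \<Longrightarrow>
    to_poly (r \<odot>\<^bsub>F\<^esub> f) = pscale r (to_poly f)"
  unfolding to_poly_def using P.lin_ext_smult[where A = "I \<times> I" and g = pair_poly, OF pair_poly_closed] by simp

lemma to_poly_diff: "f \<in> carrier F \<Longrightarrow> h \<in> carrier F \<Longrightarrow>
    to_poly (f \<ominus>\<^bsub>F\<^esub> h) = to_poly f \<ominus>\<^bsub>P\<^esub> to_poly h"
  unfolding to_poly_def using P.lin_ext_diff[where A = "I \<times> I" and g = pair_poly, OF pair_poly_closed] by simp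

lemma to_poly_e: "a \<in> I \<Longrightarrow> b \<in> I \<Longrightarrow> to_poly (e a b) = indexed_pmult (indexed_var (cl a)) (cl b)"
  unfolding to_poly_def
  using P.lin_ext_basis_vec[where A = "I \<times> I" and g = pair_poly and p = "(a, b)", OF pair_poly_closed]
  by (simp add: pair_poly_def)

lemma to_poly_zero: "to_poly (\<lambda>_. \<zero>) = (\<lambda>_. \<zero>)"
  unfolding to_poly_def
  using P.lin_ext_zero[where A = "I \<times> I" and g = pair_poly, OF pair_poly_closed] by (simp add: indexed_zero_def)

subsection \<open>The relations of the symmetric algebra in degree two\<close>

abbreviation S :: "('a set multiset \<Rightarrow> 'a) set" where
  "S \<equiv> sym_ideal R Q"

lemma Q_ops:
  assumes "a \<in> I"
  shows "b \<in> I \<Longrightarrow> cl a \<oplus>\<^bsub>Q\<^esub> cl b = cl (a \<oplus> b)" "r \<in> carrier R \<Longrightarrow> r \<odot>\<^bsub>Q\<^esub> cl a = cl (r \<otimes> a)"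
  using ideal_quot_add[OF J] ideal_quot_smult[OF J] assms Ic by auto

lemma sym_relations_eq:
  "sym_relations R Q =
     {indexed_var (cl (a \<oplus> b)) \<ominus>\<^bsub>P\<^esub> indexed_padd (indexed_var (cl a)) (indexed_var (cl b)) |a b. a \<in> I \<and> b \<in> I}
   \<union> {indexed_var (cl (r \<otimes> a)) \<ominus>\<^bsub>P\<^esub> pscale r (indexed_var (cl a)) |r a. r \<in> carrier R \<and> a \<in> I}"
  (is "_ = ?A \<union> ?B")
proof
  show "sym_relations R Q \<subseteq> ?A \<union> ?B"
  proof
    fix p assume "p \<in> sym_relations R Q"
    then consider x y where "x \<in> V" "y \<in> V" "p = indexed_var (x \<oplus>\<^bsub>Q\<^esub> y) \<ominus>\<^bsub>P\<^esub> (indexed_var x \<oplus>\<^bsub>P\<^esub> indexed_var y)"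
      | r x where "r \<in> carrier R" "x \<in> V" "p = indexed_var (r \<odot>\<^bsub>Q\<^esub> x) \<ominus>\<^bsub>P\<^esub> (r \<odot>\<^bsub>P\<^esub> indexed_var x)"
      unfolding sym_relations_def Let_def by blast
    then show "p \<in> ?A \<union> ?B"
    proof cases
      case 1
      then obtain a b where "a \<in> I" "b \<in> I" "x = cl a" "y = cl b" using V_cl by blast
      then show ?thesis using 1(3) Q_ops(1) by auto
    next
      case 2
      then obtain a where "a \<in> I" "x = cl a" using V_cl by blast
      then show ?thesis using 2(1,3) Q_ops(2) by auto
    qed
  qed
  show "?A \<union> ?B \<subseteq> sym_relations R Q"
  proof
    fix p assume "p \<in> ?A \<union> ?B"
    then consider a b where "a \<in> I" "b \<in> I"
        "p = indexed_var (cl (a \<oplus> b)) \<ominus>\<^bsub>P\<^esub> indexed_padd (indexed_var (cl a)) (indexed_var (cl b))"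
      | r a where "r \<in> carrier R" "a \<in> I" "p = indexed_var (cl (r \<otimes> a)) \<ominus>\<^bsub>P\<^esub> pscale r (indexed_var (cl a))"
      by blast
    then show "p \<in> sym_relations R Q"
    proof cases
      case 1
      then have "p = indexed_var (cl a \<oplus>\<^bsub>Q\<^esub> cl b) \<ominus>\<^bsub>P\<^esub> (indexed_var (cl a) \<oplus>\<^bsub>P\<^esub> indexed_var (cl b))"
        using Q_ops(1) by simp
      then show ?thesis using cl_V 1(1,2) unfolding sym_relations_def Let_def by blast
    next
      case 2
      then have "p = indexed_var (r \<odot>\<^bsub>Q\<^esub> cl a) \<ominus>\<^bsub>P\<^esub> (r \<odot>\<^bsub>P\<^esub> indexed_var (cl a))"
        using Q_ops(2) by simp
      then show ?thesis using cl_V 2(1,2) unfolding sym_relations_def Let_def by blast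
    qed
  qed
qed

lemma sym_relations_closed: "sym_relations R Q \<subseteq> carrier P"
proof -
  have minus: "p \<ominus>\<^bsub>P\<^esub> q \<in> polys V" if "p \<in> polys V" "q \<in> polys V" for p q
    using P.minus_closed[of p q] that by simp
  have "indexed_var (cl a) \<in> polys V" if "a \<in> I" for a
    by (rule indexed_var_poly[OF cl_V[OF that]])
  moreover have "a \<oplus> b \<in> I" if "a \<in> I" "b \<in> I" for a b by (rule idealD(3)[OF I that])
  moreover have "r \<otimes> a \<in> I" if "r \<in> carrier R" "a \<in> I" for r a by (rule idealD(4)[OF I that])
  ultimately show ?thesis
    unfolding sym_relations_eq by (auto intro!: minus indexed_pset.indexed_padd pscale_closed)
qed

lemma sym_ideal: "ideal S P"
  unfolding sym_ideal_def by (rule Pc.genideal_ideal[OF sym_relations_closed])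

lemma sym_submodule: "submodule S R P"
  by (rule ideal_imp_submodule_poly[OF sym_ideal])

lemma relation_mult_mem:
  assumes "p \<in> sym_relations R Q" "v \<in> V"
  shows "indexed_pmult p v \<in> S"
proof -
  have p: "p \<in> S" using Pc.genideal_self[OF sym_relations_closed] assms(1) unfolding sym_ideal_def by blast
  have pc: "p \<in> polys V" using sym_relations_closed assms(1) by auto
  have "p \<otimes>\<^bsub>P\<^esub> indexed_var v \<in> S"
    by (rule Pc.idealD(5)[OF sym_ideal _ p]) (simp add: indexed_var_poly assms(2))
  then show ?thesis using conv_var[where p = p, OF polys_coeff[OF pc]] by simp
qed

text \<open>A linearity relation of \<open>F\<close> becomes a defining relation of the symmetric
  algebra times a variable; a symmetry relation becomes zero because variables commute.\<close>

lemma sym_kernel_le: "f \<in> N \<Longrightarrow> to_poly f \<in> S"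
proof -
  let ?K = "{f \<in> carrier F. to_poly f \<in> S}"
  have K: "submodule ?K R F"
    unfolding to_poly_def
    by (rule P.submodule_lin_ext_vimage[where A = "I \<times> I" and g = pair_poly, OF pair_poly_closed sym_submodule])
  have "relations \<subseteq> ?K"
  proof
    fix f assume f: "f \<in> relations"
    then have fc: "f \<in> carrier F" using relations_closed by blast
    have var: "indexed_var (cl a) \<in> polys V" if "a \<in> I" for a by (rule indexed_var_poly[OF cl_V[OF that]])
    from f consider a b c where "a \<in> I" "b \<in> I" "c \<in> I" "f = e (a \<oplus> b) c \<ominus>\<^bsub>F\<^esub> (e a c \<oplus>\<^bsub>F\<^esub> e b c)"
      | r a c where "r \<in> carrier R" "a \<in> I" "c \<in> I" "f = e (r \<otimes> a) c \<ominus>\<^bsub>F\<^esub> (r \<odot>\<^bsub>F\<^esub> e a c)"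
      | a b where "a \<in> I" "b \<in> I" "f = e a b \<ominus>\<^bsub>F\<^esub> e b a"
      unfolding relations_def by blast
    then have "to_poly f \<in> S"
    proof cases
      case 1
      have ab: "a \<oplus> b \<in> I" by (rule idealD(3)[OF I 1(1,2)])
      let ?r = "indexed_var (cl (a \<oplus> b)) \<ominus>\<^bsub>P\<^esub> indexed_padd (indexed_var (cl a)) (indexed_var (cl b))"
      have "to_poly f = indexed_pmult ?r (cl c)"
        unfolding 1(4) pmult_diff[OF var[OF ab] indexed_pset.indexed_padd[OF var[OF 1(1)] var[OF 1(2)]] cl_V[OF 1(3)]]
          pmult_padd to_poly_diff[OF e_closed[OF ab 1(3)] F.a_closed[OF e_closed[OF 1(1,3)] e_closed[OF 1(2,3)]]]
          to_poly_add[OF e_closed[OF 1(1,3)] e_closed[OF 1(2,3)]] to_poly_e[OF ab 1(3)] to_poly_e[OF 1(1,3)] to_poly_e[OF 1(2,3)] ..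
      moreover have "?r \<in> sym_relations R Q" unfolding sym_relations_eq using 1(1,2) by blast
      ultimately show ?thesis using relation_mult_mem[OF _ cl_V[OF 1(3)]] by simp
    next
      case 2
      have ra: "r \<otimes> a \<in> I" by (rule idealD(4)[OF I 2(1,2)])
      let ?r = "indexed_var (cl (r \<otimes> a)) \<ominus>\<^bsub>P\<^esub> pscale r (indexed_var (cl a))"
      have "to_poly f = indexed_pmult ?r (cl c)"
        unfolding 2(4) pmult_diff[OF var[OF ra] pscale_closed[OF 2(1) var[OF 2(2)]] cl_V[OF 2(3)]]
          pmult_pscale[OF 2(1)] to_poly_diff[OF e_closed[OF ra 2(3)] F.smult_closed[OF 2(1) e_closed[OF 2(2,3)]]]
          to_poly_smult[OF e_closed[OF 2(2,3)] 2(1)] to_poly_e[OF ra 2(3)] to_poly_e[OF 2(2,3)] ..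
      moreover have "?r \<in> sym_relations R Q" unfolding sym_relations_eq using 2(1,2) by blast
      ultimately show ?thesis using relation_mult_mem[OF _ cl_V[OF 2(3)]] by simp
    next
      case 3
      have "to_poly f = \<zero>\<^bsub>P\<^esub>"
        unfolding 3(3) to_poly_diff[OF e_closed[OF 3(1,2)] e_closed[OF 3(2,1)]]
          to_poly_e[OF 3(1,2)] to_poly_e[OF 3(2,1)] pmult_var_commute[of "cl b"]
        using P.diff_zero_iff pmult_poly[OF var[OF 3(1)] cl_V[OF 3(2)]] by simp
      then show ?thesis using P.submodule_zero[OF sym_submodule] by simp
    qed
    then show "f \<in> ?K" using fc by blast
  qed
  then have "W \<subseteq> ?K" unfolding W_def by (rule F.span_least[OF K])
  moreover have "{e a b |a b. a \<in> J \<and> b \<in> I} \<subseteq> ?K"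
  proof
    fix f assume "f \<in> {e a b |a b. a \<in> J \<and> b \<in> I}"
    then obtain a b where ab: "a \<in> J" "b \<in> I" "f = e a b" by blast
    have aI: "a \<in> I" using ab(1) JI by blast
    have z: "\<zero> \<in> I" by (rule idealD(2)[OF I])
    have cl: "cl a = J" "cl \<zero> = J"
      using coset_eq_ideal_iff[OF J Ic[OF aI]] coset_eq_ideal_iff[OF J zero_closed] ab(1) idealD(2)[OF J] by auto
    let ?v = "indexed_var (cl \<zero>)"
    have v: "?v \<in> polys V" by (rule indexed_var_poly[OF cl_V[OF z]])
    \<comment> \<open>With scalar zero, a relation of the second kind is just the variable of the
      zero class. Hence that variable, and its products with variables, lie in
      \<open>S\<close>.\<close>
    have "indexed_var (cl (\<zero> \<otimes> \<zero>)) \<ominus>\<^bsub>P\<^esub> pscale \<zero> ?v \<in> sym_relations R Q"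
      unfolding sym_relations_eq using z by blast
    moreover have "indexed_var (cl (\<zero> \<otimes> \<zero>)) \<ominus>\<^bsub>P\<^esub> pscale \<zero> ?v = ?v"
      using poly_algebra_minus[OF v pscale_closed[OF zero_closed v]] polys_coeff[OF v]
      by (simp add: pscale_def a_minus_def)
    ultimately have "indexed_pmult ?v (cl b) \<in> S" using relation_mult_mem[OF _ cl_V[OF ab(2)]] by simp
    then show "f \<in> ?K" using ab(2,3) aI e_closed to_poly_e[OF aI ab(2)] cl by simp
  qed
  then have "W_ideal J \<subseteq> ?K" unfolding W_ideal_def by (rule F.span_least[OF K])
  ultimately have "N \<subseteq> ?K" unfolding sym_kernel_def by (rule F.set_add_least[OF K])
  then show "f \<in> N \<Longrightarrow> to_poly f \<in> S" by blast
qed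

subsection \<open>Recovering a tensor from a polynomial\<close>

text \<open>Each monomial of degree two in the classes is lifted to a chosen pair of representatives, which
  inverts \<^const>\<open>to_poly\<close> modulo \<^const>\<open>sym_kernel\<close>.\<close>

definition rep :: "'a set multiset \<Rightarrow> 'a \<times> 'a" where
  "rep m = (SOME q. q \<in> I \<times> I \<and> pair_class q = m)"

definition from_poly :: "('a set multiset \<Rightarrow> 'a) \<Rightarrow> 'a \<times> 'a \<Rightarrow> 'a" where
  "from_poly p = (\<lambda>q. if q \<in> I \<times> I \<and> rep (pair_class q) = q then p (pair_class q) else \<zero>)"

lemma rep_pair_class: "q \<in> I \<times> I \<Longrightarrow> rep (pair_class q) \<in> I \<times> I \<and> pair_class (rep (pair_class q)) = pair_class q"
  unfolding rep_def by (rule someI[of _ q]) simp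

lemma from_poly_closed:
  assumes "p \<in> polys V"
  shows "from_poly p \<in> carrier F"
proof -
  have "{q. from_poly p q \<noteq> \<zero>} \<subseteq> rep ` {m. p m \<noteq> \<zero>}"
    by (force simp: from_poly_def split: if_splits)
  then have "finite {q. from_poly p q \<noteq> \<zero>}" by (rule finite_surj[OF finite_poly_support[OF assms]])
  then show ?thesis using polys_coeff[OF assms] by (auto simp: free_module_sel from_poly_def)
qed

lemma from_poly_padd: "from_poly (indexed_padd p q) = from_poly p \<oplus>\<^bsub>F\<^esub> from_poly q"
  by (auto simp: from_poly_def indexed_padd_def free_module_sel)

lemma from_poly_pscale: "r \<in> carrier R \<Longrightarrow> from_poly (pscale r p) = r \<odot>\<^bsub>F\<^esub> from_poly p"
  by (auto simp: from_poly_def pscale_def free_module_sel)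

lemma from_poly_zero: "(\<And>m. size m = 2 \<Longrightarrow> p m = \<zero>) \<Longrightarrow> from_poly p = \<zero>\<^bsub>F\<^esub>"
  by (auto simp: from_poly_def pair_class_def free_module_sel)

lemma from_poly_diff:
  assumes "p \<in> polys V" "q \<in> polys V"
  shows "from_poly (p \<ominus>\<^bsub>P\<^esub> q) = from_poly p \<ominus>\<^bsub>F\<^esub> from_poly q"
proof -
  have c: "from_poly p \<in> carrier F" "from_poly q \<in> carrier F" "from_poly (p \<ominus>\<^bsub>P\<^esub> q) \<in> carrier F"
    using from_poly_closed assms P.minus_closed[of p q] by auto
  have "indexed_padd (p \<ominus>\<^bsub>P\<^esub> q) q = p" using P.diff_add_cancel[of p q] assms by simp
  then have "from_poly p = from_poly (p \<ominus>\<^bsub>P\<^esub> q) \<oplus>\<^bsub>F\<^esub> from_poly q" using from_poly_padd by metis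
  moreover have "from_poly (p \<ominus>\<^bsub>P\<^esub> q) \<oplus>\<^bsub>F\<^esub> from_poly q \<ominus>\<^bsub>F\<^esub> from_poly q = from_poly (p \<ominus>\<^bsub>P\<^esub> q)"
    using c by (simp add: a_minus_def F.a_assoc F.r_neg)
  ultimately show ?thesis by metis
qed

lemma from_poly_pair: 
  assumes "a \<in> I" "b \<in> I"
  shows "from_poly (indexed_pmult (indexed_var (cl a)) (cl b)) = basis_vec (rep (pair_class (a, b)))"
proof
  fix q
  have r: "rep (pair_class (a, b)) \<in> I \<times> I" "pair_class (rep (pair_class (a, b))) = pair_class (a, b)"
    using rep_pair_class[of "(a, b)"] assms by auto
  show "from_poly (indexed_pmult (indexed_var (cl a)) (cl b)) q = basis_vec (rep (pair_class (a, b))) q"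
  proof (cases "q = rep (pair_class (a, b))")
    case True
    then show ?thesis using r by (simp add: from_poly_def pmult_var_apply basis_vec_def) (simp add: pair_class_def)
  next
    case False
    then have "pair_class q \<noteq> pair_class (a, b) \<or> rep (pair_class q) \<noteq> q" by auto
    then show ?thesis using False by (auto simp: from_poly_def pmult_var_apply basis_vec_def) (simp add: pair_class_def)
  qed
qed

lemma N_submodule: "submodule N R F" and W_le_N: "W \<subseteq> N" and W_ideal_le_N: "W_ideal J \<subseteq> N"
  using sym_kernel_submodule[OF JI] by auto

lemma e_class_cong:
  assumes "a \<in> I" "a' \<in> I" "b \<in> I" "cl a = cl a'"
  shows "e a b \<ominus>\<^bsub>F\<^esub> e a' b \<in> N"
proof -
  have c: "a \<in> carrier R" "a' \<in> carrier R" using assms Ic by auto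
  have d: "a \<ominus> a' \<in> J" using quotient_eq_iff_same_a_r_cos[OF J c] assms(4) by simp
  then have dI: "a \<ominus> a' \<in> I" using JI by blast
  have aa: "a = (a \<ominus> a') \<oplus> a'" using c by algebra
  have "e ((a \<ominus> a') \<oplus> a') b \<ominus>\<^bsub>F\<^esub> (e (a \<ominus> a') b \<oplus>\<^bsub>F\<^esub> e a' b) \<in> N"
    by (rule W_relations(1)[OF W_le_N dI assms(3,2)])
  then have 1: "e a b \<ominus>\<^bsub>F\<^esub> (e (a \<ominus> a') b \<oplus>\<^bsub>F\<^esub> e a' b) \<in> N" unfolding aa[symmetric] .
  have d1: "e (a \<ominus> a') b \<in> N" using W_ideal_e[OF d assms(3)] W_ideal_le_N by blast
  note ec = e_closed[OF assms(1,3)] e_closed[OF dI assms(3)] e_closed[OF assms(2,3)]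
  have 2: "(e (a \<ominus> a') b \<oplus>\<^bsub>F\<^esub> e a' b) \<ominus>\<^bsub>F\<^esub> e a' b \<in> N"
    using d1 ec by (simp add: a_minus_def F.a_assoc F.r_neg)
  show ?thesis by (rule F.submodule_diff_trans[OF N_submodule ec(1) F.a_closed[OF ec(2,3)] ec(3) 1 2])
qed

lemma from_poly_pair_cong:
  assumes ab: "a \<in> I" "b \<in> I"
  shows "from_poly (indexed_pmult (indexed_var (cl a)) (cl b)) \<ominus>\<^bsub>F\<^esub> e a b \<in> N"
proof -
  obtain a' b' where r: "rep (pair_class (a, b)) = (a', b')" by (cases "rep (pair_class (a, b))")
  have ab': "a' \<in> I" "b' \<in> I" and eq: "{#cl a', cl b'#} = {#cl a, cl b#}"
    using rep_pair_class[of "(a, b)"] ab r by (auto simp: pair_class_def)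
  have swap: "e x y \<ominus>\<^bsub>F\<^esub> e y x \<in> N" if "x \<in> I" "y \<in> I" for x y
    by (rule W_relations(3)[OF W_le_N that])
  have main: "e x y \<ominus>\<^bsub>F\<^esub> e x' y' \<in> N"
    if h: "x \<in> I" "y \<in> I" "x' \<in> I" "y' \<in> I" "cl x = cl x'" "cl y = cl y'" for x y x' y'
  proof -
    note T = F.submodule_diff_trans[OF N_submodule]
    have "e x y \<ominus>\<^bsub>F\<^esub> e x' y \<in> N" by (rule e_class_cong[OF h(1,3,2,5)])
    moreover have "e x' y \<ominus>\<^bsub>F\<^esub> e y x' \<in> N" by (rule swap[OF h(3,2)])
    moreover have "e y x' \<ominus>\<^bsub>F\<^esub> e y' x' \<in> N" by (rule e_class_cong[OF h(2,4,3,6)])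
    moreover have "e y' x' \<ominus>\<^bsub>F\<^esub> e x' y' \<in> N" by (rule swap[OF h(4,3)])
    ultimately show ?thesis
      using T[of "e x y" "e x' y" "e y x'"] T[of "e x y" "e y x'" "e y' x'"] T[of "e x y" "e y' x'" "e x' y'"]
        e_closed h(1-4) by blast
  qed
  have "e a' b' \<ominus>\<^bsub>F\<^esub> e a b \<in> N"
  proof (cases "cl a' = cl a \<and> cl b' = cl b")
    case True
    then show ?thesis using main[OF ab' ab] by blast
  next
    case False
    \<comment> \<open>A monomial forgets the order of its two classes; the symmetry relation
      restores it.\<close>
    then have "cl a' = cl b" "cl b' = cl a" using eq by (auto simp: add_eq_conv_ex)
    then have "e a' b' \<ominus>\<^bsub>F\<^esub> e b a \<in> N" using main[OF ab' ab(2,1)] by blast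
    then show ?thesis
      using F.submodule_diff_trans[OF N_submodule _ _ _ _ swap[OF ab(2,1)]] e_closed ab ab' by blast
  qed
  then show ?thesis unfolding from_poly_pair[OF ab] r .
qed

lemma from_to_poly:
  assumes "f \<in> carrier F"
  shows "from_poly (to_poly f) \<ominus>\<^bsub>F\<^esub> f \<in> N"
  using assms
proof (induction rule: free_module_induct)
  case zero
  have "from_poly (to_poly (\<lambda>_. \<zero>)) = \<zero>\<^bsub>F\<^esub>" unfolding to_poly_zero by (rule from_poly_zero) simp
  moreover have "\<zero>\<^bsub>F\<^esub> \<ominus>\<^bsub>F\<^esub> \<zero>\<^bsub>F\<^esub> \<in> N"
    using F.submodule_zero[OF N_submodule] by (simp add: F.diff_zero_iff[THEN iffD2])
  ultimately show ?case by (simp add: free_module_sel(2))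
next
  case (add g r p)
  obtain a b where p: "p = (a, b)" "a \<in> I" "b \<in> I" using add by (cases p) auto
  note ec = e_closed[OF p(2,3)]
  have re: "r \<odot>\<^bsub>F\<^esub> e a b \<in> carrier F" by (rule F.smult_closed[OF add(2) ec])
  have q: "indexed_pmult (indexed_var (cl a)) (cl b) \<in> polys V"
    by (rule pmult_poly[OF indexed_var_poly[OF cl_V[OF p(2)]] cl_V[OF p(3)]])
  have "from_poly (to_poly (r \<odot>\<^bsub>F\<^esub> e a b \<oplus>\<^bsub>F\<^esub> g))
      = r \<odot>\<^bsub>F\<^esub> from_poly (indexed_pmult (indexed_var (cl a)) (cl b)) \<oplus>\<^bsub>F\<^esub> from_poly (to_poly g)"
    unfolding to_poly_add[OF re add(1)] from_poly_padd to_poly_smult[OF ec add(2)] from_poly_pscale[OF add(2)]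
      to_poly_e[OF p(2,3)] ..
  moreover have "\<dots> \<ominus>\<^bsub>F\<^esub> (r \<odot>\<^bsub>F\<^esub> e a b \<oplus>\<^bsub>F\<^esub> g) \<in> N"
    by (rule F.submodule_diff_add[OF N_submodule F.smult_closed[OF add(2) from_poly_closed[OF q]] re
          from_poly_closed[OF to_poly_closed[OF add(1)]] add(1)
          F.submodule_diff_smult[OF N_submodule from_poly_closed[OF q] ec add(2) from_poly_pair_cong[OF p(2,3)]] add.IH])
  ultimately show ?case unfolding p(1) by simp
qed

text \<open>An ideal large enough to contain \<open>S\<close> whose members have their degree-two
  part in \<open>N\<close>. Closure under multiplication needs control of the lower degrees: a zero
  constant term, and a degree-one part that lands in \<open>N\<close> after multiplication by any
  variable.\<close>

definition vanishing_polys :: "('a set multiset \<Rightarrow> 'a) set" where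
  "vanishing_polys = {p \<in> polys V. p {#} = \<zero> \<and> (\<forall>v\<in>V. from_poly (indexed_pmult p v) \<in> N) \<and> from_poly p \<in> N}"

lemma vanishing_polys_ideal: "ideal vanishing_polys P"
proof (rule Pc.ideal_criterion)
  note N = F.submoduleE(4,5)[OF N_submodule]
  have zero: "from_poly (\<lambda>_. \<zero>) \<in> N"
    using from_poly_zero[of "\<lambda>_. \<zero>"] F.submodule_zero[OF N_submodule] by simp
  show "a \<in> carrier P" if "a \<in> vanishing_polys" for a using that by (simp add: vanishing_polys_def)
  have "indexed_pmult (\<lambda>_. \<zero>) v = (\<lambda>_. \<zero>)" for v :: "'a set" by (auto simp: indexed_pmult_def)
  moreover have "(\<lambda>_. \<zero>) \<in> polys V" using indexed_pset.indexed_const[OF zero_closed] by (simp add: indexed_zero_def)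
  ultimately show "\<zero>\<^bsub>P\<^esub> \<in> vanishing_polys"
    using zero by (simp add: vanishing_polys_def indexed_zero_def)
  have add: "indexed_padd p q \<in> vanishing_polys" if "p \<in> vanishing_polys" "q \<in> vanishing_polys" for p q
    using that N(2) indexed_pset.indexed_padd[of p V "carrier R" q]
    by (simp add: vanishing_polys_def pmult_padd from_poly_padd) (simp add: indexed_padd_def)
  then show "p \<oplus>\<^bsub>P\<^esub> q \<in> vanishing_polys" if "p \<in> vanishing_polys" "q \<in> vanishing_polys" for p q
    using that by simp
  have pmult: "indexed_pmult p v \<in> vanishing_polys" if p: "p \<in> vanishing_polys" and v: "v \<in> V" for p v
  proof -
    have p0: "p {#} = \<zero>" using p by (simp add: vanishing_polys_def)
    \<comment> \<open>After two multiplications by variables, the degree-two part comes from the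
      constant term of \<open>p\<close> alone, which is zero.\<close>
    have "from_poly (indexed_pmult (indexed_pmult p v) w) = \<zero>\<^bsub>F\<^esub>" for w
    proof (rule from_poly_zero)
      fix m :: "'a set multiset" assume m: "size m = 2"
      have "m - {#w#} - {#v#} = {#}" if "w \<in># m" "v \<in># m - {#w#}"
        using that m by (metis One_nat_def diff_Suc_1 numeral_2_eq_2 size_Diff_singleton size_eq_0_iff_empty)
      then show "indexed_pmult (indexed_pmult p v) w m = \<zero>" using p0 by (auto simp: indexed_pmult_def)
    qed
    then show ?thesis
      using p v F.submodule_zero[OF N_submodule] pmult_poly[of p V v]
      unfolding vanishing_polys_def by (simp add: indexed_pmult_empty)
  qed
  show "q \<otimes>\<^bsub>P\<^esub> p \<in> vanishing_polys" if q: "q \<in> carrier P" and p: "p \<in> vanishing_polys" for q p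
  proof -
    have pc: "p \<in> polys V" using p by (simp add: vanishing_polys_def)
    note c = polys_coeff[OF pc]
    have "q \<in> polys V" using q by simp
    then have "conv q p \<in> vanishing_polys"
    proof (induction rule: indexed_pset.induct)
      case (indexed_const k)
      show ?case unfolding conv_const[OF indexed_const c]
        using p N(1)[OF indexed_const] indexed_const pscale_closed[OF indexed_const pc]
        by (simp add: vanishing_polys_def pmult_pscale from_poly_pscale) (simp add: pscale_def)
    next
      case (indexed_padd q q')
      show ?case unfolding conv_padd[OF polys_coeff[OF indexed_padd(1)] polys_coeff[OF indexed_padd(2)] c]
        by (rule add[OF indexed_padd.IH])
    next
      case (indexed_pmult q i)
      show ?case unfolding conv_pmult[OF polys_coeff[OF indexed_pmult(1)] c]
        by (rule pmult[OF indexed_pmult.IH indexed_pmult(2)])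
    qed
    then show ?thesis by simp
  qed
qed

text \<open>The defining relations are homogeneous of degree one, so they have no constant or
  quadratic part. Times a variable, they become linearity relations of \<open>F\<close> up to the
  choice of representatives, which \<open>from_poly_pair_cong\<close> absorbs.\<close>

lemma sym_ideal_le_vanishing: "S \<subseteq> vanishing_polys"
  unfolding sym_ideal_def
proof (rule Pc.genideal_minimal[OF vanishing_polys_ideal], rule subsetI)
  fix p assume p: "p \<in> sym_relations R Q"
  have pc: "p \<in> polys V" using p sym_relations_closed by auto
  have var: "indexed_var (cl a) \<in> polys V" if "a \<in> I" for a by (rule indexed_var_poly[OF cl_V[OF that]])
  note pair = pmult_poly[OF var cl_V]
  have step: "from_poly (indexed_pmult (indexed_var (cl a)) (cl c)) \<ominus>\<^bsub>F\<^esub> g \<in> N"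
    if "a \<in> I" "c \<in> I" "e a c \<ominus>\<^bsub>F\<^esub> h \<in> N" "h \<in> carrier F" "g \<in> carrier F" "g \<ominus>\<^bsub>F\<^esub> h \<in> N" for a c g h
  proof -
    have "h \<ominus>\<^bsub>F\<^esub> g = \<ominus>\<^bsub>F\<^esub> (g \<ominus>\<^bsub>F\<^esub> h)" using that(4,5) by (simp add: a_minus_def F.minus_add F.a_comm)
    then have hg: "h \<ominus>\<^bsub>F\<^esub> g \<in> N" using F.submoduleE(3)[OF N_submodule that(6)] by simp
    note T = F.submodule_diff_trans[OF N_submodule]
    note c = from_poly_closed[OF pair[OF that(1,2)]] e_closed[OF that(1,2)]
    show ?thesis
      by (rule T[OF c(1) that(4) that(5) T[OF c that(4) from_poly_pair_cong[OF that(1,2)] that(3)] hg])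
  qed
  from p consider a b where "a \<in> I" "b \<in> I"
      "p = indexed_var (cl (a \<oplus> b)) \<ominus>\<^bsub>P\<^esub> indexed_padd (indexed_var (cl a)) (indexed_var (cl b))"
    | r a where "r \<in> carrier R" "a \<in> I" "p = indexed_var (cl (r \<otimes> a)) \<ominus>\<^bsub>P\<^esub> pscale r (indexed_var (cl a))"
    unfolding sym_relations_eq by blast
  then show "p \<in> vanishing_polys"
  proof cases
    case 1
    have ab: "a \<oplus> b \<in> I" by (rule idealD(3)[OF I 1(1,2)])
    have padd: "indexed_padd (indexed_var (cl a)) (indexed_var (cl b)) \<in> polys V"
      by (rule indexed_pset.indexed_padd[OF var[OF 1(1)] var[OF 1(2)]])
    have p_eq: "p = (\<lambda>m. indexed_var (cl (a \<oplus> b)) m \<ominus> (indexed_var (cl a) m \<oplus> indexed_var (cl b) m))"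
      unfolding 1(3) poly_algebra_minus[OF var[OF ab] padd] by (simp add: indexed_padd_def)
    have p0: "p m = \<zero>" if "size m \<noteq> 1" for m
    proof -
      have "m \<noteq> {#x#}" for x using that by auto
      then show ?thesis by (simp add: p_eq indexed_var_apply a_minus_def)
    qed
    have "from_poly (indexed_pmult p v) \<in> N" if v: "v \<in> V" for v
    proof -
      obtain c where c: "c \<in> I" "v = cl c" using V_cl[OF v] by blast
      note fa = from_poly_closed[OF pair[OF 1(1) c(1)]] and fb = from_poly_closed[OF pair[OF 1(2) c(1)]]
      note ea = e_closed[OF 1(1) c(1)] and eb = e_closed[OF 1(2) c(1)]
      have "from_poly (indexed_pmult p v) = from_poly (indexed_pmult (indexed_var (cl (a \<oplus> b))) (cl c))
          \<ominus>\<^bsub>F\<^esub> (from_poly (indexed_pmult (indexed_var (cl a)) (cl c)) \<oplus>\<^bsub>F\<^esub> from_poly (indexed_pmult (indexed_var (cl b)) (cl c)))"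
        unfolding 1(3) c(2) pmult_diff[OF var[OF ab] padd cl_V[OF c(1)]] pmult_padd
          from_poly_diff[OF pair[OF ab c(1)] indexed_pset.indexed_padd[OF pair[OF 1(1) c(1)] pair[OF 1(2) c(1)]]]
          from_poly_padd ..
      also have "\<dots> \<in> N"
        by (rule step[OF ab c(1) W_relations(1)[OF W_le_N 1(1) c(1) 1(2)] F.a_closed[OF ea eb] F.a_closed[OF fa fb]
              F.submodule_diff_add[OF N_submodule fa ea fb eb from_poly_pair_cong[OF 1(1) c(1)] from_poly_pair_cong[OF 1(2) c(1)]]])
      finally show ?thesis .
    qed
    moreover have "from_poly p = \<zero>\<^bsub>F\<^esub>" by (rule from_poly_zero) (simp add: p0)
    ultimately show ?thesis
      using pc p0[of "{#}"] F.submodule_zero[OF N_submodule] by (simp add: vanishing_polys_def)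
  next
    case 2
    have ra: "r \<otimes> a \<in> I" by (rule idealD(4)[OF I 2(1,2)])
    have ps: "pscale r (indexed_var (cl a)) \<in> polys V" by (rule pscale_closed[OF 2(1) var[OF 2(2)]])
    have p_eq: "p = (\<lambda>m. indexed_var (cl (r \<otimes> a)) m \<ominus> r \<otimes> indexed_var (cl a) m)"
      unfolding 2(3) poly_algebra_minus[OF var[OF ra] ps] by (simp add: pscale_def)
    have p0: "p m = \<zero>" if "size m \<noteq> 1" for m
    proof -
      have "m \<noteq> {#x#}" for x using that by auto
      then show ?thesis using 2(1) by (simp add: p_eq indexed_var_apply a_minus_def)
    qed
    have "from_poly (indexed_pmult p v) \<in> N" if v: "v \<in> V" for v
    proof -
      obtain c where c: "c \<in> I" "v = cl c" using V_cl[OF v] by blast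
      note fa = from_poly_closed[OF pair[OF 2(2) c(1)]] and ea = e_closed[OF 2(2) c(1)]
      have "from_poly (indexed_pmult p v) = from_poly (indexed_pmult (indexed_var (cl (r \<otimes> a))) (cl c))
          \<ominus>\<^bsub>F\<^esub> (r \<odot>\<^bsub>F\<^esub> from_poly (indexed_pmult (indexed_var (cl a)) (cl c)))"
        unfolding 2(3) c(2) pmult_diff[OF var[OF ra] ps cl_V[OF c(1)]] pmult_pscale[OF 2(1)]
          from_poly_diff[OF pair[OF ra c(1)] pscale_closed[OF 2(1) pair[OF 2(2) c(1)]]] from_poly_pscale[OF 2(1)] ..
      also have "\<dots> \<in> N"
        by (rule step[OF ra c(1) W_relations(2)[OF W_le_N 2(2) c(1) 2(1)] F.smult_closed[OF 2(1) ea] F.smult_closed[OF 2(1) fa]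
              F.submodule_diff_smult[OF N_submodule fa ea 2(1) from_poly_pair_cong[OF 2(2) c(1)]]])
      finally show ?thesis .
    qed
    moreover have "from_poly p = \<zero>\<^bsub>F\<^esub>" by (rule from_poly_zero) (simp add: p0)
    ultimately show ?thesis
      using pc p0[of "{#}"] F.submodule_zero[OF N_submodule] by (simp add: vanishing_polys_def)
  qed
qed

lemma to_poly_mem_sym_ideal_iff:
  assumes "f \<in> carrier F"
  shows "to_poly f \<in> S \<longleftrightarrow> f \<in> N"
proof
  show "f \<in> N" if "to_poly f \<in> S"
  proof -
    have "from_poly (to_poly f) \<in> N" using that sym_ideal_le_vanishing by (auto simp: vanishing_polys_def)
    then show ?thesis
      using F.submodule_diff_mem[OF N_submodule from_poly_closed[OF to_poly_closed[OF assms]] assms from_to_poly[OF assms]]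
      by simp
  qed
qed (rule sym_kernel_le)

text \<open>Polynomials are built from constants by sums and multiplication by variables, and the
  quadratic part of \<open>p\<close> times a variable comes from the linear part of
  \<open>p\<close>. So surjectivity is proved together with statements about the parts of degree one
  and zero.\<close>

lemma to_poly_image: "to_poly ` carrier F = homogeneous_polys R V 2"
proof
  let ?T = "to_poly ` carrier F"
  have "(\<lambda>_. \<zero>) \<in> carrier F" using F.submodule_zero[OF F.carrier_is_submodule] by (simp add: free_module_sel(2))
  from imageI[OF this, of to_poly] have T0: "(\<lambda>_. \<zero>) \<in> ?T" unfolding to_poly_zero .
  have Tadd: "indexed_padd p q \<in> ?T" if "p \<in> ?T" "q \<in> ?T" for p q
  proof -
    from that obtain f g where "f \<in> carrier F" "g \<in> carrier F" "p = to_poly f" "q = to_poly g" by blast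
    then show ?thesis using imageI[OF F.a_closed[of f g], of to_poly] to_poly_add[of f g] by simp
  qed
  have Tscale: "pscale r p \<in> ?T" if "r \<in> carrier R" "p \<in> ?T" for r p
  proof -
    from that obtain f where "f \<in> carrier F" "p = to_poly f" by blast
    then show ?thesis using imageI[OF F.smult_closed[of r f], of to_poly] to_poly_smult[of f r] that(1) by simp
  qed
  have "to_poly f \<in> homogeneous_polys R V 2" if "f \<in> carrier F" for f
  proof -
    have "to_poly f m = \<zero>" if "size m \<noteq> 2" for m
      using \<open>f \<in> carrier F\<close>
    proof (induction rule: free_module_induct)
      case zero
      then show ?case by (simp add: to_poly_zero)
    next
      case (add g r p)
      obtain a b where p: "p = (a, b)" "a \<in> I" "b \<in> I" using add by (cases p) auto
      have "m \<noteq> {#x, y#}" for x y using \<open>size m \<noteq> 2\<close> by auto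
      then have "indexed_pmult (indexed_var (cl a)) (cl b) m = \<zero>" by (simp add: pmult_var_apply)
      then show ?case
        unfolding p(1) to_poly_add[OF F.smult_closed[OF add(2) e_closed[OF p(2,3)]] add(1)]
          to_poly_smult[OF e_closed[OF p(2,3)] add(2)] to_poly_e[OF p(2,3)]
        using add.IH add(2) by (simp add: indexed_padd_def pscale_def)
    qed
    then show ?thesis using to_poly_closed[OF that] by (auto simp: homogeneous_polys_def)
  qed
  then show "?T \<subseteq> homogeneous_polys R V 2" by blast
  have parts: "hom_part 2 p \<in> ?T \<and> (\<forall>v\<in>V. indexed_pmult (hom_part 1 p) v \<in> ?T)
      \<and> (\<forall>v\<in>V. \<forall>w\<in>V. indexed_pmult (indexed_pmult (hom_part 0 p) v) w \<in> ?T)" if "p \<in> polys V" for p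
    using that
  proof (induction rule: indexed_pset.induct)
    case (indexed_const k)
    have z: "indexed_pmult (\<lambda>_. \<zero>) v = (\<lambda>_. \<zero>)" for v :: "'a set" by (auto simp: indexed_pmult_def)
    have "indexed_pmult (indexed_pmult (indexed_const k) v) w \<in> ?T" if vw: "v \<in> V" "w \<in> V" for v w
    proof -
      obtain a b where ab: "a \<in> I" "b \<in> I" "v = cl a" "w = cl b" using V_cl vw by blast
      have "indexed_const k = pscale k (indexed_const \<one> :: 'a set multiset \<Rightarrow> 'a)"
        using indexed_const by (auto simp: indexed_const_def pscale_def)
      then have "indexed_pmult (indexed_pmult (indexed_const k) v) w = pscale k (to_poly (e a b))"
        unfolding to_poly_e[OF ab(1,2)] indexed_var_def using ab(3,4) by (simp add: pmult_pscale[OF indexed_const])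
      then show ?thesis using Tscale[OF indexed_const, of "to_poly (e a b)"] e_closed[OF ab(1,2)] by simp
    qed
    then show ?case using T0 z by (simp add: hom_part_const)
  next
    case (indexed_padd p q)
    then show ?case using Tadd by (simp add: hom_part_padd pmult_padd)
  next
    case (indexed_pmult p i)
    have z: "indexed_pmult (\<lambda>_. \<zero>) v = (\<lambda>_. \<zero>)" for v :: "'a set" by (auto simp: indexed_pmult_def)
    have "hom_part 2 (indexed_pmult p i) = indexed_pmult (hom_part 1 p) i"
      "hom_part 1 (indexed_pmult p i) = indexed_pmult (hom_part 0 p) i"
      using hom_part_pmult_Suc[of 1 p i] hom_part_pmult_Suc[of 0 p i] by (simp_all add: numeral_2_eq_2)
    then show ?case using indexed_pmult T0 z by (simp add: hom_part_pmult_0)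
  qed
  show "homogeneous_polys R V 2 \<subseteq> ?T"
  proof
    fix p assume p: "p \<in> homogeneous_polys R V 2"
    then have "hom_part 2 p = p" by (force simp: homogeneous_polys_def hom_part_def)
    moreover have "p \<in> polys V" using p by (simp add: homogeneous_polys_def)
    ultimately show "p \<in> ?T" using parts by metis
  qed
qed

lemma module_length_sym_component:
  "module_length R (sym_component R Q 2) = interval_length R F N (carrier F)"
proof (rule F.module_length_image[where \<phi> = "\<lambda>f. S +>\<^bsub>P\<^esub> to_poly f"])
  let ?C = "sym_component R Q 2"
  interpret Si: ideal S P by (rule sym_ideal)
  have pc: "f \<in> carrier F \<Longrightarrow> to_poly f \<in> carrier P" for f using to_poly_closed by simp
  show "submodule (carrier F) R F" by (rule F.carrier_is_submodule)
  show "(\<lambda>f. S +>\<^bsub>P\<^esub> to_poly f) ` carrier F = carrier ?C"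
    unfolding sym_component_def to_poly_image[symmetric] by (simp add: image_image)
  show "S +>\<^bsub>P\<^esub> to_poly (f \<oplus>\<^bsub>F\<^esub> g) = (S +>\<^bsub>P\<^esub> to_poly f) \<oplus>\<^bsub>?C\<^esub> (S +>\<^bsub>P\<^esub> to_poly g)"
    if "f \<in> carrier F" "g \<in> carrier F" for f g
    using Si.a_rcos_sum[OF pc[OF that(1)] pc[OF that(2)]] to_poly_add[OF that]
    by (simp add: sym_component_def symmetric_algebra_def quot_module_def)
  show "S +>\<^bsub>P\<^esub> to_poly (r \<odot>\<^bsub>F\<^esub> f) = r \<odot>\<^bsub>?C\<^esub> (S +>\<^bsub>P\<^esub> to_poly f)"
    if r: "r \<in> carrier R" and f: "f \<in> carrier F" for r f
  proof -
    have coset: "S +>\<^bsub>P\<^esub> (r \<odot>\<^bsub>P\<^esub> y) = S +>\<^bsub>P\<^esub> (r \<odot>\<^bsub>P\<^esub> to_poly f)" if "y \<in> S +>\<^bsub>P\<^esub> to_poly f" for y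
    proof -
      from that obtain s where s: "s \<in> S" "y = s \<oplus>\<^bsub>P\<^esub> to_poly f" by (auto simp: a_r_coset_def')
      have sc: "s \<in> carrier P" using Pc.idealD(1)[OF sym_ideal s(1)] .
      have "r \<odot>\<^bsub>P\<^esub> y = r \<odot>\<^bsub>P\<^esub> s \<oplus>\<^bsub>P\<^esub> r \<odot>\<^bsub>P\<^esub> to_poly f"
        unfolding s(2) by (rule P.smult_r_distr[OF r sc pc[OF f]])
      moreover have "r \<odot>\<^bsub>P\<^esub> s \<in> S" by (rule P.submoduleE(4)[OF sym_submodule r s(1)])
      ultimately have "r \<odot>\<^bsub>P\<^esub> y \<in> S +>\<^bsub>P\<^esub> (r \<odot>\<^bsub>P\<^esub> to_poly f)" unfolding a_r_coset_def' by blast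
      then show ?thesis
        by (rule Si.a_repr_independence'[OF _ P.smult_closed[OF r pc[OF f]], symmetric])
    qed
    have "r \<odot>\<^bsub>?C\<^esub> (S +>\<^bsub>P\<^esub> to_poly f) = (\<Union>y\<in>S +>\<^bsub>P\<^esub> to_poly f. S +>\<^bsub>P\<^esub> (r \<odot>\<^bsub>P\<^esub> y))"
      by (simp add: sym_component_def symmetric_algebra_def quot_module_def del: poly_algebra_sel)
    also have "\<dots> = (\<Union>y\<in>S +>\<^bsub>P\<^esub> to_poly f. S +>\<^bsub>P\<^esub> (r \<odot>\<^bsub>P\<^esub> to_poly f))" by (rule SUP_cong[OF refl coset])
    also have "\<dots> = S +>\<^bsub>P\<^esub> (r \<odot>\<^bsub>P\<^esub> to_poly f)" using Si.a_rcos_self[OF pc[OF f]] by blast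
    finally show ?thesis using to_poly_smult[OF f r] by simp
  qed
  have C0: "\<zero>\<^bsub>?C\<^esub> = S" by (simp add: sym_component_def symmetric_algebra_def quot_module_def)
  have "to_poly \<zero>\<^bsub>F\<^esub> = \<zero>\<^bsub>P\<^esub>" using to_poly_zero by (simp add: free_module_sel(2) indexed_zero_def)
  then show "S +>\<^bsub>P\<^esub> to_poly \<zero>\<^bsub>F\<^esub> = \<zero>\<^bsub>?C\<^esub>"
    unfolding C0 using Pc.coset_eq_ideal_iff[OF sym_ideal P.zero_closed] Pc.idealD(2)[OF sym_ideal] by simp
  have iff: "f \<in> N \<longleftrightarrow> S +>\<^bsub>P\<^esub> to_poly f = S" if "f \<in> carrier F" for f
    using Pc.coset_eq_ideal_iff[OF sym_ideal pc[OF that]] to_poly_mem_sym_ideal_iff[OF that] by blast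
  show "N = {f \<in> carrier F. S +>\<^bsub>P\<^esub> to_poly f = \<zero>\<^bsub>?C\<^esub>}"
    unfolding C0 using iff F.submoduleE(1)[OF N_submodule] by blast
qed

end

end

section \<open>Independence of the minimal reduction\<close>

context noetherian_local_ring begin

lemma primary_to_max:
  assumes "primary_to R \<mm> I"
  shows "max_primary I" "I \<subseteq> \<mm>"
proof -
  have I: "ideal I R" "I \<noteq> carrier R" and rad: "ideal_radical R I = \<mm>"
    using assms by (auto simp: primary_to_def primary_ideal_def)
  show "I \<subseteq> \<mm>" by (rule proper_ideal_le_max[OF I])
  have "P = \<mm>" if P: "primeideal P R" "I \<subseteq> P" for P
  proof
    show "P \<subseteq> \<mm>" by (rule primeideal_le_max[OF P(1)])
    show "\<mm> \<subseteq> P"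
      using primeideal_pow_mem[OF P(1)] P(2) unfolding rad[symmetric] ideal_radical_def by blast
  qed
  then show "max_primary I" using I(1) by (simp add: max_primary_def)
qed

lemma colength_minimal_reduction_eq:
  assumes I: "ideal I R" and J: "is_reduction R I J" "max_primary J" and J': "is_reduction R I J'" "max_primary J'"
    and xs: "set xs \<subseteq> carrier R" "permutable_seq {\<zero>} xs" "J = Idl (set xs)"
    and ys: "set ys \<subseteq> carrier R" "permutable_seq {\<zero>} ys" "J' = Idl (set ys)" "length ys = length xs"
  shows "colength J = colength J'"
proof -
  obtain e e' where e: "colength J = enat e" "colength J' = enat e'"
    using max_primary_finite_colength[OF J(2)] max_primary_finite_colength[OF J'(2)] by auto
  have "e' \<le> e" by (rule reduction_colength_le[OF I J(1) J'(1) xs ys e])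
  moreover have "e \<le> e'" by (rule reduction_colength_le[OF I J'(1) J(1) ys(1-3) xs ys(4)[symmetric] e(2,1)])
  ultimately show ?thesis using e by simp
qed

text \<open>The colength of \<open>B\<close> is cancelled from two sums; finiteness of the colength
  of \<open>A\<close> makes this legitimate in \<open>enat\<close>.\<close>

lemma len_eq_of_colength_eq:
  assumes "ideal A R" "ideal A' R" "ideal B R" "A \<subseteq> B" "A' \<subseteq> B"
    and "colength A = colength A'" "colength A \<noteq> \<infinity>"
  shows "len A B = len A' B"
proof -
  have "len A B + colength B = len A' B + colength B" "colength B \<noteq> \<infinity>"
    using colength_add[OF assms(1,3,4)] colength_add[OF assms(2,3,5)] assms(6,7)
    by (auto simp: plus_enat_def split: enat.splits)
  then show ?thesis by (simp add: add.commute[of _ "colength B"] enat_add_left_cancel)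
qed

lemma colength_eq_of_len_eq:
  assumes "ideal A R" "ideal A' R" "ideal B R" "ideal B' R" "A \<subseteq> B" "A' \<subseteq> B'"
    and "colength A = colength A'" "colength A \<noteq> \<infinity>" "len A B = len A' B'"
  shows "colength B = colength B'"
proof -
  have "len A B + colength B = len A B + colength B'" "len A B \<noteq> \<infinity>"
    using colength_add[OF assms(1,3,5)] colength_add[OF assms(2,4,6)] assms(7-9)
    by (auto simp: plus_enat_def split: enat.splits)
  then show ?thesis by (simp add: enat_add_left_cancel)
qed

lemma max_primary_ideal_pow:
  assumes "max_primary K"
  shows "max_primary (ideal_pow R K n)"
proof -
  have K: "ideal K R" using assms by (simp add: max_primary_def)
  have "P = \<mm>" if P: "primeideal P R" "ideal_pow R K n \<subseteq> P" for P
  proof -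
    have "K \<subseteq> P" using primeideal_pow_mem[OF P(1)] pow_mem_ideal_pow[OF K, of _ n] P(2) idealD(1)[OF K] by blast
    then show ?thesis using assms P(1) by (auto simp: max_primary_def)
  qed
  then show ?thesis using ideal_pow_ideal[OF K] by (auto simp: max_primary_def)
qed

end

theorem proposition2p1:
  fixes R :: "('a, 'b) ring_scheme" and \<mm> I J J' :: "'a set" and d :: nat
  assumes "cohen_macaulay_local_ring R \<mm>"
    and "krull_dim R = enat d" and "d > 0"
    and "infinite (carrier (R Quot \<mm>))"
    and "primary_to R \<mm> I"
    and "minimal_reduction R I J" and "minimal_reduction R I J'"
  shows "module_length R (ideal_quot R I J) = module_length R (ideal_quot R I J') \<and>
         (\<forall>n\<ge>2. module_length R (ideal_quot R (ideal_pow R I n) (ideal_pow R J (n - 1) \<cdot>\<^bsub>R\<^esub> I))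
               = module_length R (ideal_quot R (ideal_pow R I n) (ideal_pow R J' (n - 1) \<cdot>\<^bsub>R\<^esub> I))) \<and>
         module_length R (ideal_quot R (carrier R) (colon_ideal R J I))
           = module_length R (ideal_quot R (carrier R) (colon_ideal R J' I)) \<and>
         module_length R (sym_component R (ideal_quot R I J) 2)
           = module_length R (sym_component R (ideal_quot R I J') 2)"
proof -
  note cm = cohen_macaulay_local_ring.axioms[OF assms(1)]
  interpret noetherian_local_ring R \<mm>
    using cm by (simp add: noetherian_local_ring_def noetherian_local_ring_axioms_def cohen_macaulay_local_ring_axioms_def)
  note inf = assms(4) and dim = assms(2)
  have depth: "depth R \<mm> = enat d" using cohen_macaulay_local_ring.depth_eq_dim[OF assms(1)] dim by simp
  note Ip = primary_to_max[OF assms(5)]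
  have I: "ideal I R" using Ip(1) by (simp add: max_primary_def)
  have Ic: "I \<subseteq> carrier R" using idealD(1)[OF I] by blast
  obtain xs where xs: "length xs = d" "set xs \<subseteq> carrier R" "permutable_seq {\<zero>\<^bsub>R\<^esub>} xs" "J = Idl\<^bsub>R\<^esub> (set xs)"
      "adjoins {\<zero>\<^bsub>R\<^esub>} xs = J" "max_primary J"
    using minimal_reduction_regular[OF inf dim depth Ip assms(6)] by blast
  obtain ys where ys: "length ys = d" "set ys \<subseteq> carrier R" "permutable_seq {\<zero>\<^bsub>R\<^esub>} ys" "J' = Idl\<^bsub>R\<^esub> (set ys)"
      "adjoins {\<zero>\<^bsub>R\<^esub>} ys = J'" "max_primary J'"
    using minimal_reduction_regular[OF inf dim depth Ip assms(7)] by blast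
  have red: "is_reduction R I J" "is_reduction R I J'" using assms(6,7) by (auto simp: minimal_reduction_def)
  note Jr = is_reductionD(1,2)[OF red(1)] and J'r = is_reductionD(1,2)[OF red(2)]
  have xsI: "set xs \<subseteq> I" using adjoins_set[OF zeroideal xs(2)] xs(5) Jr(2) by blast
  have ysI: "set ys \<subseteq> I" using adjoins_set[OF zeroideal ys(2)] ys(5) J'r(2) by blast
  have zI: "{\<zero>\<^bsub>R\<^esub>} \<subseteq> I" using idealD(2)[OF I] by blast
  have col: "colength J = colength J'"
    by (rule colength_minimal_reduction_eq[OF I red(1) xs(6) red(2) ys(6) xs(2-4) ys(2-4)]) (simp add: xs ys)
  note fin = max_primary_finite_colength[OF xs(6)]
  have IJ: "module_length R (ideal_quot R I J) = module_length R (ideal_quot R I J')"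
    unfolding module_length_ideal_quot[OF I Jr] module_length_ideal_quot[OF I J'r]
    by (rule len_eq_of_colength_eq[OF Jr(1) J'r(1) I Jr(2) J'r(2) col fin])
  \<comment> \<open>Here \<open>k = n - 1\<close>. The case \<open>k = 1\<close> is used again for
    the symmetric squares.\<close>
  have pow: "module_length R (ideal_quot R (ideal_pow R I (Suc k)) (ideal_pow R J k \<cdot>\<^bsub>R\<^esub> I))
      = module_length R (ideal_quot R (ideal_pow R I (Suc k)) (ideal_pow R J' k \<cdot>\<^bsub>R\<^esub> I))" for k
  proof -
    let ?A = "ideal_pow R J k \<cdot>\<^bsub>R\<^esub> I" and ?A' = "ideal_pow R J' k \<cdot>\<^bsub>R\<^esub> I"
    have A: "ideal ?A R" "?A \<subseteq> ideal_pow R I (Suc k)" and A': "ideal ?A' R" "?A' \<subseteq> ideal_pow R I (Suc k)"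
      using ideal_prod_is_ideal[OF ideal_pow_ideal[OF Jr(1)] I] ideal_prod_is_ideal[OF ideal_pow_ideal[OF J'r(1)] I]
        ideal_prod_mono[OF ideal_pow_mono[OF Jr(2)] subset_refl] ideal_prod_mono[OF ideal_pow_mono[OF J'r(2)] subset_refl]
      by (simp_all add: ideal_pow_Suc)
    \<comment> \<open>The reduction enters this formula only through its colength, and
      \<open>col\<close> equates the two colengths.\<close>
    have "colength ?A = binomial_colength (colength J) (colength I) d k"
      using colength_ideal_power_mod[OF xs(3) zeroideal I xsI zI, of k]
      unfolding ideal_power_mod_zero[OF I xs(2)] xs(1,5) xs(4)[symmetric] .
    moreover have "colength ?A' = binomial_colength (colength J') (colength I) d k"
      using colength_ideal_power_mod[OF ys(3) zeroideal I ysI zI, of k]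
      unfolding ideal_power_mod_zero[OF I ys(2)] ys(1,5) ys(4)[symmetric] .
    ultimately have eq: "colength ?A = colength ?A'" using col by simp
    \<comment> \<open>This serves finiteness: \<open>?A\<close> contains a power of
      \<open>J\<close>, and such a power has finite colength.\<close>
    have "ideal_pow R J (Suc k) \<subseteq> ?A" unfolding ideal_pow_Suc by (rule ideal_prod_mono[OF subset_refl Jr(2)])
    moreover have "max_primary (ideal_pow R J (Suc k))" by (rule max_primary_ideal_pow[OF xs(6)])
    ultimately have "colength ?A \<noteq> \<infinity>"
      using max_primary_finite_colength[OF max_primary_mono] A(1) by blast
    then show ?thesis
      unfolding module_length_ideal_quot[OF ideal_pow_ideal[OF I] A] module_length_ideal_quot[OF ideal_pow_ideal[OF I] A']
      using len_eq_of_colength_eq[OF A(1) A'(1) ideal_pow_ideal[OF I] A(2) A'(2) eq] by blast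
  qed
  have "module_length R (ideal_quot R (carrier R) (colon_ideal R J I))
      = module_length R (ideal_quot R (carrier R) (colon_ideal R J' I))"
  proof -
    note C = colon_ideal_ideal[OF Jr(1) Ic] and C' = colon_ideal_ideal[OF J'r(1) Ic]
    have sub: "colon_ideal R J I \<subseteq> carrier R" "colon_ideal R J' I \<subseteq> carrier R" by (auto simp: colon_ideal_def)
    have reg: "regular_seq {\<zero>\<^bsub>R\<^esub>} xs" "regular_seq {\<zero>\<^bsub>R\<^esub>} ys" using xs(3) ys(3) by (simp_all add: permutable_seq_def)
    \<comment> \<open>The length of \<open>R/(J : I)\<close> is that of \<open>R/J\<close> minus
      that of \<open>(J : I)/J\<close>, and neither depends on the reduction.\<close>
    have "len J (colon_ideal R J I) = len J' (colon_ideal R J' I)"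
      using len_colon_regular_seq[OF inf I Ip(2) zeroideal zI xsI reg(1) ysI reg(2)] xs(1,5) ys(1,5) by simp
    then show ?thesis
      unfolding module_length_ideal_quot[OF oneideal C sub(1)] module_length_ideal_quot[OF oneideal C' sub(2)]
      by (rule colength_eq_of_len_eq[OF Jr(1) J'r(1) C C' subset_colon_ideal[OF Jr(1) Ic] subset_colon_ideal[OF J'r(1) Ic] col fin])
  qed
  moreover have "module_length R (sym_component R (ideal_quot R I J) 2)
      = module_length R (sym_component R (ideal_quot R I J') 2)"
  proof -
    interpret ideal_square R I by (intro ideal_square.intro ideal_square_axioms.intro cring_axioms I)
    have "module_length R (ideal_quot R (I \<cdot>\<^bsub>R\<^esub> I) (J \<cdot>\<^bsub>R\<^esub> I)) = module_length R (ideal_quot R (I \<cdot>\<^bsub>R\<^esub> I) (J' \<cdot>\<^bsub>R\<^esub> I))"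
      using pow[of 1] ideal_pow_1 I Jr(1) J'r(1) by (simp add: ideal_pow_Suc)
    then show ?thesis
      unfolding module_length_sym_component[OF Jr] module_length_sym_component[OF J'r]
        interval_length_sym_kernel[OF xs(3) xsI xs(4)] interval_length_sym_kernel[OF ys(3) ysI ys(4)] by simp
  qed
  moreover have "module_length R (ideal_quot R (ideal_pow R I n) (ideal_pow R J (n - 1) \<cdot>\<^bsub>R\<^esub> I))
      = module_length R (ideal_quot R (ideal_pow R I n) (ideal_pow R J' (n - 1) \<cdot>\<^bsub>R\<^esub> I))" if "n \<ge> 2" for n
    using pow[of "n - 1"] that by simp
  ultimately show ?thesis using IJ by blast
qed

end
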